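(* There exists a universal constant $\gamma>0$ with the following property. Let $d\ge 1$, $G=\mathrm{GL}(d,\mathbb{R})$, and let $\mu$ be a compactly supported probability measure on $G$ which is semisimple and satisfies $\lambda_1(\mu)=\lambda_d(\mu)$. Then, given any compact set $K\subset G$ containing $\mathrm{supp}(\mu)$, there exist constants $\epsilon=\epsilon(K)>0$ and $C=C(K,\mu)>0$ such that for any probability measure $\mu'$ on $G$ with $\mathrm{supp}(\mu')\subset K$ and $d_{\mathrm W}(\mu',\mu)<\epsilon$, $$|\lambda_i(\mu')-\lambda_i(\mu)|\le C\,\bigl|\log d_{\mathrm W}(\mu',\mu)\bigr|^{-\gamma}\quad\text{for every } i\in\{1,\dots,d\}.$$
   Context: $G=\mathrm{GL}(d,\mathbb{R})$ carries the distance $\|g-g'\|$ given by the operator norm associated with the Euclidean norm on $\mathbb{R}^d$. For $g\in G$, $\sigma_1(g)\ge\dots\ge\sigma_d(g)>0$ are its singular values. For a compactly supported probability measure $\mu$ on $G$ the Lyapunov exponents are $\lambda_i(\mu)=\lim_{n\to\infty}\frac1n\log\sigma_i(g_n\cdots g_1)$ (almost surely), where $(g_n)$ are i.i.d. with law $\mu$. The Wasserstein distance is $d_{\mathrm W}(\mu',\mu)=\sup\{|\int_G\varphi\,d(\mu'-\mu)|:\varphi\in\mathscr{C}(G),\ \mathrm{Lip}(\varphi)\le1\}$, where $\mathscr{C}(G)$ is the space of bounded continuous real functions on $G$ and $\mathrm{Lip}(\varphi)$ is the Lipschitz constant. $\Gamma_\mu\subset G$ is the subsemigroup generated by $\mathrm{supp}(\mu)$.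 The measure $\mu$ is semisimple if every $\Gamma_\mu$-invariant subspace of $\mathbb{R}^d$ admits a $\Gamma_\mu$-invariant complementary subspace. When $d_{\mathrm W}(\mu',\mu)=0$ the right-hand side is read as $0$. *)

theory Defs
  imports
    "HOL-Probability.Probability"
    "Jordan_Normal_Form.Char_Poly"
    "Jordan_Normal_Form.VS_Connect"
begin

unbundle no vec_syntax

text \<open>
  The constant \<open>\<gamma>\<close> of the theorem does not depend on the dimension \<open>d\<close>, so \<open>d\<close> has to be quantified
  inside the statement.  Matrices are therefore those of \<^typ>\<open>real mat\<close> with explicit carriers.
\<close>

section \<open>\<open>GL(d, \<real>)\<close> as a metric space\<close>

definition euclid_norm :: "real vec \<Rightarrow> real" where
  "euclid_norm v = L2_set (\<lambda>i. v $ i) {..<dim_vec v}"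

definition op_norm :: "real mat \<Rightarrow> real" where
  "op_norm A = (SUP v\<in>{v \<in> carrier_vec (dim_col A). euclid_norm v \<le> 1}. euclid_norm (A *\<^sub>v v))"

definition GL :: "nat \<Rightarrow> real mat set" where
  "GL d = {A \<in> carrier_mat d d. invertible_mat A}"

text \<open>
  The locale \<^locale>\<open>Metric_space\<close> asks for symmetry also off the carrier, hence the value \<open>0\<close> there
  (for matrices of different sizes \<open>A - B\<close> and \<open>B - A\<close> are unrelated).
\<close>

definition GL_dist :: "nat \<Rightarrow> real mat \<Rightarrow> real mat \<Rightarrow> real" where
  "GL_dist d A B = (if A \<in> GL d \<and> B \<in> GL d then op_norm (A - B) else 0)"

definition GL_topology :: "nat \<Rightarrow> real mat topology" where
  "GL_topology d = Metric_space.mtopology (GL d) (GL_dist d)"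

lemma euclid_norm_nonneg: "0 \<le> euclid_norm v"
  by (simp add: euclid_norm_def)

lemma euclid_norm_triangle:
  assumes "v \<in> carrier_vec n" "w \<in> carrier_vec n"
  shows "euclid_norm (v + w) \<le> euclid_norm v + euclid_norm w"
proof -
  have "euclid_norm (v + w) = L2_set (\<lambda>i. v $ i + w $ i) {..<n}"
    using assms by (auto simp: euclid_norm_def intro!: L2_set_cong)
  also have "\<dots> \<le> L2_set (\<lambda>i. v $ i) {..<n} + L2_set (\<lambda>i. w $ i) {..<n}"
    by (rule L2_set_triangle_ineq)
  finally show ?thesis using assms by (simp add: euclid_norm_def)
qed

lemma euclid_norm_uminus: "euclid_norm (- v) = euclid_norm v"
proof -
  have "L2_set (\<lambda>i. (- v) $ i) {..<dim_vec v} = L2_set (\<lambda>i. v $ i) {..<dim_vec v}"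
    unfolding L2_set_def by (intro arg_cong[where f = sqrt] sum.cong) auto
  then show ?thesis by (simp add: euclid_norm_def)
qed

lemma euclid_norm_zero: "euclid_norm (0\<^sub>v n) = 0"
  unfolding euclid_norm_def by (rule L2_set_0') auto

lemma euclid_norm_unit_vec: "j < n \<Longrightarrow> euclid_norm (unit_vec n j) = 1"
proof -
  assume j: "j < n"
  have "(\<Sum>i<n. (unit_vec n j $ i :: real)\<^sup>2) = (\<Sum>i<n. if i = j then 1 else 0)"
    using j by (intro sum.cong) (auto simp: index_unit_vec)
  with j show ?thesis by (simp add: euclid_norm_def L2_set_def)
qed

lemma euclid_norm_mult_bdd:
  "bdd_above ((\<lambda>v. euclid_norm (A *\<^sub>v v)) ` {v \<in> carrier_vec (dim_col A). euclid_norm v \<le> 1})"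
proof (rule bdd_aboveI2)
  fix v assume "v \<in> {v \<in> carrier_vec (dim_col A). euclid_norm v \<le> 1}"
  then have v: "dim_vec v = dim_col A" and n: "euclid_norm v \<le> 1" by auto
  have "euclid_norm (A *\<^sub>v v) \<le> (\<Sum>i<dim_row A. \<bar>(A *\<^sub>v v) $ i\<bar>)"
    using L2_set_le_sum_abs[of "\<lambda>i. (A *\<^sub>v v) $ i" "{..<dim_row A}"] by (simp add: euclid_norm_def)
  also have "\<dots> \<le> (\<Sum>i<dim_row A. euclid_norm (row A i))"
  proof (rule sum_mono)
    fix i assume i: "i \<in> {..<dim_row A}"
    have "\<bar>(A *\<^sub>v v) $ i\<bar> = \<bar>\<Sum>j<dim_col A. row A i $ j * v $ j\<bar>"
      using i v by (simp add: scalar_prod_def lessThan_atLeast0)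
    also have "\<dots> \<le> (\<Sum>j<dim_col A. \<bar>row A i $ j\<bar> * \<bar>v $ j\<bar>)"
      by (rule order_trans[OF sum_abs]) (simp add: abs_mult)
    also have "\<dots> \<le> euclid_norm (row A i) * euclid_norm v"
      using L2_set_mult_ineq[of "\<lambda>j. row A i $ j" "\<lambda>j. v $ j" "{..<dim_col A}"] v
      by (simp add: euclid_norm_def)
    also have "\<dots> \<le> euclid_norm (row A i)"
      using n by (simp add: euclid_norm_nonneg mult_left_le)
    finally show "\<bar>(A *\<^sub>v v) $ i\<bar> \<le> euclid_norm (row A i)" .
  qed
  finally show "euclid_norm (A *\<^sub>v v) \<le> (\<Sum>i<dim_row A. euclid_norm (row A i))" .
qed

lemma op_norm_upper:
  assumes "v \<in> carrier_vec (dim_col A)" "euclid_norm v \<le> 1"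
  shows "euclid_norm (A *\<^sub>v v) \<le> op_norm A"
  unfolding op_norm_def using assms by (intro cSUP_upper euclid_norm_mult_bdd) auto

lemma op_norm_least:
  assumes "\<And>v. v \<in> carrier_vec (dim_col A) \<Longrightarrow> euclid_norm v \<le> 1 \<Longrightarrow> euclid_norm (A *\<^sub>v v) \<le> c"
  shows "op_norm A \<le> c"
proof -
  have "0\<^sub>v (dim_col A) \<in> {v \<in> carrier_vec (dim_col A). euclid_norm v \<le> 1}"
    by (simp add: euclid_norm_zero)
  then have "{v \<in> carrier_vec (dim_col A). euclid_norm v \<le> 1} \<noteq> {}"
    by blast
  then show ?thesis unfolding op_norm_def using assms by (intro cSUP_least) auto
qed

lemma op_norm_nonneg: "0 \<le> op_norm A"
  using op_norm_upper[of "0\<^sub>v (dim_col A)" A] euclid_norm_nonneg[of "A *\<^sub>v 0\<^sub>v (dim_col A)"]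
  by (simp add: euclid_norm_zero)

lemma op_norm_uminus: "op_norm (- A) = op_norm A"
proof -
  have "euclid_norm (- A *\<^sub>v v) = euclid_norm (A *\<^sub>v v)" if "v \<in> carrier_vec (dim_col A)" for v
  proof -
    have "- A *\<^sub>v v = - (A *\<^sub>v v)" using that by (intro eq_vecI) auto
    then show ?thesis by (simp add: euclid_norm_uminus)
  qed
  then show ?thesis unfolding op_norm_def by (intro SUP_cong) auto
qed

lemma op_norm_triangle:
  assumes A: "A \<in> carrier_mat m n" and B: "B \<in> carrier_mat m n"
  shows "op_norm (A + B) \<le> op_norm A + op_norm B"
proof (rule op_norm_least)
  fix v assume "v \<in> carrier_vec (dim_col (A + B))" and n: "euclid_norm v \<le> 1"
  then have v: "v \<in> carrier_vec n" using B by simp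
  have "euclid_norm ((A + B) *\<^sub>v v) = euclid_norm (A *\<^sub>v v + B *\<^sub>v v)"
    using A B v by (simp add: add_mult_distrib_mat_vec)
  also have "\<dots> \<le> euclid_norm (A *\<^sub>v v) + euclid_norm (B *\<^sub>v v)"
    using A B v by (intro euclid_norm_triangle[of _ m]) auto
  also have "\<dots> \<le> op_norm A + op_norm B"
    using A B v n by (intro add_mono op_norm_upper) auto
  finally show "euclid_norm ((A + B) *\<^sub>v v) \<le> op_norm A + op_norm B" .
qed

lemma op_norm_eq_0:
  assumes A: "A \<in> carrier_mat m n" and "op_norm A = 0"
  shows "A = 0\<^sub>m m n"
proof (rule eq_matI)
  fix i j assume "i < dim_row (0\<^sub>m m n :: real mat)" "j < dim_col (0\<^sub>m m n :: real mat)"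
  then have i: "i < m" and j: "j < n" by auto
  have "euclid_norm (A *\<^sub>v unit_vec n j) \<le> 0"
    using op_norm_upper[of "unit_vec n j" A] assms j by (simp add: euclid_norm_unit_vec)
  then have "euclid_norm (A *\<^sub>v unit_vec n j) = 0"
    using euclid_norm_nonneg by (rule antisym)
  then have "(A *\<^sub>v unit_vec n j) $ i = 0"
    using A i by (simp add: euclid_norm_def L2_set_eq_0_iff del: index_mult_mat_vec)
  then show "A $$ (i, j) = 0\<^sub>m m n $$ (i, j)"
    using A i j by simp
qed (use A in auto)

lemma Metric_space_GL: "Metric_space (GL d) (GL_dist d)"
proof
  fix A B
  show "0 \<le> GL_dist d A B"
    by (simp add: GL_dist_def op_norm_nonneg)
  show "GL_dist d A B = GL_dist d B A"
  proof (cases "A \<in> GL d \<and> B \<in> GL d")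
    case True
    then have "A - B = - (B - A)"
      by (intro eq_matI) (auto simp: GL_def)
    then show ?thesis
      using op_norm_uminus[of "B - A"] by (simp add: GL_dist_def)
  qed (auto simp: GL_dist_def)
next
  fix A B assume A: "A \<in> GL d" and B: "B \<in> GL d"
  then have cA: "A \<in> carrier_mat d d" and cB: "B \<in> carrier_mat d d"
    by (auto simp: GL_def)
  have "0\<^sub>m d d *\<^sub>v v = 0\<^sub>v d" if "v \<in> carrier_vec d" for v :: "real vec"
    using that by (intro eq_vecI) auto
  then have "op_norm (0\<^sub>m d d) \<le> 0"
    by (intro op_norm_least) (simp add: euclid_norm_zero)
  then have z: "op_norm (0\<^sub>m d d) = 0"
    using op_norm_nonneg by (rule antisym)
  show "GL_dist d A B = 0 \<longleftrightarrow> A = B"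
  proof
    assume "GL_dist d A B = 0"
    then have "A - B = 0\<^sub>m d d"
      using A B cA cB by (intro op_norm_eq_0) (auto simp: GL_dist_def)
    then have "(A - B) $$ (i, j) = 0" if "i < d" "j < d" for i j
      using that by simp
    then show "A = B"
      using cA cB by (intro eq_matI) auto
  next
    assume "A = B"
    moreover have "B - B = 0\<^sub>m d d" using cB by (intro eq_matI) auto
    ultimately show "GL_dist d A B = 0" using B z by (simp add: GL_dist_def)
  qed
  fix C assume C: "C \<in> GL d"
  then have cC: "C \<in> carrier_mat d d"
    by (simp add: GL_def)
  have "A - C = (A - B) + (B - C)"
    using cA cB cC by (intro eq_matI) auto
  moreover have "op_norm ((A - B) + (B - C)) \<le> op_norm (A - B) + op_norm (B - C)"
    using cA cB cC by (intro op_norm_triangle[of _ d d]) auto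
  ultimately show "GL_dist d A C \<le> GL_dist d A B + GL_dist d B C"
    using A B C by (simp add: GL_dist_def)
qed

lemma topspace_GL_topology: "topspace (GL_topology d) = GL d"
  by (simp add: GL_topology_def Metric_space.topspace_mtopology[OF Metric_space_GL])

section \<open>Probability measures on \<open>GL(d, \<real>)\<close>\<close>

definition prob_on_GL :: "nat \<Rightarrow> real mat measure \<Rightarrow> bool" where
  "prob_on_GL d \<mu> \<longleftrightarrow>
     prob_space \<mu> \<and> sets \<mu> = sets (sigma (GL d) {U. openin (GL_topology d) U})"

definition msupp :: "nat \<Rightarrow> real mat measure \<Rightarrow> real mat set" where
  "msupp d \<mu> = {g \<in> GL d. \<forall>U. openin (GL_topology d) U \<and> g \<in> U \<longrightarrow> 0 < emeasure \<mu> U}"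

definition lip1_test :: "nat \<Rightarrow> (real mat \<Rightarrow> real) set" where
  "lip1_test d = {\<phi>. continuous_map (GL_topology d) euclideanreal \<phi> \<and> bounded (\<phi> ` GL d) \<and>
     (\<forall>g\<in>GL d. \<forall>h\<in>GL d. \<bar>\<phi> g - \<phi> h\<bar> \<le> GL_dist d g h)}"

text \<open>
  A real supremum is enough: for compactly supported probability measures the set is bounded
  (subtract a constant from \<open>\<phi>\<close>).
\<close>

definition wasserstein :: "nat \<Rightarrow> real mat measure \<Rightarrow> real mat measure \<Rightarrow> real" where
  "wasserstein d \<mu>' \<mu> = (SUP \<phi>\<in>lip1_test d. \<bar>(LINT g|\<mu>'. \<phi> g) - (LINT g|\<mu>. \<phi> g)\<bar>)"

inductive_set gen_semigroup :: "real mat set \<Rightarrow> real mat set" for S where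
  base: "g \<in> S \<Longrightarrow> g \<in> gen_semigroup S"
| mult: "g \<in> gen_semigroup S \<Longrightarrow> h \<in> gen_semigroup S \<Longrightarrow> g * h \<in> gen_semigroup S"

definition invariant_subspace :: "nat \<Rightarrow> real mat set \<Rightarrow> real vec set \<Rightarrow> bool" where
  "invariant_subspace d \<Gamma> W \<longleftrightarrow>
     VectorSpace.subspace class_ring W (module_vec TYPE(real) d) \<and>
     (\<forall>g\<in>\<Gamma>. \<forall>w\<in>W. g *\<^sub>v w \<in> W)"

definition semisimple :: "nat \<Rightarrow> real mat measure \<Rightarrow> bool" where
  "semisimple d \<mu> \<longleftrightarrow>
     (\<forall>W. invariant_subspace d (gen_semigroup (msupp d \<mu>)) W \<longrightarrow>
       (\<exists>W'. invariant_subspace d (gen_semigroup (msupp d \<mu>)) W' \<and>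
          W \<inter> W' = {0\<^sub>v d} \<and> {w + w' | w w'. w \<in> W \<and> w' \<in> W'} = carrier_vec d))"

section \<open>Lyapunov exponents\<close>

text \<open>
  Square roots of the eigenvalues of \<open>A\<^sup>T A\<close>, with multiplicity, in decreasing order and
  indexed from \<open>1\<close>.
\<close>

definition singular_value :: "real mat \<Rightarrow> nat \<Rightarrow> real" where
  "singular_value A i =
     rev (sorted_list_of_multiset (image_mset sqrt (proots (char_poly (A\<^sup>T * A))))) ! (i - 1)"

text \<open>With \<open>g\<^sub>k = \<omega> (k - 1)\<close>, this is \<open>g\<^sub>n \<cdots> g\<^sub>1\<close>.\<close>

primrec left_prod :: "nat \<Rightarrow> (nat \<Rightarrow> real mat) \<Rightarrow> nat \<Rightarrow> real mat" where
  "left_prod d \<omega> 0 = 1\<^sub>m d"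
| "left_prod d \<omega> (Suc n) = \<omega> n * left_prod d \<omega> n"

definition lyapunov_exponent :: "nat \<Rightarrow> real mat measure \<Rightarrow> nat \<Rightarrow> real" where
  "lyapunov_exponent d \<mu> i =
     (THE c. AE \<omega> in (\<Pi>\<^sub>M k\<in>(UNIV :: nat set). \<mu>).
        (\<lambda>n. ln (singular_value (left_prod d \<omega> n) i) / real n) \<longlonglongrightarrow> c)"

end

theory Submission
  imports Defs
begin

text \<open>
  \<^bold>\<open>Reduction to a rate for one measure.\<close>  The first exponent of \<open>\<mu>'\<close> is at most the expectation of
  \<open>ln \<parallel>P\<^sub>n\<parallel> / n\<close>, where \<open>P\<^sub>n\<close> is the product of \<open>n\<close> independent matrices of law \<open>\<mu>'\<close>.  For a fixed \<open>n\<close> this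
  expectation is Lipschitz in the measure, with a constant exponential in \<open>n\<close>
  (\<open>expected_size_Lipschitz\<close>).  If for \<open>\<mu>\<close> it exceeds \<open>\<lambda>\<^sub>1\<close> by at most a constant times
  \<open>n\<close> to the power \<open>-1/4\<close>, then \<open>n\<close> of the order of the logarithm of the distance bounds the first
  exponent of \<open>\<mu>'\<close>, with \<open>\<gamma> = 1/4\<close> (\<open>first_exponent_bound\<close>).  The
  sum of all exponents is the expectation of \<open>ln \<bar>det g\<bar>\<close>, which is Lipschitz too; as no exponent can
  rise much, none can fall much (\<open>exponents_bound\<close>).

  \<^bold>\<open>The rate.\<close>  Scale the matrices so that all exponents of \<open>\<mu>\<close> vanish.  The vectors \<open>x\<close> for which the
  expectations of \<open>ln (1 + \<parallel>P\<^sub>n x\<parallel>)\<close> are summable against \<open>n\<close> to the power \<open>-7/4\<close> form an invariant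
  subspace.  By semisimplicity it has an invariant complement, and if this were not zero, it would
  contain a vector for which the expectations are only of the order of the square root of \<open>n\<close>, which
  is summable (\<open>slow_meets_invariant\<close>).  So all vectors are slow, and subadditivity turns the
  summability into a bound by \<open>n\<close> to the power \<open>3/4\<close> (\<open>expected_growth_bound\<close>).

  \<^bold>\<open>A slow vector\<close> (\<open>slow_vector\<close>) comes from a quantitative form of Furstenberg's argument.  The unitary
  representation on square integrable functions on \<open>\<real>\<^sup>q\<close> has an averaging operator.  As the products
  do not grow exponentially, the iterates of the indicator of a ball under this operator do not decay
  exponentially, so their normalised squares are almost invariant densities; a cluster point is a
  finitely additive mean on \<open>\<real>\<^sup>q - 0\<close> that almost every matrix preserves (\<open>invariant_mean\<close>).  Among the
  subspaces all of whose conical neighbourhoods keep a positive mean, those of the least dimension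
  have finitely many images, and on them the matrices are similarities up to bounded factors
  (\<open>finite_orbit\<close>).  The size along the images is therefore an additive functional of a finite Markov
  chain.  It has no drift, and its fluctuations are of the order of the square root
  (\<open>chain_sum_square_root_growth\<close>).

  \<^bold>\<open>Existence of the exponents\<close> is the subadditive ergodic theorem for independent sequences, applied
  to the norms of minors, which are comparable to products of the largest singular values
  (\<open>minors_norm_singular_values\<close>).
\<close>

unbundle no inner_syntax
no_notation matrix_matrix_mult (infixl "**" 70) and matrix_vector_mult (infixl "*v" 70)
notation mult_mat_vec (infixl "*v" 70) and one_mat ("Id") and zero_vec ("0v") and zero_mat ("0m")
  and smult_vec (infixl ".v" 70) and smult_mat (infixl ".m" 70)
  and iff (infixr "<->" 25) and scalar_prod (infix "**" 70)

abbreviation (input) Mat :: "nat \<Rightarrow> nat \<Rightarrow> real mat set" where "Mat \<equiv> carrier_mat"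
abbreviation (input) Vec :: "nat \<Rightarrow> real vec set" where "Vec \<equiv> carrier_vec"
abbreviation (input) Bor :: "'a measure \<Rightarrow> ('a \<Rightarrow> 'b::topological_space) set" where "Bor M \<equiv> borel_measurable M"
abbreviation (input) lyap :: "nat \<Rightarrow> real mat measure \<Rightarrow> nat \<Rightarrow> real" where "lyap \<equiv> lyapunov_exponent"
abbreviation (input) lims :: "(nat \<Rightarrow> real) \<Rightarrow> real \<Rightarrow> bool" (infix "--->" 60)
  where "f ---> c \<equiv> f \<longlonglongrightarrow> c"

lemmas LINT_cong = Bochner_Integration.integral_cong and LINT_add = Bochner_Integration.integral_add
  and LINT_sum = Bochner_Integration.integral_sum and LINT_nonneg = Bochner_Integration.integral_nonneg
  and L1_add = Bochner_Integration.integrable_add and L1_diff = Bochner_Integration.integrable_diff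
  and L1_sum = Bochner_Integration.integrable_sum and L1_bound = Bochner_Integration.integrable_bound
  and Mv_assoc = assoc_mult_mat_vec and MM_assoc = assoc_mult_mat and Mv_add = mult_add_distrib_mat_vec
  and Mv_index = index_mult_mat_vec

section \<open>Entrywise norms\<close>

text \<open>
  Sums of absolute values: with them the estimates below need no inner products, and all norms of a
  finite-dimensional space give the same exponents.
\<close>

definition vn :: "real vec => real" where
"vn x = (SUM i<dim_vec x. abs (x $ i))"

definition mn :: "real mat => real" where
"mn A = (SUM i<dim_row A. SUM j<dim_col A. abs (A $$ (i, j)))"

lemma vn_nonneg [simp]: "0 <= vn x" by (simp add: vn_def sum_nonneg)

lemma mn_nonneg [simp]: "0 <= mn A" by (simp add: mn_def sum_nonneg)

lemma vn_zero [simp]: "vn (0v n) = 0" by (simp add: vn_def)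

lemma mn_zero [simp]: "mn (0m n m) = 0" by (simp add: mn_def)

lemma vn_eq_0: "x : Vec n ==> vn x = 0 <-> x = 0v n" by (auto simp: vn_def sum_nonneg_eq_0_iff intro!: eq_vecI)

lemma vn_pos: "x : Vec n ==> x ~= 0v n ==> 0 < vn x" using vn_eq_0[of x n] vn_nonneg[of x] by linarith

lemma vn_add:
assumes "x : Vec n" "y : Vec n"
shows "vn (x + y) <= vn x + vn y"
proof -
have "(SUM i<n. abs (x $ i + y $ i)) <= (SUM i<n. abs (x $ i) + abs (y $ i))" by (intro sum_mono abs_triangle_ineq)
with assms show ?thesis by (simp add: vn_def sum.distrib)
qed

lemma vn_smult [simp]: "vn (c .v x) = abs c * vn x" by (simp add: vn_def sum_distrib_left abs_mult)

lemma vn_minus: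
assumes "x : Vec n" "y : Vec n"
shows "vn (x - y) <= vn x + vn y"
proof -
have "(SUM i<n. abs (x $ i - y $ i)) <= (SUM i<n. abs (x $ i) + abs (y $ i))" by (intro sum_mono abs_triangle_ineq4)
with assms show ?thesis by (simp add: vn_def sum.distrib)
qed

lemma vn_ge_diff:
assumes "x : Vec n" "y : Vec n"
shows "vn x - vn y <= vn (x + y)"
proof -
have "x = (x + y) - y" using assms by (intro eq_vecI) auto
hence "vn x <= vn (x + y) + vn y" using vn_minus[of "x + y" n y] assms by simp
thus ?thesis by simp
qed

lemma mn_add:
assumes "A : Mat n m" "B : Mat n m"
shows "mn (A + B) <= mn A + mn B"
proof -
have "(SUM i<n. SUM j<m. abs (A $$ (i,j) + B $$ (i,j))) <= (SUM i<n. SUM j<m. abs (A $$ (i,j)) + abs (B $$ (i,j)))"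
 by (intro sum_mono abs_triangle_ineq)
with assms show ?thesis by (simp add: mn_def sum.distrib)
qed

lemma mn_smult [simp]: "mn (c .m A) = abs c * mn A" by (simp add: mn_def sum_distrib_left abs_mult)

lemma entry_le_mn:
assumes "i < dim_row A" "j < dim_col A"
shows "abs (A $$ (i, j)) <= mn A"
proof -
have "abs (A $$ (i, j)) <= (SUM j<dim_col A. abs (A $$ (i, j)))" using assms by (intro member_le_sum) auto
also have "... <= mn A"
 unfolding mn_def using assms by (intro member_le_sum[of i _ "%i. SUM j<dim_col A. abs (A $$ (i, j))"]) (auto intro: sum_nonneg)
finally show ?thesis .
qed

lemma index_mult_vec_sum:
assumes "i < dim_row A" "dim_vec x = dim_col A"
shows "(A *v x) $ i = (SUM j<dim_col A. A $$ (i, j) * x $ j)" using assms by (auto simp: scalar_prod_def lessThan_atLeast0 intro!: sum.cong)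

lemma index_mult_mat_sum:
assumes "i < dim_row A" "j < dim_col B" "dim_col A = dim_row B"
shows "(A * B) $$ (i, j) = (SUM l<dim_row B. A $$ (i, l) * B $$ (l, j))"
using assms by (auto simp: scalar_prod_def lessThan_atLeast0 intro!: sum.cong)

lemma vn_mult:
assumes "A : Mat n m" "x : Vec m"
shows "vn (A *v x) <= mn A * vn x"
proof -
have "vn (A *v x) = (SUM i<n. abs (SUM j<m. A $$ (i, j) * x $ j))"
 unfolding vn_def using assms by (intro sum.cong arg_cong[where f=abs] index_mult_vec_sum[THEN trans]) (auto simp del: Mv_index)
also have "... <= (SUM i<n. SUM j<m. abs (A $$ (i, j)) * abs (x $ j))" by (intro sum_mono order_trans[OF sum_abs]) (simp add: abs_mult)
also have "... <= (SUM i<n. SUM j<m. abs (A $$ (i, j)) * vn x)"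
 using assms by (intro sum_mono mult_left_mono) (auto simp: vn_def intro!: member_le_sum)
also have "... = mn A * vn x" using assms by (simp add: mn_def sum_distrib_right)
finally show ?thesis .
qed

lemma mn_cols: "A : Mat n m ==> mn A = (SUM j<m. vn (col A j))" by (subst mn_def, subst sum.swap) (auto simp: vn_def intro!: sum.cong)

lemma mn_mult:
assumes A: "A : Mat n m" and B: "B : Mat m k"
shows "mn (A * B) <= mn A * mn B"
proof -
have "mn (A * B) = (SUM j<k. vn (col (A * B) j))" using A B by (intro mn_cols) auto
also have "... = (SUM j<k. vn (A *v col B j))" using A B by (intro sum.cong refl arg_cong[where f = vn]) (subst col_mult2[OF A B], auto)
also have "... <= (SUM j<k. mn A * vn (col B j))" using A B by (intro sum_mono vn_mult[of _ n m]) auto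
also have "... = mn A * mn B" using B by (simp add: mn_cols[OF B] sum_distrib_left)
finally show ?thesis .
qed

lemma mn_one [simp]: "mn (Id n) = real n"
proof -
have "(SUM i<n. SUM j<n. abs (Id n $$ (i, j)) :: real) = (SUM i<n. SUM j<n. if j = i then 1 else 0)" by (intro sum.cong) auto
also have "... = (SUM i<n. 1)" by (intro sum.cong) (auto simp: sum.delta)
finally show ?thesis by (simp add: mn_def)
qed

lemma vn_unit [simp]: "j < n ==> vn (unit_vec n j) = 1"
proof -
assume j: "j < n"
have "(SUM i<n. abs (unit_vec n j $ i) :: real) = (SUM i<n. if i = j then 1 else 0)" using j by (intro sum.cong) (auto simp: index_unit_vec)
with j show ?thesis by (simp add: vn_def)
qed

lemma mn_le_sup:
assumes A: "A : Mat n m" and c: "!!x. x : Vec m ==> vn (A *v x) <= c * vn x"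
shows "mn A <= real m * c"
proof -
have "vn (col A j) <= c" if "j < m" for j
proof -
 have "A *v unit_vec m j = col A j" using that A by (intro eq_vecI) auto
 thus ?thesis using c[of "unit_vec m j"] that by simp
qed
hence "(SUM j<m. vn (col A j)) <= (SUM j<m. c)" by (intro sum_mono) auto
thus ?thesis by (simp add: mn_cols[OF A])
qed

lemma mn_eq_0: "A : Mat n m ==> mn A = 0 <-> A = 0m n m"
proof
assume A: "A : Mat n m" and "mn A = 0"
hence "A $$ (i, j) = 0" if "i < n" "j < m" for i j using entry_le_mn[of i A j] that by auto
thus "A = 0m n m" using A by (intro eq_matI) auto
qed auto

lemma mn_le_entries:
assumes "A : Mat n m" "!!i j. i < n ==> j < m ==> abs (A $$ (i, j)) <= c"
shows "mn A <= real n * real m * c"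
proof -
have "(SUM i<n. SUM j<m. abs (A $$ (i, j))) <= (SUM i<n. SUM j<m. c)" using assms by (intro sum_mono) auto
with assms show ?thesis by (simp add: mn_def)
qed

lemma permutes_lt: "p permutes {0..<n::nat} ==> i < n ==> p i < n" using permutes_in_image[of p "{0..<n}" i] by simp

lemma det_abs_le:
fixes A :: "real mat"
assumes A: "A : Mat n n" and c: "!!i j. i < n ==> j < n ==> abs (A $$ (i, j)) <= c j"
shows "abs (det A) <= fact n * (PROD j<n. c j)"
proof -
have cn: "0 <= c j" if "j < n" for j using c[of j j] that abs_ge_zero order_trans by blast
have "abs (det A) <= (SUM p | p permutes {0..<n}. abs (signof p * (PROD i = 0..<n. A $$ (i, p i))))" unfolding det_def'[OF A] by (rule sum_abs)
also have "... <= (SUM p | p permutes {0..<n}. (PROD j<n. c j))"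
proof (rule sum_mono)
 fix p assume "p : {p. p permutes {0..<n}}"
 hence p: "p permutes {0..<n}" by simp
 have "abs (signof p * (PROD i = 0..<n. A $$ (i, p i))) = (PROD i = 0..<n. abs (A $$ (i, p i)))" by (simp add: abs_mult sign_def abs_prod)
 also have "... <= (PROD i = 0..<n. c (p i))" using p by (intro prod_mono) (auto intro!: c simp: permutes_lt)
 also have "... = (PROD j = 0..<n. c j)" using prod.permute[OF p, of c] by (simp add: comp_def)
 finally show "abs (signof p * (PROD i = 0..<n. A $$ (i, p i))) <= (PROD j<n. c j)" by (simp add: lessThan_atLeast0)
qed
also have "... = fact n * (PROD j<n. c j)" by (simp add: card_permutations[of "{0..<n}" n])
finally show ?thesis .
qed

lemma det_le_mn: "(A::real mat) : Mat n n ==> abs (det A) <= fact n * mn A ^ n" using det_abs_le[of A n "%_. mn A"] entry_le_mn[of _ A] by auto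

text \<open>Cramer's rule: the adjugate is a polynomial of degree \<open>n - 1\<close> in the entries.\<close>

lemma vn_inverse_bound:
assumes A: "A : Mat n n" and x: "x : Vec n"
shows "abs (det A) * vn x <= real n * real n * fact (n - 1) * mn A ^ (n - 1) * vn (A *v x)"
proof -
have adj: "adj_mat A : Mat n n" "adj_mat A * A = det A .m Id n" using adj_mat[OF A] by auto
have "mn (adj_mat A) <= real n * real n * (fact (n - 1) * mn A ^ (n - 1))"
proof (rule mn_le_entries[OF adj(1)])
 fix i j assume ij: "i < n" "j < n"
 have D: "mat_delete A j i : Mat (n - 1) (n - 1)" using A by (auto simp: mat_delete_def)
 have "abs (adj_mat A $$ (i, j)) = abs (det (mat_delete A j i))" using A ij by (simp add: adj_mat_def cofactor_def abs_mult power_abs)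
 also have "... <= fact (n - 1) * (PROD j<n - 1. mn A)"
 proof (rule det_abs_le[OF D])
  fix a b assume "a < n - 1" "b < n - 1"
  thus "abs (mat_delete A j i $$ (a, b)) <= mn A" using A ij by (auto simp: mat_delete_def intro!: entry_le_mn)
 qed
 finally show "abs (adj_mat A $$ (i, j)) <= fact (n - 1) * mn A ^ (n - 1)" by simp
qed
moreover have "abs (det A) * vn x <= mn (adj_mat A) * vn (A *v x)"
proof -
 have "adj_mat A *v (A *v x) = (adj_mat A * A) *v x" using Mv_assoc[OF adj(1) A x] by simp
 also have "... = det A .v (Id n *v x)" unfolding adj(2) using x by (intro eq_vecI) auto
 also have "... = det A .v x" using x by simp
 finally have "abs (det A) * vn x = vn (adj_mat A *v (A *v x))" by simp
 thus ?thesis using vn_mult[OF adj(1), of "A *v x"] A x by simp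
qed
ultimately show ?thesis using mult_right_mono[of "mn (adj_mat A)" "real n * real n * (fact (n - 1) * mn A ^ (n - 1))" "vn (A *v x)"]
 by (simp add: mult.assoc del: One_nat_def)
qed

lemma invertible_mat_det: "A : Mat n n ==> invertible_mat A <-> det A ~= (0::real)"
proof
assume A: "A : Mat n n" and "invertible_mat A"
then obtain B where B: "A * B = Id n" "B * A = Id (dim_row B)" by (auto simp: invertible_mat_def inverts_mat_def)
have "dim_col B = n" using arg_cong[OF B(1), of dim_col] by simp
moreover have "dim_row B = n" using arg_cong[OF B(2), of dim_col] A by simp
ultimately have "B : Mat n n" by auto
hence "det A * det B = 1" using det_mult[OF A] B(1) by (metis det_one)
thus "det A ~= 0" by auto
next
assume A: "A : Mat n n" and d: "det A ~= 0"
let ?B = "(1 / det A) .m adj_mat A"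
have aA: "adj_mat A : Mat n n" using adj_mat(1)[OF A] .
have "A * ?B = Id n" using d by (subst mult_smult_distrib[OF A aA]) (auto simp: adj_mat(2)[OF A] intro!: eq_matI)
moreover have "?B * A = Id n" using d by (subst mult_smult_assoc_mat[OF aA A]) (auto simp: adj_mat(3)[OF A] intro!: eq_matI)
ultimately show "invertible_mat A" using A aA by (auto simp: invertible_mat_def inverts_mat_def intro!: exI[of _ ?B])
qed

lemma inverse_mat_exists:
assumes A: "A : Mat n n" and d: "det A ~= (0::real)"
obtains B where "B : Mat n n" "A * B = Id n" "B * A = Id n" "det B ~= 0"
proof -
let ?B = "(1 / det A) .m adj_mat A"
have B: "?B : Mat n n" using adj_mat(1)[OF A] by simp
have 1: "A * ?B = Id n" using A adj_mat[OF A] d by (subst mult_smult_distrib[OF A adj_mat(1)[OF A]]) (auto intro!: eq_matI)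
have 2: "?B * A = Id n" using A adj_mat[OF A] d by (subst mult_smult_assoc_mat[OF adj_mat(1)[OF A] A]) (auto intro!: eq_matI)
have "det A * det ?B = 1" using det_mult[OF A B] 1 by simp
hence "det ?B ~= 0" by auto
with that B 1 2 show thesis by blast
qed

section \<open>Minors\<close>

text \<open>
  Rows and columns of a minor are given by arbitrary maps instead of increasing ones: this makes
  sums over them products of sums, at the price of counting every minor repeatedly.
\<close>

definition index_maps :: "nat => nat => (nat => nat) set" where
"index_maps k d = ({0..<k} \<rightarrow>\<^sub>E {0..<d})"

definition minor :: "nat => (nat => nat) => (nat => nat) => real mat => real" where
"minor k f h A = det (mat k k (%(i, j). A $$ (f i, h j)))"

definition minors_norm :: "nat => nat => real mat => real" where
"minors_norm d k A = (SUM f:index_maps k d. SUM h:index_maps k d. abs (minor k f h A))"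

lemma finite_index_maps [simp]: "finite (index_maps k d)" by (simp add: index_maps_def finite_PiE)

lemma card_index_maps: "card (index_maps k d) = d ^ k" by (simp add: index_maps_def card_PiE)

lemma index_maps_less: "f : index_maps k d ==> i < k ==> f i < d" by (auto simp: index_maps_def PiE_def Pi_def)

lemma index_maps_permute:
assumes "p permutes {0..<k}"
shows "bij_betw (%r. r \<circ> p) (index_maps k d) (index_maps k d)"
proof (rule bij_betwI[where g = "%r. r \<circ> Hilbert_Choice.inv p"])
have *: "(%r. r \<circ> q) : index_maps k d \<rightarrow> index_maps k d" if q: "q permutes {0..<k}" for q unfolding index_maps_def
proof (intro Pi_I PiE_I)
 fix r x assume r: "r : {0..<k} \<rightarrow>\<^sub>E {0..<d}"
 show "x : {0..<k} ==> (r \<circ> q) x : {0..<d}" using r permutes_in_image[OF q, of x] by (auto simp: PiE_def Pi_def)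
 show "x ~: {0..<k} ==> (r \<circ> q) x = undefined" using r permutes_not_in[OF q, of x] by (auto simp: PiE_def extensional_def)
qed
show "(%r. r \<circ> p) : index_maps k d \<rightarrow> index_maps k d" using * assms by auto
show "(%r. r \<circ> Hilbert_Choice.inv p) : index_maps k d \<rightarrow> index_maps k d" using * permutes_inv[OF assms] by auto
show "(r \<circ> p) \<circ> Hilbert_Choice.inv p = r" for r :: "nat => nat" using permutes_inverses[OF assms] by (auto simp: fun_eq_iff)
show "(r \<circ> Hilbert_Choice.inv p) \<circ> p = r" for r :: "nat => nat" using permutes_inverses[OF assms] by (auto simp: fun_eq_iff)
qed

lemma minor_permute:
assumes "p permutes {0..<k}"
shows "minor k (r \<circ> p) h A = signof p * minor k r h A"
proof -
let ?M = "mat k k (%(i, j). A $$ (r i, h j))"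
have "mat k k (%(i, j). A $$ ((r \<circ> p) i, h j)) = mat k k (%(i, j). ?M $$ (p i, j))" using assms by (intro eq_matI) (auto simp: permutes_lt)
thus ?thesis unfolding minor_def using det_permute_rows[of ?M k p] assms by simp
qed

lemma minor_mult_expand:
assumes A: "A : Mat d d" and B: "B : Mat d d"
 and f: "f : index_maps k d" and h: "h : index_maps k d"
shows "minor k f h (A * B) = (SUM r:index_maps k d. (PROD i = 0..<k. A $$ (f i, r i)) * minor k r h B)"
proof -
have "minor k f h (A * B) =
  (SUM p | p permutes {0..<k}. signof p * (PROD i = 0..<k. SUM l:{0..<d}. A $$ (f i, l) * B $$ (l, h (p i))))" unfolding minor_def
 by (subst det_def'[of _ k])
  (insert A B index_maps_less[OF f] index_maps_less[OF h],
  auto intro!: sum.cong prod.cong index_mult_mat_sum[THEN trans] simp: permutes_lt lessThan_atLeast0 simp del: index_mult_mat)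
also have "... = (SUM p | p permutes {0..<k}. signof p *
  (SUM r:index_maps k d. PROD i = 0..<k. A $$ (f i, r i) * B $$ (r i, h (p i))))" unfolding index_maps_def by (subst prod_sum_PiE) auto
also have "... = (SUM r:index_maps k d. SUM p | p permutes {0..<k}. signof p *
  (PROD i = 0..<k. A $$ (f i, r i) * B $$ (r i, h (p i))))" unfolding sum_distrib_left by (rule sum.swap)
also have "... = (SUM r:index_maps k d. (PROD i = 0..<k. A $$ (f i, r i)) * minor k r h B)"
proof (rule sum.cong[OF refl])
 fix r
 have "minor k r h B = (SUM p | p permutes {0..<k}. signof p * (PROD i = 0..<k. B $$ (r i, h (p i))))"
  unfolding minor_def by (subst det_def'[of _ k]) (auto intro!: sum.cong prod.cong simp: permutes_lt)
 thus "(SUM p | p permutes {0..<k}. signof p * (PROD i = 0..<k. A $$ (f i, r i) * B $$ (r i, h (p i))))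
  = (PROD i = 0..<k. A $$ (f i, r i)) * minor k r h B" by (simp add: prod.distrib sum_distrib_left mult_ac)
qed
finally show ?thesis .
qed

text \<open>
  In the multilinear expansion of the minor of a product every permutation of the inner index map
  contributes the same minor up to sign; summing over the permutations restores the determinant.
\<close>

theorem Cauchy_Binet:
assumes A: "A : Mat d d" and B: "B : Mat d d"
 and f: "f : index_maps k d" and h: "h : index_maps k d"
shows "fact k * minor k f h (A * B) = (SUM r:index_maps k d. minor k f r A * minor k r h B)"
proof -
have "minor k f h (A * B) = (SUM r:index_maps k d. signof p * (PROD i = 0..<k. A $$ (f i, r (p i))) * minor k r h B)"
 if p: "p permutes {0..<k}" for p
proof -
 have "minor k f h (A * B) = (SUM r:index_maps k d. (PROD i = 0..<k. A $$ (f i, (r \<circ> p) i)) * minor k (r \<circ> p) h B)"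
  unfolding minor_mult_expand[OF assms] by (rule sum.reindex_bij_betw[OF index_maps_permute[OF p], symmetric])
 also have "... = (SUM r:index_maps k d. signof p * (PROD i = 0..<k. A $$ (f i, r (p i))) * minor k r h B)"
  unfolding minor_permute[OF p] by (intro sum.cong) auto
 finally show ?thesis .
qed
hence "(SUM p | p permutes {0..<k}. minor k f h (A * B)) =
 (SUM p | p permutes {0..<k}. SUM r:index_maps k d. signof p * (PROD i = 0..<k. A $$ (f i, r (p i))) * minor k r h B)" by (intro sum.cong) auto
also have "... = (SUM r:index_maps k d. SUM p | p permutes {0..<k}. signof p * (PROD i = 0..<k. A $$ (f i, r (p i))) * minor k r h B)"
 by (rule sum.swap)
also have "... = (SUM r:index_maps k d. minor k f r A * minor k r h B)"
proof (rule sum.cong[OF refl])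
 fix r
 have "minor k f r A = (SUM p | p permutes {0..<k}. signof p * (PROD i = 0..<k. A $$ (f i, r (p i))))"
  unfolding minor_def by (subst det_def'[of _ k]) (auto intro!: sum.cong prod.cong simp: permutes_lt)
 thus "(SUM p | p permutes {0..<k}. signof p * (PROD i = 0..<k. A $$ (f i, r (p i))) * minor k r h B) = minor k f r A * minor k r h B"
  by (simp add: sum_distrib_right)
qed
finally show ?thesis by (simp add: card_permutations[of "{0..<k}" k])
qed

lemma minors_norm_nonneg: "0 <= minors_norm d k A" by (simp add: minors_norm_def sum_nonneg)

lemma minors_norm_mult:
assumes A: "A : Mat d d" and B: "B : Mat d d"
shows "minors_norm d k (A * B) <= minors_norm d k A * minors_norm d k B"
proof -
let ?I = "index_maps k d"
have "abs (minor k f h (A * B)) <= (SUM r:?I. abs (minor k f r A) * abs (minor k r h B))"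
 if "f : ?I" "h : ?I" for f h
proof -
 have "abs (minor k f h (A * B)) <= fact k * abs (minor k f h (A * B))"
  using mult_right_mono[OF fact_ge_1[of k, where ?'a = real], of "abs (minor k f h (A * B))"] by simp
 also have "... = abs (SUM r:?I. minor k f r A * minor k r h B)"
  using Cauchy_Binet[OF A B that] by (simp add: abs_mult flip: Cauchy_Binet[OF A B that])
 also have "... <= (SUM r:?I. abs (minor k f r A) * abs (minor k r h B))" by (rule order_trans[OF sum_abs]) (simp add: abs_mult)
 finally show ?thesis .
qed
hence "minors_norm d k (A * B) <= (SUM f:?I. SUM h:?I. SUM r:?I. abs (minor k f r A) * abs (minor k r h B))"
 unfolding minors_norm_def by (intro sum_mono)
also have "... = (SUM f:?I. SUM r:?I. abs (minor k f r A) * (SUM h:?I. abs (minor k r h B)))"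
 unfolding sum_distrib_left by (intro sum.cong[OF refl] sum.swap)
also have "... <= (SUM f:?I. SUM r:?I. abs (minor k f r A) * minors_norm d k B)" unfolding minors_norm_def
 by (intro sum_mono mult_left_mono member_le_sum[where f = "%r. SUM h:?I. abs (minor k r h B)"]) (auto intro: sum_nonneg)
also have "... = minors_norm d k A * minors_norm d k B" by (simp add: minors_norm_def sum_distrib_right)
finally show ?thesis .
qed

lemma minors_norm_le_entries:
assumes "A : Mat d d" "!!i j. i < d ==> j < d ==> abs (A $$ (i, j)) <= c"
shows "minors_norm d k A <= d ^ k * d ^ k * (fact k * c ^ k)"
proof -
have "minors_norm d k A <= (SUM f:index_maps k d. SUM h:index_maps k d. fact k * c ^ k)" unfolding minors_norm_def minor_def using assms
 by (intro sum_mono det_abs_le[of _ k "%_. c", simplified prod_constant card_lessThan])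
  (auto simp: index_maps_less)
thus ?thesis by (simp add: card_index_maps mult_ac)
qed

section \<open>Subspaces as ranges of injective matrices\<close>

text \<open>
  Subspaces are handled as ranges of matrices with independent columns, so that restricting a linear
  map to a subspace is again a matrix.
\<close>

definition rng :: "real mat => real vec set" where
"rng B = (%y. B *v y) ` Vec (dim_col B)"

definition kern :: "real mat => real vec set" where
"kern S = {x : Vec (dim_col S). S *v x = 0v (dim_row S)}"

definition inj_mat :: "real mat => bool" where
"inj_mat B <-> kern B <= {0v (dim_col B)}"

definition lsub :: "nat => real vec set => bool" where
"lsub q F <-> F <= Vec q & 0v q : F & (ALL x:F. ALL y:F. x + y : F) & (ALL c. ALL x:F. c .v x : F)"

lemma scalar_prod_self_eq_0:
"x : Vec n ==> (x ** x = (0::real)) <-> x = 0v n" by (auto simp: scalar_prod_def sum_nonneg_eq_0_iff intro!: eq_vecI)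

lemma scalar_prod_self_nonneg [simp]: "0 <= x ** (x::real vec)" by (simp add: scalar_prod_def sum_nonneg)

lemma mult_mat_zero_vec: "A : Mat n m ==> A *v 0v m = (0v n :: real vec)" by (auto intro!: eq_vecI)

lemma inj_matD:
"inj_mat B ==> B : Mat q r ==> y : Vec r ==> B *v y = 0v q ==> y = 0v r" by (auto simp: inj_mat_def kern_def)

lemma inj_matI:
"B : Mat q r ==> (!!y. y : Vec r ==> B *v y = 0v q ==> y = 0v r) ==> inj_mat B" by (auto simp: inj_mat_def kern_def)

lemma inj_mat_square: "B : Mat n n ==> inj_mat B <-> det B ~= 0" by (auto simp: inj_mat_def kern_def det_0_iff_vec_prod_zero)

text \<open>Zero rows make the matrix square without changing its kernel.\<close>

lemma wide_matrix_kernel: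
fixes B :: "real mat"
assumes B: "B : Mat r q" and "r < q"
obtains v where "v : Vec q" "v ~= 0v q" "B *v v = 0v r"
proof -
define M :: "real mat" where "M = mat q q (%(i, j). if i < r then B $$ (i, j) else 0)"
have M: "M : Mat q q" by (simp add: M_def)
have "M\<^sup>T *v unit_vec q r = (0v q :: real vec)" using \<open>r < q\<close> M by (intro eq_vecI) (auto simp: M_def)
moreover have "unit_vec q r ~= (0v q :: real vec)" using \<open>r < q\<close> vn_unit[of r q] by (metis vn_zero zero_neq_one)
ultimately have "det M\<^sup>T = 0" using M by (subst det_0_iff_vec_prod_zero[of _ q]) (auto intro!: exI[of _ "unit_vec q r"])
then obtain v where v: "v : Vec q" "v ~= 0v q" "M *v v = 0v q" using M det_0_iff_vec_prod_zero[of M q] by (auto simp: det_transpose)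
have "(B *v v) $ i = 0" if i: "i < r" for i
proof -
 have "(M *v v) $ i = (SUM j<q. M $$ (i, j) * v $ j)" using M v i \<open>r < q\<close> by (subst index_mult_vec_sum) auto
 also have "... = (SUM j<q. B $$ (i, j) * v $ j)" using i \<open>r < q\<close> by (intro sum.cong) (auto simp: M_def)
 also have "... = (B *v v) $ i" using B v i by (subst index_mult_vec_sum) auto
 finally show ?thesis using v i \<open>r < q\<close> by simp
qed
hence "B *v v = 0v r" using B by (intro eq_vecI) (auto simp del: Mv_index)
with v that show thesis by blast
qed

lemma rng_factor:
assumes B: "B : Mat q r" and B': "B' : Mat q r'" and sub: "rng B <= rng B'"
obtains C where "C : Mat r' r" "B = B' * C"
proof -
have "EX c. c : Vec r' & col B j = B' *v c" if "j < r" for j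
proof -
 have "B *v unit_vec r j = col B j" using B that by (intro eq_vecI) auto
 hence "col B j : rng B" using B that unfolding rng_def by (auto intro!: image_eqI[of _ _ "unit_vec r j"])
 thus ?thesis using sub B' by (auto simp: rng_def)
qed
then obtain c where c: "!!j. j < r ==> c j : Vec r' & col B j = B' *v c j" by metis
define C where "C = mat r' r (%(i, j). c j $ i)"
have C: "C : Mat r' r" by (simp add: C_def)
have "col C j = c j" if "j < r" for j using c[OF that] that by (intro eq_vecI) (auto simp: C_def)
hence "col (B' * C) j = col B j" if "j < r" for j using that c[OF that] by (subst col_mult2[OF B' C]) auto
hence "B = B' * C" using B B' C by (intro mat_col_eqI) auto
with C that show thesis by blast
qed

lemma rng_dim_le:
assumes B: "B : Mat q r" "inj_mat B" and B': "B' : Mat q r'" and sub: "rng B <= rng B'"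
shows "r <= r'"
proof (rule ccontr)
assume "\<not> r <= r'"
obtain C where C: "C : Mat r' r" "B = B' * C" using rng_factor[OF B(1) B' sub] .
obtain v where v: "v : Vec r" "v ~= 0v r" "C *v v = 0v r'" using wide_matrix_kernel[OF C(1)] \<open>\<not> r <= r'\<close> by auto
have "B *v v = 0v q" unfolding C(2) Mv_assoc[OF B' C(1) v(1)] v(3) using mult_mat_zero_vec[OF B'] .
with v inj_matD[OF B(2,1)] show False by blast
qed

lemma rng_dim_eq:
assumes B: "B : Mat q r" "inj_mat B" and B': "B' : Mat q r" and sub: "rng B <= rng B'"
shows "rng B = rng B'"
proof
obtain C where C: "C : Mat r r" "B = B' * C" using rng_factor[OF B(1) B' sub] .
have "inj_mat C"
proof (rule inj_matI[OF C(1)])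
 fix y assume y: "y : Vec r" "C *v y = 0v r"
 hence "B *v y = 0v q" unfolding C(2) Mv_assoc[OF B' C(1) y(1)] using mult_mat_zero_vec[OF B'] by simp
 thus "y = 0v r" using inj_matD[OF B(2,1)] y by blast
qed
hence "det C ~= 0" using inj_mat_square C by blast
then obtain D where D: "D : Mat r r" "C * D = Id r" using inverse_mat_exists[OF C(1)] by metis
have "B' *v y = B *v (D *v y)" if "y : Vec r" for y
proof -
 have "B *v (D *v y) = B' *v (C *v (D *v y))" unfolding C(2) using B' C(1) D(1) that by (subst Mv_assoc[of _ q r _ r]) auto
 also have "C *v (D *v y) = y" using C D that by (metis Mv_assoc one_mult_mat_vec)
 finally show ?thesis by simp
qed
thus "rng B' <= rng B" using B B' D by (auto simp: rng_def)
qed (rule sub)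

lemma left_inverse_exists:
assumes B: "B : Mat q r" "inj_mat B"
obtains L where "L : Mat r q" "L * B = Id r"
proof -
have BT: "B\<^sup>T : Mat r q" using B by simp
have G: "B\<^sup>T * B : Mat r r" using B by simp
have "inj_mat (B\<^sup>T * B)"
proof (rule inj_matI[OF G])
 fix y assume y: "y : Vec r" "(B\<^sup>T * B) *v y = 0v r"
 have By: "B *v y : Vec q" using B y by simp
 have "(B *v y) ** (B *v y) = (B\<^sup>T *v (B *v y)) ** y" using transpose_vec_mult_scalar[OF B(1) y(1) By] by simp
 also have "... = 0" using y Mv_assoc[OF BT B(1) y(1)] by simp
 finally have "B *v y = 0v q" using scalar_prod_self_eq_0[OF By] by simp
 thus "y = 0v r" using inj_matD[OF B(2,1)] y by blast
qed
hence "det (B\<^sup>T * B) ~= 0" using inj_mat_square[OF G] by blast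
then obtain D where D: "D : Mat r r" "D * (B\<^sup>T * B) = Id r" using inverse_mat_exists[OF G] by metis
have "(D * B\<^sup>T) * B = Id r" using D MM_assoc[OF D(1) BT B(1)] by simp
with that[of "D * B\<^sup>T"] D BT show thesis by simp
qed

lemma lsub_rng: "B : Mat q r ==> lsub q (rng B)" unfolding lsub_def rng_def
proof (intro conjI ballI allI)
assume B: "B : Mat q r"
let ?R = "(*\<^sub>v) B ` Vec (dim_col B)"
show "?R <= Vec q" using B by auto
show "0v q : ?R" using B by (intro image_eqI[of _ _ "0v r"]) auto
show "x + y : ?R" if xy: "x : ?R" "y : ?R" for x y
proof -
 from xy obtain a b where "a : Vec r" "b : Vec r" "x = B *v a" "y = B *v b" using B by auto
 thus ?thesis using B by (intro image_eqI[of _ _ "a + b"]) (auto simp: Mv_add)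
qed
show "c .v x : ?R" if x: "x : ?R" for c x
proof -
 from x obtain a where "a : Vec r" "x = B *v a" using B by auto
 thus ?thesis using B by (intro image_eqI[of _ _ "c .v a"]) (auto simp: mult_mat_vec)
qed
qed

lemma lsub_kern: "S : Mat p q ==> lsub q (kern S)" by (auto simp: lsub_def kern_def Mv_add mult_mat_vec intro!: eq_vecI)

text \<open>
  An injective matrix into the subspace with the greatest number of columns is onto: a vector outside
  its range could be appended as a further column.
\<close>

theorem lsub_basis:
assumes F: "lsub q F"
obtains r B where "r <= q" "B : Mat q r" "inj_mat B" "rng B = F"
proof -
define Q where "Q r <-> (EX B:Mat q r. inj_mat B & rng B <= F)" for r
have Q0: "Q 0" unfolding Q_def
proof (intro bexI[of _ "0m q 0"] conjI)
 show "inj_mat (0m q 0)" by (rule inj_matI[of _ q 0]) auto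
 have "0m q 0 *v x = 0v q" if "x : Vec 0" for x :: "real vec" using that by (intro eq_vecI) (auto simp: scalar_prod_def)
 thus "rng (0m q 0) <= F" using F by (auto simp: rng_def lsub_def)
qed auto
have Qle: "r <= q" if "Q r" for r
proof -
 from that obtain B where B: "B : Mat q r" "inj_mat B" by (auto simp: Q_def)
 moreover have "rng B <= rng (Id q)" using B by (auto simp: rng_def)
 ultimately show ?thesis using rng_dim_le[of B q r "Id q" q] by auto
qed
define r where "r = (GREATEST r. Q r)"
have Qr: "Q r" unfolding r_def using Q0 Qle by (rule GreatestI_nat)
have max: "\<not> Q (Suc r)" using Greatest_le_nat[of Q "Suc r" q] Qle by (auto simp: r_def)
from Qr obtain B where B: "B : Mat q r" "inj_mat B" "rng B <= F" by (auto simp: Q_def)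
have "F <= rng B"
proof (rule ccontr)
 assume "\<not> F <= rng B"
 then obtain x where x: "x : F" "x ~: rng B" by blast
 have xc: "x : Vec q" using F x by (auto simp: lsub_def)
 define B' where "B' = mat q (Suc r) (%(i, j). if j < r then B $$ (i, j) else x $ i)"
 have B': "B' : Mat q (Suc r)" by (simp add: B'_def)
 have mul: "B' *v y = B *v vec r (%j. y $ j) + (y $ r) .v x" if y: "y : Vec (Suc r)" for y
 proof (rule eq_vecI)
  fix i assume "i < dim_vec (B *v vec r (%j. y $ j) + (y $ r) .v x)"
  hence i: "i < q" using xc by simp
  have "(B' *v y) $ i = (SUM j<Suc r. B' $$ (i, j) * y $ j)" using B' y i by (subst index_mult_vec_sum) auto
  also have "... = (SUM j<r. B $$ (i, j) * y $ j) + x $ i * y $ r" using i by (simp add: B'_def)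
  also have "... = (B *v vec r (%j. y $ j) + (y $ r) .v x) $ i" using B xc i by (simp add: index_mult_vec_sum del: Mv_index)
  finally show "(B' *v y) $ i = (B *v vec r (%j. y $ j) + (y $ r) .v x) $ i" .
 qed (use B' xc in auto)
 have inF: "B *v v : F" if "v : Vec r" for v using B that by (auto simp: rng_def)
 have "inj_mat B'"
 proof (rule inj_matI[OF B'])
  fix y assume y: "y : Vec (Suc r)" and 0: "B' *v y = 0v q"
  let ?v = "vec r (%j. y $ j)"
  have eq: "B *v ?v + (y $ r) .v x = 0v q" using mul[OF y] 0 by simp
  have yr: "y $ r = 0"
  proof (rule ccontr)
   assume ne: "y $ r ~= 0"
   have "x $ i = (B *v ((- 1 / y $ r) .v ?v)) $ i" if i: "i < q" for i
   proof -
    have "(B *v ?v + (y $ r) .v x) $ i = 0" using eq i by simp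
    hence e: "(B *v ?v) $ i + y $ r * x $ i = 0" using B xc i by (simp del: Mv_index)
    have "B *v ((- 1 / y $ r) .v ?v) = (- 1 / y $ r) .v (B *v ?v)" using B by (intro mult_mat_vec[of _ q r]) auto
    hence "(B *v ((- 1 / y $ r) .v ?v)) $ i = (- 1 / y $ r) * (B *v ?v) $ i" using B i by (simp del: Mv_index)
    moreover have "x $ i = (- 1 / y $ r) * (B *v ?v) $ i" using e ne by (simp add: field_simps del: Mv_index)
    ultimately show ?thesis by simp
   qed
   hence "x = B *v ((- 1 / y $ r) .v ?v)" using xc B by (intro eq_vecI) (auto simp del: Mv_index)
   hence "x : rng B" using B by (auto simp: rng_def intro!: image_eqI)
   with x show False by simp
  qed
  hence "B *v ?v = 0v q"
  proof -
   have "(y $ r) .v x = 0v q" using yr xc by (intro eq_vecI) auto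
   thus ?thesis using eq right_zero_vec[OF mult_mat_vec_carrier[OF B(1) vec_carrier, of "%j. y $ j"]] by simp
  qed
  hence "?v = 0v r" using inj_matD[OF B(2,1)] by auto
  hence "y $ j = 0" if "j < r" for j using that by (metis index_vec index_zero_vec(1))
  hence "y $ j = 0" if "j < Suc r" for j using yr that by (auto simp: less_Suc_eq)
  thus "y = 0v (Suc r)" using y by (intro eq_vecI) auto
 qed
 moreover have "rng B' <= F" using B' mul inF x F by (auto simp: rng_def lsub_def)
 ultimately have "Q (Suc r)" using B' by (auto simp: Q_def)
 with max show False ..
qed
with B Qle[OF Qr] that show thesis by blast
qed

text \<open>For a left inverse \<open>L\<close> of \<open>B\<close>, the kernel of \<open>1 - B L\<close> is the range of \<open>B\<close>, which turns a range into a kernel.\<close>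

lemma annihilator_exists:
assumes B: "B : Mat q r" "inj_mat B"
obtains S where "S : Mat q q" "kern S = rng B"
proof -
obtain L where L: "L : Mat r q" "L * B = Id r" using left_inverse_exists[OF B] .
define S where "S = Id q - B * L"
have S: "S : Mat q q" unfolding S_def using B L by (intro minus_carrier_mat mult_carrier_mat)
have Sx: "S *v x = x - B *v (L *v x)" if "x : Vec q" for x
 unfolding S_def minus_mult_distrib_mat_vec[OF one_carrier_mat mult_carrier_mat[OF B(1) L(1)] that]
  Mv_assoc[OF B(1) L(1) that] using that by simp
have "kern S = rng B"
proof (intro equalityI subsetI)
 fix x assume "x : kern S"
 hence x: "x : Vec q" "x - B *v (L *v x) = 0v q" using S Sx by (auto simp: kern_def)
 have "x = B *v (L *v x)"
 proof (rule eq_vecI)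
  fix i assume "i < dim_vec (B *v (L *v x))"
  hence "i < q" using B by simp
  moreover have "(x - B *v (L *v x)) $ i = 0" using x(2) \<open>i < q\<close> by simp
  ultimately show "x $ i = (B *v (L *v x)) $ i" using x(1) B by (simp del: Mv_index)
 qed (use x B in auto)
 thus "x : rng B" using B L x by (auto simp: rng_def)
next
 fix x assume "x : rng B"
 then obtain y where y: "y : Vec r" "x = B *v y" using B by (auto simp: rng_def)
 have x: "x : Vec q" using y B by simp
 have "L *v x = y" using y B L by (metis Mv_assoc one_mult_mat_vec)
 hence "S *v x = x - x" using Sx[OF x] y by simp
 thus "x : kern S" using x S by (auto simp: kern_def)
qed
with that S show thesis by blast
qed

lemma inj_mat_lower_bound:
assumes B: "B : Mat q r" "inj_mat B"
obtains C where "C > 0" "!!y. y : Vec r ==> vn y <= C * vn (B *v y)"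
proof -
obtain L where L: "L : Mat r q" "L * B = Id r" using left_inverse_exists[OF B] .
have "vn y <= (mn L + 1) * vn (B *v y)" if y: "y : Vec r" for y
proof -
 have "y = L *v (B *v y)" using B L y by (metis Mv_assoc one_mult_mat_vec)
 hence "vn y <= mn L * vn (B *v y)" using vn_mult[OF L(1), of "B *v y"] B y by auto
 also have "... <= (mn L + 1) * vn (B *v y)" by (intro mult_right_mono) auto
 finally show ?thesis .
qed
moreover have "mn L + 1 > 0" using mn_nonneg[of L] by linarith
ultimately show thesis using that by blast
qed

text \<open>
  Adding \<open>B B\<^sup>T\<close>, where \<open>B\<close> is a basis of the kernel of \<open>S\<close>, makes \<open>S\<^sup>T S\<close> invertible; the part of
  \<open>x\<close> that \<open>S\<close> does not see then lies in the kernel, where \<open>S'\<close> vanishes as well.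
\<close>

theorem kernel_comparison:
assumes S: "S : Mat p q" and S': "S' : Mat p' q" and sub: "kern S <= kern S'"
obtains C where "C > 0" "!!x. x : Vec q ==> vn (S' *v x) <= C * vn (S *v x)"
proof -
obtain r B where B: "B : Mat q r" "inj_mat B" "rng B = kern S" using lsub_basis[OF lsub_kern[OF S]] .
have ST: "S\<^sup>T : Mat q p" and BT: "B\<^sup>T : Mat r q" using S B by auto
define G where "G = S\<^sup>T * S + B * B\<^sup>T"
have G: "G : Mat q q" using S B by (simp add: G_def)
have Gx: "G *v x = S\<^sup>T *v (S *v x) + B *v (B\<^sup>T *v x)" if "x : Vec q" for x unfolding G_def using S B ST BT that
 by (simp add: add_mult_distrib_mat_vec[of _ q q] Mv_assoc[of _ q p] Mv_assoc[of _ q r])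
have SB0: "S *v (B *v y) = 0v p" if "y : Vec r" for y
proof -
 have "B *v y : kern S" unfolding B(3)[symmetric] rng_def using B(1) that by auto
 thus ?thesis using S by (auto simp: kern_def)
qed
have BTB: "B\<^sup>T * B : Mat r r" using B by simp
have BTB_inj: "y = 0v r" if y: "y : Vec r" "B\<^sup>T *v (B *v y) = 0v r" for y
proof -
 have By: "B *v y : Vec q" using B y by simp
 have "(B *v y) ** (B *v y) = (B\<^sup>T *v (B *v y)) ** y" using transpose_vec_mult_scalar[OF B(1) y(1) By] by simp
 hence "B *v y = 0v q" using scalar_prod_self_eq_0[OF By] y by simp
 thus ?thesis using inj_matD[OF B(2,1)] y by blast
qed
have "inj_mat G"
proof (rule inj_matI[OF G])
 fix x assume x: "x : Vec q" "G *v x = 0v q"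
 have Sx: "S *v x : Vec p" and BTx: "B\<^sup>T *v x : Vec r" using S BT x by auto
 have "0 = (G *v x) ** x" using x by simp
 also have "... = (S\<^sup>T *v (S *v x)) ** x + (B *v (B\<^sup>T *v x)) ** x"
  unfolding Gx[OF x(1)] using ST Sx BTx B x by (intro add_scalar_prod_distrib[of _ q]) auto
 also have "(S\<^sup>T *v (S *v x)) ** x = (S *v x) ** (S *v x)" using transpose_vec_mult_scalar[OF S x(1) Sx] by simp
 also have "(B *v (B\<^sup>T *v x)) ** x = (B\<^sup>T *v x) ** (B\<^sup>T *v x)" using transpose_vec_mult_scalar[OF BT x(1) BTx] by simp
 finally have "(S *v x) ** (S *v x) + (B\<^sup>T *v x) ** (B\<^sup>T *v x) = 0" by simp
 hence "(S *v x) ** (S *v x) = 0" "(B\<^sup>T *v x) ** (B\<^sup>T *v x) = 0"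
  using scalar_prod_self_nonneg[of "S *v x"] scalar_prod_self_nonneg[of "B\<^sup>T *v x"] by linarith+
 hence Sx0: "S *v x = 0v p" and BTx0: "B\<^sup>T *v x = 0v r" using scalar_prod_self_eq_0 Sx BTx by auto
 have "x : rng B" using Sx0 x S by (auto simp: B kern_def)
 then obtain y where y: "y : Vec r" "x = B *v y" using B by (auto simp: rng_def)
 hence "y = 0v r" using BTB_inj BTx0 by blast
 thus "x = 0v q" using y B by auto
qed
hence "det G ~= 0" using inj_mat_square[OF G] by blast
then obtain H where H: "H : Mat q q" "H * G = Id q" using inverse_mat_exists[OF G] by metis
have HGx: "H *v (G *v x) = x" if "x : Vec q" for x using H G that by (metis Mv_assoc one_mult_mat_vec)
have "inj_mat (B\<^sup>T * B)" by (rule inj_matI[OF BTB]) (rule BTB_inj, simp_all only: Mv_assoc[OF BT B(1)])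
hence "det (B\<^sup>T * B) ~= 0" using inj_mat_square[OF BTB] by blast
then obtain D where D: "D : Mat r r" "(B\<^sup>T * B) * D = Id r" using inverse_mat_exists[OF BTB] by metis
have HB: "H *v (B *v z) = B *v (D *v z)" if z: "z : Vec r" for z
proof -
 let ?y = "D *v z"
 have y: "?y : Vec r" using D z by simp
 have By: "B *v ?y : Vec q" using B y by simp
 have "B\<^sup>T *v (B *v ?y) = ((B\<^sup>T * B) * D) *v z" unfolding Mv_assoc[OF BTB D(1) z] Mv_assoc[OF BT B(1) y] ..
 hence "B\<^sup>T *v (B *v ?y) = z" unfolding D(2) using z by simp
 hence "G *v (B *v ?y) = B *v z"
  unfolding Gx[OF By] SB0[OF y] mult_mat_zero_vec[OF ST] using left_zero_vec[OF mult_mat_vec_carrier[OF B(1) z]] by simp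
 thus ?thesis using HGx[OF By] by simp
qed
define T where "T = S' * (H * S\<^sup>T)"
have T: "T : Mat p' p" using S' H ST by (simp add: T_def)
have fac: "S' *v x = T *v (S *v x)" if x: "x : Vec q" for x
proof -
 have Sx: "S *v x : Vec p" and z: "B\<^sup>T *v x : Vec r" using S BT x by auto
 have "x = H *v (S\<^sup>T *v (S *v x)) + H *v (B *v (B\<^sup>T *v x))"
  using HGx[OF x] Mv_add[OF H(1) mult_mat_vec_carrier[OF ST Sx] mult_mat_vec_carrier[OF B(1) z]] unfolding Gx[OF x] by simp
 also have "H *v (B *v (B\<^sup>T *v x)) = B *v (D *v (B\<^sup>T *v x))" using HB[OF z] .
 finally have xe: "x = H *v (S\<^sup>T *v (S *v x)) + B *v (D *v (B\<^sup>T *v x))" .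
 have "B *v (D *v (B\<^sup>T *v x)) : kern S'" using sub B D z by (auto simp: rng_def)
 hence 0: "S' *v (B *v (D *v (B\<^sup>T *v x))) = 0v p'" using S' by (auto simp: kern_def)
 have "S' *v x = S' *v (H *v (S\<^sup>T *v (S *v x))) + S' *v (B *v (D *v (B\<^sup>T *v x)))"
  by (subst xe, rule Mv_add[OF S']) (insert H ST Sx B D z, auto)
 also have "... = S' *v (H *v (S\<^sup>T *v (S *v x)))"
  unfolding 0 using mult_mat_vec_carrier[OF S' mult_mat_vec_carrier[OF H(1) mult_mat_vec_carrier[OF ST Sx]]] by simp
 also have "... = T *v (S *v x)" unfolding T_def Mv_assoc[OF S' mult_carrier_mat[OF H(1) ST] Sx] Mv_assoc[OF H(1) ST Sx] ..
 finally show ?thesis .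
qed
have "vn (S' *v x) <= (mn T + 1) * vn (S *v x)" if x: "x : Vec q" for x
proof -
 have "vn (S' *v x) <= mn T * vn (S *v x)" using fac[OF x] vn_mult[OF T, of "S *v x"] S x by simp
 also have "... <= (mn T + 1) * vn (S *v x)" by (intro mult_right_mono) auto
 finally show ?thesis .
qed
moreover have "mn T + 1 > 0" using mn_nonneg[of T] by linarith
ultimately show thesis using that by blast
qed

section \<open>Compactness of bounded sets of matrices\<close>

lemma finitely_many_subsequences:
fixes f :: "nat => 'a => real"
assumes "finite X" "!!p k. p : X ==> abs (f k p) <= c"
shows "EX s. strict_mono s & (ALL p:X. convergent (%k. f (s k) p))" using assms
proof (induction X rule: finite_induct)
case empty
thus ?case by (intro exI[of _ id]) (auto simp: strict_mono_def)
next
case (insert p X)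
then obtain s where s: "strict_mono s" "ALL p:X. convergent (%k. f (s k) p)" by auto
have "bounded (range (%k. f (s k) p))" using insert.prems by (intro boundedI[of _ c]) auto
then obtain l r where r: "strict_mono r" "((%k. f (s k) p) \<circ> r) ---> l" using bounded_imp_convergent_subsequence by blast
have "convergent (%k. f ((s \<circ> r) k) p')" if "p' : insert p X" for p'
proof (cases "p' = p")
 case True
 thus ?thesis using r by (auto simp: comp_def convergent_def)
next
 case False
 with s that have "convergent (%k. f (s k) p')" by auto
 then obtain l' where "(%k. f (s k) p') ---> l'" by (auto simp: convergent_def)
 thus ?thesis using LIMSEQ_subseq_LIMSEQ[OF _ r(1)] by (auto simp: convergent_def comp_def)
qed
thus ?case using s(1) r(1) using insert.hyps by (intro exI[of _ "s \<circ> r"] conjI strict_mono_o) auto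
qed

lemma bounded_matrices_subsequence:
fixes A :: "nat => real mat"
assumes A: "!!k. A k : Mat n m" "!!k. mn (A k) <= c"
obtains s L where "strict_mono s" "L : Mat n m"
 "!!i j. i < n ==> j < m ==> (%k. A (s k) $$ (i, j)) ---> L $$ (i, j)"
proof -
have "EX s. strict_mono s & (ALL p:{..<n} \<times> {..<m}. convergent (%k. A (s k) $$ p))"
proof (rule finitely_many_subsequences[where c = c and f = "%k p. A k $$ p"])
 fix p k assume "p : {..<n} \<times> {..<m}"
 hence "abs (A k $$ p) <= mn (A k)" using A(1)[of k] by (auto intro: entry_le_mn)
 with A(2)[of k] show "abs (A k $$ p) <= c" by simp
qed auto
then obtain s where s: "strict_mono s" "!!p. p : {..<n} \<times> {..<m} ==> convergent (%k. A (s k) $$ p)" by blast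
show thesis
proof (rule that[of s "mat n m (%p. lim (%k. A (s k) $$ p))"])
 show "(%k. A (s k) $$ (i, j)) ---> mat n m (%p. lim (%k. A (s k) $$ p)) $$ (i, j)" if "i < n" "j < m" for i j
  using s(2)[of "(i, j)"] that by (simp add: convergent_LIMSEQ_iff)
qed (use s in auto)
qed

lemma tendsto_mn_diff:
assumes A: "!!k. A k : Mat n m" and L: "L : Mat n m"
 and lim: "!!i j. i < n ==> j < m ==> (%k. A k $$ (i, j)) ---> L $$ (i, j)"
shows "(%k. mn (A k - L)) ---> 0"
proof -
have "(%k. SUM i<n. SUM j<m. abs (A k $$ (i, j) - L $$ (i, j))) ---> (SUM i<n. SUM j<m. abs (L $$ (i, j) - L $$ (i, j)))"
 by (intro tendsto_intros lim) auto
moreover have "mn (A k - L) = (SUM i<n. SUM j<m. abs (A k $$ (i, j) - L $$ (i, j)))" for k using A[of k] L by (simp add: mn_def)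
ultimately show ?thesis by simp
qed

lemma tendsto_det:
assumes A: "!!k. A k : Mat n n" and L: "L : Mat n n"
 and lim: "!!i j. i < n ==> j < n ==> (%k. A k $$ (i, j)) ---> (L $$ (i, j) :: real)"
shows "(%k. det (A k)) ---> det L" unfolding det_def'[OF A] det_def'[OF L] by (intro tendsto_intros lim) (auto simp: permutes_lt)

section \<open>Spectral theorem and singular values\<close>

lemma symmetric_scalar_prod:
fixes G :: "real mat"
assumes "G : Mat d d" "G\<^sup>T = G" "x : Vec d" "y : Vec d"
shows "(G *v x) ** y = x ** (G *v y)" using transpose_vec_mult_scalar[of G d d y x] assms by simp

lemma scalar_prod_commute: "x : Vec n ==> y : Vec n ==> x ** y = y ** (x :: real vec)" by (auto simp: scalar_prod_def mult.commute)

lemma quadratic_nonpos_imp_linear_zero: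
fixes a c :: real
assumes "!!t. 2 * t * a + t^2 * c <= 0" "0 <= a"
shows "a = 0"
proof (rule ccontr)
assume "a ~= 0"
with assms(2) have a: "0 < a" by simp
define t where "t = a / (abs c + 1)"
have t: "0 < t" using a by (simp add: t_def)
have "t * abs c <= a" using a by (simp add: t_def field_simps)
hence "- a <= t * c" using t by (smt (verit) abs_le_iff abs_mult mult_minus_right zero_less_mult_iff abs_ge_self mult_le_cancel_left_pos minus_le_iff)
hence "0 < t * (2 * a + t * c)" using a t by (intro mult_pos_pos) auto
with assms(1)[of t] show False by (simp add: algebra_simps power2_eq_square)
qed

text \<open>
  The eigenvectors are found one after the other, each maximising the quadratic form on the unit
  sphere of the orthogonal complement of the previous ones; the eigenvalues then come out in
  decreasing order, the order in which singular values are indexed.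
\<close>

definition eigen_system :: "nat => real mat => nat => (nat => real vec) => (nat => real) => bool" where
"eigen_system d G r u l <->
 (ALL i<r. u i : Vec d & G *v u i = l i .v u i) \<and>
 (ALL i<r. ALL j<r. u i ** u j = (if i = j then 1 else 0)) \<and>
 (ALL i j. i <= j --> j < r --> l j <= l i) \<and>
 (ALL v:Vec d. (ALL i<r. v ** u i = 0) --> (ALL i<r. v ** (G *v v) <= l i * (v ** v)))"

lemma quadratic_form_maximum:
fixes G :: "real mat"
assumes G: "G : Mat d d" and u: "!!i. i < r ==> u i : Vec d" and r: "r < d"
obtains x where "x : Vec d" "x ** x = 1" "!!i. i < r ==> x ** u i = 0"
 "!!v. v : Vec d ==> v ** v = 1 ==> (!!i. i < r ==> v ** u i = 0) ==> v ** (G *v v) <= x ** (G *v x)"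
proof -
define S where "S = {v : Vec d. v ** v = 1 & (ALL i<r. v ** u i = 0)}"
define qf where "qf v = v ** (G *v v)" for v
have qf_sum: "qf v = (SUM i<d. v $ i * (SUM j<d. G $$ (i, j) * v $ j))" if "v : Vec d" for v unfolding qf_def scalar_prod_def[of v] using G that
 by (auto simp: index_mult_vec_sum lessThan_atLeast0 simp del: Mv_index intro!: sum.cong)
obtain v0 where v0: "v0 : Vec d" "v0 ~= 0v d" "mat r d (%(i, j). u i $ j) *v v0 = 0v r"
 using wide_matrix_kernel[of "mat r d (%(i, j). u i $ j)" r d] r by auto
have v0u: "v0 ** u i = 0" if i: "i < r" for i
proof -
 have "u i ** v0 = (mat r d (%(i, j). u i $ j) *v v0) $ i" using i u[OF i] v0(1,2) by (simp add: scalar_prod_def)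
 also have "... = 0" unfolding v0(3) using i by simp
 finally show ?thesis using scalar_prod_commute[OF u[OF i] v0(1)] by simp
qed
define c where "c = v0 ** v0"
have c: "0 < c" using scalar_prod_self_eq_0[OF v0(1)] v0(2) scalar_prod_self_nonneg[of v0] by (simp add: c_def less_le)
have "(1 / sqrt c) .v v0 : S" unfolding S_def using v0 v0u u c by (auto simp: c_def[symmetric] real_sqrt_mult[symmetric])
hence S_ne: "S ~= {}" by blast
have entry: "abs (v $ i) <= 1" if "v : S" "i < d" for v i
proof -
 have "(v $ i)^2 <= (SUM i<d. (v $ i)^2)" using that by (intro member_le_sum) auto
 also have "... = v ** v" using that by (auto simp: scalar_prod_def S_def lessThan_atLeast0 power2_eq_square intro!: sum.cong)
 also have "... = 1" using that by (simp add: S_def)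
 finally show ?thesis by (simp add: abs_square_le_1)
qed
have bdd: "qf v <= mn G" if v: "v : S" for v
proof -
 have "qf v <= (SUM i<d. SUM j<d. abs (G $$ (i, j)))" unfolding sum_distrib_left qf_sum[of v, OF that[unfolded S_def, THEN CollectD, THEN conjunct1]]
 proof (intro sum_mono)
  fix i j assume "i : {..<d}" "j : {..<d}"
  hence "abs (v $ i) * abs (v $ j) <= 1 * 1" using entry[OF v] by (intro mult_mono) auto
  hence "abs (v $ i * v $ j) * abs (G $$ (i, j)) <= 1 * abs (G $$ (i, j))" by (intro mult_right_mono) (auto simp: abs_mult)
  thus "v $ i * (G $$ (i, j) * v $ j) <= abs (G $$ (i, j))" using abs_ge_self[of "v $ i * v $ j * G $$ (i, j)"] by (simp add: abs_mult mult_ac)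
 qed
 thus ?thesis using G by (simp add: mn_def)
qed
define s where "s = Sup (qf ` S)"
have bddS: "bdd_above (qf ` S)" using bdd by (auto intro!: bdd_aboveI)
have up: "qf v <= s" if "v : S" for v unfolding s_def using bddS that by (intro cSUP_upper)
have "EX v:S. s - 1 / real (Suc n) < qf v" for n
proof -
 have "s - 1 / real (Suc n) < Sup (qf ` S)" by (simp add: s_def)
 thus ?thesis using less_cSUP_iff[OF S_ne bddS] by auto
qed
then obtain v where v: "!!n. v n : S" "!!n. s - 1 / real (Suc n) < qf (v n)" by metis
have vc: "v n : Vec d" for n using v(1)[of n] by (simp add: S_def)
obtain e where e: "strict_mono e" "!!i. i < d ==> convergent (%k. v (e k) $ i)"
 using finitely_many_subsequences[of "{..<d}" "%k i. v k $ i" 1] entry[OF v(1)] by auto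
define x where "x = vec d (%i. lim (%k. v (e k) $ i))"
have x: "x : Vec d" by (simp add: x_def)
have lim: "(%k. v (e k) $ i) ---> x $ i" if "i < d" for i using e(2)[OF that] that by (simp add: x_def convergent_LIMSEQ_iff)
have limw: "(%k. v (e k) ** w) ---> x ** w" if w: "w : Vec d" for w unfolding scalar_prod_def using w by (intro tendsto_intros lim) auto
have lim1: "(%k. v (e k) ** v (e k)) ---> x ** x" unfolding scalar_prod_def carrier_vecD[OF vc] carrier_vecD[OF x] by (intro tendsto_intros lim) auto
have limq: "(%k. qf (v (e k))) ---> qf x" unfolding qf_sum[OF vc] qf_sum[OF x] by (intro tendsto_intros lim) auto
have "x ** x = 1" using lim1 v(1) by (simp add: S_def LIMSEQ_const_iff)
moreover have "x ** u i = 0" if "i < r" for i using limw[OF u[OF that]] v(1) that by (simp add: S_def LIMSEQ_const_iff)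
moreover have "s <= qf x"
proof (rule LIMSEQ_le[OF _ limq])
 have "(%k. s - 1 / real (Suc k)) ---> s - 0" by (intro tendsto_intros LIMSEQ_inverse_real_of_nat[unfolded inverse_eq_divide])
 thus "((%k. s - 1 / real (Suc k)) \<circ> e) ---> s" using LIMSEQ_subseq_LIMSEQ[OF _ e(1)] by simp
 show "EX N. ALL n>=N. ((%k. s - 1 / real (Suc k)) \<circ> e) n <= qf (v (e n))" using v(2)[of "e _"] by (auto intro!: less_imp_le)
qed
ultimately show thesis using that[OF x] up by (auto simp: S_def qf_def intro: order_trans)
qed

lemma eigen_system_exists:
fixes G :: "real mat"
assumes G: "G : Mat d d" "G\<^sup>T = G" and "r <= d"
shows "EX u l. eigen_system d G r u l" using \<open>r <= d\<close>
proof (induction r)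
case 0
show ?case by (auto simp: eigen_system_def)
next
case (Suc r)
then obtain u l where E: "eigen_system d G r u l" by auto
have u: "u i : Vec d" "G *v u i = l i .v u i" if "i < r" for i using E that by (auto simp: eigen_system_def)
obtain x where x: "x : Vec d" "x ** x = 1" "!!i. i < r ==> x ** u i = 0"
 and xmax: "!!v. v : Vec d ==> v ** v = 1 ==> (!!i. i < r ==> v ** u i = 0) ==> v ** (G *v v) <= x ** (G *v x)"
 by (rule quadratic_form_maximum[OF G(1), of r u]) (use u(1) Suc.prems in \<open>auto\<close>)
define m where "m = x ** (G *v x)"
have Gc: "G *v v : Vec d" if "v : Vec d" for v using G that by simp
have max: "v ** (G *v v) <= m * (v ** v)" if v: "v : Vec d" "!!i. i < r ==> v ** u i = 0" for v
proof (cases "v = 0v d")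
 case True
 thus ?thesis using G by (simp add: scalar_prod_def)
next
 case False
 define c where "c = v ** v"
 have c: "0 < c" using scalar_prod_self_eq_0[OF v(1)] False scalar_prod_self_nonneg[of v] by (simp add: c_def less_le)
 let ?w = "(1 / sqrt c) .v v"
 have "?w ** (G *v ?w) <= m" unfolding m_def
 proof (rule xmax)
  show "?w : Vec d" using v by simp
  show "?w ** ?w = 1" using v c by (simp add: c_def[symmetric] real_sqrt_mult[symmetric])
  show "?w ** u i = 0" if "i < r" for i using v(2)[OF that] v(1) u(1)[OF that] by simp
 qed
 moreover have "?w ** (G *v ?w) = (v ** (G *v v)) / c" using v c Gc[OF v(1)] G(1) by (simp add: mult_mat_vec[of _ d d] real_sqrt_mult[symmetric])
 ultimately show ?thesis using c by (simp add: c_def[symmetric] field_simps)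
qed
have eig: "G *v x = m .v x"
proof -
 define w where "w = G *v x - m .v x"
 have w: "w : Vec d" using Gc[OF x(1)] x by (simp add: w_def)
 have wu: "w ** u i = 0" if i: "i < r" for i
 proof -
  have "w ** u i = (G *v x) ** u i - m * (x ** u i)" unfolding w_def using Gc[OF x(1)] x(1) u[OF i] by (simp add: minus_scalar_prod_distrib[of _ d])
  also have "(G *v x) ** u i = x ** (l i .v u i)" using symmetric_scalar_prod[OF G x(1) u(1)[OF i]] u(2)[OF i] by simp
  finally show ?thesis using x(3)[OF i] x(1) u(1)[OF i] by simp
 qed
 have ww: "w ** (G *v x) - m * (w ** x) = w ** w" unfolding w_def using Gc[OF x(1)] x(1) by (simp add: scalar_prod_minus_distrib[of _ d])
 have "w ** w = 0"
 proof (rule quadratic_nonpos_imp_linear_zero)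
  fix t :: real
  let ?v = "x + t .v w"
  have v: "?v : Vec d" using x w by simp
  have Gv: "G *v ?v = G *v x + t .v (G *v w)" using G x w by (simp add: Mv_add[of _ d d] mult_mat_vec[of _ d d])
  have e1: "?v ** (G *v ?v) = m + 2 * t * (w ** (G *v x)) + t^2 * (w ** (G *v w))"
   unfolding Gv using x(1) w Gc[OF x(1)] Gc[OF w] symmetric_scalar_prod[OF G x(1) w]
    scalar_prod_commute[OF Gc[OF x(1)] w]
   by (simp add: add_scalar_prod_distrib[of _ d] scalar_prod_add_distrib[of _ d] m_def power2_eq_square algebra_simps)
  have e2: "?v ** ?v = 1 + 2 * t * (w ** x) + t^2 * (w ** w)" using x(1,2) w scalar_prod_commute[OF x(1) w]
   by (simp add: add_scalar_prod_distrib[of _ d] scalar_prod_add_distrib[of _ d] power2_eq_square algebra_simps)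
  have "?v ** (G *v ?v) <= m * (?v ** ?v)" using x w u wu by (intro max[OF v]) (simp add: add_scalar_prod_distrib[of _ d])
  thus "2 * t * (w ** w) + t^2 * (w ** (G *v w) - m * (w ** w)) <= 0" unfolding e1 e2 ww[symmetric] by (simp add: algebra_simps)
 qed simp
 hence "w = 0v d" using scalar_prod_self_eq_0[OF w] by simp
 hence "(G *v x - m .v x) $ i = 0" if "i < d" for i using that by (simp add: w_def)
 thus ?thesis using Gc[OF x(1)] x(1) G(1) by (intro eq_vecI) (auto simp del: Mv_index)
qed
have "eigen_system d G (Suc r) (u(r := x)) (l(r := m))" unfolding eigen_system_def
proof (intro conjI allI impI ballI)
 fix i assume "i < Suc r"
 thus "(u(r := x)) i : Vec d" "G *v (u(r := x)) i = (l(r := m)) i .v (u(r := x)) i" using u x eig by (auto simp: less_Suc_eq)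
next
 fix i j assume "i < Suc r" "j < Suc r"
 thus "(u(r := x)) i ** (u(r := x)) j = (if i = j then 1 else 0)"
  using E x u scalar_prod_commute[OF x(1) u(1)] by (auto simp: less_Suc_eq eigen_system_def)
next
 fix i j :: nat assume "i <= j" "j < Suc r"
 moreover have "m <= l i" if "i < r"
 proof -
  have "x ** (G *v x) <= l i * (x ** x)" using E x that by (auto simp: eigen_system_def)
  thus ?thesis using x by (simp add: m_def)
 qed
 ultimately show "(l(r := m)) j <= (l(r := m)) i" using E by (auto simp: less_Suc_eq eigen_system_def)
next
 fix v i assume v: "v : Vec d" "ALL i<Suc r. v ** (u(r := x)) i = 0" and i: "i < Suc r"
 have vu: "v ** u i = 0" if "i < r" for i using v(2)[rule_format, of i] that by simp
 show "v ** (G *v v) <= (l(r := m)) i * (v ** v)" using i v(1) vu max E by (auto simp: less_Suc_eq eigen_system_def)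
qed
thus ?case by blast
qed

lemma proots_linear_factors: "proots (\<Prod>a\<leftarrow>xs. [:- a, 1:]) = mset (xs :: real list)"
proof (induction xs)
case (Cons a xs)
have "(\<Prod>a\<leftarrow>xs. [:- a, 1 :: real:]) ~= 0" by (auto simp: prod_list_zero_iff)
hence "proots (\<Prod>a\<leftarrow>a # xs. [:- a, 1:]) = proots [:- a, 1:] + proots (\<Prod>a\<leftarrow>xs. [:- a, 1:])"
 unfolding list.map prod_list.Cons by (intro proots_mult) auto
thus ?case by (simp add: Cons del: mult_pCons_left)
qed simp

text \<open>
  The columns of \<open>A U\<close>, for an orthonormal eigenbasis \<open>U\<close> of \<open>A\<^sup>T A\<close>, are orthogonal with the
  singular values as lengths.
\<close>

lemma singular_frame_exists:
assumes A: "A : Mat d d" and det: "det A ~= 0"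
obtains U s where "U : Mat d d" "U * U\<^sup>T = Id d" "!!i j. i < d ==> j < d ==> abs (U $$ (i, j)) <= 1"
 "!!i. i < d ==> 0 < s i" "!!i j. i <= j ==> j < d ==> s j <= s i"
 "(A * U)\<^sup>T * (A * U) = mat d d (%(i, j). if i = j then (s i)\<^sup>2 else 0)"
 "!!i. i < d ==> singular_value A (Suc i) = s i" "(PROD i<d. s i) = abs (det A)"
proof -
define G where "G = A\<^sup>T * A"
have AT: "A\<^sup>T : Mat d d" using A by simp
have G: "G : Mat d d" "G\<^sup>T = G" using A AT transpose_mult[OF AT A] by (auto simp: G_def)
obtain u l where E: "eigen_system d G d u l" using eigen_system_exists[OF G order_refl] by blast
define U where "U = mat d d (%(i, j). u j $ i)"
have U: "U : Mat d d" by (simp add: U_def)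
have u: "u i : Vec d" "G *v u i = l i .v u i" if "i < d" for i using E that by (auto simp: eigen_system_def)
have uu: "u i ** u j = (if i = j then 1 else 0)" if "i < d" "j < d" for i j using E that by (auto simp: eigen_system_def)
have colU: "col U j = u j" if "j < d" for j using u(1)[OF that] that by (intro eq_vecI) (auto simp: U_def)
have UT: "U\<^sup>T : Mat d d" using U by simp
have UTU: "U\<^sup>T * U = Id d"
proof (rule eq_matI)
 fix i j assume "i < dim_row (Id d :: real mat)" "j < dim_col (Id d :: real mat)"
 hence ij: "i < d" "j < d" by auto
 have "row U\<^sup>T i = u i" using U ij colU by simp
 thus "(U\<^sup>T * U) $$ (i, j) = Id d $$ (i, j)" using U ij colU uu by simp
qed (use U in auto)
have UUT: "U * U\<^sup>T = Id d" using mat_mult_left_right_inverse[OF UT U UTU] .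
have AU: "A * U : Mat d d" using A U by simp
have diag: "(A * U)\<^sup>T * (A * U) = mat d d (%(i, j). if i = j then l i else 0)"
proof -
 have "(A * U)\<^sup>T * (A * U) = U\<^sup>T * (G * U)" unfolding G_def using A U AT UT
  by (simp add: transpose_mult[OF A U] MM_assoc[of _ d d _ d _ d])
 also have "... = mat d d (%(i, j). if i = j then l i else 0)"
 proof (rule eq_matI)
  fix i j assume "i < dim_row (mat d d (%(i, j). if i = j then l i else 0))" "j < dim_col (mat d d (%(i, j). if i = j then l i else 0))"
  hence ij: "i < d" "j < d" by auto
  have "row U\<^sup>T i = u i" using U ij colU by simp
  moreover have "col (G * U) j = l j .v u j" using col_mult2[OF G(1) U ij(2)] colU[OF ij(2)] u(2)[OF ij(2)] by simp
  ultimately have "(U\<^sup>T * (G * U)) $$ (i, j) = u i ** (l j .v u j)" using U G ij by simp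
  thus "(U\<^sup>T * (G * U)) $$ (i, j) = mat d d (%(i, j). if i = j then l i else 0) $$ (i, j)"
   using ij uu[OF ij] u(1)[OF ij(1)] u(1)[OF ij(2)] by simp
 qed (use U G in auto)
 finally show ?thesis .
qed
have lpos: "0 < l i" if i: "i < d" for i
proof -
 have "inj_mat A" using inj_mat_square[OF A] det by simp
 moreover have "u i ~= 0v d" using uu[OF i i] scalar_prod_self_eq_0[OF u(1)[OF i]] by auto
 ultimately have ne: "A *v u i ~= 0v d" using inj_matD[OF _ A u(1)[OF i]] by blast
 have Au: "A *v u i : Vec d" using A u(1)[OF i] by simp
 have "(A *v u i) ** (A *v u i) = (A\<^sup>T *v (A *v u i)) ** u i" using transpose_vec_mult_scalar[OF A u(1)[OF i] Au] by simp
 also have "A\<^sup>T *v (A *v u i) = G *v u i" unfolding G_def using Mv_assoc[OF AT A u(1)[OF i]] by simp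
 also have "(G *v u i) ** u i = l i" using u[OF i] uu[OF i i] by simp
 finally show ?thesis using ne scalar_prod_self_eq_0[OF Au] scalar_prod_self_nonneg[of "A *v u i"] by (simp add: less_le)
qed
define s where "s i = sqrt (l i)" for i
have ss: "(s i)^2 = l i" if "i < d" for i using lpos[OF that] by (simp add: s_def)
have dec: "s j <= s i" if "i <= j" "j < d" for i j using E that by (auto simp: eigen_system_def s_def)
have Ubd: "abs (U $$ (i, j)) <= 1" if ij: "i < d" "j < d" for i j
proof -
 have "(u j $ i)^2 <= (SUM i<d. (u j $ i)^2)" using ij by (intro member_le_sum) auto
 also have "... = u j ** u j" using u(1)[OF ij(2)] by (auto simp: scalar_prod_def lessThan_atLeast0 power2_eq_square intro!: sum.cong)
 also have "... = 1" using uu ij by simp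
 finally show ?thesis using ij by (simp add: U_def abs_square_le_1)
qed
define D where "D = mat d d (%(i, j). if i = j then l i else 0)"
have D: "D : Mat d d" by (simp add: D_def)
have "similar_mat G D"
proof -
 have GU: "G * U : Mat d d" using G U by simp
 have 1: "U\<^sup>T * (G * U) = D" using diag A U AT UT by (simp add: D_def G_def transpose_mult[OF A U] MM_assoc[of _ d d _ d _ d])
 have "U * D * U\<^sup>T = (U * U\<^sup>T) * G * (U * U\<^sup>T)"
  unfolding 1[symmetric] using G U UT GU by (simp add: MM_assoc[of _ d d _ d _ d] del: UUT)
 hence "G = U * D * U\<^sup>T" using UUT G by simp
 thus ?thesis unfolding similar_mat_def similar_mat_wit_def using G D U UT UUT UTU by (intro exI[of _ U] exI[of _ "U\<^sup>T"]) (simp add: Let_def)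
qed
hence "char_poly G = char_poly D" by (rule char_poly_similar)
also have "... = (\<Prod>a\<leftarrow>diag_mat D. [:- a, 1:])" by (rule char_poly_upper_triangular[OF D]) (auto simp: D_def)
also have "diag_mat D = map l [0..<d]" by (simp add: diag_mat_def D_def)
finally have "proots (char_poly G) = mset (map l [0..<d])" by (simp only: proots_linear_factors)
hence "image_mset sqrt (proots (char_poly G)) = mset (map sqrt (map l [0..<d]))" by (simp only: mset_map)
also have "map sqrt (map l [0..<d]) = map s [0..<d]" by (simp add: s_def)
finally have "image_mset sqrt (proots (char_poly G)) = mset (rev (map s [0..<d]))" by (simp only: mset_rev)
moreover have "sorted (rev (map s [0..<d]))" by (auto simp: sorted_wrt_iff_nth_less rev_nth intro!: dec)
ultimately have "sorted_list_of_multiset (image_mset sqrt (proots (char_poly G))) = rev (map s [0..<d])"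
 by (metis sorted_list_of_multiset_mset sorted_sort_id)
hence sv: "singular_value A (Suc i) = s i" if "i < d" for i using that by (simp add: singular_value_def G_def)
have "(PROD i<d. s i) = abs (det A)"
proof -
 have "det U * det U = 1" using arg_cong[OF UTU, of det] det_mult[OF UT U] det_transpose[OF U] by simp
 moreover have "det ((A * U)\<^sup>T * (A * U)) = (det A * det U) * (det A * det U)"
  using det_mult[OF _ AU, of "(A * U)\<^sup>T"] AU det_transpose[OF AU] det_mult[OF A U] by simp
 moreover have "det D = (PROD i<d. l i)"
 proof -
  have "upper_triangular D" by (auto simp: D_def)
  hence "det D = prod_list (map l [0..<d])" using det_upper_triangular[OF _ D] \<open>diag_mat D = map l [0..<d]\<close> by simp
  thus ?thesis by (simp add: prod.distinct_set_conv_list[symmetric] lessThan_atLeast0)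
 qed
 ultimately have "(PROD i<d. l i) = (det A)^2" using diag by (simp add: D_def power2_eq_square algebra_simps)
 moreover have "(PROD i<d. l i) = (PROD i<d. s i)^2" by (simp add: prod_power_distrib ss)
 ultimately have "(PROD i<d. s i)^2 = abs (det A)^2" by simp
 moreover have "0 <= (PROD i<d. s i)" using lpos by (intro prod_nonneg) (auto simp: s_def less_imp_le)
 ultimately show ?thesis by (simp only: power2_eq_iff_nonneg abs_ge_zero)
qed
moreover have "(A * U)\<^sup>T * (A * U) = mat d d (%(i, j). if i = j then (s i)\<^sup>2 else 0)" unfolding diag by (intro eq_matI) (auto simp: ss)
ultimately show thesis using that[of U s] U UUT Ubd lpos dec sv by (auto simp: s_def)
qed

lemma sum_squares_le_square_sum_abs:
fixes x :: "'a => real"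
assumes "finite I"
shows "(SUM r:I. (x r)^2) <= (SUM r:I. abs (x r))^2" using assms
proof (induction I rule: finite_induct)
case (insert r I)
have "0 <= 2 * abs (x r) * (SUM r:I. abs (x r))" by (intro mult_nonneg_nonneg sum_nonneg) auto
hence "(SUM r:I. (x r)^2) <= (SUM r:I. abs (x r))^2 + 2 * abs (x r) * (SUM r:I. abs (x r))" using insert.IH by linarith
with insert.hyps show ?case by (simp add: power2_sum)
qed simp

lemma prod_le_initial_prod:
fixes s :: "nat => real"
assumes "finite H" "H <= {..<d}" "!!i. i < d ==> 0 < s i" "!!i j. i <= j ==> j < d ==> s j <= s i"
shows "(PROD i:H. s i) <= (PROD i<card H. s i)" using assms(1,2)
proof (induction "card H" arbitrary: H)
case 0
thus ?case by simp
next
case (Suc k)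
hence ne: "H ~= {}" by auto
define m where "m = Max H"
have m: "m : H" using ne Suc.prems by (simp add: m_def)
have "H <= {..m}" using Suc.prems by (auto simp: m_def)
hence "card H <= Suc m" using card_mono[of "{..m}" H] by simp
hence km: "k <= m" using Suc.hyps by simp
have md: "m < d" using m Suc.prems by auto
have "(PROD i:H. s i) = s m * (PROD i:H - {m}. s i)" using m Suc.prems by (intro prod.remove) auto
also have "... <= s k * (PROD i<k. s i)"
proof (rule mult_mono)
 show "s m <= s k" using assms(4) km md by blast
 have "card (H - {m}) = k" using Suc m by simp
 thus "(PROD i:H - {m}. s i) <= (PROD i<k. s i)" using Suc.hyps(1)[of "H - {m}"] Suc.prems by auto
 show "0 <= s k" using assms(3)[of k] km md by simp
 show "0 <= (PROD i:H - {m}. s i)" using Suc.prems assms(3) by (intro prod_nonneg) (force intro: less_imp_le)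
qed
also have "... = (PROD i<card H. s i)" using Suc.hyps(2)[symmetric] by (simp add: mult.commute)
finally show ?case .
qed

text \<open>
  Orthogonal matrices have bounded minors, so by submultiplicativity passing from \<open>A\<close> to \<open>A U\<close>,
  whose columns are orthogonal with the singular values as lengths, costs only a constant.
\<close>

theorem minors_norm_singular_values:
assumes A: "A : Mat d d" and det: "det A ~= 0" and k: "k <= d"
defines "c \<equiv> real d ^ k * real d ^ k * fact k"
shows "(PROD i<k. singular_value A (Suc i)) <= c * minors_norm d k A"
 and "minors_norm d k A <= c * c * (PROD i<k. singular_value A (Suc i))"
 and "!!i. i < d ==> 0 < singular_value A (Suc i)"
 and "!!i j. i <= j ==> j < d ==> singular_value A (Suc j) <= singular_value A (Suc i)"
 and "(PROD i<d. singular_value A (Suc i)) = abs (det A)"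
proof -
obtain U s where U: "U : Mat d d" "U * U\<^sup>T = Id d" "!!i j. i < d ==> j < d ==> abs (U $$ (i, j)) <= 1"
 and s: "!!i. i < d ==> 0 < s i" "!!i j. i <= j ==> j < d ==> s j <= s i"
 and AU: "(A * U)\<^sup>T * (A * U) = mat d d (%(i, j). if i = j then (s i)\<^sup>2 else 0)"
 and sv: "!!i. i < d ==> singular_value A (Suc i) = s i" "(PROD i<d. s i) = abs (det A)" by (rule singular_frame_exists[OF A det]) blast
let ?I = "index_maps k d"
define B where "B = A * U"
have B: "B : Mat d d" using A U by (simp add: B_def)
have BT: "B\<^sup>T : Mat d d" using B by simp
have UT: "U\<^sup>T : Mat d d" using U by simp
have prods: "(PROD i<k. singular_value A (Suc i)) = (PROD i<k. s i)" using sv(1) k by (intro prod.cong) auto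
have c0: "0 <= c" by (simp add: c_def)
have NU: "minors_norm d k U <= c" "minors_norm d k U\<^sup>T <= c"
proof -
 show "minors_norm d k U <= c" unfolding c_def using minors_norm_le_entries[OF U(1,3), of k] by simp
 have "abs (U\<^sup>T $$ (i, j)) <= 1" if "i < d" "j < d" for i j using U(1) U(3)[OF that(2,1)] that by simp
 thus "minors_norm d k U\<^sup>T <= c" unfolding c_def using minors_norm_le_entries[OF UT, of 1 k] by simp
qed
have P0: "0 <= (PROD i<k. s i)" by (intro prod_nonneg less_imp_le s(1)) (use k in auto)
have entryB: "abs (B $$ (i, j)) <= s j" if ij: "i < d" "j < d" for i j
proof -
 have "(B\<^sup>T * B) $$ (j, j) = (s j)^2" using AU ij by (simp add: B_def)
 moreover have "(B\<^sup>T * B) $$ (j, j) = (SUM i<d. (B $$ (i, j))^2)" using B ij by (subst index_mult_mat_sum) (auto simp: power2_eq_square)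
 moreover have "(B $$ (i, j))^2 <= (SUM i<d. (B $$ (i, j))^2)" using ij by (intro member_le_sum) auto
 ultimately have "(B $$ (i, j))^2 <= (s j)^2" by simp
 thus ?thesis using s(1)[OF ij(2)] by (simp add: abs_le_square_iff[symmetric])
qed
have NB: "minors_norm d k B <= c * (PROD i<k. s i)"
proof -
 have "abs (minor k f h B) <= fact k * (PROD i<k. s i)" if f: "f : ?I" and h: "h : ?I" for f h
 proof (cases "inj_on h {0..<k}")
  case True
  have "abs (minor k f h B) <= fact k * (PROD j<k. s (h j))" unfolding minor_def using entryB index_maps_less[OF f] index_maps_less[OF h]
   by (intro det_abs_le) auto
  also have "(PROD j<k. s (h j)) = (PROD i:h ` {0..<k}. s i)" using True by (simp add: prod.reindex lessThan_atLeast0)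
  also have "... <= (PROD i<card (h ` {0..<k}). s i)" using index_maps_less[OF h] s by (intro prod_le_initial_prod[where d = d]) auto
  also have "card (h ` {0..<k}) = k" using True by (simp add: card_image)
  finally show ?thesis by simp
 next
  case False
  then obtain a b where ab: "a < k" "b < k" "a ~= b" "h a = h b" by (auto simp: inj_on_def)
  have "minor k f h B = 0" unfolding minor_def using ab by (intro det_identical_columns[of _ k a b]) (auto intro!: eq_vecI)
  thus ?thesis using P0 by simp
 qed
 hence "minors_norm d k B <= (SUM f:?I. SUM h:?I. fact k * (PROD i<k. s i))" unfolding minors_norm_def by (intro sum_mono)
 thus ?thesis by (simp add: card_index_maps c_def mult_ac)
qed
have "A = B * U\<^sup>T" unfolding B_def using A U UT by (simp add: MM_assoc[of _ d d _ d _ d])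
hence "minors_norm d k A <= minors_norm d k B * minors_norm d k U\<^sup>T" using minors_norm_mult[OF B UT] by simp
also have "... <= (c * (PROD i<k. s i)) * c"
 using NB NU c0 by (intro mult_mono) (auto simp: minors_norm_nonneg intro: order_trans[OF minors_norm_nonneg])
finally show "minors_norm d k A <= c * c * (PROD i<k. singular_value A (Suc i))" by (simp add: prods mult_ac)
show "(PROD i<k. singular_value A (Suc i)) <= c * minors_norm d k A"
proof -
 define f0 where "f0 = restrict id {0..<k}"
 have f0: "f0 : ?I" using k by (auto simp: f0_def index_maps_def)
 have "minor k f0 f0 (B\<^sup>T * B) = (PROD i<k. s i)^2"
 proof -
  let ?M = "mat k k (%(i, j). (B\<^sup>T * B) $$ (f0 i, f0 j))"
  have M: "?M = mat k k (%(i, j). if i = j then (s i)\<^sup>2 else 0)"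
   using AU k by (intro eq_matI) (auto simp: f0_def B_def simp del: index_mult_mat)
  have "det ?M = prod_list (diag_mat ?M)" unfolding M by (rule det_upper_triangular[of _ k]) auto
  also have "... = (PROD i<k. (s i)^2)" unfolding M by (auto simp: diag_mat_def prod.distinct_set_conv_list[symmetric] lessThan_atLeast0)
  finally show ?thesis by (simp add: minor_def prod_power_distrib)
 qed
 moreover have "minor k f0 r B\<^sup>T = minor k r f0 B" if r: "r : ?I" for r
 proof -
  have "mat k k (%(i, j). B\<^sup>T $$ (f0 i, r j)) = (mat k k (%(i, j). B $$ (r i, f0 j)))\<^sup>T"
   using B index_maps_less[OF f0] index_maps_less[OF r] by (intro eq_matI) auto
  thus ?thesis by (simp add: minor_def det_transpose[of _ k])
 qed
 ultimately have "fact k * (PROD i<k. s i)^2 = (SUM r:?I. (minor k r f0 B)^2)" using Cauchy_Binet[OF BT B f0 f0] by (simp add: power2_eq_square)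
 also have "... <= (SUM r:?I. abs (minor k r f0 B))^2" by (rule sum_squares_le_square_sum_abs) simp
 also have "... <= (minors_norm d k B)^2" unfolding minors_norm_def using f0
  by (intro power_mono sum_mono member_le_sum[where f = "%h. abs (minor k _ h B)"] sum_nonneg) auto
 finally have "fact k * (PROD i<k. s i)^2 <= (minors_norm d k B)^2" .
 moreover have "(PROD i<k. s i)^2 <= fact k * (PROD i<k. s i)^2"
  using mult_right_mono[OF fact_ge_1[of k, where ?'a = real], of "(PROD i<k. s i)^2"] by simp
 ultimately have "(PROD i<k. s i)^2 <= (minors_norm d k B)^2" by linarith
 hence "(PROD i<k. s i) <= minors_norm d k B" by (rule power2_le_imp_le) (rule minors_norm_nonneg)
 also have "... <= minors_norm d k A * minors_norm d k U" unfolding B_def using minors_norm_mult[OF A U(1)] .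
 also have "... <= minors_norm d k A * c" using NU minors_norm_nonneg by (intro mult_left_mono) auto
 finally show ?thesis by (simp add: prods mult_ac)
qed
show "!!i. i < d ==> 0 < singular_value A (Suc i)" using sv s by simp
show "!!i j. i <= j ==> j < d ==> singular_value A (Suc j) <= singular_value A (Suc i)" using sv s by simp
show "(PROD i<d. singular_value A (Suc i)) = abs (det A)" using sv by simp
qed

section \<open>The subadditive ergodic theorem for independent sequences\<close>

lemma sum_lessThan_add: "(SUM k<a + b. f k) = (SUM k<a. f k) + (SUM k<b. f (a + k) :: real)" for a b :: nat by (induction b) (auto simp: add.assoc)

context sequence_space
begin

definition shift :: "(nat => 'a) => nat => 'a" where
"shift w = (%i. w (Suc i))"

lemma shift_funpow: "(shift ^^ m) w = (%i. w (m + i))" by (induction m) (auto simp: shift_def)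

lemma shift_case_nat [simp]: "shift (case_nat s w) = w" by (auto simp: shift_def)

lemma shift_comb_seq [simp]: "(shift ^^ i) (comb_seq i w w') = w'" by (auto simp: shift_funpow comb_seq_def)

lemma measurable_shift [measurable]: "shift : measurable S S" unfolding shift_def by (rule measurable_PiM_single') (auto simp: space_PiM)

lemma measurable_shift_funpow [measurable]: "(shift ^^ m) : measurable S S"
unfolding shift_funpow by (rule measurable_PiM_single') (auto simp: space_PiM)

lemma distr_shift_funpow: "distr S S (shift ^^ m) = S"
proof (rule measure_eqI)
fix A assume "A : sets (distr S S (shift ^^ m))"
hence A: "A : sets S" by simp
have "emeasure (distr S S (shift ^^ m)) A = emeasure S ((shift ^^ m) -` A Int space S)" using A by (intro emeasure_distr) auto
also have "... = emeasure (distr (S \<Otimes>\<^sub>M S) S (%(w, w'). comb_seq m w w')) ((shift ^^ m) -` A Int space S)" by (simp only: PiM_comb_seq)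
also have "... = emeasure (S \<Otimes>\<^sub>M S) ((%(w, w'). comb_seq m w w') -` ((shift ^^ m) -` A Int space S) Int space (S \<Otimes>\<^sub>M S))"
 using A by (intro emeasure_distr) (auto intro!: measurable_comb_seq measurable_sets[OF measurable_shift_funpow])
also have "(%(w, w'). comb_seq m w w') -` ((shift ^^ m) -` A Int space S) Int space (S \<Otimes>\<^sub>M S) = space S \<times> A"
 using sets.sets_into_space[OF A] measurable_space[OF measurable_comb_seq[of m M]] by (auto simp: space_pair_measure split_beta')
also have "emeasure (S \<Otimes>\<^sub>M S) (space S \<times> A) = emeasure S A"
 using A by (subst P.emeasure_pair_measure_Times) (auto simp: P.emeasure_space_1)
finally show "emeasure (distr S S (shift ^^ m)) A = emeasure S A" .
qed auto

lemma integral_shift_funpow: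
fixes f :: "(nat => 'a) => real"
assumes "f : Bor S"
shows "(LINT w|S. f ((shift ^^ m) w)) = (LINT w|S. f w)" using integral_distr[of "shift ^^ m" S S f] assms by (simp add: distr_shift_funpow)

lemma integral_case_nat:
fixes f :: "(nat => 'a) => real"
assumes [measurable]: "f : Bor S" and bd: "!!w. w : space S ==> abs (f w) <= c"
shows "(LINT w|S. f w) = (LINT s|M. LINT w|S. f (case_nat s w))"
proof -
interpret PP: pair_prob_space M S by unfold_locales
have cn: "case_nat s w : space S" if "s : space M" "w : space S" for s w using that by (auto simp: space_PiM PiE_iff split: nat.split)
have "(LINT w|S. f w) = (LINT w|(distr (M \<Otimes>\<^sub>M S) S (%(s, w). case_nat s w)). f w)" by (simp only: PiM_iter)
also have "... = (LINT p|(M \<Otimes>\<^sub>M S). f (case_prod case_nat p))" by (subst integral_distr) (auto simp: split_beta')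
also have "... = (LINT s|M. LINT w|S. f (case_nat s w))"
proof (subst PP.integral_fst'[symmetric])
 show "integrable (M \<Otimes>\<^sub>M S) (%p. f (case_prod case_nat p))"
  by (intro PP.integrable_const_bound[of _ c] AE_I2) (auto simp: split_beta' space_pair_measure intro!: bd cn)
qed auto
finally show ?thesis .
qed

text \<open>
  An event that is invariant under the shift does not depend on any finite set of coordinates.
  It is thus independent of all cylinders, hence of itself.
\<close>

theorem shift_invariant_0_1:
assumes E [measurable]: "E : sets S" and m: "1 <= m"
 and inv: "!!w. w : space S ==> (shift ^^ m) w : E <-> w : E"
shows "measure S E = 0 | measure S E = 1"
proof -
have inv_k: "(shift ^^ (m * k)) w : E <-> w : E" if "w : space S" for w k
proof (induction k)
 case (Suc k)
 have "(shift ^^ (m * Suc k)) w = (shift ^^ m) ((shift ^^ (m * k)) w)"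
  by (simp add: funpow_add[symmetric] flip: funpow_swap1 comp_apply[of "shift ^^ m"])
 thus ?case using Suc inv[of "(shift ^^ (m * k)) w"] measurable_space[OF measurable_shift_funpow that] by simp
qed simp
have "density S (indicator E) = density S (%_. emeasure S E)"
proof (rule measure_eqI_PiM_infinite)
 show "sets (density S (indicator E)) = sets (Pi\<^sub>M UNIV (%_. M))" "sets (density S (%_. emeasure S E)) = sets (Pi\<^sub>M UNIV (%_. M))" by auto
 show "finite_measure (density S (indicator E))" by (intro finite_measureI) (simp add: emeasure_density)
 fix A J assume J: "finite J" "J <= (UNIV :: nat set)" and A: "!!i. i : J ==> A i : sets M"
 let ?X = "prod_emb UNIV (%_. M) J (Pi\<^sub>E J A)"
 have X [measurable]: "?X : sets S" using J A by (intro sets_PiM_I) auto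
 obtain k where k: "!!j. j : J ==> j < m * k"
 proof -
  have "j < m * Suc (Max J)" if "j : J" for j
   using Max_ge[OF J(1) that] m by (metis Suc_le_lessD add_mono mult_le_mono1 nat_mult_1 le_imp_less_Suc order_less_le_trans)
  thus thesis using that by blast
 qed
 have inX: "comb_seq (m * k) w w' : ?X <-> w : ?X" if "w : space S" "w' : space S" for w w'
  using that k measurable_space[OF measurable_comb_seq[of "m * k" M], of "(w, w')"]
  by (auto simp: prod_emb_def comb_seq_def PiE_iff space_PiM space_pair_measure Ball_def)
 have "emeasure (density S (indicator E)) ?X = emeasure S (?X Int E)" using emeasure_restricted[OF E X] by (simp only: Int_commute)
 also have "... = emeasure (distr (S \<Otimes>\<^sub>M S) S (%(w, w'). comb_seq (m * k) w w')) (?X Int E)" by (simp only: PiM_comb_seq)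
 also have "... = emeasure (S \<Otimes>\<^sub>M S) ((%(w, w'). comb_seq (m * k) w w') -` (?X Int E) Int space (S \<Otimes>\<^sub>M S))"
  by (intro emeasure_distr) (auto intro!: measurable_comb_seq)
 also have "(%(w, w'). comb_seq (m * k) w w') -` (?X Int E) Int space (S \<Otimes>\<^sub>M S) = ?X \<times> E"
 proof (intro equalityI subsetI)
  fix p assume p: "p : (%(w, w'). comb_seq (m * k) w w') -` (?X Int E) Int space (S \<Otimes>\<^sub>M S)"
  obtain w w' where pe: "p = (w, w')" by (cases p)
  have sp: "w : space S" "w' : space S" using p pe by (auto simp: space_pair_measure)
  have cs: "comb_seq (m * k) w w' : space S"
   using measurable_space[OF measurable_comb_seq[of "m * k" M], of "(w, w')"] sp by (simp add: space_pair_measure)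
  show "p : ?X \<times> E" using p pe inX[OF sp] inv_k[OF cs, of k] by simp
 next
  fix p assume p: "p : ?X \<times> E"
  obtain w w' where pe: "p = (w, w')" by (cases p)
  have sp: "w : space S" "w' : space S"
   using p pe subsetD[OF sets.sets_into_space[OF X], of w] subsetD[OF sets.sets_into_space[OF E], of w'] by blast+
  have cs: "comb_seq (m * k) w w' : space S"
   using measurable_space[OF measurable_comb_seq[of "m * k" M], of "(w, w')"] sp by (simp add: space_pair_measure)
  show "p : (%(w, w'). comb_seq (m * k) w w') -` (?X Int E) Int space (S \<Otimes>\<^sub>M S)"
   using p pe inX[OF sp] inv_k[OF cs, of k] sp by (simp add: space_pair_measure)
 qed
 also have "emeasure (S \<Otimes>\<^sub>M S) (?X \<times> E) = emeasure S ?X * emeasure S E" by (intro P.emeasure_pair_measure_Times X E)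
 also have "... = emeasure (density S (%_. emeasure S E)) ?X" using emeasure_density_const[OF X] by (simp only: mult.commute)
 finally show "emeasure (density S (indicator E)) ?X = emeasure (density S (%_. emeasure S E)) ?X" .
qed
hence "emeasure (density S (indicator E)) E = emeasure (density S (%_. emeasure S E)) E" by simp
hence "emeasure S E = emeasure S E * emeasure S E" unfolding emeasure_restricted[OF E E] emeasure_density_const[OF E] by simp
hence "measure S E = measure S E * measure S E" by (simp add: P.emeasure_eq_measure flip: ennreal_mult)
thus ?thesis by auto
qed

text \<open>
  A run of length \<open>n\<close> is cut into blocks: from a good point the next \<open>l\<close> steps cost at most \<open>c l\<close> for
  some \<open>l \<le> N\<close>; a single step is taken from a bad one.  Only the expected number of bad points
  matters, and by invariance it is \<open>n\<close> times the probability of being bad.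
\<close>

lemma subadditive_expectation_le:
fixes Z :: "nat => (nat => 'a) => real"
assumes [measurable]: "!!n. Z n : Bor S"
 and bd: "!!n w. w : space S ==> abs (Z n w) <= C * (real n + 1)"
 and sub: "!!a b w. w : space S ==> Z (a + b) w <= Z a w + Z b (((shift ^^ m) ^^ a) w)"
 and ev: "AE w in S. EX n>=1. Z n w <= real n * c"
 and e: "0 < e"
shows "EX n0. ALL n>=n0. (LINT w|S. Z n w) <= real n * (c + e)"
proof -
let ?U = "shift ^^ m"
have U_sp: "(?U ^^ a) w : space S" if "w : space S" for a w
 using measurable_space[OF measurable_shift_funpow[of "m * a"] that] by (simp add: funpow_mult mult.commute)
have C: "0 <= C" using bd[of _ 0] P.not_empty abs_ge_zero order_trans by (metis all_not_in_conv mult.right_neutral add_0 of_nat_0)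
define K where "K = 2 * C + abs c"
have K: "0 <= K" using C by (simp add: K_def)
define bad where "bad N = {w : space S. ALL l:{1..N}. real l * c < Z l w}" for N
have bad [measurable]: "bad N : sets S" for N unfolding bad_def by measurable
have "(%N. measure S (bad N)) ---> measure S (\<Inter>N. bad N)" by (rule P.finite_Lim_measure_decseq) (auto simp: decseq_def bad_def)
moreover have "measure S (\<Inter>N. bad N) = 0"
proof -
 have "AE w in S. w ~: (\<Inter>N. bad N)" using ev
 proof eventually_elim
  case (elim w)
  then obtain n where "n >= 1" "Z n w <= real n * c" by auto
  hence "w ~: bad n" by (auto simp: bad_def not_less intro!: bexI[of _ n])
  thus ?case by blast
 qed
 hence "emeasure S (\<Inter>N. bad N) = 0" by (subst (asm) AE_iff_measurable[of "\<Inter>N. bad N"]) (auto simp: bad_def)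
 thus ?thesis by (simp add: measure_def)
qed
ultimately have lim0: "(%N. measure S (bad N)) ---> 0" by simp
have "0 < e / (2 * (K + 1))" using e K by simp
with lim0 have "eventually (%N. measure S (bad N) < e / (2 * (K + 1))) sequentially" by (intro order_tendstoD) auto
then obtain N where N: "measure S (bad N) < e / (2 * (K + 1))" by (auto simp: eventually_sequentially)
define J where "J n w = (SUM k<n. indicator (bad N) ((?U ^^ k) w) :: real)" for n w
have J_nonneg: "0 <= J n w" for n w by (simp add: J_def sum_nonneg)
have J_split: "J (l + n) w = J l w + J n ((?U ^^ l) w)" for l n w
proof -
 have "(?U ^^ (l + k)) w = (?U ^^ k) ((?U ^^ l) w)" for k by (simp only: add.commute[of l] funpow_add comp_apply)
 thus ?thesis unfolding J_def sum_lessThan_add by simp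
qed
have main: "Z n w <= c * real n + K * J n w + K * (real N + 1)" if "w : space S" for n w using that
proof (induction n arbitrary: w rule: less_induct)
 case (less n)
 show ?case
 proof (cases "n <= N")
  case True
  have "Z n w <= C * (real n + 1)" using bd[OF less.prems, of n] by linarith
  also have "... <= C * (real N + 1)" using C True by (intro mult_left_mono) auto
  finally have 1: "Z n w <= C * (real N + 1)" .
  have "- c * real n <= abs c * real n" by (intro mult_right_mono) auto
  also have "... <= abs c * (real N + 1)" using True by (intro mult_left_mono) auto
  finally have 2: "- c * real n <= abs c * (real N + 1)" .
  have "K * (real N + 1) = 2 * (C * (real N + 1)) + abs c * (real N + 1)" by (simp add: K_def algebra_simps)
  hence "C * (real N + 1) <= c * real n + K * (real N + 1)" using 2 mult_nonneg_nonneg[OF C, of "real N + 1"] by linarith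
  thus ?thesis using 1 mult_nonneg_nonneg[OF K J_nonneg[of n w]] by linarith
 next
  case False
  show ?thesis
  proof (cases "w : bad N")
   case True
   obtain n' where n': "n = 1 + n'" using False by (metis add.commute le_add_diff_inverse not_le le_zero_eq less_one nat_le_linear)
   have "Z n w <= Z 1 w + Z n' ((?U ^^ 1) w)" unfolding n' by (rule sub[OF less.prems])
   also have "Z 1 w <= 2 * C" using bd[OF less.prems, of 1] by simp
   also have "Z n' ((?U ^^ 1) w) <= c * real n' + K * J n' ((?U ^^ 1) w) + K * (real N + 1)" using n' by (intro less.IH U_sp[OF less.prems]) auto
   also have "2 * C + (c * real n' + K * J n' ((?U ^^ 1) w) + K * (real N + 1)) <= c * real n + K * J n w + K * (real N + 1)"
    using True unfolding n' J_split by (simp add: J_def K_def algebra_simps)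
   finally show ?thesis by simp
  next
   case False': False
   then obtain l where l: "1 <= l" "l <= N" "Z l w <= real l * c" using less.prems by (auto simp: bad_def not_less)
   obtain n' where n': "n = l + n'" using l False by (metis le_add_diff_inverse nat_le_linear order_trans)
   have "Z n w <= Z l w + Z n' ((?U ^^ l) w)" unfolding n' by (rule sub[OF less.prems])
   also have "Z n' ((?U ^^ l) w) <= c * real n' + K * J n' ((?U ^^ l) w) + K * (real N + 1)" using n' l by (intro less.IH U_sp[OF less.prems]) auto
   also note l(3)
   also have "real l * c + (c * real n' + K * J n' ((?U ^^ l) w) + K * (real N + 1)) <= c * real n + K * J n w + K * (real N + 1)"
    using mult_nonneg_nonneg[OF K J_nonneg[of l w]] unfolding n' J_split by (simp add: algebra_simps)
   finally show ?thesis by simp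
  qed
 qed
qed
have U_meas: "(?U ^^ k) : measurable S S" for k using measurable_shift_funpow[of "m * k"] by (simp add: funpow_mult mult.commute)
have EJ: "(LINT w|S. J n w) = real n * measure S (bad N)" for n
proof -
 have int: "integrable S (%w. indicator (bad N) ((?U ^^ k) w) :: real)" for k
  using U_meas[of k] by (intro P.integrable_const_bound[of _ 1]) (auto simp: indicator_def)
 have "(LINT w|S. indicator (bad N) ((?U ^^ k) w)) = measure S (bad N)" for k
  using integral_shift_funpow[of "indicator (bad N)" "m * k"] sets.sets_into_space[OF bad[of N]] by (simp add: funpow_mult mult.commute Int_absorb2)
 thus ?thesis unfolding J_def using int by (subst LINT_sum) auto
qed
have J_meas [measurable]: "J n : Bor S" for n unfolding J_def using U_meas by measurable
have J_le: "J n w <= real n" for n w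
 unfolding J_def using sum_mono[of "{..<n}" "%k. indicator (bad N) ((?U ^^ k) w)" "%_. 1 :: real"] by (simp add: indicator_def)
have J_int: "integrable S (J n)" for n using J_nonneg J_le by (intro P.integrable_const_bound[of _ "real n"]) auto
have Z_int: "integrable S (Z n)" for n using bd by (intro P.integrable_const_bound[of _ "C * (real n + 1)"] AE_I2) auto
have EZ: "(LINT w|S. Z n w) <= c * real n + K * (real n * measure S (bad N)) + K * (real N + 1)" for n
proof -
 have "(LINT w|S. Z n w) <= (LINT w|S. c * real n + K * J n w + K * (real N + 1))"
 proof (rule integral_mono[OF Z_int])
  show "integrable S (%w. c * real n + K * J n w + K * (real N + 1))"
   using J_int[of n] by (intro L1_add integrable_mult_right P.integrable_const) auto
 qed (rule main)
 also have "... = c * real n + K * (real n * measure S (bad N)) + K * (real N + 1)" using J_int[of n] by (simp add: EJ P.prob_space)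
 finally show ?thesis .
qed
obtain n0 :: nat where n0: "K * (real N + 1) * 2 / e <= real n0" using real_arch_simple by blast
show ?thesis
proof (intro exI[of _ n0] allI impI)
 fix n assume "n0 <= n"
 hence "K * (real N + 1) * 2 / e <= real n" using n0 by linarith
 hence 1: "K * (real N + 1) <= real n * (e / 2)" using e by (simp add: field_simps)
 have "K * measure S (bad N) <= K * (e / (2 * (K + 1)))" using N K by (intro mult_left_mono) auto
 also have "... <= e / 2" using K e by (simp add: field_simps)
 finally have "real n * (K * measure S (bad N)) <= real n * (e / 2)" by (intro mult_left_mono) auto
 hence "c * real n + K * (real n * measure S (bad N)) + K * (real N + 1) <= real n * (c + e)" using 1 by (simp add: algebra_simps)
 with EZ[of n] show "(LINT w|S. Z n w) <= real n * (c + e)" by linarith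
qed
qed

text \<open>
  The lower limit is almost unchanged by the shift, so it is almost surely constant.  If it were
  below \<open>g\<close>, so would be the expectations, by the previous lemma.
\<close>

lemma subadditive_eventually_ge:
fixes Z :: "nat => (nat => 'a) => real"
assumes meas [measurable]: "!!n. Z n : Bor S"
 and bd: "!!n w. w : space S ==> abs (Z n w) <= C * (real n + 1)"
 and sub: "!!a b w. w : space S ==> Z (a + b) w <= Z a w + Z b (((shift ^^ m) ^^ a) w)"
 and inv: "!!n w. w : space S ==> abs (Z (Suc n) w - Z n ((shift ^^ m) w)) <= C'"
 and m: "1 <= m" and g: "!!n. 1 <= n ==> real n * g <= (LINT w|S. Z n w)" and c: "c < g"
shows "AE w in S. eventually (%n. real n * c <= Z n w) sequentially"
proof -
define c' where "c' = (c + g) / 2"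
have c': "c < c'" "c' < g" using c by (auto simp: c'_def)
define th where "th j = c' - 1 / real (Suc j)" for j :: nat
define E where "E = {w : space S. EX j. ALL n. EX k>=n. Z k w < real k * th j}"
have E [measurable]: "E : sets S" unfolding E_def by measurable
have th_mono: "th j < th (Suc j)" for j by (simp add: th_def frac_less2)
have th_gap: "EX n0. ALL k>=n0. real k * th j + B <= real k * th (Suc j)" for j B
proof -
 obtain n0 :: nat where "B / (th (Suc j) - th j) <= real n0" using real_arch_simple by blast
 hence "B / (th (Suc j) - th j) <= real k" if "n0 <= k" for k using that by linarith
 thus ?thesis using th_mono[of j] by (intro exI[of _ n0]) (auto simp: field_simps)
qed
have "measure S E = 0 | measure S E = 1"
proof (rule shift_invariant_0_1[OF E m])
 fix w assume sp: "w : space S"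
 have sp': "(shift ^^ m) w : space S" using measurable_space[OF measurable_shift_funpow sp] .
 show "(shift ^^ m) w : E <-> w : E"
 proof
  assume "(shift ^^ m) w : E"
  then obtain j where j: "!!n. EX k>=n. Z k ((shift ^^ m) w) < real k * th j" by (auto simp: E_def)
  obtain n0 where n0: "!!k. k >= n0 ==> real k * th j + (C' + abs (th (Suc j))) <= real k * th (Suc j)" using th_gap by blast
  have "EX k>=n. Z k w < real k * th (Suc j)" for n
  proof -
   obtain k where k: "k >= max n n0" "Z k ((shift ^^ m) w) < real k * th j" using j by blast
   have "Z (Suc k) w < real k * th j + C'" using inv[OF sp, of k] k by linarith
   also have "... <= real (Suc k) * th (Suc j)" using n0[of k] k by (simp add: algebra_simps)
   finally show ?thesis using k by (intro exI[of _ "Suc k"]) auto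
  qed
  thus "w : E" using sp by (auto simp: E_def)
 next
  assume "w : E"
  then obtain j where j: "!!n. EX k>=n. Z k w < real k * th j" by (auto simp: E_def)
  obtain n0 where n0: "!!k. k >= n0 ==> real k * th j + (C' + abs (th j)) <= real k * th (Suc j)" using th_gap by blast
  have "EX k>=n. Z k ((shift ^^ m) w) < real k * th (Suc j)" for n
  proof -
   obtain k where k: "k >= Suc (max n n0)" "Z k w < real k * th j" using j by blast
   then obtain k' where k': "k = Suc k'" by (cases k) auto
   have "Z k' ((shift ^^ m) w) < real (Suc k') * th j + C'" using inv[OF sp, of k'] k(2) unfolding k' by linarith
   also have "... <= real k' * th (Suc j)" using n0[of k'] k k' by (simp add: algebra_simps)
   finally show ?thesis using k k' by (intro exI[of _ k']) auto
  qed
  thus "(shift ^^ m) w : E" using sp' by (auto simp: E_def)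
 qed
qed
moreover have "measure S E ~= 1"
proof
 assume "measure S E = 1"
 hence "AE w in S. w : E" by (simp add: P.prob_eq_1)
 hence "AE w in S. EX n>=1. Z n w <= real n * c'"
 proof eventually_elim
  case (elim w)
  then obtain j where j: "!!n. EX k>=n. Z k w < real k * th j" by (auto simp: E_def)
  obtain k where k: "k >= 1" "Z k w < real k * th j" using j by blast
  have "real k * th j <= real k * c'" by (intro mult_left_mono) (auto simp: th_def)
  with k show ?case by (intro exI[of _ k] conjI) linarith+
 qed
 from subadditive_expectation_le[OF meas bd sub this, of "(g - c') / 2"]
 obtain n0 where n0: "!!n. n >= n0 ==> (LINT w|S. Z n w) <= real n * (c' + (g - c') / 2)" using c' by auto
 have "real (Suc n0) * g <= real (Suc n0) * (c' + (g - c') / 2)" using order_trans[OF g[of "Suc n0"] n0[of "Suc n0"]] by (simp del: of_nat_Suc)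
 hence "g <= c' + (g - c') / 2" by (rule mult_left_le_imp_le) simp
 thus False using c' by (simp add: field_simps)
qed
ultimately have "measure S E = 0" by blast
hence nE: "AE w in S. w ~: E" by (intro AE_not_in) (auto simp: null_sets_def P.emeasure_eq_measure)
obtain j :: nat where j: "1 / real (Suc j) < c' - c" using c' reals_Archimedean[of "c' - c"] by (auto simp: inverse_eq_divide)
from nE show ?thesis using AE_space
proof eventually_elim
 case (elim w)
 then obtain n where n: "!!k. k >= n ==> ~ Z k w < real k * th j" by (auto simp: E_def)
 have "real k * c <= Z k w" if "k >= n" for k
 proof -
  have "real k * c <= real k * th j" using j by (intro mult_left_mono) (auto simp: th_def)
  with n[OF that] show ?thesis by linarith
 qed
 thus ?case by (auto simp: eventually_sequentially)
qed
qed

text \<open>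
  The lower limit is covered by the previous lemma.  For the upper limit, subadditivity bounds the
  process by the sum of the values on blocks of a fixed length; the negative of this sum is additive,
  and the same lemma applies to it and to a power of the shift.
\<close>

theorem subadditive_ergodic:
fixes X :: "nat => (nat => 'a) => real"
assumes meas [measurable]: "!!n. X n : Bor S"
 and bd: "!!n w. w : space S ==> abs (X n w) <= C * (real n + 1)"
 and sub: "!!a b w. w : space S ==> X (a + b) w <= X a w + X b ((shift ^^ a) w)"
 and inv: "!!n w. w : space S ==> abs (X (Suc n) w - X n (shift w)) <= C'"
obtains L where "AE w in S. (%n. X n w / real n) ---> L"
 "!!n. 1 <= n ==> L <= (LINT w|S. X n w) / real n"
proof -
have C: "0 <= C" using bd[of _ 0] P.not_empty abs_ge_zero order_trans by (metis all_not_in_conv mult.right_neutral add_0 of_nat_0)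
have X_int: "integrable S (X n)" for n using bd by (intro P.integrable_const_bound[of _ "C * (real n + 1)"] AE_I2) auto
define u where "u n = (LINT w|S. X n w) / real n" for n
define L where "L = Inf (u ` {1..})"
have u_lower: "- 2 * C <= u n" if n: "1 <= n" for n
proof -
 have "C * (real n + 1) <= C * (2 * real n)" using n C by (intro mult_left_mono) auto
 hence "!!w. w : space S ==> - 2 * C * real n <= X n w" using bd[of _ n] by (fastforce simp: abs_le_iff)
 hence "(LINT w|S. - 2 * C * real n) <= (LINT w|S. X n w)" by (intro integral_mono_AE X_int) auto
 thus ?thesis using n by (simp add: u_def P.prob_space field_simps)
qed
hence bdd: "bdd_below (u ` {1..})" by (intro bdd_belowI2[of _ "- 2 * C"]) auto
have Lu: "L <= u n" if "1 <= n" for n unfolding L_def using that by (intro cINF_lower bdd) auto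
have lower: "AE w in S. eventually (%n. real n * c <= X n w) sequentially" if c: "c < L" for c
proof (rule subadditive_eventually_ge[OF meas bd, of 1 C' L])
 show "real n * L <= (LINT w|S. X n w)" if "1 <= n" for n using Lu[OF that] that by (simp add: u_def field_simps)
qed (use sub inv c in auto)
have upper: "AE w in S. eventually (%n. X n w <= real n * c) sequentially" if c: "L < c" for c
proof -
 have "EX m:{1..}. u m < c" using c cINF_less_iff[of "{1..}" u c] bdd by (auto simp: L_def)
 then obtain m where m: "1 <= m" "u m < c" by auto
 define c1 where "c1 = (u m + c) / 2"
 have c1: "u m < c1" "c1 < c" using m by (auto simp: c1_def)
 let ?U = "shift ^^ m"
 have U_sp: "(?U ^^ a) w : space S" if "w : space S" for a w
  using measurable_space[OF measurable_shift_funpow[of "m * a"] that] by (simp add: funpow_mult mult.commute)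
 have U_meas [measurable]: "(?U ^^ k) : measurable S S" for k using measurable_shift_funpow[of "m * k"] by (simp add: funpow_mult mult.commute)
 define Z where "Z n w = - (SUM k<n. X m ((?U ^^ k) w))" for n w
 have "AE w in S. eventually (%n. real n * (- real m * c1) <= Z n w) sequentially"
 proof (rule subadditive_eventually_ge[of Z "C * (real m + 1)" m "C * (real m + 1)" "- real m * u m"])
  show "Z n : Bor S" for n unfolding Z_def by measurable
  fix w assume sp: "w : space S"
  show "abs (Z n w) <= C * (real m + 1) * (real n + 1)" for n
  proof -
   have "abs (Z n w) <= (SUM k<n. C * (real m + 1))"
    unfolding Z_def abs_minus_cancel using bd[OF U_sp[OF sp]] by (intro order_trans[OF sum_abs] sum_mono)
   also have "... <= C * (real m + 1) * (real n + 1)" using C by (simp add: algebra_simps)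
   finally show ?thesis .
  qed
  show "Z (a + b) w <= Z a w + Z b ((?U ^^ a) w)" for a b
  proof -
   have "(?U ^^ (a + k)) w = (?U ^^ k) ((?U ^^ a) w)" for k by (simp only: add.commute[of a] funpow_add comp_apply)
   thus ?thesis unfolding Z_def sum_lessThan_add by simp
  qed
  show "abs (Z (Suc n) w - Z n (?U w)) <= C * (real m + 1)" for n
   using bd[OF sp, of m] by (simp add: Z_def sum.lessThan_Suc_shift funpow_swap1 del: sum.lessThan_Suc)
 next
  fix n :: nat assume "1 <= n"
  have "(LINT w|S. X m ((?U ^^ k) w)) = (LINT w|S. X m w)" for k
   using integral_shift_funpow[OF meas, of m "m * k"] by (simp add: funpow_mult mult.commute)
  moreover have "integrable S (%w. X m ((?U ^^ k) w))" for k using bd[OF U_sp] by (intro P.integrable_const_bound[of _ "C * (real m + 1)"] AE_I2) auto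
  ultimately have "(LINT w|S. Z n w) = - real n * (LINT w|S. X m w)" unfolding Z_def by (simp add: LINT_sum)
  thus "real n * (- real m * u m) <= (LINT w|S. Z n w)" using m by (simp add: u_def)
 qed (use m c1 in auto)
 thus ?thesis using AE_space
 proof eventually_elim
  case (elim w)
  then obtain n1 where n1: "!!n. n >= n1 ==> real n * (- real m * c1) <= Z n w" by (auto simp: eventually_sequentially)
  have blocks: "X (q * m) w <= X 0 w - Z q w" for q
  proof (induction q)
   case (Suc q)
   have "X (q * m + m) w <= X (q * m) w + X m ((shift ^^ (q * m)) w)" using sub elim by blast
   also have "(shift ^^ (q * m)) w = (?U ^^ q) w" by (simp add: funpow_mult mult.commute)
   finally show ?case using Suc by (simp add: Z_def add.commute)
  qed (simp add: Z_def)
  have bound: "X n w <= real n * c1 + (C + abs c1 * real m + C * (real m + 1))" if n: "n >= (n1 + 1) * m" for n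
  proof -
   define q where "q = n div m"
   define r where "r = n mod m"
   have nqr: "n = q * m + r" by (simp add: q_def r_def)
   have r: "r < m" using m by (simp add: r_def)
   have q: "q >= n1" using n m by (metis q_def div_le_mono nonzero_mult_div_cancel_right add_leD1 not_one_le_zero)
   have "X n w <= X (q * m) w + X r ((shift ^^ (q * m)) w)" unfolding nqr using sub elim by blast
   also have "X (q * m) w <= C + real (q * m) * c1" using blocks[of q] n1[OF q] bd[of w 0] elim by (simp add: algebra_simps abs_le_iff)
   also have "X r ((shift ^^ (q * m)) w) <= C * (real m + 1)"
   proof -
    have "X r ((shift ^^ (q * m)) w) <= C * (real r + 1)" using bd[OF measurable_space[OF measurable_shift_funpow], of w] elim by (meson abs_le_D1)
    also have "... <= C * (real m + 1)" using r C by (intro mult_left_mono) auto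
    finally show ?thesis .
   qed
   also have "real (q * m) * c1 = real n * c1 - real r * c1" by (simp add: nqr algebra_simps)
   also have "- (real r * c1) <= abs c1 * real m"
   proof -
    have "- (real r * c1) <= real r * abs c1" by (metis abs_ge_minus_self abs_mult abs_of_nat)
    also have "... <= real m * abs c1" using r by (intro mult_right_mono) auto
    finally show ?thesis by (simp add: mult.commute)
   qed
   hence "C + (real n * c1 - real r * c1) + C * (real m + 1) <= real n * c1 + (C + abs c1 * real m + C * (real m + 1))" by linarith
   finally show ?thesis by simp
  qed
  define B where "B = C + abs c1 * real m + C * (real m + 1)"
  obtain n2 :: nat where n2: "B / (c - c1) <= real n2" using real_arch_simple by blast
  have "X n w <= real n * c" if n: "n >= max ((n1 + 1) * m) n2" for n
  proof -
   have "B / (c - c1) <= real n" using n2 n by linarith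
   hence "B <= real n * (c - c1)" using c1 by (simp add: field_simps)
   thus ?thesis using bound[of n] n by (simp add: B_def algebra_simps)
  qed
  thus ?case unfolding eventually_sequentially by blast
 qed
qed
have "AE w in S. ALL j::nat. eventually (%n. real n * (L - 1 / real (Suc j)) <= X n w) sequentially"
 unfolding AE_all_countable by (intro allI lower) simp
moreover have "AE w in S. ALL j::nat. eventually (%n. X n w <= real n * (L + 1 / real (Suc j))) sequentially"
 unfolding AE_all_countable by (intro allI upper) simp
ultimately have "AE w in S. (%n. X n w / real n) ---> L"
proof eventually_elim
 case (elim w)
 show ?case
 proof (rule tendstoI)
  fix e :: real assume "0 < e"
  then obtain j :: nat where j: "1 / real (Suc j) < e" using reals_Archimedean[of e] by (auto simp: inverse_eq_divide)
  from elim(1)[rule_format, of j] elim(2)[rule_format, of j] eventually_gt_at_top[of 0]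
  show "eventually (%n. dist (X n w / real n) L < e) sequentially"
  proof eventually_elim
   case (elim n)
   hence "L - 1 / real (Suc j) <= X n w / real n" "X n w / real n <= L + 1 / real (Suc j)"
    by (simp_all add: pos_le_divide_eq pos_divide_le_eq mult.commute)
   with j show ?case by (simp add: dist_real_def abs_less_iff)
  qed
 qed
qed
with Lu show thesis by (intro that[of L]) (auto simp: u_def)
qed

end

section \<open>Products of independent random matrices\<close>

lemma sequence_space_intro: "prob_space M ==> sequence_space M" by (intro sequence_space.intro product_prob_spaceI)

lemma measurable_det:
fixes X :: "'a => real mat"
assumes X: "!!w. w : space N ==> X w : Mat n n"
 and m: "!!i j. i < n ==> j < n ==> (%w. X w $$ (i, j)) : Bor N"
shows "(%w. det (X w)) : Bor N"
proof -
have "(%w. SUM p | p permutes {0..<n}. signof p * (PROD i = 0..<n. X w $$ (i, p i))) : Bor N"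
 using m permutes_lt by (intro borel_measurable_sum borel_measurable_times borel_measurable_const borel_measurable_prod) auto
thus ?thesis by (subst measurable_cong[where g = "%w. SUM p | p permutes {0..<n}. signof p * (PROD i = 0..<n. X w $$ (i, p i))"])
  (simp_all add: det_def'[OF X])
qed

lemma measurable_minors_norm:
fixes X :: "'a => real mat"
assumes m: "!!i j. i < d ==> j < d ==> (%w. X w $$ (i, j)) : Bor N"
shows "(%w. minors_norm d k (X w)) : Bor N" unfolding minors_norm_def minor_def
proof (intro borel_measurable_sum borel_measurable_abs measurable_det)
fix f h i j assume "f : index_maps k d" "h : index_maps k d" "i < k" "j < k"
thus "(%w. mat k k (%(i, j). X w $$ (f i, h j)) $$ (i, j)) : Bor N" using m by (simp add: index_maps_less)
qed auto

lemma measurable_mn: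
fixes X :: "'a => real mat"
assumes X: "!!w. w : space N ==> X w : Mat n m"
 and m: "!!i j. i < n ==> j < m ==> (%w. X w $$ (i, j)) : Bor N"
shows "(%w. mn (X w)) : Bor N"
proof -
have "(%w. SUM i<n. SUM j<m. abs (X w $$ (i, j))) : Bor N" using m by (intro borel_measurable_sum borel_measurable_abs) auto
thus ?thesis by (subst measurable_cong[where g = "%w. SUM i<n. SUM j<m. abs (X w $$ (i, j))"]) (use X in \<open>auto simp: mn_def\<close>)
qed

lemma measurable_mult_mat_entries:
fixes X Y :: "'a => real mat"
assumes "!!w. w : space N ==> X w : Mat n m" "!!w. w : space N ==> Y w : Mat m k"
 and X: "!!i j. i < n ==> j < m ==> (%w. X w $$ (i, j)) : Bor N"
 and Y: "!!i j. i < m ==> j < k ==> (%w. Y w $$ (i, j)) : Bor N"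
 and ij: "i < n" "j < k"
shows "(%w. (X w * Y w) $$ (i, j)) : Bor N"
proof -
have "(%w. SUM l<m. X w $$ (i, l) * Y w $$ (l, j)) : Bor N" using ij by (intro borel_measurable_sum borel_measurable_times X Y) auto
moreover have "(X w * Y w) $$ (i, j) = (SUM l<m. X w $$ (i, l) * Y w $$ (l, j))" if "w : space N" for w
 using carrier_matD[OF assms(1)[OF that]] carrier_matD[OF assms(2)[OF that]] ij by (subst index_mult_mat_sum) auto
ultimately show ?thesis by (subst measurable_cong) auto
qed

lemma measurable_vn_mult:
fixes X :: "'a => real mat" and Y :: "'a => real vec"
assumes "!!w. w : space N ==> X w : Mat n m" "!!w. w : space N ==> Y w : Vec m"
 and X: "!!i j. i < n ==> j < m ==> (%w. X w $$ (i, j)) : Bor N"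
 and Y: "!!j. j < m ==> (%w. Y w $ j) : Bor N"
shows "(%w. vn (X w *v Y w)) : Bor N"
proof -
have "(%w. SUM i<n. abs (SUM j<m. X w $$ (i, j) * Y w $ j)) : Bor N"
 by (intro borel_measurable_sum borel_measurable_abs borel_measurable_times X Y) auto
moreover have "vn (X w *v Y w) = (SUM i<n. abs (SUM j<m. X w $$ (i, j) * Y w $ j))" if "w : space N" for w
 unfolding vn_def using assms(1,2)[OF that] by (auto simp: index_mult_vec_sum simp del: Mv_index intro!: sum.cong)
ultimately show ?thesis by (subst measurable_cong) auto
qed

text \<open>
  Uniform bounds on the matrices and on their inverses; the latter is written for vectors, which
  restricts well to subspaces.
\<close>

locale random_matrices = sequence_space M for M :: "'a measure" +
fixes A :: "'a => real mat" and q :: nat and b :: real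
assumes A_carrier: "!!s. s : space M ==> A s : Mat q q"
 and A_meas: "!!i j. i < q ==> j < q ==> (%s. A s $$ (i, j)) : Bor M"
 and A_norm: "!!s. s : space M ==> mn (A s) <= b"
 and A_lower: "!!s v. s : space M ==> v : Vec q ==> vn v <= b * vn (A s *v v)"
 and q_pos: "1 <= q" and b_ge_1: "1 <= b"
begin

definition prodA :: "nat => (nat => 'a) => real mat" where
"prodA n w = left_prod q (%k. A (w k)) n"

lemma space_S: "w : space S <-> (ALL k. w k : space M)" by (auto simp: space_PiM)

lemma prodA_0 [simp]: "prodA 0 w = Id q" by (simp add: prodA_def)

lemma prodA_Suc: "prodA (Suc n) w = A (w n) * prodA n w" by (simp add: prodA_def)

lemma prodA_carrier [simp]: "w : space S ==> prodA n w : Mat q q" by (induction n) (auto simp: prodA_Suc space_S A_carrier intro!: mult_carrier_mat)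

lemma shift_space: "w : space S ==> (shift ^^ m) w : space S" by (auto simp: space_S shift_funpow)

lemma prodA_add:
assumes w: "w : space S"
shows "prodA (m + n) w = prodA n ((shift ^^ m) w) * prodA m w"
proof (induction n)
case 0
thus ?case using prodA_carrier[OF w, of m] by simp
next
case (Suc n)
have "A (w (m + n)) : Mat q q" using w by (simp add: space_S A_carrier)
thus ?case using prodA_carrier[OF w, of m] prodA_carrier[OF shift_space[OF w], of n m] Suc
 by (simp add: prodA_Suc shift_funpow MM_assoc[of _ q q _ q _ q])
qed

lemma prodA_1 [simp]: "w : space S ==> prodA 1 w = A (w 0)" using A_carrier[of "w 0"] by (simp add: prodA_Suc space_S)

lemma prodA_Suc_0 [simp]: "w : space S ==> prodA (Suc 0) w = A (w 0)" using prodA_1 by simp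

lemma q_ge_1: "1 <= real q" using q_pos by simp

lemma A_norm': "s : space M ==> mn (A s) <= real q * b" using A_norm[of s] mult_right_mono[OF q_ge_1, of b] b_ge_1 by linarith

lemma prodA_Suc_shift:
assumes "w : space S"
shows "prodA (Suc n) w = prodA n (shift w) * A (w 0)" using prodA_add[OF assms, of 1 n] assms by simp

lemma case_nat_space: "s : space M ==> w : space S ==> case_nat s w : space S" by (auto simp: space_S split: nat.split)

lemma prodA_case_nat:
assumes "s : space M" "w : space S"
shows "prodA (Suc n) (case_nat s w) = prodA n w * A s" using prodA_Suc_shift[OF case_nat_space[OF assms]] by simp

lemma measurable_prodA_entry [measurable]:
"i < q ==> j < q ==> (%w. prodA n w $$ (i, j)) : Bor S"
proof (induction n arbitrary: i j)
case (Suc n)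
have "(%w. A (w n) $$ (i, j)) : Bor S" if "i < q" "j < q" for i j using A_meas[OF that] by measurable
thus ?case unfolding prodA_Suc using Suc by (intro measurable_mult_mat_entries[of _ _ q q _ q]) (auto simp: space_S A_carrier)
qed auto

lemma measurable_mn_prodA [measurable]: "(%w. mn (prodA n w)) : Bor S" by (rule measurable_mn[of _ _ q q]) auto

lemma measurable_det_prodA [measurable]: "(%w. det (prodA n w)) : Bor S" by (rule measurable_det[of _ _ q]) auto

lemma measurable_vn_prodA [measurable]: "v : Vec q ==> (%w. vn (prodA n w *v v)) : Bor S" by (rule measurable_vn_mult[of _ _ q q]) auto

lemma prodA_norm: "w : space S ==> mn (prodA n w) <= real q * b ^ n"
proof (induction n)
case (Suc n)
have "mn (prodA (Suc n) w) <= mn (A (w n)) * mn (prodA n w)"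
 unfolding prodA_Suc using Suc.prems by (intro mn_mult[of _ q q _ q]) (auto simp: space_S A_carrier)
also have "... <= b * (real q * b ^ n)" using Suc A_norm[of "w n"] b_ge_1 by (intro mult_mono) (auto simp: space_S)
finally show ?case by (simp add: mult_ac)
qed simp

lemma prodA_lower: "w : space S ==> v : Vec q ==> vn v <= b ^ n * vn (prodA n w *v v)"
proof (induction n)
case (Suc n)
have Pv: "prodA n w *v v : Vec q" using mult_mat_vec_carrier[OF prodA_carrier[OF Suc.prems(1)] Suc.prems(2)] .
have An: "A (w n) : Mat q q" using Suc.prems by (simp add: space_S A_carrier)
have "vn v <= b ^ n * vn (prodA n w *v v)" using Suc by simp
also have "... <= b ^ n * (b * vn (A (w n) *v (prodA n w *v v)))"
 using A_lower[of "w n", OF _ Pv] Suc.prems b_ge_1 by (intro mult_left_mono) (auto simp: space_S)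
also have "A (w n) *v (prodA n w *v v) = prodA (Suc n) w *v v"
 unfolding prodA_Suc using Mv_assoc[OF An prodA_carrier[OF Suc.prems(1)] Suc.prems(2)] by simp
finally show ?case by (simp add: mult_ac)
qed simp

lemma lower_bound_imp_inverse:
assumes X: "X : Mat q q" and c: "!!v. v : Vec q ==> vn v <= c * vn (X *v v)"
obtains Y where "Y : Mat q q" "X * Y = Id q" "Y * X = Id q" "mn Y <= real q * c" "det X ~= 0"
proof -
have "inj_mat X"
proof (rule inj_matI[OF X])
 fix y assume y: "y : Vec q" "X *v y = 0v q"
 hence "vn y <= 0" using c[of y] by simp
 hence "vn y = 0" using vn_nonneg[of y] by linarith
 thus "y = 0v q" using vn_eq_0[OF y(1)] by simp
qed
hence d: "det X ~= 0" using inj_mat_square[OF X] by simp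
obtain Y where Y: "Y : Mat q q" "X * Y = Id q" "Y * X = Id q" by (rule inverse_mat_exists[OF X d])
have "mn Y <= real q * c"
proof (rule mn_le_sup[OF Y(1)])
 fix x :: "real vec" assume x: "x : Vec q"
 have "X *v (Y *v x) = x" using Mv_assoc[OF X Y(1) x] Y(2) x by simp
 thus "vn (Y *v x) <= c * vn x" using c[of "Y *v x"] Y(1) x by simp
qed
with that Y d show thesis by blast
qed

lemma prodA_inverse:
assumes "w : space S"
obtains Y where "Y : Mat q q" "prodA n w * Y = Id q" "Y * prodA n w = Id q" "mn Y <= real q * b ^ n"
by (rule lower_bound_imp_inverse[OF prodA_carrier[OF assms] prodA_lower[OF assms]]) blast

lemma prodA_det: "w : space S ==> det (prodA n w) ~= 0" by (rule lower_bound_imp_inverse[OF prodA_carrier prodA_lower]) auto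

lemma A_inverse:
assumes "s : space M"
obtains Y where "Y : Mat q q" "A s * Y = Id q" "Y * A s = Id q" "mn Y <= real q * b" "det (A s) ~= 0"
by (rule lower_bound_imp_inverse[OF A_carrier[OF assms] A_lower[OF assms]]) blast

text \<open>
  Furstenberg and Kesten's theorem for any submultiplicative size of matrices that is bounded by a
  power of the norm: it is used for the norm itself and for the norms of minors, which replace
  exterior powers.
\<close>

theorem Furstenberg_Kesten:
fixes e :: "real mat => real"
assumes meas [measurable]: "!!n. (%w. e (prodA n w)) : Bor S"
 and sub: "!!X Y. X : Mat q q ==> Y : Mat q q ==> e (X * Y) <= e X * e Y"
 and nonneg: "!!X. 0 <= e X" and one: "1 <= e (Id q)"
 and up: "!!X. X : Mat q q ==> e X <= c * mn X ^ k" and c: "1 <= c"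
obtains L where "AE w in S. (%n. ln (e (prodA n w)) / real n) ---> L"
 "!!n. 1 <= n ==> L <= (LINT w|S. ln (e (prodA n w))) / real n"
proof -
have inv_bound: "0 < e X & abs (ln (e X)) <= ln c + real k * ln B"
 if X: "X : Mat q q" "Y : Mat q q" "X * Y = Id q" "mn X <= B" "mn Y <= B" and B: "1 <= B" for X Y B
proof -
 have le: "e Z <= c * B ^ k" if "Z : Mat q q" "mn Z <= B" for Z
  using up[OF that(1)] power_mono[OF that(2) mn_nonneg, of k] c by (smt (verit) mult_left_mono)
 have 1: "1 <= e X * e Y" using sub[OF X(1,2)] X(3) one by simp
 hence "e X ~= 0" by auto
 hence pos: "0 < e X" using nonneg[of X] by (simp add: less_le)
 have cb: "0 < c * B ^ k" using c B by simp
 have "1 <= e X * (c * B ^ k)" using 1 mult_left_mono[OF le[OF X(2,5)] nonneg[of X]] by linarith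
 hence "ln 1 <= ln (e X * (c * B ^ k))" using pos cb by (subst ln_le_cancel_iff) auto
 moreover have "ln (e X * (c * B ^ k)) = ln (e X) + (ln c + real k * ln B)" using pos c B by (simp add: ln_mult ln_realpow)
 moreover have "ln (e X) <= ln (c * B ^ k)" using le[OF X(1,4)] pos by (simp add: ln_mono)
 moreover have "ln (c * B ^ k) = ln c + real k * ln B" using c B by (simp add: ln_mult ln_realpow)
 ultimately show ?thesis using pos by auto
qed
define X where "X n w = ln (e (prodA n w))" for n w
have qb: "1 <= real q * b ^ n" for n using mult_mono[of 1 "real q" 1 "b ^ n"] q_pos b_ge_1 by simp
have bd: "0 < e (prodA n w) & abs (X n w) <= ln c + real k * ln (real q * b ^ n)" if w: "w : space S" for n w
proof -
 obtain Y where Y: "Y : Mat q q" "prodA n w * Y = Id q" "mn Y <= real q * b ^ n" by (rule prodA_inverse[OF w])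
 show ?thesis unfolding X_def by (rule inv_bound[OF prodA_carrier[OF w] Y(1,2) prodA_norm[OF w] Y(3) qb])
qed
define C where "C = ln c + real k * ln (real q) + real k * ln b"
have lnb: "0 <= ln b" "0 <= ln c" "0 <= ln (real q)" using b_ge_1 c q_pos by auto
have C: "ln c + real k * ln (real q * b ^ n) <= C * (real n + 1)" for n
proof -
 have "ln (real q * b ^ n) = ln (real q) + real n * ln b" using q_pos b_ge_1 by (simp add: ln_mult ln_realpow)
 moreover have "0 <= (ln c + real k * ln (real q)) * real n + real k * ln b" using lnb by (intro add_nonneg_nonneg mult_nonneg_nonneg) auto
 ultimately show ?thesis by (simp add: C_def algebra_simps)
qed
have near: "abs (X (Suc n) w - X n (shift w)) <= ln c + real k * ln (real q * b)" if w: "w : space S" for n w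
proof -
 have s: "w 0 : space M" using w by (simp add: space_S)
 have w': "shift w : space S" using shift_space[OF w, of 1] by simp
 obtain Y where Y: "Y : Mat q q" "A (w 0) * Y = Id q" "Y * A (w 0) = Id q" "mn Y <= real q * b" by (rule A_inverse[OF s])
 note An = A_norm'[OF s]
 have qb1: "1 <= real q * b" using qb[of 1] by simp
 let ?P = "prodA n (shift w)" and ?P' = "prodA (Suc n) w"
 have PP: "?P' = ?P * A (w 0)" by (rule prodA_Suc_shift[OF w])
 have "?P' * Y = ?P * (A (w 0) * Y)" unfolding PP using prodA_carrier[OF w'] A_carrier[OF s] Y(1) by (rule MM_assoc)
 hence PP': "?P = ?P' * Y" using Y(2) prodA_carrier[OF w', of n] by simp
 have 1: "e ?P' <= e ?P * e (A (w 0))" unfolding PP by (rule sub[OF prodA_carrier[OF w'] A_carrier[OF s]])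
 have 2: "e ?P <= e ?P' * e Y" by (subst PP', rule sub[OF prodA_carrier[OF w] Y(1)])
 have b1: "0 < e (A (w 0)) & abs (ln (e (A (w 0)))) <= ln c + real k * ln (real q * b)" by (rule inv_bound[OF A_carrier[OF s] Y(1,2) An Y(4) qb1])
 have b2: "0 < e Y & abs (ln (e Y)) <= ln c + real k * ln (real q * b)" by (rule inv_bound[OF Y(1) A_carrier[OF s] Y(3,4) An qb1])
 have p: "0 < e ?P" "0 < e ?P'" using bd[OF w'] bd[OF w] by auto
 have "ln (e ?P') <= ln (e ?P * e (A (w 0)))" "ln (e ?P) <= ln (e ?P' * e Y)" using 1 2 p by (auto intro: ln_mono)
 thus ?thesis using b1 b2 p by (simp add: X_def ln_mult abs_le_iff)
qed
obtain L where "AE w in S. (%n. X n w / real n) ---> L" "!!n. 1 <= n ==> L <= (LINT w|S. X n w) / real n"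
proof (rule subadditive_ergodic[of X C "ln c + real k * ln (real q * b)"])
 show "X n : Bor S" for n unfolding X_def by measurable
 show "abs (X n w) <= C * (real n + 1)" if "w : space S" for n w using bd[OF that, of n] C[of n] by linarith
 show "X (m + n) w <= X m w + X n ((shift ^^ m) w)" if w: "w : space S" for m n w
 proof -
  have w': "(shift ^^ m) w : space S" by (rule shift_space[OF w])
  have "e (prodA (m + n) w) <= e (prodA n ((shift ^^ m) w)) * e (prodA m w)"
   unfolding prodA_add[OF w] by (rule sub[OF prodA_carrier[OF w'] prodA_carrier[OF w]])
  hence "X (m + n) w <= ln (e (prodA n ((shift ^^ m) w)) * e (prodA m w))" unfolding X_def using bd[OF w, of "m + n"] by (intro ln_mono) auto
  thus ?thesis using bd[OF w, of m] bd[OF w', of n] by (simp add: X_def ln_mult)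
 qed
qed (use near in blast)+
thus thesis using that by (simp add: X_def)
qed

text \<open>The logarithm of the determinant is additive, so it and its negative are both subadditive.\<close>

lemma det_limit:
"AE w in S. (%n. ln (abs (det (prodA n w))) / real n) ---> (LINT s|M. ln (abs (det (A s))))"
proof -
define X where "X n w = ln (abs (det (prodA n w)))" for n w
define C where "C = ln (fact q) + real q * ln (real q * b)"
have C0: "0 <= C" using q_pos b_ge_1 mult_mono[of 1 "real q" 1 b] by (simp add: C_def)
have detA: "abs (ln (abs (det (A s)))) <= C" if s: "s : space M" for s
proof -
 obtain Y where Y: "Y : Mat q q" "A s * Y = Id q" "mn Y <= real q * b" by (rule A_inverse[OF s])
 note An = A_norm'[OF s]
 have dd: "abs (det (A s)) * abs (det Y) = 1" using det_mult[OF A_carrier[OF s] Y(1)] Y(2) by (simp flip: abs_mult)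
 hence nz: "0 < abs (det (A s))" "0 < abs (det Y)" by auto
 have le: "ln (abs (det Z)) <= C" if Z: "Z : Mat q q" "mn Z <= real q * b" "0 < abs (det Z)" for Z
 proof -
  have "abs (det Z) <= fact q * (real q * b) ^ q"
   using det_le_mn[OF Z(1)] power_mono[OF Z(2) mn_nonneg, of q] by (smt (verit) fact_gt_zero mult_left_mono)
  hence "ln (abs (det Z)) <= ln (fact q * (real q * b) ^ q)" using Z(3) by (intro ln_mono) auto
  also have "... = C" using q_pos b_ge_1 by (simp add: C_def ln_mult ln_realpow)
  finally show ?thesis .
 qed
 have "ln (abs (det (A s))) + ln (abs (det Y)) = 0" using dd nz by (metis ln_mult_pos ln_one)
 with le[OF A_carrier[OF s] An nz(1)] le[OF Y(1,3) nz(2)] show ?thesis by linarith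
qed
have add: "X (m + n) w = X m w + X n ((shift ^^ m) w)" if w: "w : space S" for m n w
proof -
 have w': "(shift ^^ m) w : space S" by (rule shift_space[OF w])
 have "abs (det (prodA (m + n) w)) = abs (det (prodA n ((shift ^^ m) w))) * abs (det (prodA m w))"
  unfolding prodA_add[OF w] using det_mult[OF prodA_carrier[OF w'] prodA_carrier[OF w]] by (simp add: abs_mult)
 thus ?thesis using prodA_det[OF w] prodA_det[OF w'] by (simp add: X_def ln_mult)
qed
have one: "X 1 w = ln (abs (det (A (w 0))))" if "w : space S" for w using that by (simp add: X_def)
have near: "X (Suc n) w = ln (abs (det (A (w 0)))) + X n (shift w)" if "w : space S" for n w using add[OF that, of 1 n] one[OF that] by simp
have bd: "abs (X n w) <= C * (real n + 1)" if "w : space S" for n w using that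
proof (induction n arbitrary: w)
 case 0
 thus ?case using C0 by (simp add: X_def)
next
 case (Suc n)
 have "shift w : space S" using shift_space[OF Suc.prems, of 1] by simp
 hence "abs (X n (shift w)) <= C * (real n + 1)" by (rule Suc.IH)
 moreover have "abs (ln (abs (det (A (w 0))))) <= C" using Suc.prems by (intro detA) (simp add: space_S)
 ultimately show ?case using near[OF Suc.prems, of n] by (simp add: algebra_simps)
qed
have X_meas [measurable]: "X n : Bor S" for n unfolding X_def by measurable
have near': "abs (X (Suc n) w - X n (shift w)) <= C" if "w : space S" for n w using near[OF that, of n] detA[of "w 0"] that by (simp add: space_S)
obtain L1 where L1: "AE w in S. (%n. X n w / real n) ---> L1" "!!n. 1 <= n ==> L1 <= (LINT w|S. X n w) / real n"
 by (rule subadditive_ergodic[OF X_meas bd, of C]) (use add near' in auto)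
obtain L2 where L2: "AE w in S. (%n. - X n w / real n) ---> L2" "!!n. 1 <= n ==> L2 <= (LINT w|S. - X n w) / real n"
 by (rule subadditive_ergodic[of "%n w. - X n w" C C]) (use bd add near' in \<open>auto simp: abs_minus_commute\<close>)
have "AE w in S. L2 = - L1" using L1(1) L2(1)
proof eventually_elim
 case (elim w)
 hence "(%n. - X n w / real n) ---> - L1" using tendsto_minus[OF elim(1)] by simp
 with elim(2) show ?case by (rule LIMSEQ_unique)
qed
hence L12: "L2 = - L1" by simp
have "(LINT w|S. X 1 w) = (LINT s|M. LINT w|S. X 1 (case_nat s w))" by (rule integral_case_nat[OF X_meas]) (rule bd)
also have "... = (LINT s|M. ln (abs (det (A s))))"
proof (rule LINT_cong[OF refl])
 fix s assume s: "s : space M"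
 have "(LINT w|S. X 1 (case_nat s w)) = (LINT w|S. ln (abs (det (A s))))" using one[OF case_nat_space[OF s]] by (intro LINT_cong) auto
 thus "(LINT w|S. X 1 (case_nat s w)) = ln (abs (det (A s)))" by (simp add: P.prob_space)
qed
finally have "L1 = (LINT s|M. ln (abs (det (A s))))" using L1(2)[of 1] L2(2)[of 1] L12 by simp
with L1(1) show ?thesis by (simp add: X_def)
qed

lemma minors_norm_one: "k <= q ==> 1 <= minors_norm q k (Id q)"
proof -
assume k: "k <= q"
define f where "f = restrict id {0..<k}"
have f: "f : index_maps k q" using k by (auto simp: f_def index_maps_def)
have "mat k k (%(i, j). Id q $$ (f i, f j)) = (Id k :: real mat)" using k by (intro eq_matI) (auto simp: f_def)
hence "1 = abs (minor k f f (Id q))" by (simp add: minor_def)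
also have "... <= (SUM h:index_maps k q. abs (minor k f h (Id q)))" using f by (intro member_le_sum) auto
also have "... <= minors_norm q k (Id q)"
 unfolding minors_norm_def using f by (intro member_le_sum[where f = "%f. SUM h:index_maps k q. abs (minor k f h (Id q))"]) (auto intro: sum_nonneg)
finally show ?thesis .
qed

theorem minors_norm_limit:
assumes "k <= q"
obtains L where "AE w in S. (%n. ln (minors_norm q k (prodA n w)) / real n) ---> L"
proof -
have "(%w. minors_norm q k (prodA n w)) : Bor S" for n by (rule measurable_minors_norm) auto
moreover have "minors_norm q k X <= real (q ^ k * q ^ k * fact k) * mn X ^ k" if X: "X : Mat q q" for X
 using minors_norm_le_entries[OF X, of "mn X" k] entry_le_mn[of _ X] X by (auto simp: mult_ac)
moreover have "1 <= real (q ^ k * q ^ k * fact k)"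
proof -
 have "0 < q ^ k * q ^ k * fact k" using q_pos by simp
 thus ?thesis by (metis One_nat_def Suc_leI real_of_nat_ge_one_iff)
qed
ultimately show thesis using Furstenberg_Kesten[of "minors_norm q k"] minors_norm_mult minors_norm_nonneg minors_norm_one[OF assms] that by metis
qed

theorem norm_limit:
obtains L where "AE w in S. (%n. ln (mn (prodA n w)) / real n) ---> L"
 "!!n. 1 <= n ==> L <= (LINT w|S. ln (mn (prodA n w))) / real n"
proof (rule Furstenberg_Kesten[of mn 1 1])
show "mn (X * Y) <= mn X * mn Y" if "X : Mat q q" "Y : Mat q q" for X Y using mn_mult that .
qed (use q_pos that in auto)

text \<open>Bounded factors in a size of matrices do not change its exponential growth rate.\<close>

lemma ln_ratio_limit:
assumes lim: "(%n. ln (f n) / real n) ---> L"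
 and pos: "!!n. 0 < f n" "!!n. 0 < g n" and fg: "!!n. f n <= c * g n" "!!n. g n <= c * f n"
shows "(%n. ln (g n) / real n) ---> L"
proof -
have c: "0 < c" using fg(1)[of 0] pos(1)[of 0] pos(2)[of 0] by (metis less_le_trans zero_less_mult_pos2)
have bd: "abs (ln (g n) - ln (f n)) <= abs (ln c)" for n
proof -
 have "ln (f n) <= ln (c * g n)" "ln (g n) <= ln (c * f n)" using fg pos by (auto intro: ln_mono)
 moreover have "ln (c * g n) = ln c + ln (g n)" "ln (c * f n) = ln c + ln (f n)" using c pos by (simp_all only: ln_mult_pos)
 ultimately show ?thesis by linarith
qed
have "(%n. (ln (g n) - ln (f n)) / real n) ---> 0"
proof (rule Lim_null_comparison)
 show "eventually (%n. norm ((ln (g n) - ln (f n)) / real n) <= abs (ln c) / real n) sequentially"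
  using bd by (intro always_eventually allI) (simp add: divide_right_mono)
 show "(%n. abs (ln c) / real n) ---> 0" by (rule lim_const_over_n)
qed
hence "(%n. ln (f n) / real n + (ln (g n) - ln (f n)) / real n) ---> L + 0" by (intro tendsto_add lim)
thus ?thesis by (simp add: diff_divide_distrib)
qed

lemma initial_product_limit:
assumes k: "k <= q"
obtains L where "AE w in S. (%n. ln (PROD i<k. singular_value (prodA n w) (Suc i)) / real n) ---> L"
proof -
obtain L where L: "AE w in S. (%n. ln (minors_norm q k (prodA n w)) / real n) ---> L" by (rule minors_norm_limit[OF k])
define c where "c = real q ^ k * real q ^ k * fact k"
have c: "1 <= c"
proof -
 have 1: "1 <= real q ^ k" using q_ge_1 by (rule one_le_power)
 have 2: "1 <= real q ^ k * real q ^ k" using mult_mono[OF 1 1] by simp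
 show ?thesis unfolding c_def using mult_mono[OF 2 fact_ge_1[of k]] by simp
qed
from L have "AE w in S. (%n. ln (PROD i<k. singular_value (prodA n w) (Suc i)) / real n) ---> L" using AE_space
proof eventually_elim
 case (elim w)
 note sv = minors_norm_singular_values[OF prodA_carrier[OF elim(2)] prodA_det[OF elim(2)] k, folded c_def]
 have P0: "0 < (PROD i<k. singular_value (prodA n w) (Suc i))" for n using sv(3) k by (intro prod_pos) auto
 have N0: "0 < minors_norm q k (prodA n w)" for n using less_le_trans[OF P0[of n] sv(1)[of n]] c by (simp add: zero_less_mult_iff)
 show ?case
 proof (rule ln_ratio_limit[OF elim(1) N0 P0])
  show "minors_norm q k (prodA n w) <= (c * c) * (PROD i<k. singular_value (prodA n w) (Suc i))" for n by (rule sv(2))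
  show "(PROD i<k. singular_value (prodA n w) (Suc i)) <= (c * c) * minors_norm q k (prodA n w)" for n
  proof -
   have "1 * (c * minors_norm q k (prodA n w)) <= c * (c * minors_norm q k (prodA n w))" using c N0[of n] by (intro mult_right_mono) auto
   with sv(1)[of n] show ?thesis by (simp add: mult.assoc)
  qed
 qed
qed
with that show thesis by blast
qed

text \<open>A singular value is a quotient of products of the largest ones.\<close>

theorem singular_value_limit:
assumes i: "i < q"
obtains L where "AE w in S. (%n. ln (singular_value (prodA n w) (Suc i)) / real n) ---> L"
proof -
obtain L1 where L1: "AE w in S. (%n. ln (PROD i<i. singular_value (prodA n w) (Suc i)) / real n) ---> L1"
 by (rule initial_product_limit[of i]) (use i in auto)
obtain L2 where L2: "AE w in S. (%n. ln (PROD i<Suc i. singular_value (prodA n w) (Suc i)) / real n) ---> L2"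
 by (rule initial_product_limit[of "Suc i"]) (use i in auto)
from L1 L2 have "AE w in S. (%n. ln (singular_value (prodA n w) (Suc i)) / real n) ---> L2 - L1" using AE_space
proof eventually_elim
 case (elim w)
 note sv = minors_norm_singular_values(3)[OF prodA_carrier[OF elim(3)] prodA_det[OF elim(3)] order_refl]
 have P0: "0 < (PROD i<i. singular_value (prodA n w) (Suc i))" for n using sv i by (intro prod_pos) auto
 have "ln (PROD i<Suc i. singular_value (prodA n w) (Suc i)) / real n - ln (PROD i<i. singular_value (prodA n w) (Suc i)) / real n
  = ln (singular_value (prodA n w) (Suc i)) / real n" for n
  unfolding prod.lessThan_Suc ln_mult_pos[OF P0[of n] sv[OF i, of n]] by (simp add: add_divide_distrib)
 with tendsto_diff[OF elim(2,1)] show ?case by simp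
qed
with that show thesis by blast
qed

lemma first_singular_value_bounds:
assumes X: "X : Mat q q" "det X ~= 0"
defines "c \<equiv> real q * real q * (real q * real q)"
shows "singular_value X 1 <= c * c * mn X" "mn X <= c * c * singular_value X 1" "0 < mn X"
proof -
note sv = minors_norm_singular_values[OF X q_pos]
have q1: "1 <= real q" using q_pos by simp
have q2: "1 <= real q * real q" using mult_mono[OF q1 q1] by simp
have entries: "mn X <= real q * real q * minors_norm q 1 X"
proof (rule mn_le_entries[OF X(1)])
 fix i j assume ij: "i < q" "j < q"
 define f where "f = restrict (%_. i) {0..<1::nat}"
 define h where "h = restrict (%_. j) {0..<1::nat}"
 have fh: "f : index_maps 1 q" "h : index_maps 1 q" using ij by (auto simp: f_def h_def index_maps_def)
 have "mat 1 1 (%(i, j). X $$ (f i, h j)) = mat 1 1 (%_. X $$ (i, j))" by (intro eq_matI) (auto simp: f_def h_def)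
 hence "abs (X $$ (i, j)) = abs (minor 1 f h X)" by (simp add: minor_def det_single)
 also have "... <= (SUM h:index_maps 1 q. abs (minor 1 f h X))" using fh by (intro member_le_sum) auto
 also have "... <= minors_norm q 1 X"
  unfolding minors_norm_def using fh by (intro member_le_sum[where f = "%f. SUM h:index_maps 1 q. abs (minor 1 f h X)"]) (auto intro: sum_nonneg)
 finally show "abs (X $$ (i, j)) <= minors_norm q 1 X" .
qed
have N1: "minors_norm q 1 X <= real q * real q * mn X" using minors_norm_le_entries[OF X(1), of "mn X" 1] entry_le_mn[of _ X] X(1) by auto
have s0: "0 < singular_value X 1" using sv(3)[of 0] q_pos by simp
have s1: "singular_value X 1 <= real q * real q * minors_norm q 1 X" using sv(1) by simp
have s2: "minors_norm q 1 X <= real q * real q * (real q * real q) * singular_value X 1" using sv(2) by (simp add: mult.assoc)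
have c1: "1 <= c" unfolding c_def using mult_mono[OF q2 q2] by simp
have "singular_value X 1 <= real q * real q * (real q * real q * mn X)" using s1 mult_left_mono[OF N1, of "real q * real q"] by (simp add: mult.assoc)
also have "... = 1 * (c * mn X)" by (simp add: c_def mult.assoc)
also have "... <= c * (c * mn X)" using c1 by (intro mult_right_mono) auto
finally show "singular_value X 1 <= c * c * mn X" by (simp add: mult.assoc)
have "mn X <= real q * real q * (c * singular_value X 1)" using entries mult_left_mono[OF s2, of "real q * real q"] by (simp add: c_def mult.assoc)
also have "... <= c * (c * singular_value X 1)"
proof (rule mult_right_mono)
 show "real q * real q <= c" unfolding c_def using mult_left_mono[OF q2, of "real q * real q"] by simp
 show "0 <= c * singular_value X 1" using c1 s0 by simp
qed
finally show "mn X <= c * c * singular_value X 1" by (simp add: mult.assoc)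
have "mn X ~= 0" using det_le_mn[OF X(1)] X(2) q_pos by (auto simp: power_0_left)
thus "0 < mn X" using mn_nonneg[of X] by (simp add: less_le)
qed

end

section \<open>Lebesgue measure on vectors\<close>

definition LM :: "nat => (nat => real) measure" where
"LM q = (\<Pi>\<^sub>M i\<in>{..<q}. lborel)"

definition VB :: "nat => real vec measure" where
"VB q = vimage_algebra (Vec q) (%v. restrict (%i. v $ i) {..<q}) (\<Pi>\<^sub>M i\<in>{..<q}. borel)"

definition LV :: "nat => real vec measure" where
"LV q = distr (LM q) (VB q) (vec q)"

lemma sets_LM: "sets (LM q) = sets (\<Pi>\<^sub>M i\<in>{..<q}. borel)" unfolding LM_def by (intro sets_PiM_cong) auto

lemma space_VB [simp]: "space (VB q) = Vec q" by (simp add: VB_def)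

lemma space_LV [simp]: "space (LV q) = Vec q" by (simp add: LV_def)

lemma sets_LV [simp]: "sets (LV q) = sets (VB q)" by (simp add: LV_def)

lemma measurable_coord: "i < q ==> (%v. v $ i) : Bor (VB q)"
proof -
assume i: "i < q"
have "(%v. restrict (%i. v $ i) {..<q}) : measurable (VB q) (\<Pi>\<^sub>M i\<in>{..<q}. borel :: real measure)"
 unfolding VB_def by (rule measurable_vimage_algebra1) (auto simp: space_PiM)
from measurable_compose[OF this measurable_component_singleton[of i]] i
show ?thesis by simp
qed

lemma measurable_VB:
assumes "!!x. x : space N ==> g x : Vec q"
 and "!!i. i < q ==> (%x. g x $ i) : Bor N"
shows "g : measurable N (VB q)" unfolding VB_def
proof (rule measurable_vimage_algebra2)
show "(%x. restrict (%i. g x $ i) {..<q}) : measurable N (\<Pi>\<^sub>M i\<in>{..<q}. borel)" using assms(2) by (intro measurable_restrict) auto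
qed (use assms(1) in auto)

lemma measurable_vec [measurable]: "vec q : measurable (LM q) (VB q)"
proof (rule measurable_VB)
fix i assume i: "i < q"
have "(%x. x i) : Bor (\<Pi>\<^sub>M i\<in>{..<q}. borel)" using i by (intro measurable_component_singleton) auto
hence "(%x. x i) : Bor (LM q)" using measurable_cong_sets[OF sets_LM refl] by blast
thus "(%x. vec q x $ i) : Bor (LM q)" using i by simp
qed auto

lemma measurable_mult_vec:
assumes A: "A : Mat p q"
shows "(%v. A *v v) : measurable (VB q) (VB p)"
proof (rule measurable_VB)
fix i assume i: "i < p"
have "(%v. SUM j<q. A $$ (i, j) * v $ j) : Bor (VB q)" by (intro borel_measurable_sum borel_measurable_times measurable_coord) auto
moreover have "(A *v v) $ i = (SUM j<q. A $$ (i, j) * v $ j)" if "v : space (VB q)" for v using A i that by (subst index_mult_vec_sum) auto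
ultimately show "(%v. (A *v v) $ i) : Bor (VB q)" by (subst measurable_cong) auto
qed (use A in auto)

lemma measurable_vn: "vn : Bor (VB q)"
proof -
have "(%v. SUM i<q. abs (v $ i)) : Bor (VB q)" by (intro borel_measurable_sum borel_measurable_abs measurable_coord) auto
thus ?thesis by (subst measurable_cong[where g = "%v. SUM i<q. abs (v $ i)"]) (auto simp: vn_def)
qed

lemma nn_integral_LV: "f : Bor (VB q) ==> (\<integral>\<^sup>+v. f v \<partial>LV q) = (\<integral>\<^sup>+x. f (vec q x) \<partial>LM q)"
unfolding LV_def by (intro nn_integral_distr) auto

text \<open>
  The change of variables formula for a single matrix.  It is stable under products and inverses, so
  it suffices to check it for the matrices of elementary row operations.
\<close>

definition volume_scaling :: "nat => real mat => bool" where
"volume_scaling q A <-> A : Mat q q & det A ~= 0 \<and>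
 (ALL f:Bor (VB q). (\<integral>\<^sup>+v. f (A *v v) \<partial>LV q) * ennreal (abs (det A)) = (\<integral>\<^sup>+v. f v \<partial>LV q))"

lemma volume_scalingD:
"volume_scaling q A ==> f : Bor (VB q) ==>
 (\<integral>\<^sup>+v. f (A *v v) \<partial>LV q) * ennreal (abs (det A)) = (\<integral>\<^sup>+v. f v \<partial>LV q)"
unfolding volume_scaling_def by blast

text \<open>By Fubini, only the coordinate that is changed matters, where the map is affine.\<close>

lemma volume_scaling_row_operation:
assumes A: "A : Mat q q" "det A ~= 0" and k: "k < q"
 and r: "!!x y. r (x(k := y)) = r x"
 and Ax: "!!x. A *v vec q x = vec q (x(k := r x + det A * x k))"
shows "volume_scaling q A" unfolding volume_scaling_def
proof (intro conjI A ballI)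
fix f :: "real vec => ennreal" assume f: "f : Bor (VB q)"
interpret product_sigma_finite "%_::nat. lborel :: real measure" by standard
define I where "I = {..<q} - {k}"
have I: "finite I" "k ~: I" and qI: "{..<q} = insert k I" using k by (auto simp: I_def)
have LMI: "LM q = (\<Pi>\<^sub>M i\<in>insert k I. lborel)" by (simp add: LM_def qI)
have fm: "(%x. f (vec q x)) : Bor (\<Pi>\<^sub>M i\<in>insert k I. lborel)" using measurable_compose[OF measurable_vec f] by (simp add: LMI)
have fAm: "(%x. f (A *v vec q x)) : Bor (\<Pi>\<^sub>M i\<in>insert k I. lborel)"
 using measurable_compose[OF measurable_vec measurable_compose[OF measurable_mult_vec[OF A(1)] f]] by (simp add: LMI)
have line: "(\<integral>\<^sup>+y. f (A *v vec q (x(k := y))) \<partial>lborel) * ennreal (abs (det A)) = (\<integral>\<^sup>+y. f (vec q (x(k := y))) \<partial>lborel)"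
 if x: "x : space (\<Pi>\<^sub>M i\<in>I. lborel :: real measure)" for x
proof -
 have "(%y. x(k := y)) : measurable lborel (\<Pi>\<^sub>M i\<in>insert k I. lborel :: real measure)"
  using x by (intro measurable_fun_upd[where J = I]) auto
 hence [measurable]: "(%y. f (vec q (x(k := y)))) : Bor borel" using measurable_compose[OF _ fm] by simp
 have "(\<integral>\<^sup>+y. f (vec q (x(k := y))) \<partial>lborel) = ennreal (abs (det A)) * (\<integral>\<^sup>+y. f (vec q (x(k := r x + det A * y))) \<partial>lborel)"
  using A(2) by (intro nn_integral_real_affine) auto
 also have "(%y. f (vec q (x(k := r x + det A * y)))) = (%y. f (A *v vec q (x(k := y))))" by (simp add: Ax r)
 finally show ?thesis by (simp only: mult.commute)
qed
have "(\<integral>\<^sup>+v. f (A *v v) \<partial>LV q) * ennreal (abs (det A))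
  = (\<integral>\<^sup>+x. (\<integral>\<^sup>+y. f (A *v vec q (x(k := y))) \<partial>lborel) \<partial>(\<Pi>\<^sub>M i\<in>I. lborel)) * ennreal (abs (det A))"
 using measurable_compose[OF measurable_mult_vec[OF A(1)] f] by (simp add: nn_integral_LV LMI product_nn_integral_insert[OF I fAm])
also have "... = (\<integral>\<^sup>+x. (\<integral>\<^sup>+y. f (A *v vec q (x(k := y))) \<partial>lborel) * ennreal (abs (det A)) \<partial>(\<Pi>\<^sub>M i\<in>I. lborel))"
proof (rule nn_integral_multc[symmetric])
 interpret I: finite_product_sigma_finite "%_::nat. lborel :: real measure" I by standard (rule I(1))
 have "(%(x, y). f (A *v vec q (x(k := y)))) : Bor ((\<Pi>\<^sub>M i\<in>I. lborel) \<Otimes>\<^sub>M lborel)"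
  using measurable_compose[OF measurable_add_dim fAm] by (simp add: split_beta' I)
 thus "(%x. \<integral>\<^sup>+y. f (A *v vec q (x(k := y))) \<partial>lborel) : Bor (\<Pi>\<^sub>M i\<in>I. lborel)"
  by (intro lborel.borel_measurable_nn_integral)
qed
also have "... = (\<integral>\<^sup>+x. (\<integral>\<^sup>+y. f (vec q (x(k := y))) \<partial>lborel) \<partial>(\<Pi>\<^sub>M i\<in>I. lborel))"
 by (intro nn_integral_cong line)
also have "... = (\<integral>\<^sup>+v. f v \<partial>LV q)" using f by (simp add: nn_integral_LV LMI product_nn_integral_insert[OF I fm])
finally show "(\<integral>\<^sup>+v. f (A *v v) \<partial>LV q) * ennreal (abs (det A)) = (\<integral>\<^sup>+v. f v \<partial>LV q)" .
qed

lemma volume_scaling_addrow: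
assumes "k < q" "l < q" "l ~= k"
shows "volume_scaling q (addrow_mat q a k l)"
proof (rule volume_scaling_row_operation[of _ _ k "%x. a * x l"])
fix x :: "nat => real"
show "addrow_mat q a k l *v vec q x = vec q (x(k := a * x l + det (addrow_mat q a k l) * x k))"
proof (rule eq_vecI)
 fix i assume "i < dim_vec (vec q (x(k := a * x l + det (addrow_mat q a k l) * x k)))"
 hence i: "i < q" by simp
 have "(addrow_mat q a k l *v vec q x) $ i = (SUM j<q. (if k = i & j = l then a * x l else 0) + (if j = i then x i else 0))"
 proof -
  have "addrow_mat q a k l $$ (i, j) * x j = (if k = i & j = l then a * x l else 0) + (if j = i then x i else 0)" if "j < q" for j
   using i that by (auto simp: algebra_simps)
  thus ?thesis using i by (subst index_mult_vec_sum) (auto intro!: sum.cong simp del: index_mat_addrow_mat(1))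
 qed
 also have "... = (if k = i then a * x l else 0) + x i" using i assms by (simp add: sum.distrib)
 finally show "(addrow_mat q a k l *v vec q x) $ i = vec q (x(k := a * x l + det (addrow_mat q a k l) * x k)) $ i"
  using i assms by (simp add: det_addrow_mat)
qed simp
qed (use assms in \<open>auto simp: det_addrow_mat\<close>)

lemma volume_scaling_multrow:
assumes "k < q" "a ~= 0"
shows "volume_scaling q (multrow_mat q k a)"
proof (rule volume_scaling_row_operation[of _ _ k "%_. 0"])
fix x :: "nat => real"
show "multrow_mat q k a *v vec q x = vec q (x(k := 0 + det (multrow_mat q k a) * x k))"
proof (rule eq_vecI)
 fix i assume "i < dim_vec (vec q (x(k := 0 + det (multrow_mat q k a) * x k)))"
 hence i: "i < q" by simp
 have "multrow_mat q k a $$ (i, j) * x j = (if j = i then (if k = i then a * x i else x i) else 0)" if "j < q" for j using i that by auto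
 hence "(multrow_mat q k a *v vec q x) $ i = (SUM j<q. (if j = i then (if k = i then a * x i else x i) else 0))"
  using i by (subst index_mult_vec_sum) (auto intro!: sum.cong simp del: index_mat_multrow_mat(1))
 thus "(multrow_mat q k a *v vec q x) $ i = vec q (x(k := 0 + det (multrow_mat q k a) * x k)) $ i" using i assms by (simp add: det_multrow_mat)
qed simp
qed (use assms in \<open>auto simp: det_multrow_mat\<close>)

lemma volume_scaling_mult:
assumes A: "volume_scaling q A" and B: "volume_scaling q B"
shows "volume_scaling q (A * B)" unfolding volume_scaling_def
proof (intro conjI ballI)
have c: "A : Mat q q" "B : Mat q q" using A B by (auto simp: volume_scaling_def)
show "A * B : Mat q q" using c by simp
have d: "det (A * B) = det A * det B" using det_mult[OF c] .
thus "det (A * B) ~= 0" using A B by (simp add: volume_scaling_def)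
fix f :: "real vec => ennreal" assume f: "f : Bor (VB q)"
have fA: "(%v. f (A *v v)) : Bor (VB q)" by (rule measurable_compose[OF measurable_mult_vec[OF c(1)] f])
have "(\<integral>\<^sup>+v. f ((A * B) *v v) \<partial>LV q) = (\<integral>\<^sup>+v. f (A *v (B *v v)) \<partial>LV q)"
 using c by (intro nn_integral_cong) (simp add: Mv_assoc[of _ q q])
hence "(\<integral>\<^sup>+v. f ((A * B) *v v) \<partial>LV q) * ennreal (abs (det (A * B))) =
  ((\<integral>\<^sup>+v. f (A *v (B *v v)) \<partial>LV q) * ennreal (abs (det B))) * ennreal (abs (det A))"
 by (simp add: d abs_mult ennreal_mult mult_ac)
also have "(\<integral>\<^sup>+v. f (A *v (B *v v)) \<partial>LV q) * ennreal (abs (det B)) = (\<integral>\<^sup>+v. f (A *v v) \<partial>LV q)"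
 by (rule volume_scalingD[OF B fA])
also have "... * ennreal (abs (det A)) = (\<integral>\<^sup>+v. f v \<partial>LV q)" using A f by (simp add: volume_scaling_def)
finally show "(\<integral>\<^sup>+v. f ((A * B) *v v) \<partial>LV q) * ennreal (abs (det (A * B))) = (\<integral>\<^sup>+v. f v \<partial>LV q)" .
qed

lemma volume_scaling_inverse:
assumes A: "volume_scaling q A" and B: "B : Mat q q" and AB: "A * B = Id q"
shows "volume_scaling q B" unfolding volume_scaling_def
proof (intro conjI ballI B)
have c: "A : Mat q q" using A by (simp add: volume_scaling_def)
have BA: "B * A = Id q" by (rule mat_mult_left_right_inverse[OF c B AB])
have d: "det A * det B = 1" using det_mult[OF c B] AB by simp
thus "det B ~= 0" by auto
fix f :: "real vec => ennreal" assume f: "f : Bor (VB q)"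
have fB: "(%v. f (B *v v)) : Bor (VB q)" by (rule measurable_compose[OF measurable_mult_vec[OF B] f])
have "(\<integral>\<^sup>+v. f (B *v v) \<partial>LV q) = (\<integral>\<^sup>+v. f (B *v (A *v v)) \<partial>LV q) * ennreal (abs (det A))"
 using volume_scalingD[OF A fB] by simp
also have "(\<integral>\<^sup>+v. f (B *v (A *v v)) \<partial>LV q) = (\<integral>\<^sup>+v. f v \<partial>LV q)"
 using Mv_assoc[OF B c] BA by (intro nn_integral_cong) simp
finally have "(\<integral>\<^sup>+v. f (B *v v) \<partial>LV q) * ennreal (abs (det B)) = (\<integral>\<^sup>+v. f v \<partial>LV q) * (ennreal (abs (det A)) * ennreal (abs (det B)))"
 by (simp add: mult.assoc)
also have "ennreal (abs (det A)) * ennreal (abs (det B)) = 1" using d by (simp flip: ennreal_mult abs_mult)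
finally show "(\<integral>\<^sup>+v. f (B *v v) \<partial>LV q) * ennreal (abs (det B)) = (\<integral>\<^sup>+v. f v \<partial>LV q)" by simp
qed

lemma volume_scaling_cancel:
assumes E: "volume_scaling q E" and A: "A : Mat q q" and EA: "volume_scaling q (E * A)"
shows "volume_scaling q A"
proof -
have c: "E : Mat q q" "det E ~= 0" using E by (auto simp: volume_scaling_def)
obtain F where F: "F : Mat q q" "E * F = Id q" "F * E = Id q" by (rule inverse_mat_exists[OF c])
have "F * (E * A) = (F * E) * A" using MM_assoc[OF F(1) c(1) A] by simp
hence "F * (E * A) = A" using F(3) A by simp
thus ?thesis using volume_scaling_mult[OF volume_scaling_inverse[OF E F(1,2)] EA] by simp
qed

lemma volume_scaling_one: "volume_scaling q (Id q)" unfolding volume_scaling_def by (auto intro!: nn_integral_cong)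

definition column_clearing :: "nat => nat => nat set => (nat => real) => real mat" where
"column_clearing q k X c = mat q q (%(i, j). if i = j then 1 else if j = k & i : X then c i else 0)"

lemma volume_scaling_column_clearing:
assumes "finite X" "X <= {..<q}" "k ~: X" "k < q"
shows "volume_scaling q (column_clearing q k X c)" using assms
proof (induction X rule: finite_induct)
case empty
have "column_clearing q k {} c = Id q" by (intro eq_matI) (auto simp: column_clearing_def)
thus ?case by (simp add: volume_scaling_one)
next
case (insert l X)
have C: "column_clearing q k X c : Mat q q" by (simp add: column_clearing_def)
have "column_clearing q k (insert l X) c = addrow (c l) l k (column_clearing q k X c)"
 using insert by (intro eq_matI) (auto simp: column_clearing_def)
also have "... = addrow_mat q (c l) l k * column_clearing q k X c" using insert by (intro addrow_mat[OF C]) auto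
finally show ?case using insert by (simp add: volume_scaling_mult volume_scaling_addrow)
qed

text \<open>Gaussian elimination, one column at a time.\<close>

theorem volume_scaling_invertible:
assumes A: "A : Mat q q" "det A ~= 0"
shows "volume_scaling q A"
proof -
have "volume_scaling q A" if "m <= q" "A : Mat q q" "det A ~= 0"
 "!!i j. i < q ==> j < q - m ==> A $$ (i, j) = (if i = j then 1 else 0)" for m A using that
proof (induction m arbitrary: A)
 case 0
 hence "A = Id q" by (intro eq_matI) auto
 thus ?case by (simp add: volume_scaling_one)
next
 case (Suc m)
 define k where "k = q - Suc m"
 have k: "k < q" and qm: "q - m = Suc k" using Suc.prems by (auto simp: k_def)
 note Ac = Suc.prems(2)
 note unit = Suc.prems(4)[folded k_def]
 have pivot: "EX i. k <= i & i < q & A $$ (i, k) ~= 0"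
 proof (rule ccontr)
  assume "\<not> ?thesis"
  hence z: "A $$ (i, k) = 0" if "k <= i" "i < q" for i using that by blast
  define v where "v = vec q (%j. if j = k then 1 else if j < k then - A $$ (j, k) else 0)"
  have "A *v v = 0v q"
  proof (rule eq_vecI)
   fix i assume "i < dim_vec (0v q :: real vec)"
   hence i: "i < q" by simp
   have "A $$ (i, j) * v $ j = (if j = k then A $$ (i, k) else 0) + (if j = i then (if i < k then - A $$ (i, k) else 0) else 0)" if "j < q" for j
    using unit[OF i, of j] i that by (auto simp: v_def)
   hence "(A *v v) $ i = (SUM j<q. (if j = k then A $$ (i, k) else 0) + (if j = i then (if i < k then - A $$ (i, k) else 0) else 0))"
    using Ac i by (subst index_mult_vec_sum) (auto simp: v_def intro!: sum.cong)
   also have "... = 0" using i k z[of i] by (simp add: sum.distrib)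
   finally show "(A *v v) $ i = 0v q $ i" using i by simp
  qed (use Ac in auto)
  moreover have "v : Vec q" by (simp add: v_def)
  moreover have "v $ k = 1" using k by (simp add: v_def)
  hence "v ~= 0v q" using k by auto
  ultimately have "det A = 0" using det_0_iff_vec_prod_zero[OF Ac] by blast
  thus False using Suc.prems by simp
 qed
 have normalised: "volume_scaling q B" if B: "B : Mat q q" "det B ~= 0" "B $$ (k, k) ~= 0"
  "!!i j. i < q ==> j < k ==> B $$ (i, j) = (if i = j then 1 else 0)" for B
 proof -
  define B1 where "B1 = multrow_mat q k (1 / B $$ (k, k)) * B"
  have S1: "volume_scaling q (multrow_mat q k (1 / B $$ (k, k)))" using k B(3) by (intro volume_scaling_multrow) auto
  have B1e: "B1 = multrow k (1 / B $$ (k, k)) B" unfolding B1_def using multrow_mat[OF B(1)] by simp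
  have B1c: "B1 : Mat q q" unfolding B1_def by (rule mult_carrier_mat[OF multrow_mat_carrier B(1)])
  have B1: "B1 $$ (i, j) = (if i = k then B $$ (i, j) / B $$ (k, k) else B $$ (i, j))" if "i < q" "j < q" for i j using that B(1) by (auto simp: B1e)
  define C where "C = column_clearing q k ({..<q} - {k}) (%i. - B $$ (i, k))"
  have Cc: "C : Mat q q" by (simp add: C_def column_clearing_def)
  have S2: "volume_scaling q C" unfolding C_def using k by (intro volume_scaling_column_clearing) auto
  have CB1: "(C * B1) $$ (i, j) = (if i = k then B1 $$ (k, j) else B1 $$ (i, j) - B $$ (i, k) * B1 $$ (k, j))" if "i < q" "j < q" for i j
  proof -
   have "C $$ (i, l) * B1 $$ (l, j) = (if l = i then B1 $$ (i, j) else 0) + (if l = k then (if i = k then 0 else - B $$ (i, k) * B1 $$ (k, j)) else 0)" if "l < q" for l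
    using that \<open>i < q\<close> k by (auto simp: C_def column_clearing_def)
   hence "(C * B1) $$ (i, j) = (SUM l<q. (if l = i then B1 $$ (i, j) else 0) + (if l = k then (if i = k then 0 else - B $$ (i, k) * B1 $$ (k, j)) else 0))"
    using Cc B1c that by (subst index_mult_mat_sum) (auto intro!: sum.cong)
   thus ?thesis using that k by (simp add: sum.distrib)
  qed
  have CB1c: "C * B1 : Mat q q" using Cc B1c by simp
  have "volume_scaling q (C * B1)"
  proof (rule Suc.IH)
   show "m <= q" using Suc.prems by simp
   have "det B1 ~= 0" unfolding B1_def using det_mult[OF multrow_mat_carrier B(1)] S1 B(2) by (simp add: volume_scaling_def)
   thus "det (C * B1) ~= 0" using det_mult[OF Cc B1c] S2 by (simp add: volume_scaling_def)
   show "(C * B1) $$ (i, j) = (if i = j then 1 else 0)" if ij: "i < q" "j < q - m" for i j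
   proof (cases "j = k")
    case True
    thus ?thesis using ij k B(3) CB1[of i k] B1[of k k] B1[of i k] by auto
   next
    case False
    hence j: "j < k" using ij qm by simp
    thus ?thesis using ij k CB1[of i j] B1[of k j] B1[of i j] B(4)[of i j] B(4)[of k j] by auto
   qed
  qed (rule CB1c)
  hence "volume_scaling q B1" by (rule volume_scaling_cancel[OF S2 B1c])
  thus ?thesis unfolding B1_def by (rule volume_scaling_cancel[OF S1 B(1)])
 qed
 show ?case
 proof (cases "A $$ (k, k) = 0")
  case False
  thus ?thesis using normalised[OF Ac Suc.prems(3)] unit by blast
 next
  case True
  with pivot obtain i where i: "k < i" "i < q" "A $$ (i, k) ~= 0" by (metis le_neq_implies_less)
  have S: "volume_scaling q (addrow_mat q 1 k i)" using i k by (intro volume_scaling_addrow) auto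
  have e: "addrow_mat q 1 k i * A = addrow 1 k i A" using addrow_mat[OF Ac i(2)] by simp
  have "volume_scaling q (addrow_mat q 1 k i * A)"
  proof (rule normalised)
   show "addrow_mat q 1 k i * A : Mat q q" by (rule mult_carrier_mat[OF addrow_mat_carrier Ac])
   show "det (addrow_mat q 1 k i * A) ~= 0" using det_mult[OF addrow_mat_carrier Ac] S Suc.prems(3) by (simp add: volume_scaling_def)
   show "(addrow_mat q 1 k i * A) $$ (k, k) ~= 0" unfolding e using Ac k True i by simp
   show "(addrow_mat q 1 k i * A) $$ (a, j) = (if a = j then 1 else 0)" if "a < q" "j < k" for a j
    unfolding e using Ac k i that unit[of a j] unit[of i j] by auto
  qed
  thus ?thesis by (rule volume_scaling_cancel[OF S Ac])
 qed
qed
from this[of q A] A show ?thesis by simp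
qed

lemma nn_integral_linear_image:
assumes "A : Mat q q" "det A ~= 0" "f : Bor (VB q)"
shows "(\<integral>\<^sup>+v. f (A *v v) \<partial>LV q) * ennreal (abs (det A)) = (\<integral>\<^sup>+v. f v \<partial>LV q)"
using volume_scaling_invertible[OF assms(1,2)] assms(3) by (simp add: volume_scaling_def)

definition vball :: "nat => real => real vec set" where
"vball q r = {v : Vec q. vn v <= r}"

lemma vball_sets [measurable]: "vball q r : sets (VB q)"
proof -
have [measurable]: "vn : Bor (VB q)" by (rule measurable_vn)
have "{v : space (VB q). vn v <= r} : sets (VB q)" by measurable
thus ?thesis by (simp add: vball_def)
qed

lemma emeasure_LV: "X : sets (VB q) ==> emeasure (LV q) X = emeasure (LM q) (vec q -` X Int space (LM q))"
unfolding LV_def by (intro emeasure_distr) auto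

lemma emeasure_LM_box: "(!!i. X i : sets borel) ==> emeasure (LM q) (Pi\<^sub>E {..<q} X) = (PROD i<q. emeasure lborel (X i))"
proof -
assume X: "!!i. X i : sets borel"
interpret product_sigma_finite "%_::nat. lborel :: real measure" by standard
show ?thesis unfolding LM_def using X by (intro emeasure_PiM) auto
qed

lemma box_sets_LM: "(!!i. X i : sets borel) ==> Pi\<^sub>E {..<q} X : sets (LM q)" unfolding LM_def by (intro sets_PiM_I_finite) auto

lemma emeasure_vball_finite: "emeasure (LV q) (vball q r) < \<infinity>"
proof -
have "vec q -` vball q r Int space (LM q) <= Pi\<^sub>E {..<q} (%_. {-r..r})"
proof
 fix x assume x: "x : vec q -` vball q r Int space (LM q)"
 hence e: "(SUM i<q. abs (x i)) <= r" and ext: "x : extensional {..<q}" by (auto simp: vball_def vn_def LM_def space_PiM PiE_def)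
 have "abs (x i) <= r" if "i < q" for i using member_le_sum[of i "{..<q}" "%i. abs (x i)"] that e by simp
 hence "x i : {-r..r}" if "i < q" for i using that by (auto simp: abs_le_iff minus_le_iff)
 thus "x : Pi\<^sub>E {..<q} (%_. {-r..r})" using ext unfolding PiE_iff by blast
qed
hence "emeasure (LV q) (vball q r) <= emeasure (LM q) (Pi\<^sub>E {..<q} (%_. {-r..r}))"
 unfolding emeasure_LV[OF vball_sets] by (intro emeasure_mono box_sets_LM) auto
also have "... < \<infinity>" by (subst emeasure_LM_box) (auto simp: emeasure_lborel_Icc_eq power_less_top_ennreal)
finally show ?thesis .
qed

lemma emeasure_vball_ge:
assumes "0 <= r" "1 <= q"
shows "ennreal ((r / real q) ^ q) <= emeasure (LV q) (vball q r)"
proof -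
have "Pi\<^sub>E {..<q} (%_. {0..r / real q}) <= vec q -` vball q r Int space (LM q)"
proof
 fix x assume x: "x : Pi\<^sub>E {..<q} (%_. {0..r / real q})"
 hence "(SUM i<q. abs (x i)) <= (SUM i<q. r / real q)" by (intro sum_mono) (auto simp: PiE_iff Pi_iff)
 also have "... = r" using assms by simp
 finally show "x : vec q -` vball q r Int space (LM q)" using x by (auto simp: vball_def vn_def LM_def space_PiM PiE_iff)
qed
hence "emeasure (LM q) (Pi\<^sub>E {..<q} (%_. {0..r / real q})) <= emeasure (LV q) (vball q r)"
 unfolding emeasure_LV[OF vball_sets] by (intro emeasure_mono measurable_sets[OF measurable_vec] vball_sets) auto
thus ?thesis using assms by (subst (asm) emeasure_LM_box) (auto simp: ennreal_power)
qed

lemma sigma_finite_LV: "sigma_finite_measure (LV q)"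
proof
show "EX A. countable A & A <= sets (LV q) & \<Union> A = space (LV q) & (ALL a:A. emeasure (LV q) a ~= \<infinity>)"
proof (intro exI[of _ "range (%n::nat. vball q (real n))"] conjI)
 show "\<Union> (range (%n::nat. vball q (real n))) = space (LV q)" using real_arch_simple by (auto simp: vball_def)
 show "ALL a:range (%n::nat. vball q (real n)). emeasure (LV q) a ~= \<infinity>"
  using emeasure_vball_finite[of q] by (auto simp: less_top[symmetric])
qed auto
qed

lemma emeasure_LV_zero: "1 <= q ==> emeasure (LV q) {0v q} = 0"
proof -
assume q: "1 <= q"
have s: "{0v q} = vball q 0" using vn_eq_0 vn_nonneg by (force simp: vball_def intro: antisym)
have "vec q -` {0v q} Int space (LM q) <= Pi\<^sub>E {..<q} (%_. {0})"
proof
 fix x assume x: "x : vec q -` {0v q} Int space (LM q)"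
 hence "vec q x $ i = 0" if "i < q" for i using that by simp
 thus "x : Pi\<^sub>E {..<q} (%_. {0})" using x by (auto simp: LM_def space_PiM PiE_iff extensional_def fun_eq_iff)
qed
hence "emeasure (LV q) {0v q} <= emeasure (LM q) (Pi\<^sub>E {..<q} (%_. {0}))"
 unfolding s emeasure_LV[OF vball_sets] by (intro emeasure_mono box_sets_LM) auto
also have "... = 0" using q by (subst emeasure_LM_box) auto
finally show ?thesis by simp
qed

section \<open>An invariant mean for products without exponential growth\<close>

lemma vball_iff: "v : vball q r <-> v : Vec q & vn v <= r" by (simp add: vball_def)

lemma measurable_LV_cong: "Bor (LV q) = Bor (VB q)" by (rule measurable_cong_sets) auto

lemma integral_linear_image:
fixes f :: "real vec => real"
assumes A: "A : Mat q q" "det A ~= 0" and f: "f : Bor (VB q)" "!!v. 0 <= f v"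
shows "(LINT v|(LV q). abs (det A) * f (A *v v)) = (LINT v|(LV q). f v)"
proof -
have fA: "(%v. f (A *v v)) : Bor (VB q)" by (rule measurable_compose[OF measurable_mult_vec[OF A(1)] f(1)])
have "(LINT v|(LV q). abs (det A) * f (A *v v)) = abs (det A) * enn2real (\<integral>\<^sup>+v. ennreal (f (A *v v)) \<partial>LV q)"
 using fA f(2) by (subst integral_mult_right_zero, subst integral_eq_nn_integral) (auto simp: measurable_LV_cong)
also have "... = enn2real ((\<integral>\<^sup>+v. ennreal (f (A *v v)) \<partial>LV q) * ennreal (abs (det A)))"
 by (simp add: enn2real_mult mult.commute)
also have "(\<integral>\<^sup>+v. ennreal (f (A *v v)) \<partial>LV q) * ennreal (abs (det A)) = (\<integral>\<^sup>+v. ennreal (f v) \<partial>LV q)"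
 using f(1) by (intro nn_integral_linear_image[OF A]) auto
also have "enn2real ... = (LINT v|(LV q). f v)" using f by (intro integral_eq_nn_integral[symmetric]) (auto simp: measurable_LV_cong)
finally show ?thesis .
qed

lemma linear_image_sets:
assumes A: "A : Mat q q" "det A ~= 0" and X: "X : sets (VB q)"
shows "(*\<^sub>v) A ` X : sets (VB q)" "!!v. v : Vec q ==> A *v v : (*\<^sub>v) A ` X <-> v : X"
proof -
obtain B where B: "B : Mat q q" "A * B = Id q" "B * A = Id q" by (rule inverse_mat_exists[OF A])
have Xc: "X <= Vec q" using sets.sets_into_space[OF X] by simp
have BA: "B *v (A *v v) = v" if "v : Vec q" for v using Mv_assoc[OF B(1) A(1) that] B(3) that by simp
have AB: "A *v (B *v v) = v" if "v : Vec q" for v using Mv_assoc[OF A(1) B(1) that] B(2) that by simp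
have "(*\<^sub>v) A ` X = (*\<^sub>v) B -` X Int space (VB q)"
proof (intro equalityI subsetI)
 fix w assume "w : (*\<^sub>v) A ` X"
 thus "w : (*\<^sub>v) B -` X Int space (VB q)" using BA Xc A(1) by auto
next
 fix w assume "w : (*\<^sub>v) B -` X Int space (VB q)"
 thus "w : (*\<^sub>v) A ` X" using AB[of w] by (intro image_eqI[of _ _ "B *v w"]) auto
qed
thus "(*\<^sub>v) A ` X : sets (VB q)" using measurable_sets[OF measurable_mult_vec[OF B(1)] X] by simp
show "A *v v : (*\<^sub>v) A ` X <-> v : X" if "v : Vec q" for v
proof
 assume "A *v v : (*\<^sub>v) A ` X"
 then obtain x where x: "x : X" "A *v v = A *v x" by auto
 hence "v = x" using BA[OF that] BA[of x] Xc by auto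
 with x show "v : X" by simp
qed auto
qed

text \<open>Tychonoff's theorem: the functions from sets to the unit interval form a compact space.\<close>

lemma cluster_point_of_set_functions:
fixes h :: "nat => 'b set => real"
assumes "!!n X. 0 <= h n X & h n X <= 1"
obtains m F where "F ~= bot" "F <= filtermap h sequentially" "!!X. ((%f. f X) \<longlongrightarrow> m X) F"
proof -
have "compact (PiE UNIV (%_::'b set. {0..1::real}))"
 using compactin_PiE[of "%_. euclidean" UNIV "%_. {0..1::real}"] by (simp add: euclidean_product_topology)
moreover have "filtermap h sequentially ~= bot" by (simp add: filtermap_bot_iff)
moreover have "eventually (%f. f : PiE UNIV (%_::'b set. {0..1::real})) (filtermap h sequentially)"
 using assms by (simp add: eventually_filtermap PiE_iff)
ultimately obtain m where m: "inf (nhds m) (filtermap h sequentially) ~= bot" unfolding compact_filter by blast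
show thesis
proof (rule that[OF m])
 show "inf (nhds m) (filtermap h sequentially) <= filtermap h sequentially" by simp
 fix X :: "'b set"
 have "((%f. f X) \<longlongrightarrow> m X) (nhds m)"
 proof (rule topological_tendstoI)
  fix U :: "real set" assume U: "open U" "m X : U"
  have "open ((%f::'b set => real. f X) -` U)" by (rule open_vimage[OF U(1)]) simp
  hence "eventually (%f. f : (%f. f X) -` U) (nhds m)" using U(2) by (intro eventually_nhds_in_open) auto
  thus "eventually (%f. f X : U) (nhds m)" by simp
 qed
 thus "((%f. f X) \<longlongrightarrow> m X) (inf (nhds m) (filtermap h sequentially))" by (rule tendsto_mono[rotated]) simp
qed
qed

text \<open>As \<open>1 - x \<le> - ln x\<close>, relative drops sum up to at most a telescoping sum of logarithms.\<close>

lemma sum_telescope_le_ln: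
fixes a :: "nat => real"
assumes "!!n. 0 < a n"
shows "(SUM n<N. 1 - a (Suc n) / a n) <= ln (a 0) - ln (a N)"
proof (induction N)
case (Suc N)
have "ln (a (Suc N) / a N) <= a (Suc N) / a N - 1" using assms by (intro ln_le_minus_one) simp
hence "1 - a (Suc N) / a N <= ln (a N) - ln (a (Suc N))" using assms[of N] assms[of "Suc N"] by (simp add: ln_div)
with Suc show ?case by simp
qed simp

context random_matrices
begin

text \<open>The products and their inverses grow at most subexponentially.\<close>

definition no_growth :: bool where
"no_growth <-> (ALL e>0. AE w in S. eventually (%n. mn (prodA n w) <= exp (real n * e) \<and>
  exp (- (real n * e)) <= abs (det (prodA n w))) sequentially)"

text \<open>
  \<open>profile n\<close> is the \<open>n\<close>-th image of the indicator of the unit ball under the averaging operator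
  of the unitary representation \<open>f \<mapsto> \<bar>det g\<bar>\<^sup>1\<^sup>/\<^sup>2 f \<circ> g\<close> on square integrable functions, written as an
  integral over the random product.
\<close>

definition profile :: "nat => real vec => real" where
"profile n v = (LINT w|S. (if vn (prodA n w *v v) <= 1 then sqrt (abs (det (prodA n w))) else 0))"

definition moved :: "nat => 'a => real vec => real" where
"moved n s v = sqrt (abs (det (A s))) * profile n (A s *v v)"

definition mass :: "nat => real" where
"mass n = (LINT v|(LV q). (profile n v)^2)"

definition cn :: "nat => real" where
"cn n = sqrt (fact q * (real q * b ^ n) ^ q)"

lemma cn_nonneg [simp]: "0 <= cn n" using b_ge_1 by (simp add: cn_def)

lemma sqrt_det_le: "w : space S ==> sqrt (abs (det (prodA n w))) <= cn n"
proof -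
assume w: "w : space S"
have "abs (det (prodA n w)) <= fact q * mn (prodA n w) ^ q" by (rule det_le_mn[OF prodA_carrier[OF w]])
also have "... <= fact q * (real q * b ^ n) ^ q" using prodA_norm[OF w, of n] by (intro mult_left_mono power_mono) auto
finally show ?thesis by (simp add: cn_def)
qed

lemma measurable_fst_coord: "i < q ==> (%p. fst p $ i) : Bor (LV q \<Otimes>\<^sub>M N)"
using measurable_compose[OF measurable_fst, of "%v. v $ i" "LV q" borel N] measurable_coord[of i q] by (simp add: measurable_LV_cong)

lemma measurable_profile_joint:
"(%(v, w). if vn (prodA n w *v v) <= 1 then sqrt (abs (det (prodA n w))) else 0) : Bor (LV q \<Otimes>\<^sub>M S)"
proof -
have "(%p. vn (prodA n (snd p) *v fst p)) : Bor (LV q \<Otimes>\<^sub>M S)"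
proof (rule measurable_vn_mult)
 show "(%p. prodA n (snd p) $$ (i, j)) : Bor (LV q \<Otimes>\<^sub>M S)" if "i < q" "j < q" for i j
  using measurable_compose[OF measurable_snd measurable_prodA_entry[OF that, of n]] .
qed (auto simp: space_pair_measure measurable_fst_coord)
thus ?thesis unfolding split_beta' by measurable
qed

lemma profile_measurable: "profile n : Bor (VB q)"
proof -
have "(%v. LINT w|S. (if vn (prodA n w *v v) <= 1 then sqrt (abs (det (prodA n w))) else 0)) : Bor (LV q)"
 by (rule P.borel_measurable_lebesgue_integral[OF measurable_profile_joint])
thus ?thesis by (simp add: profile_def[abs_def] measurable_LV_cong)
qed

lemma profile_integrand_measurable:
"v : Vec q ==> (%w. if vn (prodA n w *v v) <= 1 then sqrt (abs (det (prodA n w))) else 0) : Bor S" by measurable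

lemma profile_nonneg: "0 <= profile n v" unfolding profile_def by (intro integral_nonneg_AE) auto

lemma profile_integrable:
"v : Vec q ==> integrable S (%w. if vn (prodA n w *v v) <= 1 then sqrt (abs (det (prodA n w))) else 0)"
using sqrt_det_le by (intro P.integrable_const_bound[of _ "cn n"] AE_I2 profile_integrand_measurable) auto

lemma profile_le: "v : Vec q ==> profile n v <= cn n"
proof -
assume v: "v : Vec q"
have "profile n v <= (LINT w|S. cn n)" unfolding profile_def using sqrt_det_le by (intro integral_mono profile_integrable v) auto
thus ?thesis by (simp add: P.prob_space)
qed

lemma profile_support: "v : Vec q ==> b ^ n < vn v ==> profile n v = 0"
proof -
assume v: "v : Vec q" "b ^ n < vn v"
have "\<not> vn (prodA n w *v v) <= 1" if "w : space S" for w
proof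
 assume "vn (prodA n w *v v) <= 1"
 hence "b ^ n * vn (prodA n w *v v) <= b ^ n * 1" using b_ge_1 by (intro mult_left_mono) auto
 with prodA_lower[OF that v(1), of n] v(2) show False by simp
qed
hence "profile n v = (LINT w|S. 0)" unfolding profile_def by (intro LINT_cong) auto
thus ?thesis by simp
qed

lemma profile_Suc: "v : Vec q ==> profile (Suc n) v = (LINT s|M. moved n s v)"
proof -
assume v: "v : Vec q"
have "profile (Suc n) v = (LINT s|M. LINT w|S. (if vn (prodA (Suc n) (case_nat s w) *v v) <= 1 then sqrt (abs (det (prodA (Suc n) (case_nat s w)))) else 0))"
 unfolding profile_def using sqrt_det_le by (intro integral_case_nat[where c = "cn (Suc n)"] profile_integrand_measurable v) auto
also have "... = (LINT s|M. moved n s v)"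
proof (rule LINT_cong[OF refl])
 fix s assume s: "s : space M"
 have "(LINT w|S. (if vn (prodA (Suc n) (case_nat s w) *v v) <= 1 then sqrt (abs (det (prodA (Suc n) (case_nat s w)))) else 0))
   = (LINT w|S. sqrt (abs (det (A s))) * (if vn (prodA n w *v (A s *v v)) <= 1 then sqrt (abs (det (prodA n w))) else 0))"
 proof (rule LINT_cong[OF refl])
  fix w assume w: "w : space S"
  show "(if vn (prodA (Suc n) (case_nat s w) *v v) <= 1 then sqrt (abs (det (prodA (Suc n) (case_nat s w)))) else 0)
    = sqrt (abs (det (A s))) * (if vn (prodA n w *v (A s *v v)) <= 1 then sqrt (abs (det (prodA n w))) else 0)"
   unfolding prodA_case_nat[OF s w] Mv_assoc[OF prodA_carrier[OF w] A_carrier[OF s] v]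
    det_mult[OF prodA_carrier[OF w] A_carrier[OF s]] by (simp add: abs_mult real_sqrt_mult mult.commute)
 qed
 thus "(LINT w|S. (if vn (prodA (Suc n) (case_nat s w) *v v) <= 1 then sqrt (abs (det (prodA (Suc n) (case_nat s w)))) else 0)) = moved n s v"
  by (simp add: moved_def profile_def)
qed
finally show ?thesis .
qed

lemma A_det: "s : space M ==> det (A s) ~= 0" by (rule A_inverse) auto

lemma moved_nonneg: "0 <= moved n s v" by (simp add: moved_def profile_nonneg)

lemma moved_measurable: "(%(v, s). moved n s v) : Bor (LV q \<Otimes>\<^sub>M M)"
proof -
have entries: "(%p. A (snd p) $$ (i, j)) : Bor (LV q \<Otimes>\<^sub>M M)" if "i < q" "j < q" for i j
 using measurable_compose[OF measurable_snd A_meas[OF that]] .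
have "(%p. A (snd p) *v fst p) : measurable (LV q \<Otimes>\<^sub>M M) (VB q)"
proof (rule measurable_VB)
 fix p assume "p : space (LV q \<Otimes>\<^sub>M M)"
 thus "A (snd p) *v fst p : Vec q" using A_carrier[of "snd p"] by (auto simp: space_pair_measure)
next
 fix i assume i: "i < q"
 have "(%p. SUM j<q. A (snd p) $$ (i, j) * fst p $ j) : Bor (LV q \<Otimes>\<^sub>M M)"
  using i by (intro borel_measurable_sum borel_measurable_times entries measurable_fst_coord) auto
 moreover have "(A (snd p) *v fst p) $ i = (SUM j<q. A (snd p) $$ (i, j) * fst p $ j)" if "p : space (LV q \<Otimes>\<^sub>M M)" for p
  using that A_carrier[of "snd p"] i by (subst index_mult_vec_sum) (auto simp: space_pair_measure)
 ultimately show "(%p. (A (snd p) *v fst p) $ i) : Bor (LV q \<Otimes>\<^sub>M M)" by (subst measurable_cong) auto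
qed
hence 1: "(%p. profile n (A (snd p) *v fst p)) : Bor (LV q \<Otimes>\<^sub>M M)" by (rule measurable_compose[OF _ profile_measurable])
have "(%p. det (A (snd p))) : Bor (LV q \<Otimes>\<^sub>M M)"
 using entries A_carrier by (intro measurable_det[of _ _ q]) (auto simp: space_pair_measure)
with 1 show ?thesis unfolding moved_def split_beta' by measurable
qed

lemma moved_measurable_vec: "s : space M ==> moved n s : Bor (LV q)"
using measurable_compose[OF measurable_Pair2'[of s M] moved_measurable[of n]] by simp

lemma moved_le:
assumes "s : space M" "v : Vec q"
shows "moved n s v <= cn 1 * cn n"
proof -
obtain w where w: "w : space S" using P.not_empty by blast
have "case_nat s w : space S" by (rule case_nat_space[OF assms(1) w])
hence "sqrt (abs (det (A s))) <= cn 1" using sqrt_det_le[of "case_nat s w" 1] by simp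
moreover have "profile n (A s *v v) <= cn n" using A_carrier[OF assms(1)] assms(2) by (intro profile_le) simp
ultimately show ?thesis unfolding moved_def by (intro mult_mono profile_nonneg) auto
qed

lemma moved_support:
assumes "s : space M" "v : Vec q" "b ^ Suc n < vn v"
shows "moved n s v = 0"
proof -
have "b ^ n < vn (A s *v v)"
proof (rule ccontr)
 assume "\<not> b ^ n < vn (A s *v v)"
 hence "b * vn (A s *v v) <= b * b ^ n" using b_ge_1 by (intro mult_left_mono) auto
 with A_lower[OF assms(1,2)] assms(3) show False by simp
qed
hence "profile n (A s *v v) = 0" using A_carrier[OF assms(1)] assms(2) by (intro profile_support) auto
thus ?thesis by (simp add: moved_def)
qed

lemma integrable_bounded_support:
fixes f :: "real vec => real"
assumes "f : Bor (LV q)" "!!v. v : Vec q ==> abs (f v) <= c"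
 "!!v. v : Vec q ==> r < vn v ==> f v = 0"
shows "integrable (LV q) f" using assms emeasure_vball_finite[of q r]
by (intro integrableI_bounded_set[of "vball q r" _ _ c] AE_I2) (auto simp: vball_iff not_le)

lemma profile_sq_integrable: "integrable (LV q) (%v. (profile n v)^2)"
proof (rule integrable_bounded_support[where c = "(cn n)^2" and r = "b ^ n"])
show "(%v. (profile n v)^2) : Bor (LV q)" using profile_measurable[of n] by (auto simp: measurable_LV_cong)
qed (use profile_le profile_nonneg profile_support in \<open>auto intro: power_mono\<close>)

lemma moved_sq_integrable: "s : space M ==> integrable (LV q) (%v. (moved n s v)^2)"
proof (rule integrable_bounded_support[where c = "(cn 1 * cn n)^2" and r = "b ^ Suc n"])
assume s: "s : space M"
show "(%v. (moved n s v)^2) : Bor (LV q)" using moved_measurable_vec[OF s, of n] by measurable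
show "abs ((moved n s v)^2) <= (cn 1 * cn n)^2" if "v : Vec q" for v using power_mono[OF moved_le[OF s that] moved_nonneg, of n 2] by simp
qed (auto simp: moved_support)

lemma diff_sq_integrable: "s : space M ==> integrable (LV q) (%v. (moved n s v - profile (Suc n) v)^2)"
proof (rule L1_bound[of _ "%v. 2 * (moved n s v)^2 + 2 * (profile (Suc n) v)^2"])
assume s: "s : space M"
show "integrable (LV q) (%v. 2 * (moved n s v)^2 + 2 * (profile (Suc n) v)^2)"
 using moved_sq_integrable[OF s, of n] profile_sq_integrable[of "Suc n"] by simp
show "(%v. (moved n s v - profile (Suc n) v)^2) : Bor (LV q)"
 using moved_measurable_vec[OF s, of n] profile_measurable[of "Suc n"] by (auto simp: measurable_LV_cong)
have "(x - y)^2 <= 2 * x^2 + 2 * y^2" for x y :: real using zero_le_power2[of "x + y"] by (simp add: power2_sum power2_diff)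
thus "AE v in LV q. norm ((moved n s v - profile (Suc n) v)^2) <= norm (2 * (moved n s v)^2 + 2 * (profile (Suc n) v)^2)" by (intro AE_I2) simp
qed

lemma integral_moved_sq: "s : space M ==> (LINT v|(LV q). (moved n s v)^2) = mass n"
proof -
assume s: "s : space M"
have "(LINT v|(LV q). (moved n s v)^2) = (LINT v|(LV q). abs (det (A s)) * (profile n (A s *v v))^2)" by (simp add: moved_def power_mult_distrib)
also have "... = mass n" unfolding mass_def using profile_measurable[of n] by (intro integral_linear_image A_carrier[OF s] A_det[OF s]) auto
finally show ?thesis .
qed

definition defect :: "nat => 'a => real" where
"defect n s = (LINT v|(LV q). (moved n s v - profile (Suc n) v)^2)"

text \<open>
  The variance of the images of \<open>profile n\<close> under the random matrix is the drop of the squared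
  norm.  As the squared norms decay subexponentially, the drops are small on average.
\<close>

lemma integral_defect: "integrable M (defect n)" "(LINT s|M. defect n s) = mass n - mass (Suc n)"
proof -
interpret LVs: sigma_finite_measure "LV q" by (rule sigma_finite_LV)
interpret PV: pair_sigma_finite "LV q" M by unfold_locales
define R where "R = b ^ Suc n"
define c where "c = cn 1 * cn n"
have fin: "emeasure (LV q \<Otimes>\<^sub>M M) (vball q R \<times> space M) < \<infinity>"
 using emeasure_vball_finite[of q R] by (subst M.emeasure_pair_measure_Times) (auto simp: M.emeasure_space_1)
have int: "integrable (LV q \<Otimes>\<^sub>M M) F"
 if "F : Bor (LV q \<Otimes>\<^sub>M M)" "!!v s. v : Vec q ==> s : space M ==> abs (F (v, s)) <= C"
  "!!v s. v : Vec q ==> s : space M ==> R < vn v ==> F (v, s) = 0" for F and C :: real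
 using that fin by (intro integrableI_bounded_set[of "vball q R \<times> space M" _ _ C] AE_I2)
  (auto simp: space_pair_measure vball_iff simp flip: not_less)
have dS: "(%p. profile (Suc n) (fst p)) : Bor (LV q \<Otimes>\<^sub>M M)"
 using profile_measurable[of "Suc n"] by (intro measurable_compose[OF measurable_fst]) (simp add: measurable_LV_cong)
have mv: "(%p. moved n (snd p) (fst p)) : Bor (LV q \<Otimes>\<^sub>M M)" using moved_measurable[of n] by (simp add: split_beta')
have bm: "moved n s v <= c" if "v : Vec q" "s : space M" for v s unfolding c_def by (rule moved_le[OF that(2,1)])
have bd: "profile (Suc n) v <= cn (Suc n)" if "v : Vec q" for v by (rule profile_le[OF that])
have i2: "integrable (LV q \<Otimes>\<^sub>M M) (%p. profile (Suc n) (fst p) * moved n (snd p) (fst p))"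
proof (rule int[of _ "cn (Suc n) * c"])
 show "abs (profile (Suc n) (fst (v, s)) * moved n (snd (v, s)) (fst (v, s))) <= cn (Suc n) * c"
  if "v : Vec q" "s : space M" for v s using bm[OF that] bd[OF that(1)] by (simp add: abs_mult profile_nonneg moved_nonneg mult_mono)
qed (use dS mv profile_support in \<open>auto simp: R_def\<close>)
have i3: "integrable (LV q \<Otimes>\<^sub>M M) (%p. (moved n (snd p) (fst p) - profile (Suc n) (fst p))^2)"
proof (rule int[of _ "(c + cn (Suc n))^2"])
 show "abs ((moved n (snd (v, s)) (fst (v, s)) - profile (Suc n) (fst (v, s)))^2) <= (c + cn (Suc n))^2"
  if "v : Vec q" "s : space M" for v s
 proof -
  have "abs (moved n s v - profile (Suc n) v) <= abs (c + cn (Suc n))"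
   using bm[OF that] bd[OF that(1)] profile_nonneg[of "Suc n" v] moved_nonneg[of n s v] by linarith
  thus ?thesis by (simp add: abs_le_square_iff)
 qed
qed (use dS mv profile_support moved_support in \<open>auto simp: R_def\<close>)
have defect: "defect n s = mass n - 2 * (LINT v|(LV q). profile (Suc n) v * moved n s v) + mass (Suc n)"
 if s: "s : space M" for s
proof -
 have ip: "integrable (LV q) (%v. profile (Suc n) v * moved n s v)"
 proof (rule integrable_bounded_support[where c = "cn (Suc n) * c" and r = R])
  show "(%v. profile (Suc n) v * moved n s v) : Bor (LV q)"
   using moved_measurable_vec[OF s, of n] profile_measurable[of "Suc n"] by (auto simp: measurable_LV_cong)
  show "abs (profile (Suc n) v * moved n s v) <= cn (Suc n) * c" if "v : Vec q" for v
   using bm[OF that s] bd[OF that] by (simp add: abs_mult profile_nonneg moved_nonneg mult_mono)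
 qed (auto simp: profile_support R_def)
 have "defect n s = (LINT v|(LV q). (moved n s v)^2 - 2 * (profile (Suc n) v * moved n s v) + (profile (Suc n) v)^2)"
  unfolding defect_def by (intro LINT_cong) (auto simp: power2_diff algebra_simps)
 also have "... = mass n - 2 * (LINT v|(LV q). profile (Suc n) v * moved n s v) + mass (Suc n)"
  using ip moved_sq_integrable[OF s, of n] profile_sq_integrable[of "Suc n"] integral_moved_sq[OF s, of n] by (simp add: mass_def)
 finally show ?thesis .
qed
show idef: "integrable M (defect n)"
 using PV.integrable_snd[of "%v s. (moved n s v - profile (Suc n) v)^2"] i3 by (simp add: defect_def[abs_def] split_beta')
have int_cross: "integrable M (%s. LINT v|(LV q). profile (Suc n) v * moved n s v)"
 using PV.integrable_snd[of "%v s. profile (Suc n) v * moved n s v"] i2 by (simp add: split_beta')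
have "(LINT s|M. LINT v|(LV q). profile (Suc n) v * moved n s v) = (LINT v|(LV q). LINT s|M. profile (Suc n) v * moved n s v)"
 using i2 by (intro PV.Fubini_integral) (simp add: split_beta')
also have "... = (LINT v|(LV q). (profile (Suc n) v)^2)" by (intro LINT_cong) (auto simp: profile_Suc power2_eq_square)
finally have cross: "(LINT s|M. LINT v|(LV q). profile (Suc n) v * moved n s v) = mass (Suc n)" by (simp add: mass_def)
have "(LINT s|M. defect n s) = (LINT s|M. mass n - 2 * (LINT v|(LV q). profile (Suc n) v * moved n s v) + mass (Suc n))"
 by (intro LINT_cong) (auto simp: defect)
also have "... = mass n - mass (Suc n)" using int_cross by (simp add: cross M.prob_space)
finally show "(LINT s|M. defect n s) = mass n - mass (Suc n)" .
qed

lemma defect_nonneg: "0 <= defect n s" unfolding defect_def by (intro integral_nonneg_AE) auto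

lemma mass_decreasing: "mass (Suc n) <= mass n" using integral_defect(2)[of n] integral_nonneg_AE[of "defect n" M] defect_nonneg by simp

lemma mass_antimono: "m <= n ==> mass n <= mass m" by (rule lift_Suc_antimono_le[where f = mass]) (rule mass_decreasing)

text \<open>
  With probability at least one half the product maps a ball of radius \<open>e\<^sup>-\<^sup>n\<^sup>e\<close> into the unit ball and
  has a determinant of at least that size.
\<close>

lemma mass_lower_bound:
assumes ng: no_growth and e: "0 < e"
shows "eventually (%n. 1 / 4 * exp (- (real n * e)) * (exp (- (real n * e)) / real q) ^ q <= mass n) sequentially"
proof -
define good where "good n w <-> mn (prodA n w) <= exp (real n * e) & exp (- (real n * e)) <= abs (det (prodA n w))" for n w
define G where "G n = {w : space S. ALL k>=n. good k w}" for n
have good_set [measurable]: "{w : space S. good n w} : sets S" for n unfolding good_def by measurable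
have G [measurable]: "G n : sets S" for n
proof -
 have "G n = space S Int (\<Inter>k\<in>{n..}. {w : space S. good k w})" by (auto simp: G_def)
 thus ?thesis by simp
qed
have "AE w in S. EX n. ALL k>=n. good k w" using ng e by (simp add: no_growth_def good_def eventually_sequentially)
hence "AE w in S. w : (\<Union>n. G n)" using AE_space by eventually_elim (auto simp: G_def)
hence "measure S (\<Union>n. G n) = 1" by (subst P.prob_eq_1) auto
moreover have "(%n. measure S (G n)) ---> measure S (\<Union>n. G n)" by (rule P.finite_Lim_measure_incseq) (auto simp: incseq_def G_def)
ultimately have "eventually (%n. 1 / 2 < measure S (G n)) sequentially" by (intro order_tendstoD) auto
thus ?thesis
proof eventually_elim
 case (elim n)
 define r where "r = exp (- (real n * e))"
 have r: "0 < r" by (simp add: r_def)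
 have half: "1 / 2 * sqrt r <= profile n v" if v: "v : vball q r" for v
 proof -
  have vc: "v : Vec q" and vr: "vn v <= r" using v by (auto simp: vball_def)
  have "1 / 2 * sqrt r <= measure S (G n) * sqrt r" using elim r by (intro mult_right_mono) auto
  also have "... = (LINT w|S. indicator (G n) w * sqrt r)" by simp
  also have "... <= profile n v" unfolding profile_def
  proof (rule integral_mono[OF _ profile_integrable[OF vc]])
   show "integrable S (%w. indicator (G n) w * sqrt r)"
    by (intro integrable_mult_left integrable_real_indicator) (auto simp: P.emeasure_finite less_top[symmetric])
   fix w assume w: "w : space S"
   show "indicator (G n) w * sqrt r <= (if vn (prodA n w *v v) <= 1 then sqrt (abs (det (prodA n w))) else 0)"
   proof (cases "w : G n")
    case True
    hence g: "mn (prodA n w) <= exp (real n * e)" "r <= abs (det (prodA n w))" by (auto simp: G_def good_def r_def)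
    have "vn (prodA n w *v v) <= mn (prodA n w) * vn v" by (rule vn_mult[OF prodA_carrier[OF w] vc])
    also have "... <= exp (real n * e) * r" using g vr by (intro mult_mono) auto
    also have "... = 1" by (simp add: r_def exp_minus)
    finally show ?thesis using True g by simp
   qed simp
  qed
  finally show ?thesis .
 qed
 have vol: "(r / real q) ^ q <= measure (LV q) (vball q r)"
 proof -
  have "ennreal ((r / real q) ^ q) <= ennreal (measure (LV q) (vball q r))"
   using emeasure_vball_ge[of r q] r q_pos emeasure_vball_finite[of q r] by (simp add: emeasure_eq_ennreal_measure less_top)
  thus ?thesis by (simp add: ennreal_le_iff)
 qed
 have "1 / 4 * r * (r / real q) ^ q <= 1 / 4 * r * measure (LV q) (vball q r)" using vol r by (intro mult_left_mono) auto
 also have "... = (LINT v|(LV q). indicator (vball q r) v * (1 / 2 * sqrt r)^2)"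
  using r sets.sets_into_space[OF vball_sets[of q r]] by (simp add: power_mult_distrib power2_eq_square Int_absorb2)
 also have "... <= mass n" unfolding mass_def
 proof (rule integral_mono[OF _ profile_sq_integrable])
  show "integrable (LV q) (%v. indicator (vball q r) v * (1 / 2 * sqrt r)^2)"
   using emeasure_vball_finite[of q r] by (intro integrable_mult_left integrable_real_indicator) auto
  show "indicator (vball q r) v * (1 / 2 * sqrt r)^2 <= (profile n v)^2" for v
  proof (cases "v : vball q r")
   case True
   thus ?thesis using power_mono[OF half[OF True], of 2] r by simp
  qed simp
 qed
 finally show ?case by (simp add: r_def)
qed
qed

lemma mass_pos: "no_growth ==> 0 < mass n"
proof -
assume ng: no_growth
have "eventually (%k. 1 / 4 * exp (- (real k * 1)) * (exp (- (real k * 1)) / real q) ^ q <= mass k) sequentially"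
 by (rule mass_lower_bound[OF ng]) simp
then obtain k0 where k0: "!!k. k >= k0 ==> 1 / 4 * exp (- (real k * 1)) * (exp (- (real k * 1)) / real q) ^ q <= mass k"
 by (auto simp: eventually_sequentially)
have "0 < 1 / 4 * exp (- (real (max k0 n) * 1)) * (exp (- (real (max k0 n) * 1)) / real q) ^ q" using q_pos by simp
also have "... <= mass (max k0 n)" by (rule k0) simp
also have "... <= mass n" by (rule mass_antimono) simp
finally show ?thesis .
qed

lemma average_drop_tendsto_0:
assumes ng: no_growth
shows "(%N. (SUM n<N. 1 - mass (Suc n) / mass n) / real N) ---> 0"
proof -
define t where "t N = (SUM n<N. 1 - mass (Suc n) / mass n) / real N" for N
have pos: "0 < mass n" for n by (rule mass_pos[OF ng])
have t0: "0 <= t N" for N unfolding t_def using pos mass_decreasing by (intro divide_nonneg_nonneg sum_nonneg) auto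
have tl: "t N <= (ln (mass 0) - ln (mass N)) / real N" for N unfolding t_def by (intro divide_right_mono sum_telescope_le_ln pos) simp
show ?thesis unfolding t_def[symmetric]
proof (rule tendstoI)
 fix e :: real assume e: "0 < e"
 define e' where "e' = e / (2 * (1 + real q))"
 have e': "0 < e'" using e by (simp add: e'_def)
 define K where "K = ln (mass 0) + ln 4 + real q * ln (real q)"
 have "eventually (%N. K / real N < e / 2) sequentially" using e by (intro order_tendstoD(2)[OF lim_const_over_n]) simp
 with mass_lower_bound[OF ng e'] eventually_gt_at_top[of 0]
 show "eventually (%N. dist (t N) 0 < e) sequentially"
 proof eventually_elim
  case (elim N)
  have lq: "0 < real q" using q_pos by simp
  have "ln (1 / 4 * exp (- (real N * e')) * (exp (- (real N * e')) / real q) ^ q) <= ln (mass N)" using elim lq by (intro ln_mono) auto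
  moreover have "ln (1 / 4 * exp (- (real N * e')) * (exp (- (real N * e')) / real q) ^ q)
    = - ln 4 - real N * e' + real q * (- (real N * e') - ln (real q))" using lq by (simp add: ln_mult_pos ln_realpow ln_div)
  ultimately have "- ln (mass N) <= ln 4 + real q * ln (real q) + real N * (e' * (1 + real q))" by (simp add: algebra_simps)
  moreover have "e' * (1 + real q) = e / 2" using lq by (simp add: e'_def field_simps)
  ultimately have "ln (mass 0) - ln (mass N) <= K + real N * (e / 2)" by (simp add: K_def)
  hence "(ln (mass 0) - ln (mass N)) / real N <= (K + real N * (e / 2)) / real N" by (intro divide_right_mono) auto
  also have "... = K / real N + e / 2" using elim by (simp add: add_divide_distrib)
  finally have "t N < e" using tl[of N] elim by linarith
  thus ?case using t0[of N] by (simp add: dist_real_def)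
 qed
qed
qed

definition share :: "nat => real vec set => real" where
"share n X = (LINT v|(LV q). indicator X v * (profile n v)^2) / mass n"

lemma indicator_sq_integrable:
"X : sets (VB q) ==> integrable (LV q) (%v. indicator X v * (profile n v)^2)"
proof (rule L1_bound[OF profile_sq_integrable])
assume X: "X : sets (VB q)"
thus "(%v. indicator X v * (profile n v)^2) : Bor (LV q)" using profile_measurable[of n] by (auto simp: measurable_LV_cong)
qed (auto simp: indicator_def)

lemma share_bounds:
assumes "no_growth" "X : sets (VB q)"
shows "0 <= share n X" "share n X <= 1"
proof -
have "(LINT v|(LV q). indicator X v * (profile n v)^2) <= mass n"
 unfolding mass_def by (intro integral_mono indicator_sq_integrable assms profile_sq_integrable) (auto simp: indicator_def)
thus "share n X <= 1" using mass_pos[OF assms(1), of n] by (simp add: share_def)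
show "0 <= share n X" unfolding share_def using mass_pos[OF assms(1), of n] by (intro divide_nonneg_pos integral_nonneg_AE) auto
qed

lemma share_union:
assumes "X : sets (VB q)" "Y : sets (VB q)" "X Int Y = {}"
shows "share n (X Un Y) = share n X + share n Y"
proof -
have "(LINT v|(LV q). indicator (X Un Y) v * (profile n v)^2)
  = (LINT v|(LV q). indicator X v * (profile n v)^2 + indicator Y v * (profile n v)^2)" using assms(3) by (intro LINT_cong) (auto simp: indicator_def)
thus ?thesis using assms by (simp add: share_def indicator_sq_integrable add_divide_distrib)
qed

lemma share_nonzero: "no_growth ==> share n (Vec q - {0v q}) = 1"
proof -
assume ng: no_growth
have zs: "{0v q} : sets (LV q)"
proof -
 have "{0v q} = vball q 0" using vn_eq_0 vn_nonneg by (force simp: vball_def intro: antisym)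
 thus ?thesis by simp
qed
have "AE v in LV q. v ~: {0v q}" using emeasure_LV_zero[OF q_pos] zs by (intro AE_not_in) (auto simp: null_sets_def)
hence "(LINT v|(LV q). indicator (Vec q - {0v q}) v * (profile n v)^2) = mass n" unfolding mass_def
proof (intro integral_cong_AE)
 show "(%v. indicator (Vec q - {0v q}) v * (profile n v)^2) : Bor (LV q)"
  using zs sets.top[of "VB q"] by (intro borel_measurable_integrable indicator_sq_integrable) (auto intro: sets.Diff)
 show "(%v. (profile n v)^2) : Bor (LV q)" by (intro borel_measurable_integrable profile_sq_integrable)
 show "AE v in LV q. indicator (Vec q - {0v q}) v * (profile n v)^2 = (profile n v)^2"
  if "AE v in LV q. v ~: {0v q}" using that AE_space by eventually_elim (auto simp: indicator_def)
qed
thus ?thesis using mass_pos[OF ng, of n] by (simp add: share_def)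
qed

text \<open>
  The difference of two squares is estimated by the geometric-arithmetic mean inequality with a
  free weight, which keeps square roots out of the integrals.
\<close>

lemma share_step:
assumes ng: no_growth and s: "s : space M" and X: "X : sets (VB q)" and k: "0 < c"
shows "abs (share n ((*\<^sub>v) (A s) ` X) - share (Suc n) X)
 <= c / 2 * (defect n s / mass n) + 2 / c + (1 - mass (Suc n) / mass n)"
proof -
note AX = linear_image_sets[OF A_carrier[OF s] A_det[OF s] X]
have m: "0 < mass n" by (rule mass_pos[OF ng])
let ?I = "%v. indicator X v :: real"
have mi: "integrable (LV q) (%v. ?I v * (moved n s v)^2)"
proof (rule L1_bound[OF moved_sq_integrable[OF s]])
 show "(%v. ?I v * (moved n s v)^2) : Bor (LV q)" using moved_measurable_vec[OF s, of n] X by (auto simp: measurable_LV_cong)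
qed (auto simp: indicator_def)
have "(LINT v|(LV q). indicator ((*\<^sub>v) (A s) ` X) v * (profile n v)^2)
  = (LINT v|(LV q). abs (det (A s)) * (indicator ((*\<^sub>v) (A s) ` X) (A s *v v) * (profile n (A s *v v))^2))" using profile_measurable[of n] AX(1)
 by (intro integral_linear_image[symmetric] A_carrier[OF s] A_det[OF s]) auto
also have "... = (LINT v|(LV q). ?I v * (moved n s v)^2)" using AX(2) by (intro LINT_cong) (auto simp: moved_def power_mult_distrib indicator_def)
finally have 1: "share n ((*\<^sub>v) (A s) ` X) = (LINT v|(LV q). ?I v * (moved n s v)^2) / mass n" by (simp add: share_def)
have pt: "abs (?I v * (moved n s v)^2 - ?I v * (profile (Suc n) v)^2)
  <= c / 2 * (moved n s v - profile (Suc n) v)^2 + ((moved n s v)^2 + (profile (Suc n) v)^2) / c" for v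
proof -
 define x where "x = moved n s v"
 define y where "y = profile (Suc n) v"
 have xy: "0 <= x" "0 <= y" by (auto simp: x_def y_def moved_nonneg profile_nonneg)
 have "0 <= (sqrt c * abs (x - y) - (x + y) / sqrt c)^2" by simp
 also have "... = c * (x - y)^2 + (x + y)^2 / c - 2 * (abs (x - y) * (x + y))" using k by (simp add: power2_diff power_mult_distrib power_divide)
 finally have 1: "abs (x - y) * (x + y) <= c / 2 * (x - y)^2 + (x + y)^2 / (2 * c)" by simp
 have "(x + y)^2 / (2 * c) <= (2 * (x^2 + y^2)) / (2 * c)"
  using k zero_le_power2[of "x - y"] by (intro divide_right_mono) (auto simp: power2_sum power2_diff)
 also have "(2 * (x^2 + y^2)) / (2 * c) = (x^2 + y^2) / c" by (rule mult_divide_mult_cancel_left) simp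
 finally have "abs (x - y) * (x + y) <= c / 2 * (x - y)^2 + (x^2 + y^2) / c" using 1 by linarith
 moreover have "abs (x^2 - y\<^sup>2) = abs (x - y) * (x + y)"
  using xy by (simp add: power2_eq_square square_diff_square_factored abs_mult mult.commute)
 moreover have "abs (?I v * x^2 - ?I v * y^2) <= abs (x^2 - y\<^sup>2)" by (simp add: indicator_def)
 ultimately show ?thesis by (simp add: x_def y_def)
qed
have di: "integrable (LV q) (%v. ?I v * (profile (Suc n) v)^2)" by (rule indicator_sq_integrable[OF X])
have "abs ((LINT v|(LV q). ?I v * (moved n s v)^2) - (LINT v|(LV q). ?I v * (profile (Suc n) v)^2))
  = abs (LINT v|(LV q). ?I v * (moved n s v)^2 - ?I v * (profile (Suc n) v)^2)" using mi di by simp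
also have "... <= (LINT v|(LV q). abs (?I v * (moved n s v)^2 - ?I v * (profile (Suc n) v)^2))"
 using integral_norm_bound[of "LV q" "%v. ?I v * (moved n s v)^2 - ?I v * (profile (Suc n) v)^2"] by simp
also have "... <= (LINT v|(LV q). c / 2 * (moved n s v - profile (Suc n) v)^2 + ((moved n s v)^2 + (profile (Suc n) v)^2) / c)"
 using mi di moved_sq_integrable[OF s, of n] profile_sq_integrable[of "Suc n"] diff_sq_integrable[OF s, of n]
 by (intro integral_mono integrable_abs L1_diff L1_add integrable_mult_right integrable_divide pt)
also have "... = c / 2 * defect n s + (mass n + mass (Suc n)) / c"
 using moved_sq_integrable[OF s, of n] profile_sq_integrable[of "Suc n"] diff_sq_integrable[OF s, of n] integral_moved_sq[OF s, of n]
 by (simp add: defect_def mass_def)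
also have "... <= c / 2 * defect n s + (2 * mass n) / c" using mass_decreasing[of n] k by (intro add_left_mono divide_right_mono) auto
finally have "abs ((LINT v|(LV q). ?I v * (moved n s v)^2) - (LINT v|(LV q). ?I v * (profile (Suc n) v)^2)) / mass n
  <= (c / 2 * defect n s + (2 * mass n) / c) / mass n" using m by (intro divide_right_mono) auto
also have "... = c / 2 * (defect n s / mass n) + 2 / c" using m by (simp add: add_divide_distrib)
finally have "abs (share n ((*\<^sub>v) (A s) ` X) - (LINT v|(LV q). ?I v * (profile (Suc n) v)^2) / mass n) <= c / 2 * (defect n s / mass n) + 2 / c"
 using m by (simp add: 1 abs_divide flip: diff_divide_distrib)
moreover have "(LINT v|(LV q). ?I v * (profile (Suc n) v)^2) / mass n = (mass (Suc n) / mass n) * share (Suc n) X"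
 using mass_pos[OF ng, of "Suc n"] by (simp add: share_def)
moreover have "abs ((mass (Suc n) / mass n) * share (Suc n) X - share (Suc n) X) <= 1 - mass (Suc n) / mass n"
proof -
 have "(mass (Suc n) / mass n) * share (Suc n) X - share (Suc n) X = - ((1 - mass (Suc n) / mass n) * share (Suc n) X)" by (simp add: algebra_simps)
 moreover have "0 <= (1 - mass (Suc n) / mass n) * share (Suc n) X"
  using share_bounds[OF ng X, of "Suc n"] mass_decreasing[of n] m by (intro mult_nonneg_nonneg) auto
 ultimately have "abs ((mass (Suc n) / mass n) * share (Suc n) X - share (Suc n) X) = (1 - mass (Suc n) / mass n) * share (Suc n) X" by linarith
 also have "... <= 1 - mass (Suc n) / mass n" using share_bounds[OF ng X, of "Suc n"] mass_decreasing[of n] m by (intro mult_left_le) auto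
 finally show ?thesis .
qed
ultimately show ?thesis by linarith
qed

theorem invariant_mean:
assumes ng: no_growth
obtains m :: "real vec set => real" where
 "!!X. X : sets (VB q) ==> 0 <= m X"
 "!!X Y. X : sets (VB q) ==> Y : sets (VB q) ==> X Int Y = {} ==> m (X Un Y) = m X + m Y"
 "m (Vec q - {0v q}) = 1"
 "AE s in M. ALL X:sets (VB q). m ((*\<^sub>v) (A s) ` X) = m X"
proof -
define t where "t N = (SUM n<N. 1 - mass (Suc n) / mass n) / real N" for N
have t0: "0 <= t N" for N unfolding t_def using mass_pos[OF ng] mass_decreasing by (intro divide_nonneg_nonneg sum_nonneg) auto
define c where "c N = t N + 1 / real N" for N
have clim: "c ---> 0" unfolding c_def t_def using tendsto_add[OF average_drop_tendsto_0[OF ng] lim_const_over_n[of 1]] by simp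
define g where "g N = 1 / sqrt (c N)" for N
have cpos: "0 < c N" if "1 <= N" for N using t0[of N] that by (simp add: c_def add_nonneg_pos)
define D where "D N s = g N / 2 * ((SUM n<N. defect n s / mass n) / real N) + 2 / g N + t N + 1 / real N" for N s
define avg where "avg N X = (SUM n<N. share n X) / real N" for N X
have Dnonneg: "0 <= D N s" for N s unfolding D_def g_def using t0[of N] mass_pos[OF ng] defect_nonneg
 by (intro add_nonneg_nonneg mult_nonneg_nonneg divide_nonneg_nonneg sum_nonneg) (auto simp: c_def less_imp_le)
have close: "abs (avg N ((*\<^sub>v) (A s) ` X) - avg N X) <= D N s"
 if N: "1 <= N" and s: "s : space M" and X: "X : sets (VB q)" for N s X
proof -
 have k: "0 < g N" using cpos[OF N] by (simp add: g_def)
 have tel: "(SUM n<N. share (Suc n) X) - (SUM n<N. share n X) = share N X - share 0 X"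
  using sum_lessThan_telescope[of "%n. share n X" N] by (simp add: sum_subtractf)
 have "abs ((SUM n<N. share n ((*\<^sub>v) (A s) ` X)) - (SUM n<N. share n X))
  = abs ((SUM n<N. share n ((*\<^sub>v) (A s) ` X) - share (Suc n) X) + (share N X - share 0 X))"
  unfolding tel[symmetric] by (simp add: sum_subtractf)
 also have "... <= (SUM n<N. abs (share n ((*\<^sub>v) (A s) ` X) - share (Suc n) X)) + 1"
  using share_bounds[OF ng X, of N] share_bounds[OF ng X, of 0] by (intro order_trans[OF abs_triangle_ineq] add_mono sum_abs) auto
 also have "... <= (SUM n<N. g N / 2 * (defect n s / mass n) + 2 / g N + (1 - mass (Suc n) / mass n)) + 1"
  by (intro add_right_mono sum_mono share_step[OF ng s X k])
 also have "... = g N / 2 * (SUM n<N. defect n s / mass n) + real N * (2 / g N) + (SUM n<N. 1 - mass (Suc n) / mass n) + 1"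
  by (simp add: sum.distrib sum_distrib_left)
 finally have "abs ((SUM n<N. share n ((*\<^sub>v) (A s) ` X)) - (SUM n<N. share n X)) / real N
  <= (g N / 2 * (SUM n<N. defect n s / mass n) + real N * (2 / g N) + (SUM n<N. 1 - mass (Suc n) / mass n) + 1) / real N"
  by (intro divide_right_mono) auto
 also have "... = D N s" using N by (simp add: D_def t_def add_divide_distrib)
 finally show ?thesis by (simp add: avg_def flip: diff_divide_distrib)
qed
have Dint: "integrable M (D N)" for N unfolding D_def[abs_def] using integral_defect(1)
 by (intro L1_add integrable_mult_right integrable_divide L1_sum M.integrable_const) auto
have ED: "(LINT s|M. D N s) = g N / 2 * t N + 2 / g N + t N + 1 / real N" for N
proof -
 have i: "integrable M (%s. defect n s / mass n)" for n using integral_defect(1) by simp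
 have d: "(LINT s|M. defect n s) / mass n = 1 - mass (Suc n) / mass n" for n
  using integral_defect(2)[of n] mass_pos[OF ng, of n] by (simp add: diff_divide_distrib)
 have "(LINT s|M. D N s) = g N / 2 * ((SUM n<N. LINT s|M. defect n s / mass n) / real N) + 2 / g N + t N + 1 / real N" unfolding D_def using i
  by (simp add: M.prob_space LINT_sum L1_sum)
 thus ?thesis by (simp add: d t_def)
qed
have ED_le: "(LINT s|M. norm (D N s)) <= sqrt (c N) * (5 / 2) + c N" for N
proof -
 have "g N / 2 * t N <= g N / 2 * c N" by (intro mult_left_mono) (auto simp: c_def g_def t0)
 also have "... = (c N / sqrt (c N)) / 2" by (simp add: g_def)
 also have "c N / sqrt (c N) = sqrt (c N)" by (rule real_div_sqrt) (simp add: c_def t0)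
 finally show ?thesis using Dnonneg[of N] ED[of N] by (simp add: g_def c_def)
qed
have "(%N. LINT s|M. norm (D N s)) ---> 0"
proof (rule tendsto_sandwich[OF _ _ tendsto_const])
 have "(%N. sqrt (c N) * (5 / 2) + c N) ---> sqrt 0 * (5 / 2) + 0" by (intro tendsto_intros clim)
 thus "(%N. sqrt (c N) * (5 / 2) + c N) ---> 0" by simp
qed (use ED_le in auto)
then obtain r where r: "strict_mono r" "AE s in M. (%j. D (r j) s) ---> 0" using tendsto_L1_AE_subseq[of M D, OF Dint] by blast
define h where "h j X = (if X : sets (VB q) then avg (r j) X else 0)" for j X
have avg_bounds: "0 <= avg N X & avg N X <= 1" if X: "X : sets (VB q)" for N X
proof -
 have "(SUM n<N. share n X) <= (SUM n<N. 1)" by (intro sum_mono share_bounds[OF ng X])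
 moreover have "0 <= (SUM n<N. share n X)" by (intro sum_nonneg share_bounds[OF ng X])
 ultimately show ?thesis by (auto simp: avg_def divide_le_eq_1)
qed
obtain m F where mF: "F ~= bot" "F <= filtermap h sequentially" "!!X. ((%f. f X) \<longlongrightarrow> m X) F"
 by (rule cluster_point_of_set_functions[of h]) (use avg_bounds in \<open>auto simp: h_def\<close>)
have evF: "eventually Q F" if "eventually (%j. Q (h j)) sequentially" for Q using that mF(2) by (simp add: le_filter_def eventually_filtermap)
show thesis
proof (rule that[of m])
 show "0 <= m X" if "X : sets (VB q)" for X using avg_bounds[OF that] that by (intro tendsto_lowerbound[OF mF(3) _ mF(1)] evF) (auto simp: h_def)
 show "m (X Un Y) = m X + m Y" if XY: "X : sets (VB q)" "Y : sets (VB q)" "X Int Y = {}" for X Y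
 proof -
  have "h j (X Un Y) = h j X + h j Y" for j using XY by (simp add: h_def avg_def share_union sum.distrib add_divide_distrib)
  hence "eventually (%f. f (X Un Y) = f X + f Y) F" by (intro evF) simp
  hence "((%f. f X + f Y) \<longlongrightarrow> m (X Un Y)) F" using mF(3)[of "X Un Y"] by (rule tendsto_cong[THEN iffD1])
  moreover have "((%f. f X + f Y) \<longlongrightarrow> m X + m Y) F" by (intro tendsto_add mF)
  ultimately show ?thesis by (rule tendsto_unique[OF mF(1)])
 qed
 have r_large: "eventually (%j. 1 <= r j) sequentially"
  using eventually_ge_at_top[of 1] by eventually_elim (use strict_mono_imp_increasing[OF r(1)] order_trans in blast)
 show "m (Vec q - {0v q}) = 1"
 proof -
  have zs: "Vec q - {0v q} : sets (VB q)"
  proof -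
   have "{0v q} = vball q 0" using vn_eq_0 vn_nonneg by (force simp: vball_def intro: antisym)
   thus ?thesis using sets.top[of "VB q"] by (auto intro: sets.Diff)
  qed
  have "eventually (%f. f (Vec q - {0v q}) = 1) F" using r_large by (intro evF, eventually_elim) (simp add: h_def zs avg_def share_nonzero[OF ng])
  hence "((%f. 1) \<longlongrightarrow> m (Vec q - {0v q})) F" using mF(3) by (rule tendsto_cong[THEN iffD1])
  thus ?thesis using tendsto_unique[OF mF(1) _ tendsto_const] by blast
 qed
 show "AE s in M. ALL X:sets (VB q). m ((*\<^sub>v) (A s) ` X) = m X" using r(2) AE_space
 proof eventually_elim
  case (elim s)
  show ?case
  proof
   fix X assume X: "X : sets (VB q)"
   note AX = linear_image_sets(1)[OF A_carrier[OF elim(2)] A_det[OF elim(2)] X]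
   have "abs (m ((*\<^sub>v) (A s) ` X) - m X) <= e" if e: "0 < e" for e
   proof (rule tendsto_upperbound[OF _ _ mF(1)])
    show "((%f. abs (f ((*\<^sub>v) (A s) ` X) - f X)) \<longlongrightarrow> (abs (m ((*\<^sub>v) (A s) ` X) - m X))) F" by (intro tendsto_intros mF)
    have "eventually (%j. D (r j) s < e) sequentially" using elim(1) e by (rule order_tendstoD)
    hence "eventually (%j. abs (h j ((*\<^sub>v) (A s) ` X) - h j X) <= e) sequentially" using r_large
    proof eventually_elim
     case (elim j)
     thus ?case using close[OF elim(2) \<open>s : space M\<close> X] X AX by (simp add: h_def)
    qed
    thus "eventually (%f. abs (f ((*\<^sub>v) (A s) ` X) - f X) <= e) F" by (rule evF)
   qed
   hence "abs (m ((*\<^sub>v) (A s) ` X) - m X) <= 0" by (meson dense not_le)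
   thus "m ((*\<^sub>v) (A s) ` X) = m X" by simp
  qed
 qed
qed
qed

end

section \<open>Subspaces charged by an invariant mean\<close>

locale vector_mean =
fixes q :: nat and m :: "real vec set => real"
assumes dim_pos: "1 <= q"
 and m_nonneg: "!!X. X : sets (VB q) ==> 0 <= m X"
 and m_union: "!!X Y. X : sets (VB q) ==> Y : sets (VB q) ==> X Int Y = {} ==> m (X Un Y) = m X + m Y"
 and m_total: "m (Vec q - {0v q}) = 1"
begin

definition stab :: "real mat set" where
"stab = {g : Mat q q. det g ~= 0 & (ALL X:sets (VB q). m ((*\<^sub>v) g ` X) = m X)}"

text \<open>
  A conical neighbourhood of the kernel of \<open>S\<close>, and the mean that is left in all such neighbourhoods.
  By \<open>kernel_comparison\<close> the latter depends only on the kernel.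
\<close>

definition cone :: "real mat => real => real vec set" where
"cone S e = {x : Vec q. x ~= 0v q & vn (S *v x) <= e * vn x}"

definition content :: "real mat => real" where
"content S = (INF e\<in>{0<..}. m (cone S e))"

lemma m_empty: "m {} = 0" using m_union[of "{}" "{}"] by simp

lemma m_mono: "X : sets (VB q) ==> Y : sets (VB q) ==> X <= Y ==> m X <= m Y"
proof -
assume XY: "X : sets (VB q)" "Y : sets (VB q)" "X <= Y"
have "m Y = m X + m (Y - X)" using m_union[of X "Y - X"] XY by (simp add: Un_absorb1 Un_Diff_cancel sets.Diff)
thus ?thesis using m_nonneg[of "Y - X"] XY by (simp add: sets.Diff)
qed

lemma m_union_inter:
assumes "X : sets (VB q)" "Y : sets (VB q)"
shows "m (X Un Y) = m X + m Y - m (X Int Y)"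
proof -
have "m (X Un (Y - X)) = m X + m (Y - X)" using assms by (intro m_union) (auto intro: sets.Diff)
moreover have "m ((Y - X) Un (X Int Y)) = m (Y - X) + m (X Int Y)" using assms by (intro m_union) (auto intro: sets.Diff)
moreover have "(Y - X) Un (X Int Y) = Y" "X Un (Y - X) = X Un Y" by auto
ultimately show ?thesis by simp
qed

lemma m_union_le: "X : sets (VB q) ==> Y : sets (VB q) ==> m (X Un Y) <= m X + m Y" using m_union_inter[of X Y] m_nonneg[of "X Int Y"] by auto

lemma zero_set: "{0v q} : sets (VB q)"
proof -
have "{0v q} = vball q 0" using vn_eq_0 vn_nonneg by (force simp: vball_def intro: antisym)
thus ?thesis by simp
qed

lemma nonzero_set: "Vec q - {0v q} : sets (VB q)" using sets.top[of "VB q"] zero_set by (auto intro: sets.Diff)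

lemma m_le_1: "X : sets (VB q) ==> X <= Vec q - {0v q} ==> m X <= 1" using m_mono[OF _ nonzero_set, of X] m_total by simp

lemma cone_sets: "S : Mat p q ==> cone S e : sets (VB q)"
proof -
assume S: "S : Mat p q"
have [measurable]: "vn : Bor (VB q)" by (rule measurable_vn)
have [measurable]: "(%x. vn (S *v x)) : Bor (VB q)" by (rule measurable_compose[OF measurable_mult_vec[OF S] measurable_vn])
have "{x : space (VB q). vn (S *v x) <= e * vn x} : sets (VB q)" by measurable
moreover have "cone S e = {x : space (VB q). vn (S *v x) <= e * vn x} - {0v q}" by (auto simp: cone_def)
ultimately show ?thesis using zero_set by (auto intro: sets.Diff)
qed

lemma content_bdd: "S : Mat p q ==> bdd_below ((%e. m (cone S e)) ` {0<..})" using m_nonneg[OF cone_sets] by (intro bdd_belowI2[of _ 0]) auto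

lemma content_le: "S : Mat p q ==> 0 < e ==> content S <= m (cone S e)" unfolding content_def by (intro cINF_lower content_bdd) auto

lemma content_greatest: "(!!e. 0 < e ==> c <= m (cone S e)) ==> c <= content S" unfolding content_def by (intro cINF_greatest) auto

lemma content_nonneg: "S : Mat p q ==> 0 <= content S" by (intro content_greatest m_nonneg cone_sets)

lemma content_approx:
assumes "S : Mat p q" "content S < c"
obtains e where "0 < e" "m (cone S e) < c"
proof -
have "EX e:{0<..}. m (cone S e) < c" using assms(2) cINF_less_iff[OF _ content_bdd[OF assms(1)]] by (auto simp: content_def)
thus thesis using that by auto
qed

lemma content_mono:
assumes S: "S : Mat p q" and S': "S' : Mat p' q" and sub: "kern S <= kern S'"
shows "content S <= content S'"
proof (rule content_greatest)
fix e :: real assume e: "0 < e"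
obtain C where C: "C > 0" "!!x. x : Vec q ==> vn (S' *v x) <= C * vn (S *v x)" by (rule kernel_comparison[OF S S' sub]) blast
have "cone S (e / C) <= cone S' e"
proof
 fix x assume x: "x : cone S (e / C)"
 hence "C * vn (S *v x) <= C * (e / C * vn x)" using C(1) by (intro mult_left_mono) (auto simp: cone_def)
 also have "... = e * vn x" using C(1) by simp
 finally show "x : cone S' e" using x C(2)[of x] by (auto simp: cone_def)
qed
hence "m (cone S (e / C)) <= m (cone S' e)" by (intro m_mono cone_sets[OF S] cone_sets[OF S'])
moreover have "content S <= m (cone S (e / C))" using C(1) e by (intro content_le[OF S]) simp
ultimately show "content S <= m (cone S' e)" by linarith
qed

lemma stab_carrier: "g : stab ==> g : Mat q q" and stab_det: "g : stab ==> det g ~= 0"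
and stab_m: "g : stab ==> X : sets (VB q) ==> m ((*\<^sub>v) g ` X) = m X" by (auto simp: stab_def)

lemma stab_one: "Id q : stab"
proof -
have "(*\<^sub>v) (Id q) ` X = X" if "X : sets (VB q)" for X
 using sets.sets_into_space[OF that] by (auto simp: image_def Bex_def) (metis one_mult_mat_vec subsetD)+
thus ?thesis by (simp add: stab_def)
qed

lemma stab_mult: "g : stab ==> h : stab ==> g * h : stab"
proof -
assume g: "g : stab" and h: "h : stab"
note gc = stab_carrier[OF g] and hc = stab_carrier[OF h]
have "m ((*\<^sub>v) (g * h) ` X) = m X" if X: "X : sets (VB q)" for X
proof -
 have Xc: "X <= Vec q" using sets.sets_into_space[OF X] by simp
 have "(*\<^sub>v) (g * h) ` X = (*\<^sub>v) g ` ((*\<^sub>v) h ` X)"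
  unfolding image_image using Xc by (intro image_cong refl Mv_assoc[OF gc hc]) auto
 thus ?thesis using stab_m[OF g linear_image_sets(1)[OF hc stab_det[OF h] X]] stab_m[OF h X] by simp
qed
moreover have "det (g * h) ~= 0" using det_mult[OF gc hc] stab_det[OF g] stab_det[OF h] by simp
ultimately show ?thesis using gc hc by (simp add: stab_def)
qed

lemma stab_inverse:
assumes g: "g : stab"
obtains h where "h : stab" "g * h = Id q" "h * g = Id q"
proof -
obtain h where h: "h : Mat q q" "g * h = Id q" "h * g = Id q" "det h ~= 0" by (rule inverse_mat_exists[OF stab_carrier[OF g] stab_det[OF g]])
have "m ((*\<^sub>v) h ` X) = m X" if X: "X : sets (VB q)" for X
proof -
 have Xc: "X <= Vec q" using sets.sets_into_space[OF X] by simp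
 have "(*\<^sub>v) g ` ((*\<^sub>v) h ` X) = (%x. x) ` X"
  unfolding image_image using Xc Mv_assoc[OF stab_carrier[OF g] h(1)] h(2) by (intro image_cong refl) (metis one_mult_mat_vec subsetD)
 thus ?thesis using stab_m[OF g linear_image_sets(1)[OF h(1,4) X]] by simp
qed
hence "h : stab" using h by (simp add: stab_def)
with that h show thesis by blast
qed

lemma content_stab_le:
assumes S: "S : Mat p q" and g: "g : stab"
shows "content (S * g) <= content S"
proof (rule content_greatest)
fix e :: real assume e: "0 < e"
note gc = stab_carrier[OF g]
obtain C where C: "C > 0" "!!y. y : Vec q ==> vn y <= C * vn (g *v y)"
 by (rule inj_mat_lower_bound[OF gc]) (use inj_mat_square[OF gc] stab_det[OF g] in auto)
have Sg: "S * g : Mat p q" using S gc by simp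
have "(*\<^sub>v) g ` cone (S * g) (e / C) <= cone S e"
proof
 fix y assume "y : (*\<^sub>v) g ` cone (S * g) (e / C)"
 then obtain x where x: "x : Vec q" "x ~= 0v q" "vn ((S * g) *v x) <= e / C * vn x" "y = g *v x" by (auto simp: cone_def)
 have y: "y : Vec q" using x gc by simp
 have "y ~= 0v q" using C(2)[OF x(1)] vn_pos[OF x(1,2)] x(4) by auto
 moreover have "vn (S *v y) <= e * vn y"
 proof -
  have "vn (S *v y) = vn ((S * g) *v x)" using Mv_assoc[OF S gc x(1)] x(4) by simp
  also have "... <= e / C * vn x" by (rule x(3))
  also have "... <= e / C * (C * vn y)" using C e x by (intro mult_left_mono) auto
  finally show ?thesis using C(1) by simp
 qed
 ultimately show "y : cone S e" using y by (simp add: cone_def)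
qed
hence "m ((*\<^sub>v) g ` cone (S * g) (e / C)) <= m (cone S e)"
 by (intro m_mono linear_image_sets(1)[OF gc stab_det[OF g]] cone_sets[OF Sg] cone_sets[OF S])
moreover have "m ((*\<^sub>v) g ` cone (S * g) (e / C)) = m (cone (S * g) (e / C))" by (rule stab_m[OF g cone_sets[OF Sg]])
moreover have "content (S * g) <= m (cone (S * g) (e / C))" using C(1) e by (intro content_le[OF Sg]) simp
ultimately show "content (S * g) <= m (cone S e)" by linarith
qed

lemma content_stab:
assumes S: "S : Mat p q" and g: "g : stab"
shows "content (S * g) = content S"
proof (rule antisym[OF content_stab_le[OF S g]])
obtain h where h: "h : stab" "g * h = Id q" by (rule stab_inverse[OF g])
have "S * g * h = S * (g * h)" by (rule MM_assoc[OF S stab_carrier[OF g] stab_carrier[OF h(1)]])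
hence "S * g * h = S" using h(2) S by simp
thus "content S <= content (S * g)" using content_stab_le[OF mult_carrier_mat[OF S stab_carrier[OF g]] h(1)] by simp
qed

text \<open>Some subspace of dimension \<open>r\<close> keeps a positive mean.\<close>

definition charged :: "nat => bool" where
"charged r <-> (EX S B. S : Mat q q & B : Mat q r & inj_mat B & kern S = rng B & 0 < content S)"

definition r0 :: nat where "r0 = (LEAST r. charged r)"

lemma zero_mat_mult_vec: "x : Vec q ==> 0m p q *v x = (0v p :: real vec)" by (intro eq_vecI) auto

lemma charged_q: "charged q" unfolding charged_def
proof (intro exI conjI)
have c: "cone (0m q q) e = Vec q - {0v q}" if "0 < e" for e using that by (auto simp: cone_def zero_mat_mult_vec)
have "1 <= content (0m q q)" by (rule content_greatest) (simp add: c m_total)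
thus "0 < content (0m q q)" by linarith
show "inj_mat (Id q)" by (rule inj_matI[of _ q q]) auto
show "kern (0m q q) = rng (Id q)" by (auto simp: kern_def rng_def zero_mat_mult_vec image_def)
qed auto

lemma charged_r0: "charged r0" unfolding r0_def by (rule LeastI[of charged, OF charged_q])

lemma small_kernel_content:
assumes S: "S : Mat p q" and B: "B : Mat q r" "inj_mat B" "kern S = rng B" and r: "r < r0"
shows "content S = 0"
proof -
obtain S' where S': "S' : Mat q q" "kern S' = rng B" by (rule annihilator_exists[OF B(1,2)])
have "\<not> charged r" using not_less_Least[of r charged] r by (simp add: r0_def)
hence "\<not> 0 < content S'" using S' B by (auto simp: charged_def)
moreover have "content S <= content S'" using S' B by (intro content_mono[OF S S'(1)]) auto
ultimately show ?thesis using content_nonneg[OF S] by linarith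
qed

lemma r0_pos: "1 <= r0"
proof (rule ccontr)
assume "\<not> 1 <= r0"
hence "r0 = 0" by simp
hence "charged 0" using charged_r0 by metis
then obtain S B where S: "S : Mat q q" "B : Mat q 0" "kern S = rng B" "0 < content S" by (auto simp: charged_def)
have "B *v y = 0v q" if "y : Vec 0" for y using S(2) that by (intro eq_vecI) (auto simp: scalar_prod_def)
hence k: "kern S <= kern (Id q)" using S(2,3) by (auto simp: rng_def kern_def)
obtain C where C: "C > 0" "!!x. x : Vec q ==> vn (Id q *v x) <= C * vn (S *v x)" by (rule kernel_comparison[OF S(1) one_carrier_mat k]) blast
have "cone S (1 / (2 * C)) = {}"
proof (rule ccontr)
 assume "cone S (1 / (2 * C)) ~= {}"
 then obtain x where x: "x : Vec q" "x ~= 0v q" "vn (S *v x) <= 1 / (2 * C) * vn x" by (auto simp: cone_def)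
 have "vn x <= C * (1 / (2 * C) * vn x)" using C(2)[OF x(1)] x(1,3) C(1) by (smt (verit) mult_left_mono one_mult_mat_vec)
 thus False using vn_pos[OF x(1,2)] C(1) by simp
qed
hence "content S <= 0" using content_le[OF S(1), of "1 / (2 * C)"] C(1) m_empty by simp
with S(4) show False by simp
qed

text \<open>
  Furstenberg's lemma.  If the restrictions to a charged subspace of minimal dimension degenerate,
  a normalised limit \<open>L\<close> is singular: it pushes everything off its kernel towards its image.  Both
  have smaller dimension, so they carry no charge, and the subspace cannot carry any either.
\<close>

lemma stabiliser_bound:
assumes S0: "S0 : Mat q q" and B0: "B0 : Mat q r0" "inj_mat B0" and kS0: "kern S0 = rng B0"
 and M0: "0 < content S0"
obtains C where "C > 0" "!!g R. g : stab ==> R : Mat r0 r0 ==> g * B0 = B0 * R ==> mn R ^ r0 <= C * abs (det R)"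
proof (rule ccontr)
assume no_bound: "\<not> thesis"
define r where "r = r0"
note B0 = B0[folded r_def]
have "EX g R. g : stab & R : Mat r r & g * B0 = B0 * R & real (Suc n) * abs (det R) < mn R ^ r" for n
proof (rule ccontr)
 assume "\<not> ?thesis"
 hence "!!g R. g : stab ==> R : Mat r0 r0 ==> g * B0 = B0 * R ==> mn R ^ r0 <= real (Suc n) * abs (det R)" unfolding r_def by (meson not_less)
 thus False using that[of "real (Suc n)"] no_bound by simp
qed
then obtain g R where gR: "!!n. g n : stab" "!!n. R n : Mat r r" "!!n. g n * B0 = B0 * R n"
 "!!n. real (Suc n) * abs (det (R n)) < mn (R n) ^ r" by metis
have r1: "1 <= r" using r0_pos by (simp add: r_def)
have l: "0 < mn (R n)" for n
proof -
 have "0 < mn (R n) ^ r" using gR(4)[of n] by (rule le_less_trans[rotated]) simp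
 thus ?thesis using r1 mn_nonneg[of "R n"] by (cases "mn (R n) = 0") (auto simp: power_0_left less_le)
qed
define R' where "R' n = (1 / mn (R n)) .m R n" for n
have R'c: "R' n : Mat r r" for n using gR(2) by (simp add: R'_def)
have R'1: "mn (R' n) = 1" for n using l[of n] by (simp add: R'_def)
have R'det: "abs (det (R' n)) < 1 / real (Suc n)" for n
proof -
 have "abs (det (R' n)) = abs (det (R n)) / mn (R n) ^ r"
  using gR(2)[of n] l[of n] by (simp add: R'_def det_smult abs_mult power_abs power_one_over field_simps)
 moreover have "real (Suc n) * abs (det (R n)) / mn (R n) ^ r < 1" using gR(4)[of n] l[of n] by (simp add: divide_less_eq)
 ultimately show ?thesis by (simp add: field_simps)
qed
obtain s L where s: "strict_mono s" and L: "L : Mat r r"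
 and lim: "!!i j. i < r ==> j < r ==> (%k. R' (s k) $$ (i, j)) ---> L $$ (i, j)"
 by (rule bounded_matrices_subsequence[of R' r r 1]) (use R'c R'1 in auto)
have F: "(%k. mn (R' (s k) - L)) ---> 0" by (rule tendsto_mn_diff[OF R'c L lim])
have detL: "det L = 0"
proof -
 have "(%k. det (R' (s k))) ---> det L" by (rule tendsto_det[OF R'c L lim])
 moreover have "(%k. det (R' (s k))) ---> 0"
 proof (rule Lim_null_comparison)
  show "eventually (%k. norm (det (R' (s k))) <= 1 / real (Suc k)) sequentially"
  proof (intro always_eventually allI)
   fix k
   have "abs (det (R' (s k))) <= 1 / real (Suc (s k))" using R'det[of "s k"] by simp
   also have "... <= 1 / real (Suc k)" using strict_mono_imp_increasing[OF s, of k] by (intro divide_left_mono) auto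
   finally show "norm (det (R' (s k))) <= 1 / real (Suc k)" by simp
  qed
  show "(%k. 1 / real (Suc k)) ---> 0" using LIMSEQ_inverse_real_of_nat by (simp add: inverse_eq_divide)
 qed
 ultimately show ?thesis by (rule LIMSEQ_unique)
qed
have L0: "L ~= 0m r r"
proof
 assume L0: "L = 0m r r"
 have "mn (R' (s k) - L) = 1" for k
 proof -
  have "R' (s k) - L = R' (s k)" using R'c[of "s k"] L0 by (intro eq_matI) auto
  thus ?thesis using R'1 by simp
 qed
 with F show False by (simp add: LIMSEQ_const_iff)
qed
(* the kernel of L inside the subspace *)
obtain r1' BL where BL: "r1' <= r" "BL : Mat r r1'" "inj_mat BL" "rng BL = kern L" by (rule lsub_basis[OF lsub_kern[OF L]])
have r1'lt: "r1' < r"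
proof (rule ccontr)
 assume "\<not> r1' < r"
 hence "r1' = r" using BL by simp
 hence BLc: "BL : Mat r r" using BL by simp
 have "rng BL = rng (Id r)" by (rule rng_dim_eq[OF BLc BL(3) one_carrier_mat]) (use BLc in \<open>auto simp: rng_def image_def\<close>)
 hence z: "L *v y = 0v r" if "y : Vec r" for y using that BL(4) L by (auto simp: rng_def kern_def image_def)
 have "mn L <= real r * 0" using z by (intro mn_le_sup[OF L]) simp
 hence "mn L = 0" using mn_nonneg[of L] by simp
 with L0 mn_eq_0[OF L] show False by simp
qed
have BB1: "B0 * BL : Mat q r1'" using B0 BL by simp
have BB1i: "inj_mat (B0 * BL)"
proof (rule inj_matI[OF BB1])
 fix y assume y: "y : Vec r1'" "(B0 * BL) *v y = 0v q"
 have "B0 *v (BL *v y) = 0v q" using Mv_assoc[OF B0(1) BL(2) y(1)] y(2) by simp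
 hence "BL *v y = 0v r" using inj_matD[OF B0(2,1)] mult_mat_vec_carrier[OF BL(2) y(1)] by simp
 thus "y = 0v r1'" using inj_matD[OF BL(3,2) y(1)] by simp
qed
obtain S1 where S1: "S1 : Mat q q" "kern S1 = rng (B0 * BL)" by (rule annihilator_exists[OF BB1 BB1i])
have c1: "content S1 = 0" using small_kernel_content[OF S1(1) BB1 BB1i S1(2)] r1'lt by (simp add: r_def)
(* its image *)
have BB2: "B0 * L : Mat q r" using B0 L by simp
have BB2v: "(B0 * L) *v y = B0 *v (L *v y)" if "y : Vec r" for y by (rule Mv_assoc[OF B0(1) L that])
obtain r2 BI where BI: "r2 <= q" "BI : Mat q r2" "inj_mat BI" "rng BI = rng (B0 * L)" by (rule lsub_basis[OF lsub_rng[OF BB2]])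
have sub2: "rng (B0 * L) <= rng B0" using B0 L BB2 BB2v mult_mat_vec_carrier[OF L] by (auto simp: rng_def)
have "r2 <= r" using rng_dim_le[OF BI(2,3) B0(1)] BI(4) sub2 by simp
moreover have "r2 ~= r"
proof
 assume "r2 = r"
 hence "rng BI = rng B0" using rng_dim_eq[of BI q r B0] BI B0 sub2 by simp
 hence "rng B0 <= rng (B0 * L)" using BI(4) by simp
 then obtain D where D: "D : Mat r r" "B0 = (B0 * L) * D" by (rule rng_factor[OF B0(1) BB2])
 obtain LI where LI: "LI : Mat r q" "LI * B0 = Id r" by (rule left_inverse_exists[OF B0])
 have "B0 = B0 * (L * D)" using D(2) MM_assoc[OF B0(1) L D(1)] by simp
 hence "LI * B0 = LI * (B0 * (L * D))" by simp
 also have "... = (LI * B0) * (L * D)" using MM_assoc[OF LI(1) B0(1) mult_carrier_mat[OF L D(1)]] by simp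
 finally have "Id r = L * D" unfolding LI(2) left_mult_one_mat[OF mult_carrier_mat[OF L D(1)]] .
 hence "det L * det D = 1" using det_mult[OF L D(1)] by (metis det_one)
 with detL show False by simp
qed
ultimately have r2: "r2 < r" by simp
obtain S2 where S2: "S2 : Mat q q" "kern S2 = rng BI" by (rule annihilator_exists[OF BI(2,3)])
have c2: "content S2 = 0" using small_kernel_content[OF S2(1) BI(2,3) S2(2)] r2 by (simp add: r_def)
define M where "M = content S0"
have M: "0 < M" using M0 by (simp add: M_def)
obtain e where e: "0 < e" "m (cone S1 e) < M / 3" using content_approx[OF S1(1), of "M / 3"] c1 M by auto
obtain E where E: "0 < E" "m (cone S2 E) < M / 3" using content_approx[OF S2(1), of "M / 3"] c2 M by auto
(* splitting x = B0 y + z along the subspace *)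
obtain L0' where L0': "L0' : Mat r q" "L0' * B0 = Id r" by (rule left_inverse_exists[OF B0])
define Z where "Z = Id q - B0 * L0'"
have Zc: "Z : Mat q q" unfolding Z_def using B0 L0' by (intro minus_carrier_mat mult_carrier_mat)
have Zx: "Z *v x = x - B0 *v (L0' *v x)" if "x : Vec q" for x
 unfolding Z_def minus_mult_distrib_mat_vec[OF one_carrier_mat mult_carrier_mat[OF B0(1) L0'(1)] that]
  Mv_assoc[OF B0(1) L0'(1) that] using that by simp
have "kern S0 <= kern Z"
proof
 fix x assume "x : kern S0"
 then obtain y where y: "y : Vec r" "x = B0 *v y" using B0 by (auto simp: kS0 rng_def)
 have x: "x : Vec q" using y B0 by simp
 have "L0' *v x = y" using y Mv_assoc[OF L0'(1) B0(1) y(1)] L0'(2) by simp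
 hence "Z *v x = 0v q" using Zx[OF x] x y(2) by (auto intro!: eq_vecI)
 thus "x : kern Z" using x Zc by (simp add: kern_def)
qed
then obtain C0 where C0: "C0 > 0" "!!x. x : Vec q ==> vn (Z *v x) <= C0 * vn (S0 *v x)" by (rule kernel_comparison[OF S0 Zc]) blast
have SB: "S1 * B0 : Mat q r" using S1 B0 by simp
have "kern L <= kern (S1 * B0)"
proof
 fix y assume y: "y : kern L"
 hence yc: "y : Vec r" using L by (simp add: kern_def)
 obtain w where w: "w : Vec r1'" "y = BL *v w" using y BL by (auto simp: rng_def simp flip: BL(4))
 have "B0 *v y = (B0 * BL) *v w" using Mv_assoc[OF B0(1) BL(2) w(1)] w(2) by simp
 hence "B0 *v y : kern S1" using w BB1 by (auto simp: S1(2) rng_def)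
 thus "y : kern (S1 * B0)" using yc S1 SB B0 Mv_assoc[OF S1(1) B0(1) yc] by (simp add: kern_def)
qed
then obtain C2 where C2: "C2 > 0" "!!y. y : Vec r ==> vn ((S1 * B0) *v y) <= C2 * vn (L *v y)" by (rule kernel_comparison[OF L SB]) blast
obtain C3 where C3: "C3 > 0" "!!y. y : Vec r ==> vn y <= C3 * vn (B0 *v y)" by (rule inj_mat_lower_bound[OF B0]) blast
define C1 where "C1 = mn L0'"
have C1: "0 <= C1" by (simp add: C1_def)
define f where "f = e / (4 * C2 * C3)"
have f: "0 < f" using e C2 C3 by (simp add: f_def)
define c where "c = mn S2 * mn B0 * C1"
have cn: "0 <= c" using C1 by (simp add: c_def)
have "0 < min (e / (4 * C2)) (E * f / 2) / (C1 + c + 1)" using e C2 E f C1 cn by simp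
with F have "eventually (%k. mn (R' (s k) - L) < min (e / (4 * C2)) (E * f / 2) / (C1 + c + 1)) sequentially" by (rule order_tendstoD)
then obtain k where k: "mn (R' (s k) - L) < min (e / (4 * C2)) (E * f / 2) / (C1 + c + 1)" by (auto simp: eventually_sequentially)
define t where "t = mn (R' (s k) - L)"
have t0: "0 <= t" by (simp add: t_def)
have "t * (C1 + c + 1) <= min (e / (4 * C2)) (E * f / 2)" using k C1 cn by (simp add: t_def pos_less_divide_eq less_imp_le)
moreover have "t * C1 <= t * (C1 + c + 1)" "t * c <= t * (C1 + c + 1)" using t0 C1 cn by (auto intro: mult_left_mono)
ultimately have tC1: "t * C1 <= e / (4 * C2)" and tc: "t * c <= E * f / 2" by auto
define l' where "l' = mn (R (s k))"
have l'0: "0 < l'" using l by (simp add: l'_def)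
define h where "h = (1 / l') .m g (s k)"
note gc = stab_carrier[OF gR(1)[of "s k"]]
have hc: "h : Mat q q" using gc by (simp add: h_def)
define Q where "Q = R' (s k)"
have Qc: "Q : Mat r r" using R'c by (simp add: Q_def)
have hB: "h * B0 = B0 * Q" unfolding h_def Q_def R'_def l'_def
 using mult_smult_assoc_mat[OF gc B0(1)] mult_smult_distrib[OF B0(1) gR(2)] gR(3) by simp
have gx: "g (s k) *v x = l' .v (h *v x)" if "x : Vec q" for x using gc l'0 that by (intro eq_vecI) (auto simp: h_def)
define D where "D = 1 + mn S1 * C0 + mn h * C0 + mn S2 * mn h * C0"
have Dp: "1 <= D" "mn S1 * C0 <= D" "mn h * C0 <= D" "mn S2 * mn h * C0 <= D" using C0(1) by (auto simp: D_def add_increasing add_increasing2)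
define u where "u = min (e / 4) (min f (E * f / 2))"
have u: "0 < u" using e E f by (simp add: u_def)
define p where "p = u / D"
have p: "0 < p" using u Dp by (simp add: p_def)
have pb: "a * p <= u" if "a <= D" for a using mult_right_mono[OF that, of p] p Dp by (simp add: p_def)
define X where "X = cone S0 p - cone S1 e"
have Xs: "X : sets (VB q)" unfolding X_def by (intro sets.Diff cone_sets[OF S0] cone_sets[OF S1(1)])
have "(*\<^sub>v) (g (s k)) ` X <= cone S2 E"
proof
 fix w assume "w : (*\<^sub>v) (g (s k)) ` X"
 then obtain x where xX: "x : X" and w: "w = g (s k) *v x" by auto
 have x: "x : Vec q" "x ~= 0v q" "vn (S0 *v x) <= p * vn x" "e * vn x < vn (S1 *v x)" using xX by (auto simp: X_def cone_def)
 define y where "y = L0' *v x"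
 define z where "z = Z *v x"
 have y: "y : Vec r" using L0' x by (simp add: y_def)
 have z: "z : Vec q" using Zc x by (simp add: z_def)
 have By: "B0 *v y : Vec q" using B0 y by simp
 have xe: "x = B0 *v y + z" using Zx[OF x(1)] x(1) By B0(1) by (auto simp: z_def y_def intro!: eq_vecI)
 define v where "v = vn x"
 have v: "0 < v" using vn_pos[OF x(1,2)] by (simp add: v_def)
 have zb: "vn z <= C0 * p * v" using order_trans[OF C0(2)[OF x(1)] mult_left_mono[OF x(3), of C0]] C0(1) by (simp add: z_def v_def mult.assoc)
 have yb: "vn y <= C1 * v" unfolding y_def C1_def v_def by (rule vn_mult[OF L0'(1) x(1)])
 have b1: "a * vn z <= u * v" if a: "0 <= a" "a * C0 <= D" for a
 proof -
  have "a * vn z <= a * (C0 * p * v)" using zb a by (intro mult_left_mono)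
  also have "... = (a * C0) * p * v" by simp
  also have "... <= u * v" using pb[OF a(2)] v by (intro mult_right_mono) auto
  finally show ?thesis .
 qed
 have S1x: "S1 *v x = (S1 * B0) *v y + S1 *v z" unfolding Mv_assoc[OF S1(1) B0(1) y] by (subst xe, rule Mv_add[OF S1(1) By z])
 have "vn (S1 *v x) <= vn ((S1 * B0) *v y) + vn (S1 *v z)" unfolding S1x using SB y S1 z by (intro vn_add[of _ q]) auto
 also have "vn (S1 *v z) <= mn S1 * vn z" by (rule vn_mult[OF S1(1) z])
 also have "mn S1 * vn z <= u * v" using Dp by (intro b1) auto
 also have "u * v <= e / 4 * v" using v by (intro mult_right_mono) (auto simp: u_def)
 also have "vn ((S1 * B0) *v y) <= C2 * vn (L *v y)" by (rule C2(2)[OF y])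
 finally have "e * v < C2 * vn (L *v y) + e / 4 * v" using x(4) by (simp add: v_def)
 hence Ly: "3 * e / (4 * C2) * v <= vn (L *v y)" using C2(1) by (simp add: field_simps)
 have Ly_c: "L *v y : Vec r" and Qy_c: "Q *v y : Vec r" using L Qc y by auto
 have QLc: "Q - L : Mat r r" using Qc L by (intro minus_carrier_mat)
 have QLy: "(Q - L) *v y = Q *v y - L *v y" by (rule minus_mult_distrib_mat_vec[OF Qc L y])
 have QLb: "vn ((Q - L) *v y) <= t * (C1 * v)" using vn_mult[OF QLc y] mult_left_mono[OF yb, of t] t0 by (simp add: t_def Q_def)
 have "Q *v y = L *v y + (Q - L) *v y" unfolding QLy using Ly_c Qy_c Qc L by (intro eq_vecI) (auto simp del: Mv_index)
 hence "vn (L *v y) - vn ((Q - L) *v y) <= vn (Q *v y)" using vn_ge_diff[OF Ly_c, of "(Q - L) *v y"] mult_mat_vec_carrier[OF QLc y] by simp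
 moreover have "t * (C1 * v) <= e / (4 * C2) * v" using mult_right_mono[OF tC1, of v] v by (simp add: mult.assoc)
 ultimately have Qy: "e / (2 * C2) * v <= vn (Q *v y)" using Ly QLb by (simp add: field_simps)
 have BQ_c: "B0 *v (Q *v y) : Vec q" using B0 Qy_c by simp
 have "e / (2 * C2) * v <= C3 * vn (B0 *v (Q *v y))" using Qy C3(2)[OF Qy_c] by linarith
 hence BQ: "2 * f * v <= vn (B0 *v (Q *v y))" using C3(1) C2(1) by (simp add: f_def field_simps)
 have hz_c: "h *v z : Vec q" using hc z by simp
 have hx: "h *v x = B0 *v (Q *v y) + h *v z"
 proof -
  have "h *v x = h *v (B0 *v y) + h *v z" by (subst xe, rule Mv_add[OF hc By z])
  also have "h *v (B0 *v y) = B0 *v (Q *v y)" using Mv_assoc[OF hc B0(1) y] Mv_assoc[OF B0(1) Qc y] hB by simp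
  finally show ?thesis .
 qed
 have hz: "vn (h *v z) <= u * v" using vn_mult[OF hc z] b1[of "mn h"] Dp by simp
 have hx_low: "f * v <= vn (h *v x)"
 proof -
  have "u * v <= f * v" using v by (intro mult_right_mono) (auto simp: u_def)
  thus ?thesis using vn_ge_diff[OF BQ_c hz_c] hz BQ hx by simp
 qed
 have S2B: "S2 *v (B0 *v (Q *v y)) = S2 *v (B0 *v ((Q - L) *v y))"
 proof -
  have BLy_c: "B0 *v (L *v y) : Vec q" using B0 Ly_c by simp
  have "(B0 * L) *v y : rng (B0 * L)" using BB2 y unfolding rng_def by auto
  hence "B0 *v (L *v y) : kern S2" by (simp add: S2(2) BI(4) BB2v[OF y])
  hence z2: "S2 *v (B0 *v (L *v y)) = 0v q" using S2 by (simp add: kern_def)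
  have "S2 *v (B0 *v ((Q - L) *v y)) = S2 *v (B0 *v (Q *v y)) - S2 *v (B0 *v (L *v y))"
   unfolding QLy mult_minus_distrib_mat_vec[OF B0(1) Qy_c Ly_c] by (rule mult_minus_distrib_mat_vec[OF S2(1) BQ_c BLy_c])
  thus ?thesis unfolding z2 using mult_mat_vec_carrier[OF S2(1) BQ_c] by simp
 qed
 have d_c: "(Q - L) *v y : Vec r" using QLc y by simp
 have "vn (S2 *v (h *v x)) <= vn (S2 *v (B0 *v (Q *v y))) + vn (S2 *v (h *v z))"
  unfolding hx Mv_add[OF S2(1) BQ_c hz_c] using S2 BQ_c hz_c by (intro vn_add[of _ q]) auto
 also have "vn (S2 *v (B0 *v (Q *v y))) <= mn S2 * (mn B0 * (t * (C1 * v)))"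
 proof -
  have "vn (S2 *v (B0 *v ((Q - L) *v y))) <= mn S2 * vn (B0 *v ((Q - L) *v y))" using B0 d_c by (intro vn_mult[OF S2(1)]) simp
  also have "... <= mn S2 * (mn B0 * (t * (C1 * v)))" using vn_mult[OF B0(1) d_c] mult_left_mono[OF QLb, of "mn B0"] by (intro mult_left_mono) auto
  finally show ?thesis unfolding S2B .
 qed
 also have "mn S2 * (mn B0 * (t * (C1 * v))) = (t * c) * v" by (simp add: c_def mult_ac)
 also have "(t * c) * v <= E * f / 2 * v" using tc v by (intro mult_right_mono) auto
 also have "vn (S2 *v (h *v z)) <= E * f / 2 * v"
 proof -
  have "vn (S2 *v (h *v z)) <= mn S2 * (mn h * vn z)" using vn_mult[OF S2(1) hz_c] mult_left_mono[OF vn_mult[OF hc z], of "mn S2"] by simp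
  also have "... <= u * v" using b1[of "mn S2 * mn h"] Dp by (simp add: mult.assoc)
  also have "... <= E * f / 2 * v" using v by (intro mult_right_mono) (auto simp: u_def)
  finally show ?thesis .
 qed
 finally have "vn (S2 *v (h *v x)) <= E * (f * v)" by simp
 also have "... <= E * vn (h *v x)" using hx_low E by (intro mult_left_mono) auto
 finally have fin: "vn (S2 *v (h *v x)) <= E * vn (h *v x)" .
 have hxc: "h *v x : Vec q" using hc x by simp
 have wv: "vn w = l' * vn (h *v x)" using gx[OF x(1)] w l'0 by simp
 have "0 < vn (h *v x)" using less_le_trans[OF mult_pos_pos[OF f v] hx_low] .
 hence "0 < vn w" using wv l'0 by simp
 hence "w ~= 0v q" by auto
 moreover have "vn (S2 *v w) = l' * vn (S2 *v (h *v x))" unfolding w gx[OF x(1)] mult_mat_vec[OF S2(1) hxc] using l'0 by simp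
 hence "vn (S2 *v w) <= E * vn w" using mult_left_mono[OF fin, of l'] l'0 wv by (simp add: mult_ac)
 moreover have "w : Vec q" using w gc x by simp
 ultimately show "w : cone S2 E" by (simp add: cone_def)
qed
hence "m ((*\<^sub>v) (g (s k)) ` X) <= m (cone S2 E)" by (intro m_mono linear_image_sets(1)[OF gc stab_det[OF gR(1)] Xs] cone_sets[OF S2(1)])
hence "m X < M / 3" using stab_m[OF gR(1) Xs, of "s k"] E(2) by simp
moreover have "M <= m (cone S0 p)" unfolding M_def by (rule content_le[OF S0 p])
moreover have "m (cone S0 p) <= m (cone S1 e Un X)" by (intro m_mono cone_sets[OF S0] sets.Un cone_sets[OF S1(1)] Xs) (auto simp: X_def)
moreover have "m (cone S1 e Un X) <= m (cone S1 e) + m X" by (rule m_union_le[OF cone_sets[OF S1(1)] Xs])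
ultimately show False using e(2) M by linarith
qed

text \<open>The kernel of the stacked matrix is the intersection of the kernels.\<close>

definition stack :: "real mat => real mat => real mat" where
"stack S S' = mat (q + q) q (%(i, j). if i < q then S $$ (i, j) else S' $$ (i - q, j))"

lemma vn_stack:
assumes "S : Mat q q" "S' : Mat q q" "x : Vec q"
shows "vn (stack S S' *v x) = vn (S *v x) + vn (S' *v x)"
proof -
have T: "stack S S' : Mat (q + q) q" by (simp add: stack_def)
have 1: "(stack S S' *v x) $ i = (S *v x) $ i" if "i < q" for i
 using that assms T by (subst (1 2) index_mult_vec_sum) (auto simp: stack_def intro!: sum.cong)
have 2: "(stack S S' *v x) $ (q + i) = (S' *v x) $ i" if "i < q" for i
 using that assms T by (subst (1 2) index_mult_vec_sum) (auto simp: stack_def intro!: sum.cong)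
have "vn (stack S S' *v x) = (SUM i<q + q. abs ((stack S S' *v x) $ i))" using T by (simp add: vn_def)
also have "... = (SUM i<q. abs ((S *v x) $ i)) + (SUM i<q. abs ((S' *v x) $ i))" unfolding sum_lessThan_add by (simp add: 1 2 del: Mv_index)
finally show ?thesis using assms by (simp add: vn_def)
qed

lemma kern_stack:
assumes S: "S : Mat q q" "S' : Mat q q"
shows "kern (stack S S') = kern S Int kern S'"
proof -
have T: "stack S S' : Mat (q + q) q" by (simp add: stack_def)
have k: "x : kern X <-> x : Vec q & vn (X *v x) = 0" if "X : Mat p q" for X p x using that vn_eq_0[of "X *v x" p] by (auto simp: kern_def)
show ?thesis using vn_stack[OF S] by (auto simp: k[OF T] k[OF S(1)] k[OF S(2)] add_nonneg_eq_0_iff)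
qed

text \<open>
  A minimal charged subspace cannot share charge with its other images: their intersections have
  smaller dimension.  So the charges of distinct images add up, and there are finitely many.
\<close>

theorem finite_orbit:
obtains r k Bs C where "1 <= r" "1 <= (k::nat)" "C > 0"
 "!!i. i < k ==> Bs i : Mat q r & inj_mat (Bs i)"
 "!!g i. g : stab ==> i < k ==> EX j<k. EX R. R : Mat r r & g * Bs i = Bs j * R"
 "!!i j. i < k ==> j < k ==> rng (Bs i) = rng (Bs j) ==> i = j"
 "!!g i j R. g : stab ==> i < k ==> j < k ==> R : Mat r r ==> g * Bs i = Bs j * R
  ==> det R ~= 0 & mn R ^ r <= C * abs (det R)"
proof -
define r where "r = r0"
obtain S0 B0 where S0: "S0 : Mat q q" and B0: "B0 : Mat q r" "inj_mat B0" and kS0: "kern S0 = rng B0"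
 and M0: "0 < content S0" using charged_r0 by (auto simp: charged_def r_def)
define M where "M = content S0"
have M: "0 < M" using M0 by (simp add: M_def)
have small: "content S = 0" if "S : Mat p q" "B : Mat q r'" "inj_mat B" "kern S = rng B" "r' < r" for S B p r'
 using small_kernel_content[OF that(1-4)] that(5) by (simp add: r_def)
have r1: "1 <= r" using r0_pos by (simp add: r_def)
define orb where "orb = {rng (g * B0) | g. g : stab}"
have gB: "g * B0 : Mat q r" "inj_mat (g * B0)" if g: "g : stab" for g
proof -
 show gc: "g * B0 : Mat q r" using stab_carrier[OF g] B0 by simp
 have gi: "inj_mat g" using inj_mat_square[OF stab_carrier[OF g]] stab_det[OF g] by simp
 show "inj_mat (g * B0)"
 proof (rule inj_matI[OF gc])
  fix y assume y: "y : Vec r" "g * B0 *v y = 0v q"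
  have "g *v (B0 *v y) = 0v q" using y Mv_assoc[OF stab_carrier[OF g] B0(1) y(1)] by simp
  hence "B0 *v y = 0v q" using inj_matD[OF gi stab_carrier[OF g]] B0 y by simp
  thus "y = 0v r" using inj_matD[OF B0(2,1) y(1)] by simp
 qed
qed
have orbS: "EX S. S : Mat q q & kern S = F & content S = M" if F: "F : orb" for F
proof -
 obtain g where g: "g : stab" "F = rng (g * B0)" using F by (auto simp: orb_def)
 obtain h where h: "h : stab" "g * h = Id q" "h * g = Id q" by (rule stab_inverse[OF g(1)])
 note gc = stab_carrier[OF g(1)] and hc = stab_carrier[OF h(1)]
 have Sh: "S0 * h : Mat q q" using S0 hc by simp
 have gh: "g *v (h *v x) = x" "h *v (g *v x) = x" if "x : Vec q" for x using Mv_assoc[OF gc hc that] Mv_assoc[OF hc gc that] h that by simp_all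
 have "x : kern (S0 * h) <-> x : F" for x
 proof -
  have "x : kern (S0 * h) <-> x : Vec q & h *v x : kern S0" using S0 Sh hc Mv_assoc[OF S0 hc] by (auto simp: kern_def)
  also have "... <-> x : Vec q & (EX y:Vec r. h *v x = B0 *v y)" using B0 by (auto simp: kS0 rng_def)
  also have "... <-> (EX y:Vec r. x = (g * B0) *v y)"
  proof safe
   fix y assume y: "x : Vec q" "y : Vec r" "h *v x = B0 *v y"
   hence "x = g *v (B0 *v y)" using gh(1)[of x] by simp
   hence "x = (g * B0) *v y" using Mv_assoc[OF gc B0(1) y(2)] by simp
   thus "EX y:Vec r. x = (g * B0) *v y" using y(2) by blast
  next
   fix y :: "real vec" assume y: "y : Vec r"
   show "(g * B0) *v y : Vec q" using gB[OF g(1)] y by simp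
   show "EX y':Vec r. h *v ((g * B0) *v y) = B0 *v y'" using gh(2)[of "B0 *v y"] B0 y Mv_assoc[OF gc B0(1) y] by (intro bexI[of _ y]) auto
  qed
  also have "... <-> x : F" using gB[OF g(1)] B0(1) by (auto simp: g(2) rng_def)
  finally show ?thesis .
 qed
 hence "kern (S0 * h) = F" by blast
 moreover have "content (S0 * h) = M" unfolding M_def by (rule content_stab[OF S0 h(1)])
 ultimately show ?thesis using Sh by blast
qed
define SS where "SS F = (SOME S. S : Mat q q & kern S = F & content S = M)" for F
have SS: "SS F : Mat q q" "kern (SS F) = F" "content (SS F) = M" if "F : orb" for F using someI_ex[OF orbS[OF that]] by (auto simp: SS_def)
have orbB: "EX B. B : Mat q r & inj_mat B & rng B = F" if "F : orb" for F using that gB by (auto simp: orb_def)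
have pair_small: "EX e0>0. ALL e. 0 < e --> e <= e0 --> m (cone (SS F) e Int cone (SS F') e) <= E"
 if FF: "F : orb" "F' : orb" "F ~= F'" and E: "0 < E" for F F' E
proof -
 let ?T = "stack (SS F) (SS F')"
 have T: "?T : Mat (q + q) q" by (simp add: stack_def)
 have kT: "kern ?T = F Int F'" using kern_stack[OF SS(1)[OF FF(1)] SS(1)[OF FF(2)]] SS(2) FF by simp
 obtain r' B where B: "r' <= q" "B : Mat q r'" "inj_mat B" "rng B = kern ?T" by (rule lsub_basis[OF lsub_kern[OF T]])
 obtain BF where BF: "BF : Mat q r" "inj_mat BF" "rng BF = F" using orbB[OF FF(1)] by blast
 obtain BF' where BF': "BF' : Mat q r" "inj_mat BF'" "rng BF' = F'" using orbB[OF FF(2)] by blast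
 have "r' <= r" using rng_dim_le[OF B(2,3) BF(1)] B(4) kT BF(3) by simp
 moreover have "r' ~= r"
 proof
  assume "r' = r"
  hence "rng B = rng BF" "rng B = rng BF'" using rng_dim_eq[of B q r BF] rng_dim_eq[of B q r BF'] B kT BF BF' by auto
  with FF(3) BF BF' show False by simp
 qed
 ultimately have "content ?T = 0" using small[OF T B(2,3)] B(4) by simp
 then obtain e1 where e1: "0 < e1" "m (cone ?T e1) < E" using content_approx[OF T, of E] E by auto
 show ?thesis
 proof (intro exI[of _ "e1 / 2"] conjI allI impI)
  fix e assume e: "0 < e" "e <= e1 / 2"
  have "cone (SS F) e Int cone (SS F') e <= cone ?T e1"
  proof
   fix x assume x: "x : cone (SS F) e Int cone (SS F') e"
   hence "vn (?T *v x) <= e * vn x + e * vn x" using vn_stack[OF SS(1)[OF FF(1)] SS(1)[OF FF(2)], of x] by (auto simp: cone_def intro: add_mono)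
   also have "... = (2 * e) * vn x" by simp
   also have "... <= e1 * vn x" using e by (intro mult_right_mono) auto
   finally show "x : cone ?T e1" using x by (simp add: cone_def)
  qed
  hence "m (cone (SS F) e Int cone (SS F') e) <= m (cone ?T e1)" by (intro m_mono sets.Int cone_sets[OF T] cone_sets[OF SS(1)] FF)
  with e1 show "m (cone (SS F) e Int cone (SS F') e) <= E" by linarith
 qed (use e1 in auto)
qed
have union_sets: "(UN F:\<X>. cone (SS F) e) : sets (VB q)" if "finite \<X>" "\<X> <= orb" for \<X> e
 using that SS(1) cone_sets by (intro sets.finite_UN) auto
have overlap_small: "EX e0>0. ALL e. 0 < e --> e <= e0 --> m ((UN F':\<X>. cone (SS F') e) Int cone (SS F) e) <= E"
 if "finite \<X>" "\<X> <= orb" "F : orb" "F ~: \<X>" "0 < E" for \<X> F E using that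
proof (induction \<X> arbitrary: E rule: finite_induct)
 case empty
 thus ?case by (intro exI[of _ 1]) (auto simp: m_empty)
next
 case (insert F' \<X>)
 obtain e1 where e1: "e1 > 0" "!!e. 0 < e ==> e <= e1 ==> m ((UN F':\<X>. cone (SS F') e) Int cone (SS F) e) <= E / 2"
  using insert.IH[of "E / 2"] insert.prems by auto
 obtain e2 where e2: "e2 > 0" "!!e. 0 < e ==> e <= e2 ==> m (cone (SS F') e Int cone (SS F) e) <= E / 2"
  using pair_small[of F' F "E / 2"] insert.prems by auto
 show ?case
 proof (intro exI[of _ "min e1 e2"] conjI allI impI)
  fix e assume e: "0 < e" "e <= min e1 e2"
  have "(UN F':insert F' \<X>. cone (SS F') e) Int cone (SS F) e
    = (cone (SS F') e Int cone (SS F) e) Un ((UN F':\<X>. cone (SS F') e) Int cone (SS F) e)" by auto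
  also have "m ... <= m (cone (SS F') e Int cone (SS F) e) + m ((UN F':\<X>. cone (SS F') e) Int cone (SS F) e)"
   using insert.prems insert.hyps SS(1) by (intro m_union_le sets.Int union_sets cone_sets) auto
  also have "... <= E / 2 + E / 2" using e e1(2)[of e] e2(2)[of e] by (intro add_mono) auto
  finally show "m ((UN F':insert F' \<X>. cone (SS F') e) Int cone (SS F) e) <= E" by simp
 qed (use e1 e2 in auto)
qed
have union_large: "EX e0>0. ALL e. 0 < e --> e <= e0 --> real (card \<X>) * M - E <= m (UN F:\<X>. cone (SS F) e)"
 if "finite \<X>" "\<X> <= orb" "0 < E" for \<X> E using that
proof (induction \<X> arbitrary: E rule: finite_induct)
 case empty
 thus ?case by (intro exI[of _ 1]) (auto simp: m_empty)
next
 case (insert F \<X>)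
 obtain e1 where e1: "e1 > 0" "!!e. 0 < e ==> e <= e1 ==> real (card \<X>) * M - E / 2 <= m (UN F:\<X>. cone (SS F) e)"
  using insert.IH[of "E / 2"] insert.prems by auto
 obtain e2 where e2: "e2 > 0" "!!e. 0 < e ==> e <= e2 ==> m ((UN F':\<X>. cone (SS F') e) Int cone (SS F) e) <= E / 2"
  using overlap_small[of \<X> F "E / 2"] insert.prems insert.hyps by auto
 show ?case
 proof (intro exI[of _ "min e1 e2"] conjI allI impI)
  fix e assume e: "0 < e" "e <= min e1 e2"
  have F: "F : orb" using insert.prems by simp
  have "m (UN F:insert F \<X>. cone (SS F) e) = m ((UN F:\<X>. cone (SS F) e) Un cone (SS F) e)" by (simp add: Un_commute)
  also have "... = m (UN F:\<X>. cone (SS F) e) + m (cone (SS F) e) - m ((UN F:\<X>. cone (SS F) e) Int cone (SS F) e)"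
   using insert.prems insert.hyps by (intro m_union_inter union_sets cone_sets[OF SS(1)[OF F]]) auto
  finally have 1: "m (UN F:insert F \<X>. cone (SS F) e) = m (UN F:\<X>. cone (SS F) e) + m (cone (SS F) e) - m ((UN F:\<X>. cone (SS F) e) Int cone (SS F) e)" .
  have "M <= m (cone (SS F) e)" using content_le[OF SS(1)[OF F] e(1)] SS(3)[OF F] by simp
  thus "real (card (insert F \<X>)) * M - E <= m (UN F:insert F \<X>. cone (SS F) e)"
   using 1 e e1(2)[of e] e2(2)[of e] insert.hyps by (simp add: algebra_simps)
 qed (use e1 e2 in auto)
qed
have card_le: "real (card \<X>) * M <= 1" if X: "finite \<X>" "\<X> <= orb" for \<X>
proof (rule field_le_epsilon)
 fix E :: real assume "0 < E"
 then obtain e where e: "0 < e" "real (card \<X>) * M - E <= m (UN F:\<X>. cone (SS F) e)" using union_large[OF X] by blast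
 note e(2)
 also have "m (UN F:\<X>. cone (SS F) e) <= 1" by (rule m_le_1[OF union_sets[OF X]]) (auto simp: cone_def)
 finally show "real (card \<X>) * M <= 1 + E" by simp
qed
have fin: "finite orb"
proof (rule ccontr)
 assume inf: "infinite orb"
 obtain N :: nat where N: "1 / M < real N" using reals_Archimedean2 by blast
 obtain \<X> where "finite \<X>" "card \<X> = N" "\<X> <= orb" using infinite_arbitrarily_large[OF inf] by blast
 with card_le[of \<X>] have "real N * M <= 1" by simp
 with N M show False by (simp add: field_simps)
qed
obtain C where C: "C > 0" and Cb: "!!g R. g : stab ==> R : Mat r r ==> g * B0 = B0 * R ==> mn R ^ r <= C * abs (det R)"
 by (rule stabiliser_bound[OF S0 B0[unfolded r_def] kS0 M0]) (auto simp: r_def)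
have ne: "orb ~= {}" using stab_one by (auto simp: orb_def)
obtain f where f: "bij_betw f {0..<card orb} orb" using ex_bij_betw_nat_finite[OF fin] by blast
have fo: "f i : orb" if "i < card orb" for i using f that by (auto simp: bij_betw_def)
define G where "G i = (SOME g. g : stab & f i = rng (g * B0))" for i
have G: "G i : stab" "f i = rng (G i * B0)" if "i < card orb" for i
 using someI_ex[of "%g. g : stab & f i = rng (g * B0)"] fo[OF that] by (auto simp: G_def orb_def)
show thesis
proof (rule that[of r "card orb" C "%i. G i * B0"])
 show "1 <= card orb" using fin ne by (simp add: Suc_le_eq card_gt_0_iff)
 show "G i * B0 : Mat q r & inj_mat (G i * B0)" if "i < card orb" for i using gB[OF G(1)[OF that]] by simp
 show "EX j<card orb. EX R. R : Mat r r & g * (G i * B0) = G j * B0 * R" if g: "g : stab" and i: "i < card orb" for g i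
 proof -
  have gg: "g * G i : stab" by (rule stab_mult[OF g G(1)[OF i]])
  have as: "g * (G i * B0) = (g * G i) * B0" using MM_assoc[OF stab_carrier[OF g] stab_carrier[OF G(1)[OF i]] B0(1)] by simp
  have "rng ((g * G i) * B0) : orb" using gg by (auto simp: orb_def)
  then obtain j where j: "j < card orb" "f j = rng ((g * G i) * B0)" using bij_betw_imp_surj_on[OF f] by (metis (no_types, lifting) atLeastLessThan_iff image_iff)
  hence "rng ((g * G i) * B0) <= rng (G j * B0)" using G(2)[OF j(1)] by simp
  then obtain R where "R : Mat r r" "(g * G i) * B0 = G j * B0 * R" by (rule rng_factor[OF gB(1)[OF gg] gB(1)[OF G(1)[OF j(1)]]])
  with j as show ?thesis by auto
 qed
 show "i = j" if "i < card orb" "j < card orb" "rng (G i * B0) = rng (G j * B0)" for i j using that G(2) f by (auto simp: bij_betw_def inj_on_def)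
 show "det R ~= 0 & mn R ^ r <= C * abs (det R)"
  if g: "g : stab" and ij: "i < card orb" "j < card orb" and R: "R : Mat r r" and eq: "g * (G i * B0) = G j * B0 * R" for g i j R
 proof -
  note Gi = G(1)[OF ij(1)] and Gj = G(1)[OF ij(2)]
  obtain h where h: "h : stab" "G j * h = Id q" "h * G j = Id q" by (rule stab_inverse[OF Gj])
  note hc = stab_carrier[OF h(1)] and gc = stab_carrier[OF g] and Gic = stab_carrier[OF Gi] and Gjc = stab_carrier[OF Gj]
  have k: "h * (g * G i) : stab" using h g Gi by (intro stab_mult)
  have "(h * (g * G i)) * B0 = h * (g * (G i * B0))" using hc gc Gic B0(1) by (simp add: MM_assoc[of _ q q _ q _ r] MM_assoc[of _ q q _ q _ q])
  also have "... = (h * G j) * (B0 * R)" unfolding eq using hc Gjc B0(1) R by (simp add: MM_assoc[of _ q q _ q _ r] MM_assoc[of _ q q _ r _ r])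
  also have "... = B0 * R" using h(3) B0(1) R by simp
  finally have kB: "(h * (g * G i)) * B0 = B0 * R" .
  have "inj_mat R"
  proof (rule inj_matI[OF R])
   fix y assume y: "y : Vec r" "R *v y = 0v r"
   have "(B0 * R) *v y = B0 *v (R *v y)" by (rule Mv_assoc[OF B0(1) R y(1)])
   hence "(h * (g * G i)) * B0 *v y = 0v q" using y(2) kB mult_mat_zero_vec[OF B0(1)] by simp
   thus "y = 0v r" using inj_matD[OF gB(2,1)[OF k] y(1)] by simp
  qed
  thus ?thesis using inj_mat_square[OF R] Cb[OF k R kB] by simp
 qed
qed (use r1 C in auto)
qed

end

section \<open>Additive functionals of a finite Markov chain\<close>

context sequence_space
begin

text \<open>
  The state after \<open>n\<close> steps when \<open>s\<close> moves the state \<open>i\<close> to \<open>\<tau> s i\<close>; starting points and moves are kept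
  apart because the estimates below are uniform in the former.
\<close>

primrec chain :: "('a => nat => nat) => nat => (nat => 'a) => nat => nat" where
"chain \<tau> i w 0 = i"
| "chain \<tau> i w (Suc n) = \<tau> (w n) (chain \<tau> i w n)"

definition chain_sum :: "('a => nat => nat) => ('a => nat => real) => nat => (nat => 'a) => nat => real" where
"chain_sum \<tau> a i w n = (SUM t<n. a (w t) (chain \<tau> i w t))"

lemma chain_case_nat: "chain \<tau> i (case_nat s w) (Suc n) = chain \<tau> (\<tau> s i) w n" by (induction n) auto

lemma chain_sum_case_nat: "chain_sum \<tau> a i (case_nat s w) (Suc n) = a s i + chain_sum \<tau> a (\<tau> s i) w n"
unfolding chain_sum_def sum.lessThan_Suc_shift by (simp add: chain_case_nat del: chain.simps(2))

context
fixes \<tau> :: "'a => nat => nat" and a :: "'a => nat => real" and k :: nat and c :: real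
assumes \<tau>_meas: "!!i. (%s. \<tau> s i) : measurable M (count_space UNIV)"
 and a_meas: "!!i. (%s. a s i) : Bor M"
 and \<tau>_less: "!!s i. \<tau> s i < k" and a_bound: "!!s i. abs (a s i) <= c"
begin

lemma measurable_chain: "(%w. chain \<tau> i w n) : measurable S (count_space UNIV)"
proof (induction n)
case (Suc n)
have "(%w. \<tau> (w n) j) : measurable S (count_space UNIV)" for j
 by (rule measurable_compose[OF measurable_component_singleton[of n UNIV] \<tau>_meas]) simp
thus ?case unfolding chain.simps by (rule measurable_compose_countable[OF _ Suc])
qed simp

lemma measurable_chain_sum: "(%w. chain_sum \<tau> a i w n) : Bor S" unfolding chain_sum_def
proof (intro borel_measurable_sum)
fix t
have "(%w. a (w t) j) : Bor S" for j by (rule measurable_compose[OF measurable_component_singleton[of t UNIV] a_meas]) simp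
thus "(%w. a (w t) (chain \<tau> i w t)) : Bor S" by (rule measurable_compose_countable[OF _ measurable_chain])
qed

lemma chain_less: "i < k ==> chain \<tau> i w n < k" by (cases n) (auto simp: \<tau>_less)

lemma chain_sum_bound: "abs (chain_sum \<tau> a i w n) <= real n * c"
proof -
have "abs (chain_sum \<tau> a i w n) <= (SUM t<n. abs (a (w t) (chain \<tau> i w t)))" unfolding chain_sum_def by (rule sum_abs)
also have "... <= (SUM t<n. c)" by (intro sum_mono a_bound)
finally show ?thesis by simp
qed

lemma integrable_chain_sum: "integrable S (%w. chain_sum \<tau> a i w n)"
by (rule P.integrable_const_bound[of _ "real n * c"]) (auto simp: chain_sum_bound measurable_chain_sum)

lemma integrable_a: "integrable M (%s. a s i)" by (rule M.integrable_const_bound[of _ c]) (auto simp: a_bound a_meas)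

lemma integrable_target: "integrable M (%s. f (\<tau> s i) :: real)"
proof (rule M.integrable_const_bound[of _ "SUM j<k. abs (f j)"])
show "AE s in M. norm (f (\<tau> s i)) <= (SUM j<k. abs (f j))" using \<tau>_less by (intro AE_I2) (auto intro!: member_le_sum)
show "(%s. f (\<tau> s i)) : Bor M" by (rule measurable_compose[OF \<tau>_meas]) simp
qed

definition transition :: "nat => nat => real" where
"transition i j = (LINT s|M. (if \<tau> s i = j then 1 else 0))"

lemma integral_target: "(LINT s|M. f (\<tau> s i)) = (SUM j<k. transition i j * f j)"
proof -
have "f (\<tau> s i) = (SUM j<k. (if \<tau> s i = j then 1 else 0) * f j)" for s
proof -
 have "(SUM j<k. (if \<tau> s i = j then 1 else 0) * f j) = (SUM j<k. if \<tau> s i = j then f j else 0)" by (intro sum.cong) auto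
 thus ?thesis using \<tau>_less[of s i] by simp
qed
hence "(LINT s|M. f (\<tau> s i)) = (LINT s|M. (SUM j<k. (if \<tau> s i = j then 1 else 0) * f j))" by simp
also have "... = (SUM j<k. LINT s|M. (if \<tau> s i = j then 1 else 0) * f j)"
 by (intro LINT_sum integrable_mult_left integrable_target[of "%l. if l = _ then 1 else 0"])
finally show ?thesis by (simp add: transition_def)
qed

lemma chain_sum_first_step:
"(LINT w|S. chain_sum \<tau> a i w (Suc n)) = (LINT s|M. a s i) + (SUM j<k. transition i j * (LINT w|S. chain_sum \<tau> a j w n))"
proof -
have "(LINT w|S. chain_sum \<tau> a i w (Suc n)) = (LINT s|M. LINT w|S. chain_sum \<tau> a i (case_nat s w) (Suc n))"
 by (rule integral_case_nat[OF measurable_chain_sum chain_sum_bound])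
also have "... = (LINT s|M. a s i + (LINT w|S. chain_sum \<tau> a (\<tau> s i) w n))"
 unfolding chain_sum_case_nat using integrable_chain_sum by (simp add: P.prob_space)
also have "... = (LINT s|M. a s i) + (LINT s|M. (LINT w|S. chain_sum \<tau> a (\<tau> s i) w n))"
 by (intro LINT_add integrable_a integrable_target[of "%j. LINT w|S. chain_sum \<tau> a j w n"])
finally show ?thesis unfolding integral_target[of "%j. LINT w|S. chain_sum \<tau> a j w n"] .
qed

text \<open>
  The Poisson equation is solvable: its approximate solutions, the Cesaro means of the expected sums,
  bring the mean increment arbitrarily close to the range of the operator, and that range is closed.
\<close>

lemma Poisson_equation:
assumes drift: "!!i. i < k ==> (%n. (LINT w|S. chain_sum \<tau> a i w n) / real n) ---> 0"
shows "EX p::nat => real. ALL i<k. (LINT s|M. a s i) + (LINT s|M. p (\<tau> s i)) = p i"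
proof -
define s where "s n i = (LINT w|S. chain_sum \<tau> a i w n)" for n i
define e where "e i = (LINT s|M. a s i)" for i
define Q where "Q = mat k k (%(i, j). (if i = j then 1 else 0) - transition i j)"
have Qc: "Q : Mat k k" by (simp add: Q_def)
have Qf: "Q *v vec k f = vec k (%i. f i - (SUM j<k. transition i j * f j))" for f
proof (rule eq_vecI)
 fix i assume "i < dim_vec (vec k (%i. f i - (SUM j<k. transition i j * f j)))"
 hence i: "i < k" by simp
 have "(Q *v vec k f) $ i = (SUM j<k. ((if i = j then 1 else 0) - transition i j) * f j)" using i by (subst index_mult_vec_sum) (auto simp: Q_def)
 also have "... = (SUM j<k. (if i = j then f j else 0) - transition i j * f j)" by (intro sum.cong) (auto simp: left_diff_distrib)
 also have "... = f i - (SUM j<k. transition i j * f j)" using i by (simp add: sum_subtractf)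
 finally show "(Q *v vec k f) $ i = vec k (%i. f i - (SUM j<k. transition i j * f j)) $ i" using i by simp
qed (simp add: Q_def)
obtain r B where B: "r <= k" "B : Mat k r" "inj_mat B" "rng B = rng Q" by (rule lsub_basis[OF lsub_rng[OF Qc]])
obtain T where T: "T : Mat k k" "kern T = rng B" by (rule annihilator_exists[OF B(2,3)])
have first: "s (Suc n) i = e i + (SUM j<k. transition i j * s n j)" for n i unfolding s_def e_def by (rule chain_sum_first_step)
have s0: "s 0 i = 0" for i by (simp add: s_def chain_sum_def)
have cesaro: "Q *v vec k (%i. (SUM t<n. s t i) / real n) = vec k e - vec k (%i. s n i / real n)" if n: "1 <= n" for n
proof -
 have "(SUM t<n. s t i) / real n - (SUM j<k. transition i j * ((SUM t<n. s t j) / real n)) = e i - s n i / real n" for i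
 proof -
  have "(SUM j<k. transition i j * ((SUM t<n. s t j) / real n)) = (SUM j<k. SUM t<n. transition i j * s t j) / real n"
   by (simp add: sum_divide_distrib sum_distrib_left)
  also have "(SUM j<k. SUM t<n. transition i j * s t j) = (SUM t<n. SUM j<k. transition i j * s t j)" by (rule sum.swap)
  also have "... = (SUM t<n. s (Suc t) i - e i)" by (simp add: first)
  also have "... = (SUM t<n. s (Suc t) i) - real n * e i" by (simp add: sum_subtractf)
  also have "(SUM t<n. s (Suc t) i) = (SUM t<n. s t i) + s n i" using sum.lessThan_Suc_shift[of "%t. s t i" n] by (simp add: s0)
  finally show ?thesis using n by (simp add: field_simps)
 qed
 thus ?thesis unfolding Qf by (intro eq_vecI) auto
qed
have Tb: "T *v vec k e = T *v vec k (%i. s n i / real n)" if n: "1 <= n" for n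
proof -
 have c: "vec k e : Vec k" "vec k (%i. s n i / real n) : Vec k" by auto
 have "Q *v vec k (%i. (SUM t<n. s t i) / real n) : rng Q" using Qc unfolding rng_def by auto
 hence "vec k e - vec k (%i. s n i / real n) : rng Q" using cesaro[OF n] by simp
 hence "T *v (vec k e - vec k (%i. s n i / real n)) = 0v k" using T B(4) by (auto simp: kern_def)
 hence z: "T *v vec k e - T *v vec k (%i. s n i / real n) = 0v k" by (simp add: mult_minus_distrib_mat_vec[OF T(1) c])
 show ?thesis
 proof (rule eq_vecI)
  fix i assume "i < dim_vec (T *v vec k (%i. s n i / real n))"
  hence i: "i < k" using T by simp
  have "(T *v vec k e - T *v vec k (%i. s n i / real n)) $ i = 0" unfolding z using i by simp
  thus "(T *v vec k e) $ i = (T *v vec k (%i. s n i / real n)) $ i" using i T(1) by (simp del: Mv_index)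
 qed simp
qed
have vf: "vn (vec k f) = (SUM i<k. abs (f i))" for f :: "nat => real" by (simp add: vn_def)
have "(%n. abs (s n i / real n)) ---> 0" if "i < k" for i unfolding s_def using drift[OF that] by (rule tendsto_rabs_zero)
hence "(%n. mn T * vn (vec k (%i. s n i / real n))) ---> mn T * 0" unfolding vf by (intro tendsto_mult tendsto_const tendsto_null_sum) blast
moreover have "vn (T *v vec k e) <= mn T * vn (vec k (%i. s n i / real n))" if "1 <= n" for n unfolding Tb[OF that] by (rule vn_mult[OF T(1)]) simp
hence "EX N. ALL n>=N. vn (T *v vec k e) <= mn T * vn (vec k (%i. s n i / real n))" by blast
ultimately have "vn (T *v vec k e) <= mn T * 0" by (rule LIMSEQ_le_const)
hence "vn (T *v vec k e) = 0" using vn_nonneg[of "T *v vec k e"] by simp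
hence "T *v vec k e = 0v k" using vn_eq_0[of "T *v vec k e" k] T by simp
hence "vec k e : rng Q" using T B(4) by (auto simp: kern_def)
then obtain y where y: "y : Vec k" "vec k e = Q *v y" using Qc by (auto simp: rng_def)
have "y = vec k (%i. y $ i)" using y by (intro eq_vecI) auto
hence "vec k e = Q *v vec k (%i. y $ i)" using y(2) by simp
hence eq: "vec k e = vec k (%i. y $ i - (SUM j<k. transition i j * y $ j))" unfolding Qf .
have "e i = y $ i - (SUM j<k. transition i j * y $ j)" if "i < k" for i using arg_cong[OF eq, of "%v. v $ i"] that by simp
thus ?thesis using integral_target[of "%i. y $ i"] by (intro exI[of _ "%i. y $ i"]) (simp add: e_def)
qed

text \<open>
  Correcting the sum by a solution of the Poisson equation makes it a martingale with bounded
  increments, whose variance grows linearly.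
\<close>

theorem chain_sum_square_root_growth:
assumes drift: "!!i. i < k ==> (%n. (LINT w|S. chain_sum \<tau> a i w n) / real n) ---> 0"
shows "EX C>=0. ALL i<k. ALL n. (LINT w|S. abs (chain_sum \<tau> a i w n)) <= C * sqrt (real (Suc n))"
proof -
obtain e :: "nat => real" where e: "!!i. i < k ==> (LINT s|M. a s i) + (LINT s|M. e (\<tau> s i)) = e i" using Poisson_equation[OF drift] by blast
define p where "p = (SUM j<k. abs (e j))"
have p: "abs (e j) <= p" if "j < k" for j unfolding p_def using that by (intro member_le_sum) auto
have p0: "0 <= p" by (simp add: p_def sum_nonneg)
have c0: "0 <= c" using a_bound[of undefined 0] by linarith
define Z where "Z n i w = chain_sum \<tau> a i w n + e (chain \<tau> i w n) - e i" for n i w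
have Zm [measurable]: "Z n i : Bor S" for n i
proof -
 have "(%w. e (chain \<tau> i w n)) : Bor S" by (rule measurable_compose[OF measurable_chain]) simp
 thus ?thesis unfolding Z_def using measurable_chain_sum by (intro borel_measurable_add borel_measurable_diff) auto
qed
have Zb: "abs (Z n i w) <= real n * c + 2 * p" if "i < k" for n i w
 using chain_sum_bound[of i w n] p[OF that] p[OF chain_less[OF that, of w n]] unfolding Z_def by linarith
have Zi: "integrable S (Z n i)" if "i < k" for n i by (rule P.integrable_const_bound[of _ "real n * c + 2 * p"]) (use Zb[OF that] in auto)
have Z2b: "abs ((Z n i w)^2) <= (real n * c + 2 * p)^2" if "i < k" for n i w using power_mono[OF Zb[OF that, of n w] abs_ge_zero, where n = 2] by simp
have Z2i: "integrable S (%w. (Z n i w)^2)" if "i < k" for n i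
 by (rule P.integrable_const_bound[of _ "(real n * c + 2 * p)^2"]) (use Z2b[OF that] in auto)
define D where "D s i = a s i + e (\<tau> s i) - e i" for s i
have step: "Z (Suc n) i (case_nat s w) = D s i + Z n (\<tau> s i) w" for n i s w unfolding Z_def D_def chain_sum_case_nat chain_case_nat by simp
have Dm [measurable]: "(%s. D s i) : Bor M" for i
 unfolding D_def using measurable_compose[OF \<tau>_meas, of e borel] a_meas by (intro borel_measurable_add borel_measurable_diff) auto
define K where "K = c + 2 * p"
have Db: "abs (D s i) <= K" if "i < k" for s i unfolding D_def K_def using a_bound[of s i] p[OF that] p[OF \<tau>_less[of s i]] by linarith
have Di: "integrable M (%s. D s i)" if "i < k" for i by (rule M.integrable_const_bound[of _ K]) (use Db[OF that] in auto)
have D2b: "(D s i)^2 <= K^2" if "i < k" for s i using power_mono[OF Db[OF that] abs_ge_zero, of s 2] by simp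
have D2i: "integrable M (%s. (D s i)^2)" if "i < k" for i by (rule M.integrable_const_bound[of _ "K^2"]) (use D2b[OF that] in auto)
have D0: "(LINT s|M. D s i) = 0" if "i < k" for i unfolding D_def using e[OF that] integrable_a integrable_target[of e] by (simp add: M.prob_space)
have moments: "ALL i<k. (LINT w|S. Z n i w) = 0 & (LINT w|S. (Z n i w)^2) <= real n * K^2" for n
proof (induction n)
 case 0
 thus ?case by (simp add: Z_def chain_sum_def)
next
 case (Suc n)
 show ?case
 proof (intro allI impI conjI)
  fix i assume i: "i < k"
  have "(LINT w|S. Z (Suc n) i w) = (LINT s|M. LINT w|S. Z (Suc n) i (case_nat s w))" by (rule integral_case_nat[OF Zm Zb[OF i]])
  also have "... = (LINT s|M. D s i)" unfolding step using Zi[OF \<tau>_less] Suc \<tau>_less by (simp add: P.prob_space)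
  finally show "(LINT w|S. Z (Suc n) i w) = 0" using D0[OF i] by simp
  have "(LINT w|S. (Z (Suc n) i w)^2) = (LINT s|M. LINT w|S. (Z (Suc n) i (case_nat s w))^2)" by (rule integral_case_nat[OF _ Z2b[OF i]]) measurable
  also have "... = (LINT s|M. (D s i)^2 + (LINT w|S. (Z n (\<tau> s i) w)^2))"
  proof (rule LINT_cong[OF refl])
   fix s
   have "(LINT w|S. (Z (Suc n) i (case_nat s w))^2) = (LINT w|S. (D s i)^2 + 2 * D s i * Z n (\<tau> s i) w + (Z n (\<tau> s i) w)^2)"
    unfolding step power2_sum by (simp add: algebra_simps)
   also have "... = (D s i)^2 + 2 * D s i * (LINT w|S. Z n (\<tau> s i) w) + (LINT w|S. (Z n (\<tau> s i) w)^2)"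
    using Zi[OF \<tau>_less] Z2i[OF \<tau>_less] by (simp add: P.prob_space)
   finally show "(LINT w|S. (Z (Suc n) i (case_nat s w))^2) = (D s i)^2 + (LINT w|S. (Z n (\<tau> s i) w)^2)" using Suc \<tau>_less by simp
  qed
  also have "... <= K^2 + real n * K^2"
  proof (rule M.integral_le_const)
   show "integrable M (%s. (D s i)^2 + (LINT w|S. (Z n (\<tau> s i) w)^2))"
    using D2i[OF i] integrable_target[of "%j. LINT w|S. (Z n j w)^2"] by (intro L1_add)
   show "AE s in M. (D s i)^2 + (LINT w|S. (Z n (\<tau> s i) w)^2) <= K^2 + real n * K^2"
    using Suc \<tau>_less D2b[OF i] by (intro AE_I2 add_mono) auto
  qed
  finally show "(LINT w|S. (Z (Suc n) i w)^2) <= real (Suc n) * K^2" by (simp add: algebra_simps)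
 qed
qed
show ?thesis
proof (intro exI[of _ "(K^2 + 1) / 2 + 2 * p"] conjI allI impI)
 fix i n assume i: "i < k"
 define t where "t = sqrt (real (Suc n))"
 have t: "1 <= t" "t * t = real (Suc n)" by (simp_all add: t_def)
 have "abs (chain_sum \<tau> a i w n) <= ((Z n i w)^2 / t + t) / 2 + 2 * p" for w
 proof -
  have "0 <= (abs (Z n i w) - t)^2 / t" using t by simp
  also have "... = (Z n i w)^2 / t - 2 * abs (Z n i w) + t" using t by (simp add: power2_eq_square field_simps)
  finally have "abs (Z n i w) <= ((Z n i w)^2 / t + t) / 2" by simp
  thus ?thesis using p[OF i] p[OF chain_less[OF i, of w n]] unfolding Z_def by linarith
 qed
 hence "(LINT w|S. abs (chain_sum \<tau> a i w n)) <= (LINT w|S. ((Z n i w)^2 / t + t) / 2 + 2 * p)"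
  using Z2i[OF i] integrable_chain_sum by (intro integral_mono) auto
 also have "... = ((LINT w|S. (Z n i w)^2) / t + t) / 2 + 2 * p" using Z2i[OF i] by (simp add: P.prob_space)
 also have "(LINT w|S. (Z n i w)^2) / t <= K^2 * t"
 proof -
  have "(LINT w|S. (Z n i w)^2) <= real n * K^2" using moments i by blast
  also have "... <= (K^2 * t) * t" using t(2) by (simp add: mult.assoc mult.commute[of "real n"] mult_left_mono)
  finally show ?thesis using t(1) by (simp add: divide_le_eq)
 qed
 also have "((K^2 * t) + t) / 2 + 2 * p <= ((K^2 + 1) / 2 + 2 * p) * t" using mult_left_mono[OF t(1), of "2 * p"] p0 by (simp add: field_simps)
 finally show "(LINT w|S. abs (chain_sum \<tau> a i w n)) <= ((K^2 + 1) / 2 + 2 * p) * sqrt (real (Suc n))" by (simp add: t_def)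
qed (use p0 in simp)
qed

end

end

section \<open>A vector that grows slowly\<close>

lemma rng_subset_kern:
assumes X: "X : Mat q r" and S: "S : Mat p q"
shows "rng X <= kern S <-> S * X = 0m p r"
proof
have c: "S * X : Mat p r" using S X by simp
{
 assume sub: "rng X <= kern S"
 have "S *v (X *v y) = 0v p" if "y : Vec r" for y using sub X S that by (auto simp: rng_def kern_def)
 hence "mn (S * X) <= real r * 0" using Mv_assoc[OF S X] by (intro mn_le_sup[OF c]) simp
 hence "mn (S * X) = 0" using mn_nonneg[of "S * X"] by simp
 thus "S * X = 0m p r" using mn_eq_0[OF c] by simp
}
assume z: "S * X = 0m p r"
have "S *v (X *v y) = 0v p" if "y : Vec r" for y
proof -
 have "S *v (X *v y) = 0m p r *v y" using Mv_assoc[OF S X that] z by simp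
 also have "... = 0v p" using that by (intro eq_vecI) auto
 finally show ?thesis .
qed
thus "rng X <= kern S" using X S by (auto simp: rng_def kern_def)
qed

context random_matrices
begin

text \<open>
  The chain runs on the finitely many images of a minimal charged subspace, and the increments are
  the logarithms of the determinants of the induced maps between these subspaces.  Determinants are
  multiplicative, and on a minimal charged subspace they control the norm.
\<close>

theorem slow_vector:
assumes ng: no_growth
obtains x c where "x : Vec q" "x ~= 0v q" "0 <= c"
 "!!n. (LINT w|S. ln (1 + vn (prodA n w *v x))) <= c * sqrt (real (Suc n))"
proof -
obtain m :: "real vec set => real" where m: "!!X. X : sets (VB q) ==> 0 <= m X"
 "!!X Y. X : sets (VB q) ==> Y : sets (VB q) ==> X Int Y = {} ==> m (X Un Y) = m X + m Y"
 "m (Vec q - {0v q}) = 1" "AE s in M. ALL X:sets (VB q). m ((*\<^sub>v) (A s) ` X) = m X" by (rule invariant_mean[OF ng]) blast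
interpret V: vector_mean q m using q_pos m(1-3) by unfold_locales auto
obtain r k Bs C0 where r: "1 <= r" and k: "1 <= (k::nat)" and C0: "C0 > 0"
 and Bs: "!!i. i < k ==> Bs i : Mat q r & inj_mat (Bs i)"
 and move: "!!g i. g : V.stab ==> i < k ==> EX j<k. EX R. R : Mat r r & g * Bs i = Bs j * R"
 and distinct: "!!i j. i < k ==> j < k ==> rng (Bs i) = rng (Bs j) ==> i = j"
 and bd: "!!g i j R. g : V.stab ==> i < k ==> j < k ==> R : Mat r r ==> g * Bs i = Bs j * R
  ==> det R ~= 0 & mn R ^ r <= C0 * abs (det R)" by (rule V.finite_orbit) blast
have Bc: "Bs i : Mat q r" "inj_mat (Bs i)" if "i < k" for i using Bs[OF that] by auto
have "EX L. L : Mat r q & L * Bs i = Id r" if "i < k" for i by (rule left_inverse_exists[OF Bc[OF that]]) blast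
hence "EX Ls. ALL i<k. Ls i : Mat r q & Ls i * Bs i = Id r" by metis
then obtain Ls where Ls: "!!i. i < k ==> Ls i : Mat r q" "!!i. i < k ==> Ls i * Bs i = Id r" by blast
have "EX T. T : Mat q q & kern T = rng (Bs i)" if "i < k" for i by (rule annihilator_exists[OF Bc[OF that]]) blast
hence "EX Ss. ALL i<k. Ss i : Mat q q & kern (Ss i) = rng (Bs i)" by metis
then obtain Ss where Ss: "!!i. i < k ==> Ss i : Mat q q" "!!i. i < k ==> kern (Ss i) = rng (Bs i)" by blast
define KB where "KB = 1 + (SUM i<k. mn (Bs i)) + (SUM i<k. mn (Ls i))"
have KB1: "1 <= KB" by (simp add: KB_def sum_nonneg)
have KB: "mn (Bs i) <= KB" "mn (Ls i) <= KB" if "i < k" for i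
proof -
 have "mn (Bs i) <= (SUM i<k. mn (Bs i))" "mn (Ls i) <= (SUM i<k. mn (Ls i))" using that by (auto intro!: member_le_sum)
 moreover have "0 <= (SUM i<k. mn (Bs i))" "0 <= (SUM i<k. mn (Ls i))" by (simp_all add: sum_nonneg)
 ultimately show "mn (Bs i) <= KB" "mn (Ls i) <= KB" unfolding KB_def by linarith+
qed
have R_eq: "R = Ls j * (g * Bs i)" if "j < k" "R : Mat r r" "g * Bs i = Bs j * R" for g i j R
 using that MM_assoc[OF Ls(1)[OF that(1)] Bc(1)[OF that(1)] that(2)] Ls(2)[OF that(1)] by simp
define c1 where "c1 = ln (fact r) + abs (ln C0) + real r * ln (KB * KB)"
have det_bound: "abs (ln (abs (det R))) <= c1 + real r * ln t"
 if g: "g : V.stab" and ij: "i < k" "j < k" and R: "R : Mat r r" "g * Bs i = Bs j * R"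
  and t: "1 <= t" "mn g <= t" "!!v. v : Vec q ==> vn v <= t * vn (g *v v)" for g i j R t
proof -
 note gc = V.stab_carrier[OF g]
 have d: "det R ~= 0" "mn R ^ r <= C0 * abs (det R)" using bd[OF g ij R] by auto
 have up: "mn R <= KB * KB * t"
 proof -
  have "mn R <= mn (Ls j) * mn (g * Bs i)" unfolding R_eq[OF ij(2) R] by (rule mn_mult[OF Ls(1)[OF ij(2)] mult_carrier_mat[OF gc Bc(1)[OF ij(1)]]])
  also have "... <= KB * (t * KB)"
   using KB[OF ij(1)] KB[OF ij(2)] t KB1 order_trans[OF mn_mult[OF gc Bc(1)[OF ij(1)]] mult_mono[OF t(2) KB(1)[OF ij(1)]]] by (intro mult_mono) auto
  finally show ?thesis by (simp add: mult_ac)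
 qed
 have low: "1 <= KB * KB * t * mn R"
 proof -
  define u :: "real vec" where "u = unit_vec r 0"
  have u: "u : Vec r" "vn u = 1" using r by (auto simp: u_def)
  have Bu: "Bs i *v u : Vec q" using Bc(1)[OF ij(1)] u by simp
  have "Ls i *v (Bs i *v u) = u" using Mv_assoc[OF Ls(1)[OF ij(1)] Bc(1)[OF ij(1)] u(1)] Ls(2)[OF ij(1)] u(1) by simp
  hence "1 <= mn (Ls i) * vn (Bs i *v u)" using vn_mult[OF Ls(1)[OF ij(1)] Bu] u(2) by simp
  also have "... <= KB * (t * vn (g *v (Bs i *v u)))" using KB(2)[OF ij(1)] t(3)[OF Bu] KB1 by (intro mult_mono) auto
  also have "g *v (Bs i *v u) = Bs j *v (R *v u)" using Mv_assoc[OF gc Bc(1)[OF ij(1)] u(1)] Mv_assoc[OF Bc(1)[OF ij(2)] R(1) u(1)] R(2) by simp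
  also have "vn (Bs j *v (R *v u)) <= KB * mn R"
  proof -
   have "vn (Bs j *v (R *v u)) <= mn (Bs j) * vn (R *v u)" using R(1) u(1) by (intro vn_mult[OF Bc(1)[OF ij(2)]]) simp
   also have "... <= KB * mn R" using KB(1)[OF ij(2)] vn_mult[OF R(1) u(1)] u(2) KB1 by (intro mult_mono) auto
   finally show ?thesis .
  qed
  finally show ?thesis using KB1 t(1) by (simp add: mult_ac mult_left_mono)
 qed
 define G where "G = KB * KB * t"
 have G: "1 <= G" using mult_mono[OF mult_mono[OF KB1 KB1] t(1)] KB1 by (simp add: G_def)
 have lnG: "real r * ln G = real r * ln (KB * KB) + real r * ln t" using KB1 t(1) by (simp add: G_def ln_mult_pos distrib_left)
 have dp: "0 < abs (det R)" using d by simp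
 have "abs (det R) <= fact r * G ^ r" using order_trans[OF det_le_mn[OF R(1)] mult_left_mono[OF power_mono[OF up[folded G_def] mn_nonneg]]] by simp
 hence "ln (abs (det R)) <= ln (fact r * G ^ r)" using dp by (intro ln_mono) auto
 also have "... = ln (fact r) + real r * ln G" using G by (simp add: ln_mult_pos ln_realpow)
 finally have A: "ln (abs (det R)) <= ln (fact r) + real r * ln G" .
 have "1 <= (G * mn R) ^ r" using low by (intro one_le_power) (simp add: G_def)
 also have "... = G ^ r * mn R ^ r" by (rule power_mult_distrib)
 also have "... <= G ^ r * (C0 * abs (det R))" using d G by (intro mult_left_mono) auto
 finally have "ln 1 <= ln (G ^ r * (C0 * abs (det R)))" by (intro ln_mono) auto
 also have "... = real r * ln G + (ln C0 + ln (abs (det R)))" using G C0 dp by (simp add: ln_mult_pos ln_realpow)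
 finally have B: "0 <= real r * ln G + (ln C0 + ln (abs (det R)))" by simp
 have f0: "0 <= ln (fact r :: real)" by (simp add: fact_ge_1)
 have g0: "0 <= real r * ln G" using G by simp
 have "ln C0 <= abs (ln C0)" "0 <= abs (ln C0)" by auto
 with A B f0 g0 lnG show ?thesis unfolding c1_def by (intro abs_leI) linarith+
qed
define c where "c = c1 + real r * ln b"
have c10: "0 <= c1" using mult_mono[OF KB1 KB1] KB1 by (simp add: c1_def fact_ge_1)
have c0: "0 <= c" using c10 b_ge_1 by (simp add: c_def)
define P where "P i s j <-> i < k & j < k & mn (Ss j * (A s * Bs i)) = 0" for i s j
define \<tau> where "\<tau> s i = (LEAST j. P i s j | j = k - 1)" for s i
define Rj where "Rj s i j = (if i < k & j < k then Ls j * (A s * Bs i) else Id r)" for s i j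
define a where "a s i = max (- c) (min c (ln (abs (det (Rj s i (\<tau> s i))))))" for s i
have entries: "(%s. (A s * Bs i) $$ (x, y)) : Bor M" if "i < k" "x < q" "y < r" for i x y
 using Bc(1)[OF that(1)] that A_carrier A_meas by (intro measurable_mult_mat_entries[of M A q q "%_. Bs i" r]) auto
have entries2: "(%s. (X * (A s * Bs i)) $$ (x, y)) : Bor M" if "i < k" "X : Mat p q" "x < p" "y < r" for X p i x y
 using Bc(1)[OF that(1)] that A_carrier entries by (intro measurable_mult_mat_entries[of M "%_. X" p q _ r]) (auto intro!: mult_carrier_mat)
have P_meas: "Measurable.pred M (%s. P i s j)" for i j
proof (cases "i < k & j < k")
 case True
 hence ij: "i < k" "j < k" by auto
 have [measurable]: "(%s. mn (Ss j * (A s * Bs i))) : Bor M"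
 proof (rule measurable_mn)
  show "Ss j * (A s * Bs i) : Mat q r" if "s : space M" for s using Ss(1)[OF ij(2)] Bc(1)[OF ij(1)] A_carrier[OF that] by (intro mult_carrier_mat)
  show "(%s. (Ss j * (A s * Bs i)) $$ (x, y)) : Bor M" if "x < q" "y < r" for x y by (rule entries2[OF ij(1) Ss(1)[OF ij(2)] that])
 qed
 have "P i s j <-> mn (Ss j * (A s * Bs i)) = 0" for s using ij by (simp add: P_def)
 thus ?thesis by simp
next
 case False
 hence "P i s j <-> False" for s by (auto simp: P_def)
 thus ?thesis by simp
qed
have \<tau>m: "(%s. \<tau> s i) : measurable M (count_space UNIV)" for i unfolding \<tau>_def using P_meas by (intro measurable_Least) auto
have Rj_meas: "(%s. ln (abs (det (Rj s i j)))) : Bor M" for i j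
proof (cases "i < k & j < k")
 case True
 hence ij: "i < k" "j < k" by auto
 have [measurable]: "(%s. det (Ls j * (A s * Bs i))) : Bor M"
 proof (rule measurable_det)
  show "Ls j * (A s * Bs i) : Mat r r" if "s : space M" for s using Ls(1)[OF ij(2)] Bc(1)[OF ij(1)] A_carrier[OF that] by (intro mult_carrier_mat)
  show "(%s. (Ls j * (A s * Bs i)) $$ (x, y)) : Bor M" if "x < r" "y < r" for x y by (rule entries2[OF ij(1) Ls(1)[OF ij(2)] that])
 qed
 have "Rj s i j = Ls j * (A s * Bs i)" for s using ij by (simp add: Rj_def)
 thus ?thesis by simp
next
 case False
 hence "Rj s i j = Id r" for s by (auto simp: Rj_def)
 thus ?thesis by simp
qed
have am: "(%s. a s i) : Bor M" for i
proof -
 have [measurable]: "(%s. ln (abs (det (Rj s i (\<tau> s i))))) : Bor M"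
  by (rule measurable_compose_countable[where f = "%j s. ln (abs (det (Rj s i j)))" and g = "%s. \<tau> s i", OF Rj_meas \<tau>m])
 show ?thesis unfolding a_def by measurable
qed
have \<tau>k: "\<tau> s i < k" for s i using k Least_le[of "%j. P i s j | j = k - 1" "k - 1"] by (simp add: \<tau>_def)
have ab: "abs (a s i) <= c" for s i using c0 by (auto simp: a_def)
have one: "A s * Bs i = Bs (\<tau> s i) * Rj s i (\<tau> s i) & Rj s i (\<tau> s i) : Mat r r & a s i = ln (abs (det (Rj s i (\<tau> s i))))"
 if s: "s : space M" "A s : V.stab" and i: "i < k" for s i
proof -
 have AB: "A s * Bs i : Mat q r" using A_carrier[OF s(1)] Bc[OF i] by simp
 obtain j R where j: "j < k" "R : Mat r r" "A s * Bs i = Bs j * R" using move[OF s(2) i] by blast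
 have "Ss j * Bs j = 0m q r" using rng_subset_kern[OF Bc(1)[OF j(1)] Ss(1)[OF j(1)]] Ss(2)[OF j(1)] by simp
 hence "Ss j * (A s * Bs i) = 0m q r" unfolding j(3) using MM_assoc[OF Ss(1)[OF j(1)] Bc(1)[OF j(1)] j(2)] j(2) by simp
 hence Pj: "P i s j" using i j by (simp add: P_def)
 have "P i s (\<tau> s i) | \<tau> s i = k - 1" unfolding \<tau>_def by (rule LeastI[of "%j. P i s j | j = k - 1" j]) (use Pj in simp)
 moreover have "j = k - 1" if "\<tau> s i = k - 1" using Least_le[of "%j. P i s j | j = k - 1" j] Pj that j(1) by (simp add: \<tau>_def)
 ultimately have P: "P i s (\<tau> s i)" using Pj by auto
 define l where "l = \<tau> s i"
 have l: "l < k" using \<tau>k by (simp add: l_def)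
 have SA: "Ss l * (A s * Bs i) : Mat q r" using Ss(1)[OF l] AB by simp
 have "Ss l * (A s * Bs i) = 0m q r" using P mn_eq_0[OF SA] by (simp add: P_def l_def)
 hence "rng (A s * Bs i) <= rng (Bs l)" using rng_subset_kern[OF AB Ss(1)[OF l]] Ss(2)[OF l] by simp
 then obtain R' where R': "R' : Mat r r" "A s * Bs i = Bs l * R'" by (rule rng_factor[OF AB Bc(1)[OF l]])
 have RR: "Rj s i l = R'" using R_eq[OF l R'] i l by (simp add: Rj_def)
 have "abs (ln (abs (det R'))) <= c" unfolding c_def by (rule det_bound[OF s(2) i l R' b_ge_1 A_norm[OF s(1)] A_lower[OF s(1)]])
 hence "a s i = ln (abs (det R'))" using RR by (auto simp: a_def l_def)
 thus ?thesis using R' RR by (simp add: l_def)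
qed
define good where "good w <-> w : space S & (ALL n. A (w n) : V.stab)" for w
have good: "AE w in S. good w"
proof -
 have "AE s in M. A s : V.stab" using m(4) AE_space
 proof eventually_elim
  case (elim s)
  obtain Y where "det (A s) ~= 0" by (rule A_inverse[OF elim(2)])
  thus ?case using elim A_carrier by (simp add: V.stab_def)
 qed
 hence "AE w in S. A (w n) : V.stab" for n by (rule AE_PiM_component[rotated -1]) (auto intro: M.prob_space_axioms)
 hence "AE w in S. ALL n. A (w n) : V.stab" by (simp add: AE_all_countable)
 with AE_space show ?thesis by eventually_elim (simp add: good_def)
qed
have stab: "prodA n w : V.stab" if "good w" for n w using that V.stab_one by (induction n) (auto simp: prodA_Suc good_def intro!: V.stab_mult)
have product: "EX R. R : Mat r r & prodA n w * Bs i = Bs (chain \<tau> i w n) * R & ln (abs (det R)) = chain_sum \<tau> a i w n"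
 if w: "good w" and i: "i < k" for n i w
proof (induction n)
 case 0
 thus ?case using Bc(1)[OF i] by (intro exI[of _ "Id r"]) (simp add: chain_sum_def)
next
 case (Suc n)
 then obtain R where R: "R : Mat r r" "prodA n w * Bs i = Bs (chain \<tau> i w n) * R" "ln (abs (det R)) = chain_sum \<tau> a i w n" by blast
 define j where "j = chain \<tau> i w n"
 have j: "j < k" unfolding j_def by (cases n) (auto simp: i \<tau>k)
 define R' where "R' = Rj (w n) j (\<tau> (w n) j)"
 have sp: "w n : space M" "A (w n) : V.stab" using w by (auto simp: good_def space_S)
 have R': "A (w n) * Bs j = Bs (\<tau> (w n) j) * R'" "R' : Mat r r" "a (w n) j = ln (abs (det R'))" using one[OF sp j] by (auto simp: R'_def)
 have dR: "det R ~= 0" using bd[OF stab[OF w] i j R(1)] R(2) by (simp add: j_def)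
 have dR': "det R' ~= 0" using bd[OF sp(2) j \<tau>k R'(2,1)] by simp
 have Pc: "prodA n w : Mat q q" using w by (simp add: good_def)
 have "prodA (Suc n) w * Bs i = A (w n) * (prodA n w * Bs i)" unfolding prodA_Suc by (rule MM_assoc[OF A_carrier[OF sp(1)] Pc Bc(1)[OF i]])
 also have "... = (A (w n) * Bs j) * R" unfolding R(2) j_def[symmetric] by (rule MM_assoc[OF A_carrier[OF sp(1)] Bc(1)[OF j] R(1), symmetric])
 also have "... = Bs (chain \<tau> i w (Suc n)) * (R' * R)" unfolding R'(1) using MM_assoc[OF Bc(1)[OF \<tau>k] R'(2) R(1)] by (simp add: j_def)
 finally have "prodA (Suc n) w * Bs i = Bs (chain \<tau> i w (Suc n)) * (R' * R)" .
 moreover have "ln (abs (det (R' * R))) = chain_sum \<tau> a i w (Suc n)"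
  using dR dR' R(3) R'(3) det_mult[OF R'(2) R(1)] by (simp add: chain_sum_def abs_mult ln_mult_pos j_def)
 ultimately show ?case using R(1) R'(2) by (intro exI[of _ "R' * R"]) auto
qed
have drift: "(%n. (LINT w|S. chain_sum \<tau> a i w n) / real n) ---> 0" if i: "i < k" for i
proof -
 define h where "h = real q * real q * fact (q - 1)"
 have h: "1 <= h"
 proof -
  have "1 <= real q * real q" using mult_mono[OF q_ge_1 q_ge_1] by simp
  thus ?thesis unfolding h_def using mult_mono[of 1 "real q * real q" 1 "fact (q - 1) :: real"] by (simp add: fact_ge_1)
 qed
 define c2 where "c2 = c1 + real r * ln h"
 have est: "abs (chain_sum \<tau> a i w n) <= c2 + real n * (e * (real r * real q))"
  if w: "good w" and e: "0 < e" and g: "mn (prodA n w) <= exp (real n * e)" "exp (- (real n * e)) <= abs (det (prodA n w))" for w e n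
 proof -
  obtain R where R: "R : Mat r r" "prodA n w * Bs i = Bs (chain \<tau> i w n) * R" "ln (abs (det R)) = chain_sum \<tau> a i w n"
   using product[OF w i] by blast
  have j: "chain \<tau> i w n < k" by (cases n) (auto simp: i \<tau>k)
  have Pc: "prodA n w : Mat q q" using w by (simp add: good_def)
  define E where "E = exp (real n * e)"
  have E: "1 <= E" using e by (simp add: E_def)
  have Eq: "1 <= E ^ q" using E by (rule one_le_power)
  have t1: "1 <= h * E ^ q" using mult_mono[OF h Eq] h by simp
  have t2: "mn (prodA n w) <= h * E ^ q"
  proof -
   have "mn (prodA n w) <= E" using g by (simp add: E_def)
   also have "E <= E ^ q" using E q_pos power_increasing[of 1 q E] by simp
   also have "E ^ q <= h * E ^ q" using mult_right_mono[OF h, of "E ^ q"] E by simp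
   finally show ?thesis .
  qed
  have t3: "vn v <= h * E ^ q * vn (prodA n w *v v)" if v: "v : Vec q" for v
  proof -
   have "(1 / E) * vn v <= abs (det (prodA n w)) * vn v" using g(2) by (intro mult_right_mono) (simp_all add: E_def exp_minus inverse_eq_divide)
   also have "... <= h * mn (prodA n w) ^ (q - 1) * vn (prodA n w *v v)" unfolding h_def by (rule vn_inverse_bound[OF Pc v])
   also have "... <= h * E ^ (q - 1) * vn (prodA n w *v v)" using g(1) h by (intro mult_right_mono mult_left_mono power_mono) (auto simp: E_def)
   finally have "E * ((1 / E) * vn v) <= E * (h * E ^ (q - 1) * vn (prodA n w *v v))" using E by (intro mult_left_mono) auto
   moreover have "E * (h * E ^ (q - 1) * vn (prodA n w *v v)) = h * E ^ q * vn (prodA n w *v v)"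
   proof -
    have "E * E ^ (q - 1) = E ^ q" using q_pos power_Suc[of E "q - 1"] by simp
    thus ?thesis by (simp only: mult_ac flip: \<open>E * E ^ (q - 1) = E ^ q\<close>)
   qed
   moreover have "E * ((1 / E) * vn v) = vn v" using E by simp
   ultimately show ?thesis by linarith
  qed
  have "abs (ln (abs (det R))) <= c1 + real r * ln (h * E ^ q)" by (rule det_bound[OF stab[OF w] i j R(1,2) t1 t2 t3])
  also have "ln (h * E ^ q) = ln h + real q * (real n * e)" using h E by (simp add: ln_mult_pos ln_realpow) (simp add: E_def)
  finally show ?thesis using R(3) by (simp add: c2_def algebra_simps)
 qed
 have "AE w in S. eventually (%n. mn (prodA n w) <= exp (real n * (1 / real (Suc p))) \<and>
   exp (- (real n * (1 / real (Suc p)))) <= abs (det (prodA n w))) sequentially" for p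
  using ng unfolding no_growth_def by (elim allE[of _ "1 / real (Suc p)"]) simp
 hence "AE w in S. ALL p. eventually (%n. mn (prodA n w) <= exp (real n * (1 / real (Suc p))) \<and>
   exp (- (real n * (1 / real (Suc p)))) <= abs (det (prodA n w))) sequentially" unfolding AE_all_countable by blast
 with good have lim: "AE w in S. (%n. chain_sum \<tau> a i w n / real n) ---> 0"
 proof eventually_elim
  case (elim w)
  show ?case
  proof (rule LIMSEQ_I)
   fix D :: real assume D: "0 < D"
   obtain p where p: "2 * (real r * real q) / D < real (Suc p)"
    using reals_Archimedean2[of "2 * (real r * real q) / D"] by (metis less_trans of_nat_less_iff lessI)
   have p': "1 / real (Suc p) * (real r * real q) < D / 2" using p D by (simp add: field_simps)
   have "eventually (%n. c2 / real n < D / 2) sequentially" by (rule order_tendstoD(2)[OF lim_const_over_n]) (use D in simp)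
   hence "eventually (%n. norm (chain_sum \<tau> a i w n / real n - 0) < D) sequentially" using elim(2)[rule_format, of p] eventually_gt_at_top[of 0]
   proof eventually_elim
    case (elim n)
    have "abs (chain_sum \<tau> a i w n) <= c2 + real n * (1 / real (Suc p) * (real r * real q))"
     by (rule est[OF \<open>good w\<close>]) (use elim(2) in auto)
    hence "abs (chain_sum \<tau> a i w n) / real n <= (c2 + real n * (1 / real (Suc p) * (real r * real q))) / real n"
     by (intro divide_right_mono) auto
    also have "... = c2 / real n + 1 / real (Suc p) * (real r * real q)" using elim(3) by (simp add: add_divide_distrib)
    finally have "abs (chain_sum \<tau> a i w n) / real n < D" using elim(1) p' by linarith
    thus ?case by simp
   qed
   thus "EX no. ALL n>=no. norm (chain_sum \<tau> a i w n / real n - 0) < D" by (simp add: eventually_sequentially)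
  qed
 qed
 have "(%n. LINT w|S. chain_sum \<tau> a i w n / real n) ---> (LINT w|S. 0)"
 proof (rule integral_dominated_convergence[where w = "%_. c"])
  show "AE w in S. norm (chain_sum \<tau> a i w n / real n) <= c" for n
  proof (rule AE_I2)
   fix w
   show "norm (chain_sum \<tau> a i w n / real n) <= c"
    using chain_sum_bound[OF \<tau>m am \<tau>k ab, where i = i and w = w and n = n] c0 by (cases "n = 0") (simp_all add: divide_le_eq mult.commute)
  qed
  show "(%w. chain_sum \<tau> a i w n / real n) : Bor S" for n
   using measurable_chain_sum[OF \<tau>m am \<tau>k ab, where i = i and n = n] by measurable
 qed (use lim in auto)
 thus ?thesis by simp
qed
obtain C where C: "0 <= C" "!!i n. i < k ==> (LINT w|S. abs (chain_sum \<tau> a i w n)) <= C * sqrt (real (Suc n))"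
 using chain_sum_square_root_growth[OF \<tau>m am \<tau>k ab drift] by blast
have k0: "0 < k" using k by simp
define x where "x = Bs 0 *v unit_vec r 0"
have u: "(unit_vec r 0 :: real vec) : Vec r" "vn (unit_vec r 0) = 1" using r by auto
have x: "x : Vec q" unfolding x_def using Bc(1)[OF k0] u by simp
have x0: "x ~= 0v q"
proof
 assume "x = 0v q"
 hence "unit_vec r 0 = (0v r :: real vec)" using inj_matD[OF Bc(2,1)[OF k0] u(1)] by (simp add: x_def)
 with u(2) show False by simp
qed
define c3 where "c3 = 1 + KB * (1 + C0)"
have c3: "1 <= c3" using KB1 C0 by (simp add: c3_def)
have "(LINT w|S. ln (1 + vn (prodA n w *v x))) <= (ln c3 + C) * sqrt (real (Suc n))" for n
proof -
 have pt: "AE w in S. ln (1 + vn (prodA n w *v x)) <= ln c3 + abs (chain_sum \<tau> a 0 w n)" using good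
 proof eventually_elim
  case (elim w)
  obtain R where R: "R : Mat r r" "prodA n w * Bs 0 = Bs (chain \<tau> 0 w n) * R" "ln (abs (det R)) = chain_sum \<tau> a 0 w n"
   using product[OF elim k0] by blast
  have j: "chain \<tau> 0 w n < k" by (cases n) (auto simp: k0 \<tau>k)
  have Pc: "prodA n w : Mat q q" using elim by (simp add: good_def)
  have d: "det R ~= 0" "mn R ^ r <= C0 * abs (det R)" using bd[OF stab[OF elim] k0 j R(1,2)] by auto
  define E where "E = exp (abs (chain_sum \<tau> a 0 w n))"
  have E: "1 <= E" by (simp add: E_def)
  have "abs (det R) = exp (chain_sum \<tau> a 0 w n)" using d(1) by (simp flip: R(3))
  hence "abs (det R) <= E" by (simp add: E_def)
  hence "C0 * abs (det R) <= C0 * E" using C0 by (intro mult_left_mono) auto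
  hence RE: "mn R ^ r <= C0 * E" using d(2) by linarith
  have mR: "mn R <= (1 + C0) * E"
  proof (cases "mn R <= 1")
   case True
   also have "1 <= (1 + C0) * E" using mult_mono[of 1 "1 + C0" 1 E] E C0 by simp
   finally show ?thesis .
  next
   case False
   hence "mn R <= mn R ^ r" using r power_increasing[of 1 r "mn R"] by simp
   also have "... <= (1 + C0) * E" using RE E by (simp add: distrib_right)
   finally show ?thesis .
  qed
  have "prodA n w *v x = Bs (chain \<tau> 0 w n) *v (R *v unit_vec r 0)"
   unfolding x_def using Mv_assoc[OF Pc Bc(1)[OF k0] u(1)] Mv_assoc[OF Bc(1)[OF j] R(1) u(1)] R(2) by simp
  hence "vn (prodA n w *v x) <= mn (Bs (chain \<tau> 0 w n)) * vn (R *v unit_vec r 0)"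
   using vn_mult[OF Bc(1)[OF j], of "R *v unit_vec r 0"] R(1) u(1) by simp
  also have "... <= KB * ((1 + C0) * E)" using KB(1)[OF j] order_trans[OF vn_mult[OF R(1) u(1)]] mR u(2) KB1 by (intro mult_mono) auto
  finally have "1 + vn (prodA n w *v x) <= c3 * E" using E by (simp add: c3_def distrib_right mult.assoc)
  hence "ln (1 + vn (prodA n w *v x)) <= ln (c3 * E)" using vn_nonneg[of "prodA n w *v x"] by (intro ln_mono) linarith+
  also have "... = ln c3 + abs (chain_sum \<tau> a 0 w n)" using c3 by (simp add: E_def ln_mult_pos)
  finally show ?case .
 qed
 have i1: "integrable S (%w. ln c3 + abs (chain_sum \<tau> a 0 w n))"
  using integrable_chain_sum[OF \<tau>m am \<tau>k ab, where i = 0 and n = n] by simp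
 have "(LINT w|S. ln (1 + vn (prodA n w *v x))) <= (LINT w|S. ln c3 + abs (chain_sum \<tau> a 0 w n))"
 proof (rule integral_mono_AE[OF _ i1 pt])
  have [measurable]: "(%w. vn (prodA n w *v x)) : Bor S" by (rule measurable_vn_prodA[OF x])
  show "integrable S (%w. ln (1 + vn (prodA n w *v x)))"
  proof (rule L1_bound[OF i1])
   show "AE w in S. norm (ln (1 + vn (prodA n w *v x))) <= norm (ln c3 + abs (chain_sum \<tau> a 0 w n))" using pt by eventually_elim simp
  qed measurable
 qed
 also have "... = ln c3 + (LINT w|S. abs (chain_sum \<tau> a 0 w n))"
  using integrable_chain_sum[OF \<tau>m am \<tau>k ab, where i = 0 and n = n] by (simp add: P.prob_space)
 also have "... <= ln c3 * sqrt (real (Suc n)) + C * sqrt (real (Suc n))"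
  using C(2)[OF k0, of n] c3 mult_left_mono[of 1 "sqrt (real (Suc n))" "ln c3"] by (intro add_mono) auto
 finally show ?thesis by (simp add: distrib_right)
qed
with that[OF x x0, of "ln c3 + C"] c3 C(1) show thesis by simp
qed

end

section \<open>Semisimple products of vanishing growth rate\<close>

lemma col_in_rng:
assumes B: "B : Mat q r" and j: "j < r"
shows "col B j : rng B"
proof -
have "B *v unit_vec r j = col B j"
proof (rule eq_vecI)
 fix i assume i: "i < dim_vec (col B j)"
 have "(B *v unit_vec r j) $ i = (SUM l<r. B $$ (i, l) * (if l = j then 1 else 0))" using B i j by (subst index_mult_vec_sum) (auto intro!: sum.cong)
 also have "... = (SUM l<r. if l = j then B $$ (i, l) else 0)" by (intro sum.cong) auto
 finally show "(B *v unit_vec r j) $ i = col B j $ i" using B i j by simp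
qed (use B in simp)
thus ?thesis using B unfolding rng_def by (metis carrier_matD(2) image_eqI unit_vec_carrier)
qed

lemma mult_eq_0_columns:
assumes T: "T : Mat p q" and X: "X : Mat q r" and z: "!!j. j < r ==> col X j : kern T"
shows "T * X = 0m p r"
proof (rule eq_matI)
fix i j assume "i < dim_row (0m p r :: real mat)" "j < dim_col (0m p r :: real mat)"
hence ij: "i < p" "j < r" by auto
have "(T * X) $$ (i, j) = (T *v col X j) $ i" using T X ij by simp
also have "T *v col X j = 0v p" using z[OF ij(2)] T by (simp add: kern_def)
finally show "(T * X) $$ (i, j) = 0m p r $$ (i, j)" using ij by simp
qed (use T X in auto)

text \<open>
  Any exponent between \<open>-2\<close> and \<open>-3/2\<close> would do: square roots have to be summable with these weights, and
  the inverse weights, divided by \<open>n\<close>, which bound the growth, have to be of an order below \<open>n\<close>.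
\<close>

definition wt :: "nat => real" where
"wt n = real (Suc n) powr (- 7 / 4)"

lemma wt_pos [simp]: "0 < wt n" by (simp add: wt_def)

lemma wt_nonneg [simp]: "0 <= wt n" by (simp add: wt_def)

lemma summable_powr_Suc: "a < - 1 ==> summable (%n. real (Suc n) powr a)"
using summable_Suc_iff[of "%n. real n powr a"] by (simp add: summable_real_powr_iff)

lemma summable_wt: "summable wt" using summable_powr_Suc[of "- 7 / 4"] by (simp add: wt_def[abs_def])

lemma summable_wt_sqrt: "summable (%n. wt n * sqrt (real (Suc n)))"
proof -
have "wt n * sqrt (real (Suc n)) = real (Suc n) powr (- 5 / 4)" for n
 by (simp add: wt_def powr_half_sqrt[symmetric] powr_add[symmetric] del: of_nat_Suc)
thus ?thesis using summable_powr_Suc[of "- 5 / 4"] by simp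
qed

lemma wt_le: "wt n <= 4 * wt (Suc n)"
proof -
have "(2 * real (Suc n)) powr (- 7 / 4) <= real (Suc (Suc n)) powr (- 7 / 4)" by (rule powr_mono2') auto
hence "2 powr (- 7 / 4) * wt n <= wt (Suc n)" by (simp add: wt_def powr_mult del: of_nat_Suc)
hence A: "4 * (2 powr (- 7 / 4) * wt n) <= 4 * wt (Suc n)" by simp
have "(1::real) <= 4 * 2 powr (- 7 / 4)"
proof -
 have "(4::real) * 2 powr (- 7 / 4) = 2 powr 2 * 2 powr (- 7 / 4)" by simp
 also have "... = 2 powr (1 / 4)" by (subst powr_add[symmetric]) simp
 finally show ?thesis by (simp add: ge_one_powr_ge_zero)
qed
hence "1 * wt n <= (4 * 2 powr (- 7 / 4)) * wt n" by (intro mult_right_mono) auto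
with A show ?thesis by (simp only: mult.assoc mult_1)
qed

lemma ln_one_plus_add: "0 <= a ==> 0 <= b ==> c <= a + b ==> 0 <= c ==> ln (1 + c) <= ln (1 + a) + ln (1 + b :: real)"
proof -
assume *: "0 <= a" "0 <= b" "c <= a + b" "0 <= c"
have "(1 + a) * (1 + b) = 1 + (a + b) + a * b" by (simp add: algebra_simps)
hence "1 + c <= (1 + a) * (1 + b)" using * mult_nonneg_nonneg[OF *(1,2)] by linarith
hence "ln (1 + c) <= ln ((1 + a) * (1 + b))" using * by (intro ln_mono) auto
with * show ?thesis by (simp add: ln_mult_pos)
qed

lemma ln_one_plus_mult: "0 <= a ==> 0 <= b ==> c <= a * b ==> 0 <= c ==> ln (1 + c) <= ln (1 + a) + ln (1 + b :: real)"
proof -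
assume *: "0 <= a" "0 <= b" "c <= a * b" "0 <= c"
hence "1 + c <= (1 + a) * (1 + b)" by (simp add: algebra_simps add_increasing)
hence "ln (1 + c) <= ln ((1 + a) * (1 + b))" using * by (intro ln_mono) auto
with * show ?thesis by (simp add: ln_mult_pos)
qed

lemma ln_one_plus_sum: "finite J ==> (!!j. j : J ==> 0 <= f j) ==> ln (1 + (SUM j:J. f j)) <= (SUM j:J. ln (1 + f j :: real))"
proof (induction J rule: finite_induct)
case (insert x J)
have "ln (1 + (f x + (SUM j:J. f j))) <= ln (1 + f x) + ln (1 + (SUM j:J. f j))"
 using insert.prems by (intro ln_one_plus_add) (auto intro!: sum_nonneg add_nonneg_nonneg)
thus ?case using insert by simp
qed simp

context random_matrices
begin

definition growth :: "nat => real vec => real" where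
"growth n x = (LINT w|S. ln (1 + vn (prodA n w *v x)))"

lemma vn_prodA_bound: "w : space S ==> x : Vec q ==> vn (prodA n w *v x) <= real q * b ^ n * vn x"
by (rule order_trans[OF vn_mult[of _ q q] mult_right_mono[OF prodA_norm]]) auto

lemma growth_integrand_bound:
assumes "w : space S" "x : Vec q"
shows "abs (ln (1 + vn (prodA n w *v x))) <= ln (1 + real q * b ^ n * vn x)"
proof -
have "ln (1 + vn (prodA n w *v x)) <= ln (1 + real q * b ^ n * vn x)"
 using vn_prodA_bound[OF assms, of n] vn_nonneg[of "prodA n w *v x"] by (intro ln_mono) linarith+
thus ?thesis by simp
qed

lemma measurable_growth_integrand: "x : Vec q ==> (%w. ln (1 + vn (prodA n w *v x))) : Bor S" using measurable_vn_prodA[of x n] by measurable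

lemma integrable_growth: "x : Vec q ==> integrable S (%w. ln (1 + vn (prodA n w *v x)))" using growth_integrand_bound measurable_growth_integrand
by (intro P.integrable_const_bound[of _ "ln (1 + real q * b ^ n * vn x)"] AE_I2) auto

lemma mn_prodA_lower:
assumes "w : space S"
shows "1 <= b ^ n * mn (prodA n w)"
proof -
have u: "unit_vec q 0 : Vec q" "vn (unit_vec q 0) = 1" using q_pos by auto
have "vn (unit_vec q 0) <= b ^ n * vn (prodA n w *v unit_vec q 0)" by (rule prodA_lower[OF assms u(1)])
also have "... <= b ^ n * (mn (prodA n w) * vn (unit_vec q 0))" using vn_mult[OF prodA_carrier[OF assms] u(1)] b_ge_1 by (intro mult_left_mono) auto
finally show ?thesis using u(2) by simp
qed

lemma ln_mn_prodA_bound: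
assumes "w : space S"
shows "abs (ln (mn (prodA n w))) <= real n * ln b + ln (real q)" "0 < mn (prodA n w)"
proof -
have bn: "0 < b ^ n" using b_ge_1 by simp
have "0 < b ^ n * mn (prodA n w)" using mn_prodA_lower[OF assms, of n] by linarith
thus p: "0 < mn (prodA n w)" by (rule zero_less_mult_pos[OF _ bn])
have "ln 1 <= ln (b ^ n * mn (prodA n w))" using mn_prodA_lower[OF assms] by (intro ln_mono) auto
also have "... = real n * ln b + ln (mn (prodA n w))" using bn p b_ge_1 by (simp add: ln_mult_pos ln_realpow)
finally have 1: "0 <= real n * ln b + ln (mn (prodA n w))" by simp
have "ln (mn (prodA n w)) <= ln (real q * b ^ n)" using prodA_norm[OF assms] p by (intro ln_mono)
also have "... = ln (real q) + real n * ln b" using q_pos b_ge_1 by (simp add: ln_mult_pos ln_realpow)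
finally have 2: "ln (mn (prodA n w)) <= ln (real q) + real n * ln b" .
have "0 <= ln (real q)" using q_ge_1 by simp
with 1 2 show "abs (ln (mn (prodA n w))) <= real n * ln b + ln (real q)" by linarith
qed

lemma integrable_ln_mn_prodA: "integrable S (%w. ln (mn (prodA n w)))"
using ln_mn_prodA_bound(1) by (intro P.integrable_const_bound[of _ "real n * ln b + ln (real q)"] AE_I2) auto

lemma growth_nonneg: "0 <= growth n x" unfolding growth_def by (intro LINT_nonneg) simp

lemma growth_add:
assumes xy: "x : Vec q" "y : Vec q"
shows "growth n (x + y) <= growth n x + growth n y"
proof -
have "growth n (x + y) <= (LINT w|S. ln (1 + vn (prodA n w *v x)) + ln (1 + vn (prodA n w *v y)))" unfolding growth_def
proof (intro integral_mono L1_add integrable_growth)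
 fix w assume "w : space S"
 hence c: "prodA n w : Mat q q" by simp
 show "ln (1 + vn (prodA n w *v (x + y))) <= ln (1 + vn (prodA n w *v x)) + ln (1 + vn (prodA n w *v y))"
  using vn_add[of "prodA n w *v x" q "prodA n w *v y"] c xy by (intro ln_one_plus_add) (auto simp: Mv_add[OF c xy])
qed (use xy in auto)
also have "... = growth n x + growth n y" unfolding growth_def using integrable_growth xy by (intro LINT_add)
finally show ?thesis .
qed

lemma growth_smult:
assumes x: "x : Vec q"
shows "growth n (c .v x) <= ln (1 + abs c) + growth n x"
proof -
have "growth n (c .v x) <= (LINT w|S. ln (1 + abs c) + ln (1 + vn (prodA n w *v x)))" unfolding growth_def
proof (intro integral_mono L1_add integrable_growth)
 fix w assume "w : space S"
 hence "prodA n w *v (c .v x) = c .v (prodA n w *v x)" using mult_mat_vec[OF prodA_carrier x] by simp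
 thus "ln (1 + vn (prodA n w *v (c .v x))) <= ln (1 + abs c) + ln (1 + vn (prodA n w *v x))" by (intro ln_one_plus_mult) auto
qed (use x in auto)
also have "... = ln (1 + abs c) + growth n x" unfolding growth_def using integrable_growth[OF x, of n] by (simp add: P.prob_space)
finally show ?thesis .
qed

lemma measurable_growth_first_step:
assumes x: "x : Vec q"
shows "(%s. growth n (A s *v x)) : Bor M"
proof -
have [measurable]: "(%w. ln (1 + vn (prodA (Suc n) w *v x))) : Bor S" by (rule measurable_growth_integrand[OF x])
have "(%s. LINT w|S. ln (1 + vn (prodA (Suc n) (case_nat s w) *v x))) : Bor M" by (rule P.borel_measurable_lebesgue_integral) measurable
moreover have "growth n (A s *v x) = (LINT w|S. ln (1 + vn (prodA (Suc n) (case_nat s w) *v x)))" if s: "s : space M" for s unfolding growth_def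
 using Mv_assoc[OF prodA_carrier A_carrier[OF s] x] s by (intro LINT_cong) (simp_all add: prodA_case_nat)
ultimately show ?thesis by (subst measurable_cong) auto
qed

lemma growth_Suc:
assumes x: "x : Vec q"
shows "growth (Suc n) x = (LINT s|M. growth n (A s *v x))"
proof -
have "growth (Suc n) x = (LINT s|M. LINT w|S. ln (1 + vn (prodA (Suc n) (case_nat s w) *v x)))"
 unfolding growth_def by (rule integral_case_nat[OF measurable_growth_integrand[OF x] growth_integrand_bound[OF _ x]])
also have "... = (LINT s|M. growth n (A s *v x))" unfolding growth_def using Mv_assoc[OF prodA_carrier A_carrier x]
 by (intro LINT_cong refl) (simp add: prodA_case_nat)
finally show ?thesis .
qed

lemma growth_first_step_bound:
assumes x: "x : Vec q" and s: "s : space M"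
shows "growth n (A s *v x) <= ln (1 + real q * b ^ n * (b * vn x))"
proof -
have Ax: "A s *v x : Vec q" using A_carrier[OF s] x by simp
have "growth n (A s *v x) <= ln (1 + real q * b ^ n * vn (A s *v x))" unfolding growth_def
proof (rule P.integral_le_const[OF integrable_growth[OF Ax]], rule AE_I2)
 fix w assume "w : space S"
 from growth_integrand_bound[OF this Ax, of n] show "ln (1 + vn (prodA n w *v (A s *v x))) <= ln (1 + real q * b ^ n * vn (A s *v x))" by simp
qed
also have "... <= ln (1 + real q * b ^ n * (b * vn x))"
proof (rule ln_mono)
 have "vn (A s *v x) <= b * vn x" using order_trans[OF vn_mult[OF A_carrier[OF s] x] mult_right_mono[OF A_norm[OF s]]] by simp
 thus "1 + real q * b ^ n * vn (A s *v x) <= 1 + real q * b ^ n * (b * vn x)" using b_ge_1 by (intro add_mono mult_left_mono) auto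
 show "0 < 1 + real q * b ^ n * vn (A s *v x)" using b_ge_1 by (intro add_pos_nonneg) auto
qed
finally show ?thesis .
qed

definition slow :: "real vec set" where
"slow = {x : Vec q. summable (%n. wt n * growth n x)}"

lemma lsub_slow: "lsub q slow" unfolding lsub_def
proof (intro conjI ballI allI)
show "slow <= Vec q" by (auto simp: slow_def)
have "growth n (0v q) = 0" for n unfolding growth_def using mult_mat_zero_vec[OF prodA_carrier] by (simp cong: LINT_cong)
thus "0v q : slow" by (simp add: slow_def)
fix x assume x: "x : slow"
hence xc: "x : Vec q" and xs: "summable (%n. wt n * growth n x)" by (auto simp: slow_def)
{
 fix y assume "y : slow"
 hence yc: "y : Vec q" and ys: "summable (%n. wt n * growth n y)" by (auto simp: slow_def)
 have "summable (%n. wt n * growth n (x + y))"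
 proof (rule summable_comparison_test'[OF summable_add[OF xs ys], of 0])
  fix n
  have "wt n * growth n (x + y) <= wt n * (growth n x + growth n y)" using growth_add[OF xc yc] by (intro mult_left_mono) auto
  thus "norm (wt n * growth n (x + y)) <= wt n * growth n x + wt n * growth n y" by (simp add: growth_nonneg distrib_left)
 qed
 thus "x + y : slow" using xc yc by (simp add: slow_def)
}
fix c
have "summable (%n. wt n * growth n (c .v x))"
proof (rule summable_comparison_test'[OF summable_add[OF summable_mult2[OF summable_wt, of "ln (1 + abs c)"] xs], of 0])
 fix n
 have "wt n * growth n (c .v x) <= wt n * (ln (1 + abs c) + growth n x)" using growth_smult[OF xc] by (intro mult_left_mono) auto
 thus "norm (wt n * growth n (c .v x)) <= wt n * ln (1 + abs c) + wt n * growth n x" by (simp add: growth_nonneg distrib_left)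
qed
thus "c .v x : slow" using xc by (simp add: slow_def)
qed

text \<open>
  Integrating over the first matrix shifts the series by one place, so the series of the moved vector
  has a finite expectation.
\<close>

lemma slow_step:
assumes x: "x : slow"
shows "AE s in M. A s *v x : slow"
proof -
have xc: "x : Vec q" and xs: "summable (%n. wt n * growth n x)" using x by (auto simp: slow_def)
have m: "(%s. ennreal (wt n * growth n (A s *v x))) : Bor M" for n using measurable_growth_first_step[OF xc, of n] by measurable
have "(\<integral>\<^sup>+s. (\<Sum>n. ennreal (wt n * growth n (A s *v x))) \<partial>M) = (\<Sum>n. \<integral>\<^sup>+s. ennreal (wt n * growth n (A s *v x)) \<partial>M)"
 by (rule nn_integral_suminf[OF m])
also have "... = (\<Sum>n. ennreal (wt n * growth (Suc n) x))"
proof (intro suminf_cong)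
 fix n
 have "integrable M (%s. growth n (A s *v x))" by (rule M.integrable_const_bound[of _ "ln (1 + real q * b ^ n * (b * vn x))"])
   (auto simp: growth_nonneg measurable_growth_first_step[OF xc] intro!: AE_I2 growth_first_step_bound[OF xc])
 thus "(\<integral>\<^sup>+s. ennreal (wt n * growth n (A s *v x)) \<partial>M) = ennreal (wt n * growth (Suc n) x)"
  by (subst nn_integral_eq_integral) (auto simp: growth_nonneg growth_Suc[OF xc])
qed
also have "... ~= \<infinity>"
proof -
 have "summable (%n. 4 * (wt (Suc n) * growth (Suc n) x))" using xs summable_Suc_iff[of "%n. wt n * growth n x"] by (intro summable_mult) simp
 hence "summable (%n. wt n * growth (Suc n) x)"
 proof (rule summable_comparison_test'[of _ 0])
  fix n
  have "wt n * growth (Suc n) x <= (4 * wt (Suc n)) * growth (Suc n) x" using wt_le growth_nonneg by (intro mult_right_mono)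
  thus "norm (wt n * growth (Suc n) x) <= 4 * (wt (Suc n) * growth (Suc n) x)" by (simp add: growth_nonneg)
 qed
 from ennreal_suminf_neq_top[OF this mult_nonneg_nonneg[OF wt_nonneg growth_nonneg]] show ?thesis
  by (simp only: infinity_ennreal_def not_False_eq_True)
qed
finally have "AE s in M. (\<Sum>n. ennreal (wt n * growth n (A s *v x))) ~= \<infinity>"
 using m by (intro nn_integral_PInf_AE borel_measurable_suminf) auto
thus ?thesis using AE_space
proof eventually_elim
 case (elim s)
 hence "summable (%n. wt n * growth n (A s *v x))" by (intro summable_suminf_not_top) (auto simp: growth_nonneg)
 thus ?case using A_carrier[OF elim(2)] xc by (simp add: slow_def)
qed
qed

text \<open>Almost every matrix maps the finitely many vectors of a basis to slow vectors.\<close>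

lemma slow_invariant: "AE s in M. ALL x:slow. A s *v x : slow"
proof -
obtain r B where B: "r <= q" "B : Mat q r" "inj_mat B" "rng B = slow" by (rule lsub_basis[OF lsub_slow])
obtain T where T: "T : Mat q q" "kern T = slow" using annihilator_exists[OF B(2,3)] B(4) by metis
have "AE s in M. ALL j:{..<r}. A s *v col B j : slow" using slow_step col_in_rng[OF B(2)] B(4) by (intro AE_finite_allI) auto
thus ?thesis using AE_space
proof eventually_elim
 case (elim s)
 have AB: "A s * B : Mat q r" using A_carrier[OF elim(2)] B(2) by simp
 have "col (A s * B) j : kern T" if "j < r" for j using elim(1) that T(2) col_mult2[OF A_carrier[OF elim(2)] B(2) that] by simp
 hence "rng (A s * B) <= kern T" using mult_eq_0_columns[OF T(1) AB] rng_subset_kern[OF AB T(1)] by blast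
 hence "(A s * B) *v y : slow" if "y : Vec r" for y using that B(2) T(2) by (auto simp: rng_def)
 thus ?case using Mv_assoc[OF A_carrier[OF elim(2)] B(2)] B by (auto simp: rng_def simp flip: B(4))
qed
qed

text \<open>
  The restriction of the random product to a complementary invariant subspace again has no
  exponential growth, so it would have a slowly growing vector too.
\<close>

lemma slow_meets_invariant:
assumes ng: no_growth and U: "lsub q U" "U ~= {0v q}" and inv: "AE s in M. ALL x:U. A s *v x : U"
shows "EX x:U. x ~= 0v q & x : slow"
proof -
obtain r B where B: "r <= q" "B : Mat q r" "inj_mat B" "rng B = U" by (rule lsub_basis[OF U(1)])
note Bc = B(2)
obtain T where T: "T : Mat q q" "kern T = U" using annihilator_exists[OF B(2,3)] B(4) by metis
obtain L where L: "L : Mat r q" "L * B = Id r" by (rule left_inverse_exists[OF B(2,3)])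
have r1: "1 <= r"
proof (rule ccontr)
 assume "\<not> 1 <= r"
 hence "r = 0" by simp
 have "x = 0v q" if "x : U" for x
 proof -
  obtain y where "y : Vec r" "x = B *v y" using \<open>x : U\<close> Bc B(4) by (auto simp: rng_def)
  thus ?thesis using \<open>r = 0\<close> Bc by (intro eq_vecI) (auto simp: scalar_prod_def)
 qed
 thus False using U by (auto simp: lsub_def)
qed
define b' where "b' = real q * (b * (1 + mn L) * (1 + mn B))"
have b'1: "1 <= b * (1 + mn L) * (1 + mn B)" "mn L * (b * mn B) <= b * (1 + mn L) * (1 + mn B)"
proof -
 have "1 <= b * (1 + mn L)" using mult_mono[of 1 b 1 "1 + mn L"] b_ge_1 by simp
 thus "1 <= b * (1 + mn L) * (1 + mn B)" using mult_mono[of 1 "b * (1 + mn L)" 1 "1 + mn B"] by simp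
 have "mn L * mn B <= (1 + mn L) * (1 + mn B)" by (intro mult_mono) auto
 hence "b * (mn L * mn B) <= b * ((1 + mn L) * (1 + mn B))" using b_ge_1 by (intro mult_left_mono) auto
 thus "mn L * (b * mn B) <= b * (1 + mn L) * (1 + mn B)" by (simp add: mult_ac)
qed
have b'2: "1 <= b'" "real r <= b'" "mn L * (b * mn B) <= b'"
proof -
 have "1 * (b * (1 + mn L) * (1 + mn B)) <= b'" unfolding b'_def using q_ge_1 b'1(1) by (intro mult_right_mono) auto
 with b'1 show "1 <= b'" "mn L * (b * mn B) <= b'" by linarith+
 have "real q * 1 <= b'" unfolding b'_def using b'1(1) by (intro mult_left_mono) auto
 thus "real r <= b'" using B(1) by simp
qed
define f where "f s = (if mn (T * (A s * B)) = 0 then L * (A s * B) else Id r)" for s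
have AB: "A s * B : Mat q r" if "s : space M" for s using A_carrier[OF that] Bc by simp
have factor: "A s * B = B * f s" if s: "s : space M" and z: "mn (T * (A s * B)) = 0" for s
proof -
 have "T * (A s * B) = 0m q r" using z mn_eq_0[OF mult_carrier_mat[OF T(1) AB[OF s]]] by simp
 hence "rng (A s * B) <= rng B" using rng_subset_kern[OF AB[OF s] T(1)] T(2) B(4) by simp
 then obtain R where R: "R : Mat r r" "A s * B = B * R" by (rule rng_factor[OF AB[OF s] Bc])
 have "L * (B * R) = R" using MM_assoc[OF L(1) Bc R(1)] L(2) R(1) by simp
 thus ?thesis using R z by (simp add: f_def)
qed
have fc: "f s : Mat r r" if "s : space M" for s using L(1) AB[OF that] by (simp add: f_def)
have ABm: "(%s. (A s * B) $$ (i, j)) : Bor M" if "i < q" "j < r" for i j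
 using Bc A_carrier A_meas that by (intro measurable_mult_mat_entries[of M A q q "%_. B" r]) auto
have XABm: "(%s. (X * (A s * B)) $$ (i, j)) : Bor M" if "X : Mat p q" "i < p" "j < r" for X p i j
 using AB ABm that by (intro measurable_mult_mat_entries[of M "%_. X" p q _ r]) auto
have [measurable]: "(%s. mn (T * (A s * B))) : Bor M" by (rule measurable_mn[of _ _ q r]) (use mult_carrier_mat[OF T(1) AB] XABm[OF T(1)] in auto)
have LR: "L *v (B *v v) = v" if "v : Vec r" for v using Mv_assoc[OF L(1) Bc that] L(2) that by simp
have vL: "vn v <= mn L * vn (B *v v)" if v: "v : Vec r" for v using vn_mult[OF L(1), of "B *v v"] LR[OF v] Bc v by simp
interpret R: random_matrices M f r b'
proof
 show "f s : Mat r r" if "s : space M" for s by (rule fc[OF that])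
 show "(%s. f s $$ (i, j)) : Bor M" if ij: "i < r" "j < r" for i j
 proof -
  have [measurable]: "(%s. (L * (A s * B)) $$ (i, j)) : Bor M" by (rule XABm[OF L(1) ij])
  have "(%s. if mn (T * (A s * B)) = 0 then (L * (A s * B)) $$ (i, j) else Id r $$ (i, j)) : Bor M" by measurable
  thus ?thesis by (simp add: f_def if_distrib[of "%X. X $$ (i, j)"])
 qed
 fix s assume s: "s : space M"
 show "mn (f s) <= b'"
 proof (cases "mn (T * (A s * B)) = 0")
  case True
  have "mn (f s) <= mn L * mn (A s * B)" using True mn_mult[OF L(1) AB[OF s]] by (simp add: f_def)
  also have "... <= mn L * (b * mn B)"
   using order_trans[OF mn_mult[OF A_carrier[OF s] Bc] mult_right_mono[OF A_norm[OF s]]] by (intro mult_left_mono) auto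
  finally show ?thesis using b'2(3) by linarith
 qed (use b'2(2) in \<open>simp add: f_def\<close>)
 fix v :: "real vec" assume v: "v : Vec r"
 show "vn v <= b' * vn (f s *v v)"
 proof (cases "mn (T * (A s * B)) = 0")
  case True
  have Bv: "B *v v : Vec q" and Rv: "f s *v v : Vec r" using Bc fc[OF s] v by auto
  have e: "A s *v (B *v v) = B *v (f s *v v)" using Mv_assoc[OF A_carrier[OF s] Bc v] Mv_assoc[OF Bc fc[OF s] v] factor[OF s True] by simp
  have "vn v <= mn L * vn (B *v v)" by (rule vL[OF v])
  also have "... <= mn L * (b * vn (A s *v (B *v v)))" using A_lower[OF s Bv] by (intro mult_left_mono) auto
  also have "... <= mn L * (b * (mn B * vn (f s *v v)))" unfolding e using vn_mult[OF Bc Rv] b_ge_1 by (intro mult_left_mono) auto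
  also have "... = (mn L * (b * mn B)) * vn (f s *v v)" by simp
  also have "... <= b' * vn (f s *v v)" using b'2(3) by (intro mult_right_mono) auto
  finally show ?thesis .
 next
  case False
  thus ?thesis using v mult_right_mono[OF b'2(1), of "vn v"] by (simp add: f_def)
 qed
qed (use r1 b'2(1) in auto)
have good: "AE w in S. w : space S & (ALL n. mn (T * (A (w n) * B)) = 0)"
proof -
 have "AE s in M. mn (T * (A s * B)) = 0" using inv AE_space
 proof eventually_elim
  case (elim s)
  have "rng (A s * B) <= kern T" using elim(1) AB[OF elim(2)] Mv_assoc[OF A_carrier[OF elim(2)] Bc] T(2) B(4) Bc by (auto simp: rng_def)
  thus ?case using rng_subset_kern[OF AB[OF elim(2)] T(1)] by simp
 qed
 hence "AE w in S. mn (T * (A (w n) * B)) = 0" for n by (rule AE_PiM_component[rotated -1]) (auto intro: M.prob_space_axioms)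
 hence "AE w in S. ALL n. mn (T * (A (w n) * B)) = 0" by (simp add: AE_all_countable)
 with AE_space show ?thesis by eventually_elim simp
qed
have intertwine: "prodA n w * B = B * R.prodA n w"
 if w: "w : space S" "ALL n. mn (T * (A (w n) * B)) = 0" for n w
proof (induction n)
 case 0
 thus ?case using Bc by simp
next
 case (Suc n)
 have s: "w n : space M" using w by (simp add: space_S)
 have "prodA (Suc n) w * B = A (w n) * (prodA n w * B)" unfolding prodA_Suc by (rule MM_assoc[OF A_carrier[OF s] prodA_carrier[OF w(1)] Bc])
 also have "... = (A (w n) * B) * R.prodA n w" unfolding Suc by (rule MM_assoc[OF A_carrier[OF s] Bc R.prodA_carrier[OF w(1)], symmetric])
 also have "... = B * R.prodA (Suc n) w" unfolding R.prodA_Suc using factor[OF s] w(2) MM_assoc[OF Bc fc[OF s] R.prodA_carrier[OF w(1)]] by simp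
 finally show ?case .
qed
have R_ng: "R.no_growth" unfolding R.no_growth_def
proof (intro allI impI)
 fix e :: real assume e: "0 < e"
 define k where "k = real q * real q * fact (q - 1)"
 have k: "0 <= k" by (simp add: k_def)
 define D where "D = real r * (mn L * (k * mn B))"
 have D0: "0 <= D" using k by (simp add: D_def)
 define c where "c = 1 + mn L * mn B + fact r * D ^ r"
 have c1: "1 <= c" using D0 by (simp add: c_def)
 define e' where "e' = e / (2 * real (q * r))"
 have qr: "1 <= q * r" using q_pos r1 by simp
 have e': "0 < e'" using e qr by (simp add: e'_def)
 have e'2: "real (q * r) * e' = e / 2" using qr by (simp add: e'_def)
 have "eventually (%n. ln c / real n < e / 2) sequentially" by (rule order_tendstoD(2)[OF lim_const_over_n]) (use e in simp)
 hence ev: "eventually (%n. c <= exp (real n * (e / 2))) sequentially" using eventually_gt_at_top[of 0]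
 proof eventually_elim
  case (elim n)
  hence "ln c <= real n * (e / 2)" by (simp add: divide_less_eq mult.commute)
  hence "exp (ln c) <= exp (real n * (e / 2))" by (subst exp_le_cancel_iff)
  thus ?case using c1 by simp
 qed
 have "AE w in S. eventually (%n. mn (prodA n w) <= exp (real n * e') & exp (- (real n * e')) <= abs (det (prodA n w))) sequentially"
  using ng e' by (simp add: no_growth_def)
 thus "AE w in S. eventually (%n. mn (R.prodA n w) <= exp (real n * e) & exp (- (real n * e)) <= abs (det (R.prodA n w))) sequentially" using good
 proof eventually_elim
  case (elim w)
  note w = elim(2)[THEN conjunct1] elim(2)[THEN conjunct2]
  from elim(1) ev show ?case
  proof eventually_elim
   case (elim n)
   have Pc: "prodA n w : Mat q q" and Rc: "R.prodA n w : Mat r r" using w by auto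
   define E where "E = exp (real n * e')"
   have E1: "1 <= E" using e' by (simp add: E_def)
   have EE: "E ^ (q * r) = exp (real n * (e / 2))"
   proof -
    have "E ^ (q * r) = exp (real (q * r) * (real n * e'))" by (simp only: E_def exp_of_nat_mult)
    also have "real (q * r) * (real n * e') = real n * (real (q * r) * e')" by simp
    finally show ?thesis unfolding e'2 .
   qed
   have E_le: "E <= E ^ (q * r)" using E1 qr power_increasing[of 1 "q * r" E] by simp
   have two: "exp (real n * (e / 2)) * exp (real n * (e / 2)) = exp (real n * e)" by (subst exp_add[symmetric]) simp
   have "R.prodA n w = L * (prodA n w * B)" unfolding intertwine[OF w] using MM_assoc[OF L(1) Bc Rc] L(2) Rc by simp
   hence "mn (R.prodA n w) <= mn L * mn (prodA n w * B)" using mn_mult[OF L(1) mult_carrier_mat[OF Pc Bc]] by simp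
   also have "... <= mn L * (E * mn B)"
    using order_trans[OF mn_mult[OF Pc Bc] mult_right_mono[of _ E]] elim(1) by (intro mult_left_mono) (auto simp: E_def)
   also have "... = (mn L * mn B) * E" by simp
   also have "... <= c * exp (real n * (e / 2))" using E_le E1 D0 by (intro mult_mono) (auto simp: EE c_def)
   also have "... <= exp (real n * (e / 2)) * exp (real n * (e / 2))" using elim(2) by (intro mult_right_mono) auto
   finally have A: "mn (R.prodA n w) <= exp (real n * e)" unfolding two .
   have low: "vn v <= (mn L * (k * mn B) * E ^ q) * vn (R.prodA n w *v v)" if v: "v : Vec r" for v
   proof -
    have Bv: "B *v v : Vec q" and Rv: "R.prodA n w *v v : Vec r" using Bc Rc v by auto
    have i: "prodA n w *v (B *v v) = B *v (R.prodA n w *v v)" using Mv_assoc[OF Pc Bc v] Mv_assoc[OF Bc Rc v] intertwine[OF w, of n] by simp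
    have "(1 / E) * vn (B *v v) <= abs (det (prodA n w)) * vn (B *v v)"
     using elim(1) by (intro mult_right_mono) (simp_all add: E_def exp_minus inverse_eq_divide)
    also have "... <= k * mn (prodA n w) ^ (q - 1) * vn (prodA n w *v (B *v v))" unfolding k_def by (rule vn_inverse_bound[OF Pc Bv])
    also have "... <= k * E ^ (q - 1) * (mn B * vn (R.prodA n w *v v))"
     unfolding i using elim(1) k vn_mult[OF Bc Rv] E1 by (intro mult_mono mult_left_mono power_mono) (auto simp: E_def)
    finally have "E * ((1 / E) * vn (B *v v)) <= E * (k * E ^ (q - 1) * (mn B * vn (R.prodA n w *v v)))" using E1 by (intro mult_left_mono) auto
    moreover have "E * (k * E ^ (q - 1) * (mn B * vn (R.prodA n w *v v))) = E ^ q * (k * mn B * vn (R.prodA n w *v v))"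
    proof -
     have "E * E ^ (q - 1) = E ^ q" using q_pos power_Suc[of E "q - 1"] by simp
     thus ?thesis by (simp only: mult_ac flip: \<open>E * E ^ (q - 1) = E ^ q\<close>)
    qed
    moreover have "E * ((1 / E) * vn (B *v v)) = vn (B *v v)" using E1 by simp
    ultimately have "vn (B *v v) <= E ^ q * (k * mn B * vn (R.prodA n w *v v))" by linarith
    hence "mn L * vn (B *v v) <= mn L * (E ^ q * (k * mn B * vn (R.prodA n w *v v)))" by (intro mult_left_mono) auto
    thus ?thesis using vL[OF v] by (simp add: mult_ac)
   qed
   obtain Y where Y: "Y : Mat r r" "R.prodA n w * Y = Id r" "mn Y <= real r * (mn L * (k * mn B) * E ^ q)"
    by (rule R.lower_bound_imp_inverse[OF Rc low]) blast
   have "abs (det Y) <= fact r * mn Y ^ r" by (rule det_le_mn[OF Y(1)])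
   also have "... <= fact r * (D * E ^ q) ^ r" using Y(3) by (intro mult_left_mono power_mono) (auto simp: D_def mult_ac)
   also have "... = (fact r * D ^ r) * E ^ (q * r)" by (simp add: power_mult_distrib power_mult)
   also have "... <= c * exp (real n * (e / 2))" unfolding EE by (intro mult_right_mono) (auto simp: c_def)
   also have "... <= exp (real n * (e / 2)) * exp (real n * (e / 2))" using elim(2) by (intro mult_right_mono) auto
   finally have dY: "abs (det Y) <= exp (real n * e)" unfolding two .
   have "det (R.prodA n w) * det Y = 1" using det_mult[OF Rc Y(1)] Y(2) by simp
   hence "1 = abs (det (R.prodA n w)) * abs (det Y)" by (simp flip: abs_mult)
   also have "... <= abs (det (R.prodA n w)) * exp (real n * e)" using dY by (intro mult_left_mono) auto
   finally have "exp (- (real n * e)) <= abs (det (R.prodA n w))" by (simp add: exp_minus field_simps)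
   with A show ?case by simp
  qed
 qed
qed
obtain y c where y: "y : Vec r" "y ~= 0v r" "0 <= c"
 "!!n. (LINT w|S. ln (1 + vn (R.prodA n w *v y))) <= c * sqrt (real (Suc n))" by (rule R.slow_vector[OF R_ng]) blast
define x where "x = B *v y"
have x: "x : Vec q" using Bc y by (simp add: x_def)
have xU: "x : U" using Bc y B(4) by (auto simp: rng_def x_def)
have x0: "x ~= 0v q" using inj_matD[OF B(3) Bc y(1)] y(2) by (auto simp: x_def)
have gr: "growth n x <= ln (1 + mn B) + c * sqrt (real (Suc n))" for n
proof -
 have "growth n x <= (LINT w|S. ln (1 + mn B) + ln (1 + vn (R.prodA n w *v y)))" unfolding growth_def
 proof (intro integral_mono_AE L1_add integrable_growth[OF x] R.integrable_growth[OF y(1)])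
  show "AE w in S. ln (1 + vn (prodA n w *v x)) <= ln (1 + mn B) + ln (1 + vn (R.prodA n w *v y))" using good
  proof eventually_elim
   case (elim w)
   have Pc: "prodA n w : Mat q q" and Rc: "R.prodA n w : Mat r r" using elim by auto
   have "prodA n w *v x = B *v (R.prodA n w *v y)" using Mv_assoc[OF Pc Bc y(1)] Mv_assoc[OF Bc Rc y(1)] intertwine[of w n] elim by (simp add: x_def)
   thus ?case using vn_mult[OF Bc, of "R.prodA n w *v y"] Rc y(1) by (intro ln_one_plus_mult) auto
  qed
 qed auto
 also have "... = ln (1 + mn B) + (LINT w|S. ln (1 + vn (R.prodA n w *v y)))" using R.integrable_growth[OF y(1), of n] by (simp add: P.prob_space)
 finally show ?thesis using y(4)[of n] by linarith
qed
have "summable (%n. wt n * growth n x)"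
proof (rule summable_comparison_test'[OF summable_add[OF summable_mult2[OF summable_wt, of "ln (1 + mn B)"] summable_mult[OF summable_wt_sqrt, of c]], of 0])
 fix n
 have "wt n * growth n x <= wt n * (ln (1 + mn B) + c * sqrt (real (Suc n)))" using gr by (intro mult_left_mono) auto
 thus "norm (wt n * growth n x) <= wt n * ln (1 + mn B) + c * (wt n * sqrt (real (Suc n)))" by (simp add: growth_nonneg algebra_simps)
qed
thus ?thesis using x x0 xU by (auto simp: slow_def)
qed

text \<open>
  The subspace of slowly growing vectors is invariant and meets every nonzero invariant subspace outside \<open>0\<close>, so under
  semisimplicity it is everything.  Subadditivity turns the summability into a bound.
\<close>

theorem expected_growth_bound:
assumes ng: no_growth
 and ss: "!!W. lsub q W ==> AE s in M. ALL x:W. A s *v x : W ==>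
  EX U. lsub q U & (AE s in M. ALL x:U. A s *v x : U) & W Int U = {0v q} \<and>
   (ALL x:Vec q. EX w:W. EX u:U. x = w + u)"
obtains C where "0 <= C" "!!n. (LINT w|S. ln (mn (prodA n w))) <= C * real (Suc n) powr (3 / 4)"
proof -
obtain U where U: "lsub q U" "AE s in M. ALL x:U. A s *v x : U" "slow Int U = {0v q}"
 "!!x. x : Vec q ==> EX w:slow. EX u:U. x = w + u" using ss[OF lsub_slow slow_invariant] by blast
have "U = {0v q}"
proof (rule ccontr)
 assume "U ~= {0v q}"
 from slow_meets_invariant[OF ng U(1) this U(2)] U(3) show False by blast
qed
have slow_all: "x : slow" if x: "x : Vec q" for x
proof -
 obtain w where w: "w : slow" "x = w + 0v q" using U(4)[OF x] \<open>U = {0v q}\<close> by blast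
 hence "w : Vec q" by (simp add: slow_def)
 thus ?thesis using w by simp
qed
define v where "v n = (LINT w|S. ln (1 + mn (prodA n w)))" for n
have bd: "ln (1 + mn (prodA n w)) <= ln (1 + real q * b ^ n)" if "w : space S" for w n
 using prodA_norm[OF that, of n] mn_nonneg[of "prodA n w"] by (intro ln_mono) linarith+
have int: "integrable S (%w. ln (1 + mn (prodA n w)))" for n using bd by (intro P.integrable_const_bound[of _ "ln (1 + real q * b ^ n)"] AE_I2) auto
have v0: "0 <= v n" for n unfolding v_def by (intro LINT_nonneg) simp
have v_sub: "v (m + n) <= v m + v n" for m n
proof -
 have "v (m + n) <= (LINT w|S. ln (1 + mn (prodA m w)) + ln (1 + mn (prodA n ((shift ^^ m) w))))" unfolding v_def
 proof (intro integral_mono L1_add int)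
  show "integrable S (%w. ln (1 + mn (prodA n ((shift ^^ m) w))))"
   using bd shift_space by (intro P.integrable_const_bound[of _ "ln (1 + real q * b ^ n)"] AE_I2) auto
  fix w assume w: "w : space S"
  have "mn (prodA (m + n) w) <= mn (prodA n ((shift ^^ m) w)) * mn (prodA m w)"
   unfolding prodA_add[OF w] using w shift_space[OF w] by (intro mn_mult[of _ q q _ q]) auto
  thus "ln (1 + mn (prodA (m + n) w)) <= ln (1 + mn (prodA m w)) + ln (1 + mn (prodA n ((shift ^^ m) w)))"
   by (intro ln_one_plus_mult) (auto simp: mult.commute)
 qed
 also have "... = v m + (LINT w|S. ln (1 + mn (prodA n ((shift ^^ m) w))))" unfolding v_def
 proof (intro LINT_add int)
  show "integrable S (%w. ln (1 + mn (prodA n ((shift ^^ m) w))))"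
   using bd shift_space by (intro P.integrable_const_bound[of _ "ln (1 + real q * b ^ n)"] AE_I2) auto
 qed
 also have "(LINT w|S. ln (1 + mn (prodA n ((shift ^^ m) w)))) = v n" unfolding v_def by (rule integral_shift_funpow) measurable
 finally show ?thesis .
qed
have v_le: "v n <= (SUM j<q. growth n (unit_vec q j))" for n
proof -
 have "v n <= (LINT w|S. (SUM j<q. ln (1 + vn (prodA n w *v unit_vec q j))))" unfolding v_def
 proof (intro integral_mono int L1_sum integrable_growth)
  fix w assume "w : space S"
  hence c: "prodA n w : Mat q q" by simp
  have "col (prodA n w) j = prodA n w *v unit_vec q j" if "j < q" for j using col_mult2[OF c one_carrier_mat that] c that by simp
  hence "mn (prodA n w) = (SUM j<q. vn (prodA n w *v unit_vec q j))" unfolding mn_cols[OF c] by simp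
  thus "ln (1 + mn (prodA n w)) <= (SUM j<q. ln (1 + vn (prodA n w *v unit_vec q j)))" by (simp only:) (rule ln_one_plus_sum, auto)
 qed auto
 also have "... = (SUM j<q. growth n (unit_vec q j))" unfolding growth_def by (intro LINT_sum integrable_growth) auto
 finally show ?thesis .
qed
have sv: "summable (%n. wt n * v n)"
proof (rule summable_comparison_test'[of "%n. SUM j<q. wt n * growth n (unit_vec q j)" 0])
 show "summable (%n. SUM j<q. wt n * growth n (unit_vec q j))" using slow_all[OF unit_vec_carrier] by (intro summable_sum) (simp add: slow_def)
 fix n
 show "norm (wt n * v n) <= (SUM j<q. wt n * growth n (unit_vec q j))"
  using mult_left_mono[OF v_le[of n], of "wt n"] v0 by (simp add: sum_distrib_left)
qed
define C where "C = 2 * (\<Sum>n. wt n * v n)"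
show thesis
proof (rule that)
 show C0: "0 <= C" unfolding C_def using sv v0 by (intro mult_nonneg_nonneg suminf_nonneg) auto
 fix N
 have "real (Suc N) * v N = (SUM n<=N. v N)" by simp
 also have "... <= (SUM n<=N. v n + v (N - n))" using v_sub by (intro sum_mono) (metis atMost_iff le_add_diff_inverse)
 also have "... = (SUM n<=N. v n) + (SUM n<=N. v (N - n))" by (rule sum.distrib)
 also have "(SUM n<=N. v (N - n)) = (SUM n<=N. v n)" by (rule sum.reindex_bij_witness[of _ "%n. N - n" "%n. N - n"]) auto
 also have "(SUM n<=N. v n) + (SUM n<=N. v n) = 2 * (SUM n<=N. v n)" by simp
 also have "(SUM n<=N. v n) <= (SUM n<=N. real (Suc N) powr (7 / 4) * (wt n * v n))"
 proof (rule sum_mono)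
  fix n assume "n : {..N}"
  hence "1 <= real (Suc N) powr (7 / 4) * wt n" unfolding wt_def using powr_mono2'[of "- 7 / 4" "real (Suc n)" "real (Suc N)"]
    mult_left_mono[of "real (Suc N) powr (- 7 / 4)" "real (Suc n) powr (- 7 / 4)" "real (Suc N) powr (7 / 4)"]
   by (simp add: powr_add[symmetric] del: of_nat_Suc)
  from mult_right_mono[OF this v0[of n]] show "v n <= real (Suc N) powr (7 / 4) * (wt n * v n)" by (simp only: mult.assoc mult_1)
 qed
 also have "... = real (Suc N) powr (7 / 4) * (SUM n<=N. wt n * v n)" by (simp add: sum_distrib_left)
 also have "(SUM n<=N. wt n * v n) <= (\<Sum>n. wt n * v n)" using sum_le_suminf[OF sv, of "{..N}"] v0 by simp
 finally have "real (Suc N) * v N <= C * real (Suc N) powr (7 / 4)" by (simp add: C_def mult_left_mono mult_ac del: of_nat_Suc)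
 also have "... = real (Suc N) * (C * real (Suc N) powr (3 / 4))"
 proof -
  have "real (Suc N) * real (Suc N) powr (3 / 4) = real (Suc N) powr (1 + 3 / 4)" by (subst powr_add) simp
  thus ?thesis by simp
 qed
 finally have "v N <= C * real (Suc N) powr (3 / 4)" by simp
 moreover have "(LINT w|S. ln (mn (prodA N w))) <= v N"
  unfolding v_def using ln_mn_prodA_bound(2) by (intro integral_mono integrable_ln_mn_prodA int) (simp add: ln_mono)
 ultimately show "(LINT w|S. ln (mn (prodA N w))) <= C * real (Suc N) powr (3 / 4)" by linarith
qed
qed

end

section \<open>Compact subsets of the general linear group\<close>

lemma abs_entry_le_euclid_norm: "i < dim_vec v ==> abs (v $ i) <= euclid_norm v"
proof -
assume i: "i < dim_vec v"
have "(v $ i)^2 <= (SUM j<dim_vec v. (v $ j)^2)" using i by (intro member_le_sum) auto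
hence "sqrt ((v $ i)^2) <= sqrt (SUM j<dim_vec v. (v $ j)^2)" by (rule real_sqrt_le_mono)
thus ?thesis by (simp add: euclid_norm_def L2_set_def)
qed

lemma entry_le_op_norm:
assumes A: "A : Mat n m" and ij: "i < n" "j < m"
shows "abs (A $$ (i, j)) <= op_norm A"
proof -
have "col A j : rng A" by (rule col_in_rng[OF A ij(2)])
have u: "unit_vec m j : Vec (dim_col A)" using A by simp
have "(A *v unit_vec m j) $ i = (SUM l<m. A $$ (i, l) * (if l = j then 1 else 0))" using A ij by (subst index_mult_vec_sum) (auto intro!: sum.cong)
also have "... = (SUM l<m. if l = j then A $$ (i, l) else 0)" by (intro sum.cong) auto
also have "... = A $$ (i, j)" using ij by simp
finally have "abs (A $$ (i, j)) <= euclid_norm (A *v unit_vec m j)"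
 using abs_entry_le_euclid_norm[of i "A *v unit_vec m j"] A ij by (simp del: Mv_index)
also have "... <= op_norm A" using euclid_norm_unit_vec[OF ij(2)] by (intro op_norm_upper u) simp
finally show ?thesis .
qed

lemma mn_le_op_norm: "A : Mat n m ==> mn A <= real n * real m * op_norm A" by (intro mn_le_entries entry_le_op_norm)

lemma op_norm_le_mn: "op_norm A <= mn A"
proof (rule op_norm_least)
fix v assume v: "v : Vec (dim_col A)" "euclid_norm v <= 1"
have "euclid_norm (A *v v) <= (SUM i<dim_row A. abs ((A *v v) $ i))"
 using L2_set_le_sum_abs[of "%i. (A *v v) $ i" "{..<dim_row A}"] by (simp add: euclid_norm_def)
also have "... <= (SUM i<dim_row A. SUM j<dim_col A. abs (A $$ (i, j)))"
proof (rule sum_mono)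
 fix i assume i: "i : {..<dim_row A}"
 have "abs ((A *v v) $ i) <= (SUM j<dim_col A. abs (A $$ (i, j)) * abs (v $ j))"
  using i v by (subst index_mult_vec_sum) (auto intro!: order_trans[OF sum_abs] simp: abs_mult)
 also have "... <= (SUM j<dim_col A. abs (A $$ (i, j)) * 1)"
  using abs_entry_le_euclid_norm[of _ v] v by (intro sum_mono mult_left_mono) (auto intro: order_trans)
 finally show "abs ((A *v v) $ i) <= (SUM j<dim_col A. abs (A $$ (i, j)))" by simp
qed
finally show "euclid_norm (A *v v) <= mn A" by (simp add: mn_def)
qed

lemma GL_iff: "g : GL d <-> g : Mat d d & det g ~= 0" using invertible_mat_det by (auto simp: GL_def)

lemma openin_GL:
"openin (GL_topology d) U <-> U <= GL d & (ALL g:U. EX r>0. ALL h:GL d. op_norm (g - h) < r --> h : U)"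
proof -
have ball: "Metric_space.mball (GL d) (GL_dist d) g r = {h : GL d. op_norm (g - h) < r}" if "g : GL d" for g r
 using that by (auto simp: Metric_space.mball_def[OF Metric_space_GL] GL_dist_def)
have "(EX r>0. Metric_space.mball (GL d) (GL_dist d) g r <= U) <-> (EX r>0. ALL h:GL d. op_norm (g - h) < r --> h : U)"
 if "g : GL d" for g unfolding ball[OF that] by blast
thus ?thesis unfolding GL_topology_def Metric_space.openin_mtopology[OF Metric_space_GL] by blast
qed

lemma continuous_map_GL_Lipschitz:
assumes "!!g h. g : GL d ==> h : GL d ==> abs (f g - f h) <= L * op_norm (g - h)"
shows "continuous_map (GL_topology d) euclideanreal f" unfolding continuous_map_def
proof (intro conjI allI impI)
fix U :: "real set" assume "openin euclideanreal U"
hence U: "open U" by simp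
show "openin (GL_topology d) {g : topspace (GL_topology d). f g : U}" unfolding openin_GL topspace_GL_topology
proof (intro conjI ballI)
 fix g assume "g : {g : GL d. f g : U}"
 hence g: "g : GL d" "f g : U" by auto
 obtain e where e: "0 < e" "!!y. dist y (f g) < e ==> y : U" using U g(2) by (auto simp: open_dist)
 show "EX r>0. ALL h:GL d. op_norm (g - h) < r --> h : {g : GL d. f g : U}"
 proof (intro exI[of _ "e / (abs L + 1)"] conjI ballI impI)
  fix h assume h: "h : GL d" "op_norm (g - h) < e / (abs L + 1)"
  have "abs (f g - f h) <= L * op_norm (g - h)" by (rule assms[OF g(1) h(1)])
  also have "... <= (abs L + 1) * op_norm (g - h)" using op_norm_nonneg by (intro mult_right_mono) auto
  also have "... < e" using h(2) by (simp add: less_divide_eq mult.commute)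
  finally have "f h : U" by (intro e(2)) (simp add: dist_real_def abs_minus_commute)
  with h show "h : {g : GL d. f g : U}" by simp
 qed (use e in simp)
qed auto
qed simp

lemma continuous_entry: "i < d ==> j < d ==> continuous_map (GL_topology d) euclideanreal (%g. g $$ (i, j))"
proof (rule continuous_map_GL_Lipschitz[where L = 1])
fix g h assume "i < d" "j < d" "g : GL d" "h : GL d"
thus "abs (g $$ (i, j) - h $$ (i, j)) <= 1 * op_norm (g - h)"
 using entry_le_op_norm[of "g - h" d d i j] minus_carrier_mat[of h d d g] by (auto simp: GL_iff)
qed

lemma mn_diff_le:
assumes "g : Mat n m" "h : Mat n m"
shows "abs (mn g - mn h) <= mn (g - h)"
proof -
have 1: "g = (g - h) + h" and 2: "h = (h - g) + g" using assms by (auto intro!: eq_matI)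
have 3: "mn (h - g) = mn (g - h)" using assms by (auto simp: mn_def abs_minus_commute)
have "mn g <= mn (g - h) + mn h" using mn_add[of "g - h" n m h] assms minus_carrier_mat[OF assms(2), of g] by (simp flip: 1)
moreover have "mn h <= mn (h - g) + mn g" using mn_add[of "h - g" n m g] assms minus_carrier_mat[OF assms(1), of h] by (simp flip: 2)
ultimately show ?thesis using 3 by linarith
qed

lemma continuous_mn: "continuous_map (GL_topology d) euclideanreal mn"
proof (rule continuous_map_GL_Lipschitz[where L = "real d * real d"])
fix g h assume "g : GL d" "h : GL d"
hence c: "g : Mat d d" "h : Mat d d" by (auto simp: GL_iff)
show "abs (mn g - mn h) <= real d * real d * op_norm (g - h)" using mn_diff_le[OF c] mn_le_op_norm[OF minus_carrier_mat[OF c(2), of g]] by linarith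
qed

lemma continuous_det: "continuous_map (GL_topology d) euclideanreal det"
proof (rule continuous_map_eq)
show "continuous_map (GL_topology d) euclideanreal (%g. SUM p | p permutes {0..<d}. signof p * (PROD i = 0..<d. g $$ (i, p i)))"
 using permutes_lt by (intro continuous_map_sum continuous_map_real_mult continuous_map_prod continuous_map_const[THEN iffD2] continuous_entry)
  (auto simp: finite_permutations)
qed (auto simp: topspace_GL_topology GL_iff det_def')

lemma compact_GL_bounds:
assumes K: "compactin (GL_topology d) K"
obtains b where "2 <= b" "real d <= b" "!!g. g : K ==> mn g <= b"
 "!!g v. g : K ==> v : Vec d ==> vn v <= b * vn (g *v v)"
proof -
have KG: "K <= GL d" using compactin_subset_topspace[OF K] by (simp add: topspace_GL_topology)
have "bounded (mn ` K)" using image_compactin[OF K continuous_mn] by (simp add: compactin_euclidean_iff compact_imp_bounded)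
then obtain B where B: "!!g. g : K ==> mn g <= B" by (auto simp: bounded_iff)
have "EX D>0. ALL g:K. D <= abs (det g)"
proof (cases "K = {}")
 case False
 have "compact (det ` K)" using image_compactin[OF K continuous_det] by (simp add: compactin_euclidean_iff)
 hence "compact ((%x. abs x) ` det ` K)" by (intro compact_continuous_image continuous_intros)
 then obtain x where x: "x : (%x. abs x) ` det ` K" "!!y. y : (%x. abs x) ` det ` K ==> x <= y"
  using compact_attains_inf[of "(%x. abs x) ` det ` K"] False by blast
 have "0 < x" using x(1) KG by (auto simp: GL_iff)
 thus ?thesis using x(2) by auto
qed (auto intro: exI[of _ 1])
then obtain D where D: "0 < D" "!!g. g : K ==> D <= abs (det g)" by blast
define k where "k = real d * real d * fact (d - 1)"
define b where "b = 2 + real d + abs B + k * abs B ^ (d - 1) / D"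
have k: "0 <= k" by (simp add: k_def)
have t: "0 <= k * abs B ^ (d - 1) / D" using k D by simp
show thesis
proof (rule that[of b])
 show "2 <= b" "real d <= b" using t by (auto simp: b_def)
 show "mn g <= b" if "g : K" for g using B[OF that] t by (simp add: b_def)
 fix g and v :: "real vec" assume g: "g : K" and v: "v : Vec d"
 have gc: "g : Mat d d" using g KG by (auto simp: GL_iff)
 have "D * vn v <= abs (det g) * vn v" using D(2)[OF g] by (intro mult_right_mono) auto
 also have "... <= k * mn g ^ (d - 1) * vn (g *v v)" unfolding k_def by (rule vn_inverse_bound[OF gc v])
 also have "... <= k * abs B ^ (d - 1) * vn (g *v v)" using B[OF g] k by (intro mult_right_mono mult_left_mono power_mono) auto
 finally have "vn v <= k * abs B ^ (d - 1) / D * vn (g *v v)" using D(1) by (simp add: field_simps)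
 also have "... <= b * vn (g *v v)" by (intro mult_right_mono) (auto simp: b_def)
 finally show "vn v <= b * vn (g *v v)" .
qed
qed

section \<open>Measures with compact support\<close>

lemma space_prob_on_GL: "prob_on_GL d \<mu> ==> space \<mu> = GL d" using sets_eq_imp_space_eq[of \<mu> "sigma (GL d) {U. openin (GL_topology d) U}"]
by (simp add: prob_on_GL_def space_measure_of_conv)

lemma open_in_sets:
assumes "prob_on_GL d \<mu>" "openin (GL_topology d) U"
shows "U : sets \<mu>"
proof -
have "{U. openin (GL_topology d) U} <= Pow (GL d)" using openin_subset topspace_GL_topology by fastforce
hence "sets \<mu> = sigma_sets (GL d) {U. openin (GL_topology d) U}" using assms by (simp add: prob_on_GL_def)
with assms(2) show ?thesis by auto
qed

lemma continuous_measurable: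
assumes \<mu>: "prob_on_GL d \<mu>" and f: "continuous_map (GL_topology d) euclideanreal f"
shows "f : Bor \<mu>"
proof (rule borel_measurableI)
fix U :: "real set" assume "open U"
hence "openin (GL_topology d) {g : topspace (GL_topology d). f g : U}" using f by (simp add: continuous_map_def)
moreover have "{g : topspace (GL_topology d). f g : U} = f -` U Int space \<mu>" using \<mu> by (auto simp: space_prob_on_GL topspace_GL_topology)
ultimately show "f -` U Int space \<mu> : sets \<mu>" using open_in_sets[OF \<mu>] by metis
qed

lemma compact_in_sets:
assumes \<mu>: "prob_on_GL d \<mu>" and K: "compactin (GL_topology d) K"
shows "K : sets \<mu>"
proof -
have "closedin (GL_topology d) K"
 using compactin_imp_closedin[OF Metric_space.Hausdorff_space_mtopology[OF Metric_space_GL] K[unfolded GL_topology_def]]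
 by (simp add: GL_topology_def)
hence "openin (GL_topology d) (GL d - K)" by (simp add: closedin_def topspace_GL_topology)
from open_in_sets[OF \<mu> this] have "space \<mu> - (GL d - K) : sets \<mu>" by (rule sets.compl_sets)
moreover have "K <= GL d" using compactin_subset_topspace[OF K] by (simp add: topspace_GL_topology)
ultimately show ?thesis by (simp add: space_prob_on_GL[OF \<mu>] double_diff)
qed

text \<open>The boxes with rational data form a countable base, so the complement of the support is a null set.\<close>

lemma AE_msupp:
assumes \<mu>: "prob_on_GL d \<mu>"
shows "AE g in \<mu>. g : msupp d \<mu>"
proof -
interpret prob_space \<mu> using \<mu> by (simp add: prob_on_GL_def)
define box :: "rat list \<times> rat => real mat set" where
 "box p = {h : GL d. ALL i<d. ALL j<d. abs (h $$ (i, j) - of_rat (fst p ! (i * d + j))) < of_rat (snd p)}" for p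
have box_sets: "box p : sets \<mu>" for p
proof -
 have m: "(%h. h $$ (i, j)) : Bor \<mu>" if "i < d" "j < d" for i j by (rule continuous_measurable[OF \<mu> continuous_entry[OF that]])
 have "{h : space \<mu>. ALL i:{..<d}. ALL j:{..<d}. abs (h $$ (i, j) - of_rat (fst p ! (i * d + j))) < of_rat (snd p)} : sets \<mu>" (is "?B : _")
  using m by (intro sets.sets_Collect_finite_All borel_measurable_less borel_measurable_abs borel_measurable_diff) auto
 moreover have "?B = box p" by (auto simp: box_def space_prob_on_GL[OF \<mu>])
 ultimately show ?thesis by simp
qed
define N where "N = {p. emeasure \<mu> (box p) = 0}"
have "(UN p:N. box p) : null_sets \<mu>" using box_sets by (intro null_sets_UN' countableI_type) (auto simp: N_def null_sets_def)
moreover have "g : (UN p:N. box p)" if g: "g : GL d" "g ~: msupp d \<mu>" for g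
proof -
 obtain U where U: "openin (GL_topology d) U" "g : U" "emeasure \<mu> U = 0" using g by (auto simp: msupp_def not_gr_zero)
 obtain r where r: "0 < r" "!!h. h : GL d ==> op_norm (g - h) < r ==> h : U" using U(1,2) by (auto simp: openin_GL)
 have "0 < r / (2 * (real d * real d + 1))" using r(1) by (intro divide_pos_pos) (auto intro: add_nonneg_pos)
 then obtain e :: rat where e: "0 < real_of_rat e" "real_of_rat e < r / (2 * (real d * real d + 1))" using of_rat_dense by blast
 have "EX y::rat. abs (x - real_of_rat y) < real_of_rat e" for x :: real
 proof -
  obtain y where "x < real_of_rat y" "real_of_rat y < x + real_of_rat e" using of_rat_dense[of x "x + real_of_rat e"] e(1) by auto
  thus ?thesis by (intro exI[of _ y]) simp
 qed
 then obtain Y :: "real => rat" where Y: "!!x. abs (x - real_of_rat (Y x)) < real_of_rat e" by metis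
 define l where "l = map (%n. Y (g $$ (n div d, n mod d))) [0..<d * d]"
 have l: "l ! (i * d + j) = Y (g $$ (i, j))" if "i < d" "j < d" for i j
 proof -
  have "i * d + j < (i + 1) * d" using that by simp
  also have "... <= d * d" using that by (intro mult_right_mono) auto
  finally show ?thesis using that by (simp add: l_def)
 qed
 have gbox: "g : box (l, e)" using g Y by (auto simp: box_def l)
 have "box (l, e) <= U"
 proof
  fix h assume h: "h : box (l, e)"
  have c: "g : Mat d d" "h : Mat d d" "h : GL d" using h g by (auto simp: box_def GL_iff)
  have "mn (g - h) <= real d * real d * (2 * real_of_rat e)"
  proof (rule mn_le_entries)
   fix i j assume ij: "i < d" "j < d"
   have "abs (h $$ (i, j) - real_of_rat (Y (g $$ (i, j)))) < real_of_rat e" using h ij l by (auto simp: box_def)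
   thus "abs ((g - h) $$ (i, j)) <= 2 * real_of_rat e" using Y[of "g $$ (i, j)"] c ij by simp
  qed (use c in auto)
  also have "... <= (real d * real d + 1) * (2 * real_of_rat e)" using e(1) by (intro mult_right_mono) auto
  also have "... < r" using e(2) by (simp add: less_divide_eq mult_ac add_nonneg_pos)
  finally show "h : U" using op_norm_le_mn[of "g - h"] by (intro r(2) c(3)) linarith
 qed
 hence "emeasure \<mu> (box (l, e)) <= emeasure \<mu> U" using open_in_sets[OF \<mu> U(1)] by (intro emeasure_mono)
 hence "(l, e) : N" using U(3) by (simp add: N_def)
 with gbox show ?thesis by blast
qed
ultimately show ?thesis using \<mu> by (intro AE_I'[of "UN p:N. box p"]) (auto simp: space_prob_on_GL)
qed

text \<open>
  Off \<open>K\<close>, a null set for the measures in question, the identity matrix keeps the bounds valid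
  everywhere.
\<close>

definition cut :: "nat => real mat set => real mat => real mat" where
"cut d K g = (if g : K then g else Id d)"

locale GL_measure =
fixes d :: nat and K :: "real mat set" and b :: real and \<mu> :: "real mat measure"
assumes dim: "1 <= d" and \<mu>: "prob_on_GL d \<mu>" and K: "compactin (GL_topology d) K" and supp: "msupp d \<mu> <= K"
 and b2: "2 <= b" and db: "real d <= b" and K_norm: "!!g. g : K ==> mn g <= b"
 and K_lower: "!!g v. g : K ==> v : Vec d ==> vn v <= b * vn (g *v v)"
begin

lemma K_GL: "K <= GL d" using compactin_subset_topspace[OF K] by (simp add: topspace_GL_topology)

lemma K_carrier: "g : K ==> g : Mat d d" using K_GL by (auto simp: GL_iff)

lemma space_\<mu>: "space \<mu> = GL d" by (rule space_prob_on_GL[OF \<mu>])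

lemma AE_K: "AE g in \<mu>. g : K" using AE_msupp[OF \<mu>] supp by (auto elim!: eventually_mono)

lemma cut_carrier: "cut d K g : Mat d d" using K_carrier by (simp add: cut_def)

lemma K_sets: "K : sets \<mu>" by (rule compact_in_sets[OF \<mu> K])

lemma measurable_cut: "i < d ==> j < d ==> (%g. cut d K g $$ (i, j)) : Bor \<mu>"
proof -
assume ij: "i < d" "j < d"
have [measurable]: "(%g. g $$ (i, j)) : Bor \<mu>" by (rule continuous_measurable[OF \<mu> continuous_entry[OF ij]])
have [measurable]: "K : sets \<mu>" by (rule K_sets)
have "(%g. if g : K then g $$ (i, j) else Id d $$ (i, j)) : Bor \<mu>" by measurable
thus ?thesis by (simp add: cut_def if_distrib[of "%X. X $$ (i, j)"])
qed

end

sublocale GL_measure \<subseteq> random_matrices \<mu> "cut d K" d b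
proof (intro random_matrices.intro sequence_space_intro random_matrices_axioms.intro)
show "prob_space \<mu>" using \<mu> by (simp add: prob_on_GL_def)
show "mn (cut d K g) <= b" for g using K_norm db by (simp add: cut_def)
show "vn v <= b * vn (cut d K g *v v)" if "v : Vec d" for g v using K_lower[of g v] that b2 mult_right_mono[of 1 b "vn v"] by (auto simp: cut_def)
qed (use cut_carrier measurable_cut dim b2 in auto)

context GL_measure
begin

lemma AE_K_S: "AE w in S. ALL n. w n : K"
proof -
have "AE w in S. w n : K" for n using AE_K by (rule AE_PiM_component[rotated -1]) (auto intro: M.prob_space_axioms)
thus ?thesis by (simp add: AE_all_countable)
qed

lemma left_prod_eq_prodA: "ALL n. w n : K ==> left_prod d w n = prodA n w" by (simp add: prodA_def cut_def)

text \<open>The exponent is defined as the unique almost sure limit, which has just been shown to exist.\<close>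

lemma lyapunov_limit:
assumes i: "1 <= i" "i <= d"
shows "AE w in S. (%n. ln (singular_value (prodA n w) i) / real n) ---> lyap d \<mu> i"
proof -
obtain L where "AE w in S. (%n. ln (singular_value (prodA n w) (Suc (i - 1))) / real n) ---> L"
 by (rule singular_value_limit[of "i - 1"]) (use i in auto)
hence L: "AE w in S. (%n. ln (singular_value (prodA n w) i) / real n) ---> L" using i by simp
have L': "AE w in S. (%n. ln (singular_value (left_prod d w n) i) / real n) ---> L" using L AE_K_S by eventually_elim (simp add: left_prod_eq_prodA)
have "lyap d \<mu> i = L" unfolding lyapunov_exponent_def
proof (rule the_equality)
 show "AE w in S. (%n. ln (singular_value (left_prod d w n) i) / real n) ---> L" by (rule L')
 fix c assume "AE w in S. (%n. ln (singular_value (left_prod d w n) i) / real n) ---> c"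
 with L' have "AE w in S. c = L" by eventually_elim (rule LIMSEQ_unique)
 thus "c = L" by simp
qed
with L show ?thesis by simp
qed

lemma lyapunov_decreasing:
assumes "1 <= i" "i <= j" "j <= d"
shows "lyap d \<mu> j <= lyap d \<mu> i"
proof -
have ij: "1 <= i" "i <= d" "1 <= j" "j <= d" using assms by auto
have "AE w in S. lyap d \<mu> j <= lyap d \<mu> i" using lyapunov_limit[OF ij(1,2)] lyapunov_limit[OF ij(3,4)] AE_space
proof eventually_elim
 case (elim w)
 note sv = minors_norm_singular_values(3,4)[OF prodA_carrier[OF elim(3)] prodA_det[OF elim(3)] order_refl]
 show ?case
 proof (rule LIMSEQ_le[OF elim(2,1)], intro exI allI impI)
  fix n
  have "singular_value (prodA n w) (Suc (j - 1)) <= singular_value (prodA n w) (Suc (i - 1))" using assms by (intro sv(2)) auto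
  moreover have "0 < singular_value (prodA n w) (Suc (j - 1))" using assms by (intro sv(1)) auto
  ultimately show "ln (singular_value (prodA n w) j) / real n <= ln (singular_value (prodA n w) i) / real n"
   using ij by (intro divide_right_mono ln_mono) auto
 qed
qed
thus ?thesis by simp
qed

lemma lyapunov_first:
shows "AE w in S. (%n. ln (mn (prodA n w)) / real n) ---> lyap d \<mu> 1"
 and "1 <= n ==> lyap d \<mu> 1 <= (LINT w|S. ln (mn (prodA n w))) / real n"
proof -
obtain L where L: "AE w in S. (%n. ln (mn (prodA n w)) / real n) ---> L"
 "!!n. 1 <= n ==> L <= (LINT w|S. ln (mn (prodA n w))) / real n" by (rule norm_limit) blast
have "AE w in S. lyap d \<mu> 1 = L" using L(1) lyapunov_limit[OF order_refl dim] AE_space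
proof eventually_elim
 case (elim w)
 note fb = first_singular_value_bounds[OF prodA_carrier[OF elim(3)] prodA_det[OF elim(3)]]
 have s0: "0 < singular_value (prodA n w) 1" for n
  using minors_norm_singular_values(3)[OF prodA_carrier[OF elim(3)] prodA_det[OF elim(3)] order_refl, of 0 n] dim by simp
 have "(%n. ln (singular_value (prodA n w) 1) / real n) ---> L" by (rule ln_ratio_limit[OF elim(1) fb(3) s0 fb(2,1)])
 with elim(2) show ?case by (rule LIMSEQ_unique)
qed
hence "lyap d \<mu> 1 = L" by simp
with L show "AE w in S. (%n. ln (mn (prodA n w)) / real n) ---> lyap d \<mu> 1"
 and "1 <= n ==> lyap d \<mu> 1 <= (LINT w|S. ln (mn (prodA n w))) / real n" by auto
qed

lemma lyapunov_sum: "(SUM i<d. lyap d \<mu> (Suc i)) = (LINT g|\<mu>. ln (abs (det (cut d K g))))"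
proof -
have "AE w in S. ALL i:{..<d}. (%n. ln (singular_value (prodA n w) (Suc i)) / real n) ---> lyap d \<mu> (Suc i)"
 by (intro AE_finite_allI lyapunov_limit) auto
hence "AE w in S. (SUM i<d. lyap d \<mu> (Suc i)) = (LINT g|\<mu>. ln (abs (det (cut d K g))))" using det_limit AE_space
proof eventually_elim
 case (elim w)
 note sv = minors_norm_singular_values(3,5)[OF prodA_carrier[OF elim(3)] prodA_det[OF elim(3)] order_refl]
 have "(%n. SUM i<d. ln (singular_value (prodA n w) (Suc i)) / real n) ---> (SUM i<d. lyap d \<mu> (Suc i))" using elim(1) by (intro tendsto_sum) auto
 moreover have nz: "singular_value (prodA n w) (Suc i) ~= 0" if "i < d" for i n using sv(1)[OF that, of n] by simp
 have "(SUM i<d. ln (singular_value (prodA n w) (Suc i)) / real n) = ln (abs (det (prodA n w))) / real n" for n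
  unfolding sv(2)[of n, symmetric] sum_divide_distrib[symmetric] using sv(1) nz by (subst ln_prod) auto
 ultimately show ?case using LIMSEQ_unique[OF _ elim(2)] by simp
qed
thus ?thesis by simp
qed

end

section \<open>Expectations under two measures close in the Wasserstein distance\<close>

text \<open>
  Expanding the product of the row sums gives one term for every map of the indices, hence all terms
  of the Leibniz formula.
\<close>

lemma abs_det_le_prod_rows:
fixes A :: "real mat"
assumes A: "A : Mat n n"
shows "abs (det A) <= (PROD i:{0..<n}. SUM j:{0..<n}. abs (A $$ (i, j)))"
proof -
define r where "r p = restrict p {0..<n}" for p :: "nat => nat"
have inj: "inj_on r {p. p permutes {0..<n}}"
proof (rule inj_onI)
 fix p p' assume *: "p : {p. p permutes {0..<n}}" "p' : {p. p permutes {0..<n}}" "r p = r p'"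
 show "p = p'"
 proof
  fix x
  show "p x = p' x"
  proof (cases "x : {0..<n}")
   case True
   thus ?thesis using fun_cong[OF *(3), of x] by (simp add: r_def)
  next
   case False
   thus ?thesis using * by (auto simp: permutes_def)
  qed
 qed
qed
have sub: "r ` {p. p permutes {0..<n}} <= PiE {0..<n} (%_. {0..<n})" by (auto simp: r_def PiE_iff)
have "abs (det A) <= (SUM p | p permutes {0..<n}. abs (signof p * (PROD i = 0..<n. A $$ (i, p i))))" unfolding det_def'[OF A] by (rule sum_abs)
also have "... = (SUM p | p permutes {0..<n}. PROD i = 0..<n. abs (A $$ (i, r p i)))"
 by (intro sum.cong refl) (auto simp: abs_mult abs_prod r_def sign_def intro!: prod.cong)
also have "... = (SUM f:r ` {p. p permutes {0..<n}}. PROD i = 0..<n. abs (A $$ (i, f i)))" by (subst sum.reindex[OF inj]) simp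
also have "... <= (SUM f:PiE {0..<n} (%_. {0..<n}). PROD i = 0..<n. abs (A $$ (i, f i)))"
 by (intro sum_mono2 sub finite_PiE) (auto intro: prod_nonneg)
also have "... = (PROD i:{0..<n}. SUM j:{0..<n}. abs (A $$ (i, j)))" by (subst prod_sum_PiE) auto
finally show ?thesis .
qed

lemma det_perturbation:
fixes g h :: "real mat"
assumes g: "g : Mat n n" and h: "h : Mat n n" and Y: "Y : Mat n n" "h * Y = Id n"
shows "abs (det g) <= abs (det h) * (1 + mn (g - h) * mn Y) ^ n"
proof -
define E where "E = (g - h) * Y"
have gh: "g - h : Mat n n" by (rule minus_carrier_mat[OF h])
have E: "E : Mat n n" using gh Y by (simp add: E_def)
have gY: "g * Y : Mat n n" using g Y by simp
have "(g - h) * Y = g * Y - h * Y" by (rule minus_mult_distrib_mat[OF g h Y(1)])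
hence e: "(g * Y) $$ (i, j) = (if i = j then 1 else 0) + E $$ (i, j)" if "i < n" "j < n" for i j using that Y(2) by (simp add: E_def)
have row: "(SUM j:{0..<n}. abs ((g * Y) $$ (i, j))) <= 1 + mn E" if i: "i < n" for i
proof -
 have "(SUM j:{0..<n}. abs ((g * Y) $$ (i, j))) <= (SUM j:{0..<n}. (if i = j then 1 else 0) + abs (E $$ (i, j)))"
  using e[OF i] by (intro sum_mono) auto
 also have "... = 1 + (SUM j<n. abs (E $$ (i, j)))" using i by (simp add: lessThan_atLeast0)
 also have "(SUM j<n. abs (E $$ (i, j))) <= (SUM i<n. SUM j<n. abs (E $$ (i, j)))"
  using i by (intro member_le_sum[where f = "%i. SUM j<n. abs (E $$ (i, j))"]) auto
 finally show ?thesis using E by (simp add: mn_def)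
qed
have "abs (det (g * Y)) <= (PROD i:{0..<n}. SUM j:{0..<n}. abs ((g * Y) $$ (i, j)))" by (rule abs_det_le_prod_rows[OF gY])
also have "... <= (PROD i:{0..<n}. 1 + mn E)" using row by (intro prod_mono) simp
also have "... = (1 + mn E) ^ n" by simp
also have "... <= (1 + mn (g - h) * mn Y) ^ n" using mn_mult[OF gh Y(1)] by (intro power_mono) (auto simp: E_def)
finally have 1: "abs (det (g * Y)) <= (1 + mn (g - h) * mn Y) ^ n" .
have "det h * det Y = 1" using det_mult[OF h Y(1)] Y(2) by simp
hence "det g = det h * det (g * Y)" using det_mult[OF g Y(1)] by auto
hence "abs (det g) = abs (det h) * abs (det (g * Y))" by (simp add: abs_mult)
also have "... <= abs (det h) * (1 + mn (g - h) * mn Y) ^ n" using 1 by (intro mult_left_mono) auto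
finally show ?thesis .
qed

lemma op_norm_minus_commute:
"g : Mat n m ==> h : Mat n m ==> op_norm (h - g) = op_norm (g - h)"
proof -
assume "g : Mat n m" "h : Mat n m"
hence "h - g = - (g - h)" by auto
thus ?thesis using op_norm_uminus[of "g - h"] by auto
qed

lemma ln_diff_le: "0 < u ==> 0 < v ==> ln u - ln v <= (u - v) / (v::real)" using ln_le_minus_one[of "u / v"] by (simp add: ln_div diff_divide_distrib)

lemma mn_mult_lower:
assumes P: "P : Mat n n" and X: "X : Mat n r" and c: "!!v. v : Vec n ==> vn v <= c * vn (P *v v)"
shows "mn X <= c * mn (P * X)"
proof -
have "mn X = (SUM j<r. vn (col X j))" by (rule mn_cols[OF X])
also have "... <= (SUM j<r. c * vn (P *v col X j))" using X by (intro sum_mono c) auto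
also have "... = c * (SUM j<r. vn (col (P * X) j))" using col_mult2[OF P X] by (simp add: sum_distrib_left)
also have "... = c * mn (P * X)" using mn_cols[OF mult_carrier_mat[OF P X]] by simp
finally show ?thesis .
qed

context random_matrices
begin

text \<open>The free factor \<open>X\<close> on the right lets the first matrix of the product be split off.\<close>

definition logsize :: "nat => real mat => real" where
"logsize n X = (LINT w|S. ln (mn (prodA n w * X)))"

lemma logsize_one: "logsize n (Id q) = (LINT w|S. ln (mn (prodA n w)))"
unfolding logsize_def by (intro LINT_cong) (simp_all add: right_mult_one_mat[OF prodA_carrier])

lemma logsize_integrand_bounds:
assumes w: "w : space S" and X: "X : Mat q q" "0 < mn X"
shows "mn X <= b ^ n * mn (prodA n w * X)" "0 < mn (prodA n w * X)"
 "abs (ln (mn (prodA n w * X))) <= real n * ln b + ln (real q) + abs (ln (mn X))"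
proof -
show 1: "mn X <= b ^ n * mn (prodA n w * X)" by (rule mn_mult_lower[OF prodA_carrier[OF w] X(1) prodA_lower[OF w]])
have bn: "0 < b ^ n" using b_ge_1 by simp
have "0 < b ^ n * mn (prodA n w * X)" using 1 X(2) by linarith
thus p: "0 < mn (prodA n w * X)" by (rule zero_less_mult_pos[OF _ bn])
have "mn (prodA n w * X) <= mn (prodA n w) * mn X" by (rule mn_mult[OF prodA_carrier[OF w] X(1)])
also have "... <= real q * b ^ n * mn X" using prodA_norm[OF w] by (intro mult_right_mono) auto
finally have "ln (mn (prodA n w * X)) <= ln (real q * b ^ n * mn X)" using p by auto
also have "... = ln (real q) + real n * ln b + ln (mn X)" using q_pos b_ge_1 X(2) by (simp add: ln_mult_pos ln_realpow)
finally have up: "ln (mn (prodA n w * X)) <= ln (real q) + real n * ln b + ln (mn X)" .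
have "ln (mn X) <= ln (b ^ n * mn (prodA n w * X))" using 1 X(2) by auto
also have "... = real n * ln b + ln (mn (prodA n w * X))" using b_ge_1 p by (simp add: ln_mult_pos ln_realpow)
finally have low: "ln (mn X) <= real n * ln b + ln (mn (prodA n w * X))" .
have "0 <= ln (real q)" using q_ge_1 by simp
with up low show "abs (ln (mn (prodA n w * X))) <= real n * ln b + ln (real q) + abs (ln (mn X))" by linarith
qed

lemma measurable_logsize_integrand:
assumes X: "X : Mat q q"
shows "(%w. ln (mn (prodA n w * X))) : Bor S"
proof -
have "(%w. (prodA n w * X) $$ (i, j)) : Bor S" if "i < q" "j < q" for i j
 using X that by (intro measurable_mult_mat_entries[of S "prodA n" q q "%_. X" q]) auto
hence [measurable]: "(%w. mn (prodA n w * X)) : Bor S" using mult_carrier_mat[OF prodA_carrier X] by (intro measurable_mn[of _ _ q q]) auto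
show ?thesis by measurable
qed

lemma integrable_logsize:
assumes X: "X : Mat q q" "0 < mn X"
shows "integrable S (%w. ln (mn (prodA n w * X)))" using logsize_integrand_bounds(3)[OF _ X] measurable_logsize_integrand[OF X(1)]
by (intro P.integrable_const_bound[of _ "real n * ln b + ln (real q) + abs (ln (mn X))"] AE_I2) auto

lemma A_mult_pos:
assumes s: "s : space M" and X: "X : Mat q q" "0 < mn X"
shows "A s * X : Mat q q" "0 < mn (A s * X)" "abs (ln (mn (A s * X))) <= ln b + abs (ln (mn X))"
proof -
have 1: "mn X <= b * mn (A s * X)" by (rule mn_mult_lower[OF A_carrier[OF s] X(1) A_lower[OF s]])
show "A s * X : Mat q q" using A_carrier[OF s] X(1) by simp
have b0: "0 < b" using b_ge_1 by simp
have "0 < b * mn (A s * X)" using 1 X(2) by linarith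
thus p: "0 < mn (A s * X)" by (rule zero_less_mult_pos[OF _ b0])
have "mn (A s * X) <= b * mn X" using order_trans[OF mn_mult[OF A_carrier[OF s] X(1)] mult_right_mono[OF A_norm[OF s]]] by simp
hence "ln (mn (A s * X)) <= ln (b * mn X)" using p by auto
moreover have "ln (mn X) <= ln (b * mn (A s * X))" using 1 X(2) by auto
ultimately show "abs (ln (mn (A s * X))) <= ln b + abs (ln (mn X))" using b0 p X(2) by (simp add: ln_mult_pos abs_le_iff) linarith
qed

lemma logsize_bound:
assumes X: "X : Mat q q" "0 < mn X"
shows "abs (logsize n X) <= real n * ln b + ln (real q) + abs (ln (mn X))"
proof (rule abs_leI)
have "logsize n X <= (LINT w|S. real n * ln b + ln (real q) + abs (ln (mn X)))"
 unfolding logsize_def using logsize_integrand_bounds(3)[OF _ X, of _ n] integrable_logsize[OF X] by (intro integral_mono) (auto simp: abs_le_iff)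
thus "logsize n X <= real n * ln b + ln (real q) + abs (ln (mn X))" by (simp add: P.prob_space)
have "(LINT w|S. - (real n * ln b + ln (real q) + abs (ln (mn X)))) <= logsize n X" unfolding logsize_def
proof (intro integral_mono integrable_logsize[OF X])
 fix w assume "w : space S"
 from logsize_integrand_bounds(3)[OF this X, of n]
 show "- (real n * ln b + ln (real q) + abs (ln (mn X))) <= ln (mn (prodA n w * X))" by linarith
qed simp
thus "- logsize n X <= real n * ln b + ln (real q) + abs (ln (mn X))" by (simp add: P.prob_space)
qed

lemma logsize_case_nat:
assumes s: "s : space M" and X: "X : Mat q q"
shows "logsize n (A s * X) = (LINT w|S. ln (mn (prodA (Suc n) (case_nat s w) * X)))" unfolding logsize_def
using MM_assoc[OF prodA_carrier A_carrier[OF s] X] s by (intro LINT_cong) (simp_all add: prodA_case_nat)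

lemma measurable_logsize_step:
assumes X: "X : Mat q q"
shows "(%s. logsize n (A s * X)) : Bor M"
proof -
have [measurable]: "(%w. ln (mn (prodA (Suc n) w * X))) : Bor S" by (rule measurable_logsize_integrand[OF X])
show ?thesis using logsize_case_nat[OF _ X] by (subst measurable_cong) auto
qed

lemma logsize_Suc:
assumes X: "X : Mat q q" "0 < mn X"
shows "logsize (Suc n) X = (LINT s|M. logsize n (A s * X))"
proof -
have "logsize (Suc n) X = (LINT s|M. LINT w|S. ln (mn (prodA (Suc n) (case_nat s w) * X)))"
 unfolding logsize_def by (rule integral_case_nat[OF measurable_logsize_integrand[OF X(1)] logsize_integrand_bounds(3)[OF _ X]])
also have "... = (LINT s|M. logsize n (A s * X))" using logsize_case_nat[OF _ X(1)] by (intro LINT_cong) auto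
finally show ?thesis .
qed

lemma integrable_logsize_step:
assumes X: "X : Mat q q" "0 < mn X"
shows "integrable M (%s. logsize n (A s * X))"
proof (rule M.integrable_const_bound[OF AE_I2 measurable_logsize_step[OF X(1)]])
fix s assume "s : space M"
note AX = A_mult_pos[OF this X]
show "norm (logsize n (A s * X)) <= real n * ln b + ln (real q) + (ln b + abs (ln (mn X)))" using logsize_bound[OF AX(1,2), of n] AX(3) by simp
qed

text \<open>
  Both the difference and the lower bound are proportional to the size of \<open>X\<close>, so the constant does not
  depend on \<open>X\<close>; the induction over the number of factors relies on this.
\<close>

lemma logsize_step_Lipschitz:
assumes s: "s : space M" "t : space M" and X: "X : Mat q q" "0 < mn X"
shows "logsize n (A s * X) - logsize n (A t * X) <= real q * b ^ (2 * n + 1) * mn (A s - A t)"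
proof -
note sX = A_mult_pos[OF s(1) X] and tX = A_mult_pos[OF s(2) X]
have d: "A s - A t : Mat q q" by (rule minus_carrier_mat[OF A_carrier[OF s(2)]])
have b0: "0 < b" using b_ge_1 by simp
have pt: "ln (mn (prodA n w * (A s * X))) - ln (mn (prodA n w * (A t * X))) <= real q * b ^ (2 * n + 1) * mn (A s - A t)"
 if w: "w : space S" for w
proof -
 define u where "u = mn (prodA n w * (A s * X))"
 define v where "v = mn (prodA n w * (A t * X))"
 have u: "0 < u" unfolding u_def by (rule logsize_integrand_bounds(2)[OF w sX(1,2)])
 have v: "0 < v" unfolding v_def by (rule logsize_integrand_bounds(2)[OF w tX(1,2)])
 have "mn X <= b * mn (A t * X)" by (rule mn_mult_lower[OF A_carrier[OF s(2)] X(1) A_lower[OF s(2)]])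
 also have "... <= b * (b ^ n * v)" unfolding v_def using logsize_integrand_bounds(1)[OF w tX(1,2), of n] b0 by auto
 finally have Xv: "mn X <= b ^ (n + 1) * v" by auto
 have e: "prodA n w * (A s * X) - prodA n w * (A t * X) = prodA n w * ((A s - A t) * X)"
  using minus_mult_distrib_mat[OF A_carrier[OF s(1)] A_carrier[OF s(2)] X(1)]
   mult_minus_distrib_mat[OF prodA_carrier[OF w] sX(1) tX(1)] by simp
 have "u - v <= mn (prodA n w * (A s * X) - prodA n w * (A t * X))"
  unfolding u_def v_def using mn_diff_le[OF mult_carrier_mat[OF prodA_carrier[OF w] sX(1)] mult_carrier_mat[OF prodA_carrier[OF w] tX(1)], of n n] by linarith
 also have "... <= mn (prodA n w) * (mn (A s - A t) * mn X)"
  unfolding e using order_trans[OF mn_mult[OF prodA_carrier[OF w] mult_carrier_mat[OF d X(1)]] mult_left_mono[OF mn_mult[OF d X(1)]]] by simp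
 also have "... <= (real q * b ^ n) * (mn (A s - A t) * (b ^ (n + 1) * v))" using prodA_norm[OF w] Xv b0 by (intro mult_mono mult_nonneg_nonneg) auto
 also have "... = (real q * b ^ (2 * n + 1) * mn (A s - A t)) * v" by (simp add: power_add mult_2)
 finally have "(u - v) / v <= real q * b ^ (2 * n + 1) * mn (A s - A t)" using v by (simp add: pos_divide_le_eq)
 with ln_diff_le[OF u v] show ?thesis by (simp add: u_def v_def)
qed
have "logsize n (A s * X) - logsize n (A t * X) = (LINT w|S. ln (mn (prodA n w * (A s * X))) - ln (mn (prodA n w * (A t * X))))"
 unfolding logsize_def using integrable_logsize[OF sX(1,2)] integrable_logsize[OF tX(1,2)] by simp
also have "... <= (LINT w|S. real q * b ^ (2 * n + 1) * mn (A s - A t))"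
 using integrable_logsize[OF sX(1,2)] integrable_logsize[OF tX(1,2)] pt by (intro integral_mono) auto
finally show ?thesis by (simp add: P.prob_space)
qed

end

context GL_measure
begin

lemma K_nonempty: obtains g where "g : K"
proof -
have "K ~= {}"
proof
 assume "K = {}"
 with AE_K have "AE g in \<mu>. False" by simp
 thus False by simp
qed
thus thesis using that by blast
qed

lemma op_norm_K: "g : K ==> h : K ==> op_norm (g - h) <= 2 * b"
proof -
assume gh: "g : K" "h : K"
have c: "g : Mat d d" "h : Mat d d" "- h : Mat d d" using K_carrier gh by auto
have "g - h = g + (- h)" using c by auto
hence "mn (g - h) <= mn g + mn (- h)" using mn_add[OF c(1,3)] by simp
also have "mn (- h) = mn h" by (simp add: mn_def)
finally show ?thesis using op_norm_le_mn[of "g - h"] K_norm[OF gh(1)] K_norm[OF gh(2)] by linarith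
qed

lemma ln_det_Lipschitz:
assumes gh: "g : K" "h : K"
shows "abs (ln (abs (det g)) - ln (abs (det h))) <= real d ^ 4 * b * op_norm (g - h)"
proof -
have one: "ln (abs (det g)) - ln (abs (det h)) <= real d ^ 4 * b * op_norm (g - h)" if gh: "g : K" "h : K" for g h
proof -
 have c: "g : Mat d d" "h : Mat d d" using K_carrier gh by auto
 have hs: "h : space \<mu>" using K_GL gh space_\<mu> by auto
 obtain Y where Y: "Y : Mat d d" "h * Y = Id d" "mn Y <= real d * b" using A_inverse[OF hs] gh(2) by (auto simp: cut_def)
 have dg: "0 < abs (det g)" "0 < abs (det h)" using gh K_GL by (auto simp: GL_iff)
 define D where "D = mn (g - h) * mn Y"
 have D: "0 <= D" by (simp add: D_def)
 have "abs (det g) <= abs (det h) * (1 + D) ^ d" unfolding D_def by (rule det_perturbation[OF c Y(1,2)])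
 hence "ln (abs (det g)) <= ln (abs (det h) * (1 + D) ^ d)" using dg by auto
 also have "... = ln (abs (det h)) + real d * ln (1 + D)" using dg D by (simp add: ln_mult_pos ln_realpow)
 finally have "ln (abs (det g)) - ln (abs (det h)) <= real d * D" using mult_left_mono[OF ln_add_one_self_le_self[OF D], of "real d"] by simp
 also have "... <= real d * ((real d * real d * op_norm (g - h)) * (real d * b))"
  unfolding D_def using mn_le_op_norm[OF minus_carrier_mat[OF c(2), of g]] Y(3) op_norm_nonneg by (intro mult_left_mono mult_mono) auto
 also have "... = real d ^ 4 * b * op_norm (g - h)" by (simp add: power4_eq_xxxx)
 finally show ?thesis .
qed
have "op_norm (h - g) = op_norm (g - h)" by (rule op_norm_minus_commute[OF K_carrier[OF gh(1)] K_carrier[OF gh(2)]])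
thus ?thesis using one[OF gh] one[OF gh(2,1)] by auto
qed

end

text \<open>
  Only the Lipschitz constant on \<open>K\<close> matters: the function extends to the whole group with the same
  constant by McShane's formula, cut off to be bounded.
\<close>

lemma wasserstein_bounds:
assumes "GL_measure d K b \<mu>" "GL_measure d K b \<mu>'"
shows "0 <= wasserstein d \<mu>' \<mu>"
 and "!!e L. e : Bor \<mu> ==> e : Bor \<mu>' ==> 0 < L ==>
  (!!g h. g : K ==> h : K ==> abs (e g - e h) <= L * op_norm (g - h)) ==>
  abs ((LINT g|\<mu>'. e g) - (LINT g|\<mu>. e g)) <= L * wasserstein d \<mu>' \<mu>"
proof -
interpret G: GL_measure d K b \<mu> by fact
interpret G': GL_measure d K b \<mu>' by fact
obtain g0 where g0: "g0 : K" by (rule G.K_nonempty)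
have near: "abs ((LINT g|n. C g) - C g0) <= 2 * b"
 if C: "C : lip1_test d" and n: "GL_measure d K b n" for C n
proof -
 interpret N: GL_measure d K b n by fact
 have m: "C : Bor n" using C by (intro continuous_measurable[OF N.\<mu>]) (simp add: lip1_test_def)
 obtain B where B: "!!g. g : GL d ==> abs (C g) <= B" using C by (auto simp: lip1_test_def bounded_iff)
 have i: "integrable n C" using B m by (intro N.M.integrable_const_bound[of _ B] AE_I2) (auto simp: N.space_\<mu>)
 have "AE g in n. C g <= C g0 + 2 * b & C g0 - 2 * b <= C g" using N.AE_K
 proof eventually_elim
  case (elim g)
  have "abs (C g - C g0) <= op_norm (g - g0)" using C elim g0 N.K_GL by (auto simp: lip1_test_def GL_dist_def)
  with N.op_norm_K[OF elim g0] show ?case by linarith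
 qed
 hence "(LINT g|n. C g) <= C g0 + 2 * b" "C g0 - 2 * b <= (LINT g|n. C g)"
  using i by (auto intro!: N.M.integral_le_const N.M.integral_ge_const elim!:)
 thus ?thesis by linarith
qed
have bdd: "bdd_above ((%C. abs ((LINT g|\<mu>'. C g) - (LINT g|\<mu>. C g))) ` lip1_test d)"
proof (rule bdd_aboveI2[of _ _ "4 * b"])
 fix C assume C: "C : lip1_test d"
 show "abs ((LINT g|\<mu>'. C g) - (LINT g|\<mu>. C g)) <= 4 * b" using near[OF C assms(1)] near[OF C assms(2)] by linarith
qed
have test: "abs ((LINT g|\<mu>'. C g) - (LINT g|\<mu>. C g)) <= wasserstein d \<mu>' \<mu>" if "C : lip1_test d" for C
 unfolding wasserstein_def by (rule cSUP_upper[OF that bdd])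
have "(%_. 0) : lip1_test d" using Metric_space.nonneg[OF Metric_space_GL] by (auto simp: lip1_test_def bounded_iff)
from test[OF this] show "0 <= wasserstein d \<mu>' \<mu>" by simp
fix e :: "real mat => real" and L :: real
assume em: "e : Bor \<mu>" "e : Bor \<mu>'" and L: "0 < L"
 and Lip: "!!g h. g : K ==> h : K ==> abs (e g - e h) <= L * op_norm (g - h)"
define D where "D = 2 * b * L"
have D: "abs (e g - e g0) <= D" if "g : K" for g
 using order_trans[OF Lip[OF that g0] mult_left_mono[OF G.op_norm_K[OF that g0]]] L by (simp add: D_def mult_ac)
define p0 where "p0 g = (INF h\<in>K. e h + L * op_norm (g - h))" for g
define p where "p g = min (p0 g) (e g0 + D)" for g
have low: "e g0 - D <= e h + L * op_norm (g - h)" if "h : K" for g h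
 using D[OF that] mult_nonneg_nonneg[of L "op_norm (g - h)"] L op_norm_nonneg[of "g - h"] by linarith
have bdb: "bdd_below ((%h. e h + L * op_norm (g - h)) ` K)" for g using low by (intro bdd_belowI2)
have zero: "op_norm (g - g) = 0" if "g : Mat d d" for g
proof -
 have "mn (g - g) = 0" using that by auto
 thus ?thesis using op_norm_le_mn[of "g - g"] op_norm_nonneg[of "g - g"] by simp
qed
have tri: "op_norm (g - h) <= op_norm (g - g') + op_norm (g' - h)"
 if "g : Mat d d" "g' : Mat d d" "h : Mat d d" for g g' h
proof -
 have "g - h = (g - g') + (g' - h)" using that by auto
 thus ?thesis using op_norm_triangle[OF minus_carrier_mat[OF that(2), of g] minus_carrier_mat[OF that(3), of g']] by simp
qed
have p0K: "p0 g = e g" if g: "g : K" for g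
proof (rule antisym)
 have "p0 g <= e g + L * op_norm (g - g)" unfolding p0_def by (rule cINF_lower[OF bdb g])
 thus "p0 g <= e g" using zero[OF G.K_carrier[OF g]] by simp
 show "e g <= p0 g" unfolding p0_def
 proof (rule cINF_greatest)
  fix h assume "h : K"
  from Lip[OF g this] show "e g <= e h + L * op_norm (g - h)" by linarith
 qed (use g in auto)
qed
have pK: "p g = e g" if "g : K" for g using p0K[OF that] D[OF that] by (simp add: p_def)
have half: "p0 g - p0 g' <= L * op_norm (g - g')" if g: "g : Mat d d" "g' : Mat d d" for g g'
proof -
 have "p0 g - L * op_norm (g - g') <= p0 g'" unfolding p0_def[of g']
 proof (rule cINF_greatest)
  fix h assume h: "h : K"
  have "p0 g <= e h + L * op_norm (g - h)" unfolding p0_def by (rule cINF_lower[OF bdb h])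
  moreover have "L * op_norm (g - h) <= L * (op_norm (g - g') + op_norm (g' - h))" using tri[OF g G.K_carrier[OF h]] L by auto
  ultimately show "p0 g - L * op_norm (g - g') <= e h + L * op_norm (g' - h)" by (simp add: distrib_left)
 qed (use g0 in auto)
 thus ?thesis by linarith
qed
have pLip: "abs (p g - p h) <= L * op_norm (g - h)" if "g : GL d" "h : GL d" for g h
proof -
 have c: "g : Mat d d" "h : Mat d d" using that by (auto simp: GL_iff)
 have "0 <= L * op_norm (g - h)" using L op_norm_nonneg by simp
 thus ?thesis using half[OF c] half[OF c(2,1)] op_norm_minus_commute[OF c] by (auto simp: p_def)
qed
have pb: "abs (p g) <= abs (e g0) + D" for g
proof -
 have "e g0 - D <= p0 g" unfolding p0_def using low g0 by (intro cINF_greatest) auto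
 moreover have "0 <= D" using D[OF g0] by simp
 ultimately show ?thesis by (auto simp: p_def)
qed
have pc: "continuous_map (GL_topology d) euclideanreal p" by (rule continuous_map_GL_Lipschitz[OF pLip])
define C where "C g = p g / L" for g
have C: "C : lip1_test d" unfolding lip1_test_def
proof (intro CollectI conjI ballI)
 show Lip1: "abs (C g - C h) <= GL_dist d g h" if "g : GL d" "h : GL d" for g h
 proof -
  have "abs (C g - C h) = abs (p g - p h) / L" using L by (simp add: C_def flip: diff_divide_distrib)
  also have "... <= op_norm (g - h)" using pLip[OF that] L by (simp add: pos_divide_le_eq mult.commute)
  finally show ?thesis using that by (simp add: GL_dist_def)
 qed
 show "continuous_map (GL_topology d) euclideanreal C" using Lip1 by (intro continuous_map_GL_Lipschitz[where L = 1]) (simp add: GL_dist_def)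
 show "bounded (C ` GL d)" using pb L by (intro boundedI[of _ "(abs (e g0) + D) / L"]) (auto simp: C_def abs_divide divide_right_mono)
qed
have eq: "(LINT g|n. e g) = L * (LINT g|n. C g)" if n: "GL_measure d K b n" and m: "e : Bor n" for n
proof -
 interpret N: GL_measure d K b n by fact
 have "(LINT g|n. e g) = (LINT g|n. p g)" using N.AE_K pK by (intro integral_cong_AE m continuous_measurable[OF N.\<mu> pc]) auto
 also have "... = (LINT g|n. L * C g)" using L by (simp add: C_def)
 finally show ?thesis by simp
qed
have "abs ((LINT g|\<mu>'. e g) - (LINT g|\<mu>. e g)) = L * abs ((LINT g|\<mu>'. C g) - (LINT g|\<mu>. C g))"
 unfolding eq[OF assms(1) em(1)] eq[OF assms(2) em(2)] using L by (simp add: abs_mult flip: right_diff_distrib)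
also have "... <= L * wasserstein d \<mu>' \<mu>" using test[OF C] L by auto
finally show "abs ((LINT g|\<mu>'. e g) - (LINT g|\<mu>. e g)) <= L * wasserstein d \<mu>' \<mu>" .
qed

text \<open>The measure is replaced in one factor at a time.\<close>

theorem expected_size_Lipschitz:
assumes "GL_measure d K b \<mu>" "GL_measure d K b \<mu>'" and X: "X : Mat d d" "0 < mn X" and "n <= N"
shows "abs (random_matrices.logsize \<mu>' (cut d K) d n X - random_matrices.logsize \<mu> (cut d K) d n X)
 <= real n * (real d ^ 3 * b ^ (2 * N) * wasserstein d \<mu>' \<mu>)"
proof -
interpret G: GL_measure d K b \<mu> by fact
interpret G': GL_measure d K b \<mu>' by fact
define L where "L = real d ^ 3 * b ^ (2 * N)"
have L0: "0 < L" using G.dim G.b2 by (simp add: L_def)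
have "abs (G'.logsize n X - G.logsize n X) <= real n * (L * wasserstein d \<mu>' \<mu>)" using X \<open>n <= N\<close>
proof (induction n arbitrary: X)
 case 0
 thus ?case by (simp add: G.logsize_def G'.logsize_def G.P.prob_space G'.P.prob_space)
next
 case (Suc n)
 note X = Suc.prems(1,2)
 have sp: "space \<mu> = GL d" "space \<mu>' = GL d" by (rule G.space_\<mu> G'.space_\<mu>)+
 have sets: "sets \<mu> = sets \<mu>'" using G.\<mu> G'.\<mu> by (simp add: prob_on_GL_def)
 have m': "(%g. G.logsize n (cut d K g * X)) : Bor \<mu>'" using G.measurable_logsize_step[OF X(1), of n] measurable_cong_sets[OF sets refl] by blast
 have i': "integrable \<mu>' (%g. G.logsize n (cut d K g * X))"
 proof (rule G'.M.integrable_const_bound[OF AE_I2 m'])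
  fix g assume "g : space \<mu>'"
  hence "g : space \<mu>" by (simp add: sp)
  note gX = G.A_mult_pos[OF this X]
  show "norm (G.logsize n (cut d K g * X)) <= real n * ln b + ln (real d) + (ln b + abs (ln (mn X)))"
   using G.logsize_bound[OF gX(1,2), of n] gX(3) by simp
 qed
 have e1: "abs ((LINT g|\<mu>'. G'.logsize n (cut d K g * X)) - (LINT g|\<mu>'. G.logsize n (cut d K g * X))) <= real n * (L * wasserstein d \<mu>' \<mu>)"
 proof -
  have "abs ((LINT g|\<mu>'. G'.logsize n (cut d K g * X)) - (LINT g|\<mu>'. G.logsize n (cut d K g * X)))
    = abs (LINT g|\<mu>'. G'.logsize n (cut d K g * X) - G.logsize n (cut d K g * X))" using i' G'.integrable_logsize_step[OF X, of n] by simp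
  also have "... <= (LINT g|\<mu>'. abs (G'.logsize n (cut d K g * X) - G.logsize n (cut d K g * X)))" by (rule integral_abs_bound)
  also have "... <= real n * (L * wasserstein d \<mu>' \<mu>)"
  proof (rule G'.M.integral_le_const, intro integrable_abs L1_diff i' G'.integrable_logsize_step X, rule AE_I2)
   fix g assume "g : space \<mu>'"
   note gX = G'.A_mult_pos[OF this X]
   show "abs (G'.logsize n (cut d K g * X) - G.logsize n (cut d K g * X)) <= real n * (L * wasserstein d \<mu>' \<mu>)"
    using Suc.prems(3) by (intro Suc.IH gX) simp
  qed
  finally show ?thesis .
 qed
 have e2: "abs ((LINT g|\<mu>'. G.logsize n (cut d K g * X)) - (LINT g|\<mu>. G.logsize n (cut d K g * X))) <= L * wasserstein d \<mu>' \<mu>"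
 proof (rule wasserstein_bounds(2)[OF assms(1,2) G.measurable_logsize_step[OF X(1)] m' L0])
  have half: "G.logsize n (cut d K g * X) - G.logsize n (cut d K h * X) <= L * op_norm (g - h)" if gh: "g : K" "h : K" for g h
  proof -
   have s: "g : space \<mu>" "h : space \<mu>" using gh G.K_GL sp by auto
   have "G.logsize n (cut d K g * X) - G.logsize n (cut d K h * X) <= real d * b ^ (2 * n + 1) * mn (g - h)"
    using G.logsize_step_Lipschitz[OF s X, of n] gh by (simp add: cut_def)
   also have "... <= real d * b ^ (2 * N) * (real d * real d * op_norm (g - h))"
    using mn_le_op_norm[OF minus_carrier_mat[OF G.K_carrier[OF gh(2)], of g]] G.b2 Suc.prems(3) by (intro mult_mono power_increasing) auto
   also have "... = L * op_norm (g - h)" by (simp add: L_def power3_eq_cube)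
   finally show ?thesis .
  qed
  fix g h assume gh: "g : K" "h : K"
  show "abs (G.logsize n (cut d K g * X) - G.logsize n (cut d K h * X)) <= L * op_norm (g - h)"
   using half[OF gh] half[OF gh(2,1)] op_norm_minus_commute[OF G.K_carrier[OF gh(1)] G.K_carrier[OF gh(2)]] by auto
 qed
 have "abs (G'.logsize (Suc n) X - G.logsize (Suc n) X) <= real n * (L * wasserstein d \<mu>' \<mu>) + L * wasserstein d \<mu>' \<mu>"
  unfolding G.logsize_Suc[OF X] G'.logsize_Suc[OF X] using e1 e2 by linarith
 thus ?case by (simp add: algebra_simps)
qed
thus ?thesis by (simp add: L_def)
qed

section \<open>Semisimple measures\<close>

lemma smult_mat_mult_vec: "A : Mat n m ==> v : Vec m ==> (c .m A) *v v = c .v (A *v v :: real vec)" by auto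

lemma lsub_iff_subspace: "lsub d W <-> VectorSpace.subspace class_ring W (module_vec TYPE(real) d)"
proof -
have v: "vectorspace class_ring (module_vec TYPE(real) d)" by (rule vec_vs)
hence "Module.module class_ring (module_vec TYPE(real) d)" by (simp add: vectorspace_def)
with v show ?thesis unfolding VectorSpace.subspace_def LinearCombinations.submodule_def lsub_def by (auto simp: module_vec_simps)
qed

context GL_measure
begin

text \<open>Preserving a subspace is a closed condition, so it extends from almost every matrix to the support.\<close>

lemma AE_invariant_iff:
assumes W: "lsub d W"
shows "(AE g in \<mu>. ALL x:W. g *v x : W) <-> invariant_subspace d (gen_semigroup (msupp d \<mu>)) W"
proof
assume inv: "invariant_subspace d (gen_semigroup (msupp d \<mu>)) W"
show "AE g in \<mu>. ALL x:W. g *v x : W"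
 using AE_msupp[OF \<mu>] by eventually_elim (use inv gen_semigroup.base in \<open>auto simp: invariant_subspace_def\<close>)
next
assume ae: "AE g in \<mu>. ALL x:W. g *v x : W"
obtain r B where B: "r <= d" "B : Mat d r" "inj_mat B" "rng B = W" by (rule lsub_basis[OF W])
obtain T where T: "T : Mat d d" "kern T = W" using annihilator_exists[OF B(2,3)] B(4) by metis
have iff: "(ALL x:W. g *v x : W) <-> mn (T * (g * B)) = 0" if g: "g : Mat d d" for g
proof -
 have gB: "g * B : Mat d r" using g B(2) by simp
 have "rng (g * B) = (%x. g *v x) ` rng B" unfolding rng_def image_image using Mv_assoc[OF g B(2)] g B(2) by (intro image_cong) auto
 hence "(ALL x:W. g *v x : W) <-> rng (g * B) <= kern T" unfolding T(2) B(4) by auto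
 also have "... <-> T * (g * B) = 0m d r" by (rule rng_subset_kern[OF gB T(1)])
 finally show ?thesis using mn_eq_0[OF mult_carrier_mat[OF T(1) gB]] by simp
qed
have supp_inv: "ALL x:W. g *v x : W" if g: "g : msupp d \<mu>" for g
proof (rule ccontr)
 assume "\<not> (ALL x:W. g *v x : W)"
 have gG: "g : GL d" using g by (simp add: msupp_def)
 hence gc: "g : Mat d d" by (simp add: GL_iff)
 have Lip: "abs (mn (T * (g * B)) - mn (T * (h * B))) <= (mn T * (real d * real d) * mn B) * op_norm (g - h)"
  if "g : GL d" "h : GL d" for g h
 proof -
  have c: "g : Mat d d" "h : Mat d d" using that by (auto simp: GL_iff)
  have d: "g - h : Mat d d" by (rule minus_carrier_mat[OF c(2)])
  have cB: "g * B : Mat d r" "h * B : Mat d r" using that B(2) by (auto simp: GL_iff)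
  have "abs (mn (T * (g * B)) - mn (T * (h * B))) <= mn (T * ((g - h) * B))"
   using minus_mult_distrib_mat[OF c B(2)] mult_minus_distrib_mat[OF T(1) cB] mn_diff_le[OF mult_carrier_mat[OF T(1) cB(1)] mult_carrier_mat[OF T(1) cB(2)]] by simp
  also have "... <= mn T * (mn (g - h) * mn B)"
   using order_trans[OF mn_mult[OF T(1) mult_carrier_mat[OF d B(2)]] mult_left_mono[OF mn_mult[OF d B(2)]]] by simp
  also have "... <= mn T * ((real d * real d * op_norm (g - h)) * mn B)" using mn_le_op_norm[OF d] by (intro mult_left_mono mult_right_mono) auto
  finally show ?thesis by (simp add: mult_ac)
 qed
 have cont: "continuous_map (GL_topology d) euclideanreal (%g. mn (T * (g * B)))" by (rule continuous_map_GL_Lipschitz[OF Lip])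
 define U where "U = {h : topspace (GL_topology d). mn (T * (h * B)) : - {0}}"
 have U: "openin (GL_topology d) U" using cont unfolding U_def continuous_map_def by auto
 have "g : U" using iff[OF gc] \<open>\<not> (\<forall>x\<in>W. g *v x : W)\<close> gG by (simp add: U_def topspace_GL_topology)
 hence pos: "0 < emeasure \<mu> U" using g U by (auto simp: msupp_def)
 have "AE h in \<mu>. h ~: U" using ae by eventually_elim (use iff in \<open>auto simp: U_def topspace_GL_topology GL_iff\<close>)
 hence "emeasure \<mu> U = 0"
  using AE_iff_measurable[OF open_in_sets[OF \<mu> U], of "%h. h ~: U"] space_\<mu> openin_subset[OF U] by (auto simp: topspace_GL_topology)
 with pos show False by simp
qed
have "g : Mat d d & (ALL x:W. g *v x : W)" if "g : gen_semigroup (msupp d \<mu>)" for g using that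
proof induction
 case (base g)
 thus ?case using supp_inv by (auto simp: msupp_def GL_iff)
next
 case (mult g h)
 thus ?case using W by (auto simp: lsub_def subset_iff)
qed
thus "invariant_subspace d (gen_semigroup (msupp d \<mu>)) W" using W by (auto simp: invariant_subspace_def lsub_iff_subspace)
qed

text \<open>
  Multiplying the matrices by the constant \<open>e\<^sup>-\<^sup>\<lambda>\<close> moves all exponents to zero and changes neither
  the invariant subspaces nor the differences that matter.
\<close>

theorem semisimple_expected_growth:
assumes ss: "semisimple d \<mu>" and eq: "lyap d \<mu> 1 = lyap d \<mu> d"
obtains C where "0 <= C"
 "!!n. (LINT z|S. ln (mn (prodA n z))) <= real n * lyap d \<mu> 1 + C * real (Suc n) powr (3 / 4)"
proof -
define l where "l = lyap d \<mu> 1"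
define c where "c = exp (- l)"
have c0: "0 < c" by (simp add: c_def)
define b' where "b' = b * (c + 1 / c)"
have b'c: "c * b <= b'" "b / c <= b'" using c0 b2 by (simp_all add: b'_def distrib_left)
have b'1: "1 <= b'"
proof (cases "1 <= c")
 case True
 hence "1 * 1 <= c * b" using b2 by (intro mult_mono) auto
 with b'c show ?thesis by linarith
next
 case False
 hence "1 <= b / c" using c0 b2 by auto
 with b'c show ?thesis by linarith
qed
interpret N: random_matrices \<mu> "%g. c .m cut d K g" d b'
proof
 show "c .m cut d K g : Mat d d" for g using cut_carrier by simp
 show "(%g. (c .m cut d K g) $$ (i, j)) : Bor \<mu>" if "i < d" "j < d" for i j
 proof -
  have "(c .m cut d K g) $$ (i, j) = c * cut d K g $$ (i, j)" for g using cut_carrier[of g] that by simp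
  thus ?thesis using measurable_cut[OF that] by simp
 qed
 fix g assume g: "g : space \<mu>"
 have "c * mn (cut d K g) <= c * b" using A_norm[OF g] by (simp add: c_def)
 hence "c * mn (cut d K g) <= b'" using b'c(1) by linarith
 thus "mn (c .m cut d K g) <= b'" by (simp add: c_def)
 fix v :: "real vec" assume v: "v : Vec d"
 have e: "(c .m cut d K g) *v v = c .v (cut d K g *v v)" by (rule smult_mat_mult_vec[OF cut_carrier v])
 have "vn v <= b * vn (cut d K g *v v)" by (rule A_lower[OF g v])
 also have "... = (b / c) * vn ((c .m cut d K g) *v v)" unfolding e by (simp add: c_def)
 also have "... <= b' * vn ((c .m cut d K g) *v v)" using b'c by (intro mult_right_mono) auto
 finally show "vn v <= b' * vn ((c .m cut d K g) *v v)" .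
qed (use dim b'1 in auto)
have prod: "N.prodA n z = c ^ n .m prodA n z" if z: "z : space S" for n z
proof (induction n)
 case 0
 show ?case by (simp add: N.prodA_0) (intro eq_matI, auto)
next
 case (Suc n)
 note P = prodA_carrier[OF z, of n]
 have "N.prodA (Suc n) z = c .m (c ^ n .m (cut d K (z n) * prodA n z))"
  unfolding N.prodA_Suc Suc mult_smult_assoc_mat[OF cut_carrier smult_carrier_mat[OF P]] mult_smult_distrib[OF cut_carrier P] ..
 also have "... = c ^ Suc n .m prodA (Suc n) z" unfolding prodA_Suc by auto
 finally show ?case .
qed
have same: "lyap d \<mu> (Suc i) = l" if "i < d" for i
 using lyapunov_decreasing[of 1 "Suc i"] lyapunov_decreasing[of "Suc i" d] that eq by (simp add: l_def)
have det_sum: "(LINT g|\<mu>. ln (abs (det (cut d K g)))) = real d * l" using lyapunov_sum same by simp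
have ng: "N.no_growth" unfolding N.no_growth_def
proof (intro allI impI)
 fix e :: real assume e: "0 < e"
 show "AE z in S. eventually (%n. mn (N.prodA n z) <= exp (real n * e) & exp (- (real n * e)) <= abs (det (N.prodA n z))) sequentially"
  using lyapunov_first(1) det_limit AE_space
 proof eventually_elim
  case (elim z)
  note z = elim(3)
  have "eventually (%n. ln (mn (prodA n z)) / real n < l + e) sequentially" using elim(1) e by (intro order_tendstoD(2)) (auto simp: l_def)
  moreover have "eventually (%n. real d * l - e < ln (abs (det (prodA n z))) / real n) sequentially"
   using elim(2) e by (intro order_tendstoD(1)) (auto simp: det_sum)
  ultimately show ?case using eventually_gt_at_top[of 0]
  proof eventually_elim
   case (elim n)
   have "ln (mn (prodA n z)) <= real n * l + real n * e" using elim(1,3) by (simp add: divide_less_eq algebra_simps)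
   hence "exp (ln (mn (prodA n z))) <= exp (real n * l + real n * e)" by simp
   hence 1: "mn (prodA n z) <= exp (real n * l) * exp (real n * e)" using ln_mn_prodA_bound(2)[OF z] by (simp add: exp_add)
   have "real n * (real d * l) - real n * e <= ln (abs (det (prodA n z)))" using elim(2,3) by (simp add: less_divide_eq algebra_simps)
   hence "exp (real n * (real d * l) - real n * e) <= exp (ln (abs (det (prodA n z))))" by simp
   hence 2: "exp (real n * (real d * l)) * exp (- (real n * e)) <= abs (det (prodA n z))"
    using prodA_det[OF z, of n] by (simp add: exp_diff exp_minus divide_inverse)
   have cn: "c ^ n = exp (- (real n * l))" by (simp add: c_def exp_of_nat_mult[symmetric])
   have "(c ^ n) ^ d = exp (- (real n * (real d * l)))" unfolding cn by (simp add: exp_of_nat_mult[symmetric])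
   hence "abs (det (N.prodA n z)) = exp (- (real n * (real d * l))) * abs (det (prodA n z))"
    unfolding prod[OF z] using prodA_carrier[OF z, of n] by (simp add: det_smult abs_mult)
   moreover have "exp (- (real n * (real d * l))) * (exp (real n * (real d * l)) * exp (- (real n * e))) = exp (- (real n * e))"
    by (simp add: exp_minus)
   ultimately have "exp (- (real n * e)) <= abs (det (N.prodA n z))" using mult_left_mono[OF 2 exp_ge_zero[of "- (real n * (real d * l))"]] by linarith
   moreover have "mn (N.prodA n z) <= exp (real n * e)"
   proof -
    have "mn (N.prodA n z) = c ^ n * mn (prodA n z)" unfolding prod[OF z] by (simp add: c_def)
    also have "... <= c ^ n * (exp (real n * l) * exp (real n * e))" using 1 by (simp add: c_def)
    also have "... = exp (real n * e)" by (simp add: cn exp_minus)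
    finally show ?thesis .
   qed
   ultimately show ?case by simp
  qed
 qed
qed
have scale: "(ALL x:W. (c .m cut d K g) *v x : W) <-> (ALL x:W. g *v x : W)" if W: "lsub d W" and g: "g : K" for W g
proof -
 have "(c .m g) *v x : W <-> g *v x : W" if x: "x : W" for x
 proof -
  have xc: "x : Vec d" using W x by (auto simp: lsub_def)
  have e: "(c .m g) *v x = c .v (g *v x)" by (rule smult_mat_mult_vec[OF K_carrier[OF g] xc])
  have "g *v x = (1 / c) .v (c .v (g *v x))" using c0 by auto
  thus ?thesis unfolding e using W unfolding lsub_def by metis
 qed
 with g show ?thesis by (simp add: cut_def)
qed
have AE_scale: "(AE g in \<mu>. ALL x:W. (c .m cut d K g) *v x : W) <-> invariant_subspace d (gen_semigroup (msupp d \<mu>)) W"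
 if W: "lsub d W" for W
proof -
 have "(AE g in \<mu>. ALL x:W. (c .m cut d K g) *v x : W) <-> (AE g in \<mu>. ALL x:W. g *v x : W)"
  by (rule eventually_cong[OF AE_K]) (rule scale[OF W])
 thus ?thesis using AE_invariant_iff[OF W] by simp
qed
obtain C where C: "0 <= C" "!!n. (LINT z|S. ln (mn (N.prodA n z))) <= C * real (Suc n) powr (3 / 4)"
proof (rule N.expected_growth_bound[OF ng])
 fix W assume W: "lsub d W" "AE g in \<mu>. ALL x:W. (c .m cut d K g) *v x : W"
 hence "invariant_subspace d (gen_semigroup (msupp d \<mu>)) W" using AE_scale by simp
 with ss have "EX U. invariant_subspace d (gen_semigroup (msupp d \<mu>)) U & W Int U = {0v d} \<and>
   {w + w' | w w'. w : W & w' : U} = Vec d" unfolding semisimple_def by (elim allE[of _ W] impE)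
 then obtain U where U: "invariant_subspace d (gen_semigroup (msupp d \<mu>)) U" "W Int U = {0v d}"
  "{w + w' | w w'. w : W & w' : U} = Vec d" by (elim exE conjE)
 have lU: "lsub d U" using U(1) by (simp add: invariant_subspace_def lsub_iff_subspace)
 have "ALL x:Vec d. EX w:W. EX u:U. x = w + u" using U(3) by blast
 with U lU AE_scale[OF lU] show "EX U. lsub d U & (AE g in \<mu>. ALL x:U. (c .m cut d K g) *v x : U) & W Int U = {0v d} \<and>
   (ALL x:Vec d. EX w:W. EX u:U. x = w + u)" by blast
qed blast
show thesis
proof (rule that[OF C(1)])
 fix n
 have cn: "ln (c ^ n) = - (real n * l)" by (simp add: ln_realpow) (simp add: c_def)
 have "(LINT z|S. ln (mn (N.prodA n z))) = (LINT z|S. - (real n * l) + ln (mn (prodA n z)))"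
 proof (rule LINT_cong[OF refl])
  fix z assume z: "z : space S"
  show "ln (mn (N.prodA n z)) = - (real n * l) + ln (mn (prodA n z))"
   using prod[OF z] c0 ln_mn_prodA_bound(2)[OF z, of n] cn by (simp add: ln_mult_pos)
 qed
 also have "... = - (real n * l) + (LINT z|S. ln (mn (prodA n z)))" using integrable_ln_mn_prodA[of n] by (simp add: P.prob_space)
 finally show "(LINT z|S. ln (mn (prodA n z))) <= real n * lyap d \<mu> 1 + C * real (Suc n) powr (3 / 4)" using C(2)[of n] by (simp add: l_def)
qed
qed

end

section \<open>Hoelder continuity in the logarithm of the distance\<close>

lemma exp_neg_half_le: "0 < (l::real) ==> exp (- (l / 2)) <= 2 * l powr (- (1 / 4))"
proof -
assume l: "0 < (l::real)"
have "l powr (1 / 4) <= 1 + l"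
proof (cases "1 <= l")
 case True
 hence "l powr (1 / 4) <= l powr 1" by (intro powr_mono) auto
 thus ?thesis using l by auto
next
 case False
 hence "l powr (1 / 4) <= 1 powr (1 / 4)" using l by (intro powr_mono2) auto
 thus ?thesis using l by auto
qed
also have "... <= 2 * exp (l / 2)" using exp_ge_add_one_self[of "l / 2"] by linarith
finally have "l powr (1 / 4) * exp (- (l / 2)) <= 2 * exp (l / 2) * exp (- (l / 2))" by auto
also have "2 * exp (l / 2) * exp (- (l / 2)) = 2" by (simp add: exp_minus)
finally have "l powr (1 / 4) * exp (- (l / 2)) <= 2" .
thus ?thesis using l by (simp add: powr_minus field_simps)
qed

lemma Suc_powr_le: "1 <= n ==> real (Suc n) powr (3 / 4) / real n <= 2 * real n powr (- (1 / 4))"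
proof -
assume n: "1 <= n"
have "real (Suc n) powr (3 / 4) <= (2 * real n) powr (3 / 4)" using n by (intro powr_mono2) auto
also have "... = 2 powr (3 / 4) * real n powr (3 / 4)" by (simp add: powr_mult)
also have "... <= 2 * real n powr (3 / 4)" using powr_mono[of "3 / 4" 1 "2::real"] by (intro mult_right_mono) auto
finally have "real (Suc n) powr (3 / 4) / real n <= 2 * real n powr (3 / 4) / real n" by (intro divide_right_mono) auto
also have "real n powr (3 / 4) / real n = real n powr (- (1 / 4))" using powr_diff[of "real n" "3 / 4" 1] by simp
hence "2 * real n powr (3 / 4) / real n = 2 * real n powr (- (1 / 4))" by simp
finally show ?thesis .
qed

text \<open>
  The top exponent is bounded by the expectation at any finite time.  Since the error of the
  expectation grows exponentially in the time, a time of the order of the logarithm is the best choice.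
\<close>

lemma first_exponent_bound:
assumes M: "GL_measure d K b \<mu>" and ss: "semisimple d \<mu>" and eq: "lyap d \<mu> 1 = lyap d \<mu> d"
obtains C where "0 <= C"
 "!!\<mu>'. GL_measure d K b \<mu>' ==> wasserstein d \<mu>' \<mu> < 1 ==> lyap d \<mu>' 1 <= lyap d \<mu> 1 +
  (if wasserstein d \<mu>' \<mu> = 0 then 0 else C * abs (ln (wasserstein d \<mu>' \<mu>)) powr (- (1 / 4)))"
proof -
interpret G: GL_measure d K b \<mu> by fact
obtain C where C: "0 <= C"
 "!!n. (LINT z|(\<Pi>\<^sub>M i\<in>UNIV. \<mu>). ln (mn (G.prodA n z))) <= real n * lyap d \<mu> 1 + C * real (Suc n) powr (3 / 4)"
 by (rule G.semisimple_expected_growth[OF ss eq]) blast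
define B where "B = 4 * ln b"
have B: "0 < B" using G.b2 by (simp add: B_def)
define D where "D = 2 * C * B powr (1 / 4) + 2 * (real d ^ 3 * b^2)"
have D0: "0 <= D" using C by (simp add: D_def)
have "lyap d \<mu>' 1 <= lyap d \<mu> 1 +
  (if wasserstein d \<mu>' \<mu> = 0 then 0 else D * abs (ln (wasserstein d \<mu>' \<mu>)) powr (- (1 / 4)))"
 if M': "GL_measure d K b \<mu>'" and w1: "wasserstein d \<mu>' \<mu> < 1" for \<mu>'
proof -
 interpret G': GL_measure d K b \<mu>' by fact
 define w where "w = wasserstein d \<mu>' \<mu>"
 have w0: "0 <= w" unfolding w_def by (rule wasserstein_bounds(1)[OF M M'])
 have mono: "lyap d \<mu>' 1 <= lyap d \<mu> 1 + 2 * C * real n powr (- (1 / 4)) + real d ^ 3 * b ^ (2 * n) * w"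
  if n: "1 <= n" for n
 proof -
  have "abs (G'.logsize n (Id d) - G.logsize n (Id d)) <= real n * (real d ^ 3 * b ^ (2 * n) * w)"
   unfolding w_def using G.dim by (intro expected_size_Lipschitz M M') auto
  hence "G'.logsize n (Id d) <= real n * lyap d \<mu> 1 + C * real (Suc n) powr (3 / 4) + real n * (real d ^ 3 * b ^ (2 * n) * w)"
   using C(2)[of n] unfolding G.logsize_one by linarith
  hence "G'.logsize n (Id d) / real n <= (real n * lyap d \<mu> 1 + C * real (Suc n) powr (3 / 4) + real n * (real d ^ 3 * b ^ (2 * n) * w)) / real n"
   by (intro divide_right_mono) auto
  also have "... = lyap d \<mu> 1 + C * (real (Suc n) powr (3 / 4) / real n) + real d ^ 3 * b ^ (2 * n) * w" using n by (simp add: add_divide_distrib)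
  also have "C * (real (Suc n) powr (3 / 4) / real n) <= C * (2 * real n powr (- (1 / 4)))" by (intro mult_left_mono Suc_powr_le n C(1))
  finally show ?thesis using G'.lyapunov_first(2)[OF n] unfolding G'.logsize_one by simp
 qed
 show ?thesis
 proof (cases "w = 0")
  case True
  have "(%n. lyap d \<mu> 1 + 2 * C * real n powr (- (1 / 4))) ---> lyap d \<mu> 1 + 2 * C * 0"
   by (intro tendsto_intros tendsto_neg_powr filterlim_real_sequentially) auto
  moreover have "EX N. ALL n>=N. lyap d \<mu>' 1 <= lyap d \<mu> 1 + 2 * C * real n powr (- (1 / 4))" using mono True by auto
  ultimately have "lyap d \<mu>' 1 <= lyap d \<mu> 1 + 2 * C * 0" by (rule LIMSEQ_le_const)
  with True show ?thesis by (simp add: w_def)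
 next
  case False
  hence w: "0 < w" "w < 1" using w0 w1 by (auto simp: w_def)
  define l where "l = abs (ln w)"
  have l: "0 < l" "w = exp (- l)" using w by (auto simp: l_def)
  define n where "n = nat \<lceil>l / B\<rceil>"
  have n1: "1 <= n" "l / B <= real n" "real n <= l / B + 1"
  proof -
   have "0 < \<lceil>l / B\<rceil>" using l B by simp
   thus "1 <= n" "l / B <= real n" "real n <= l / B + 1" unfolding n_def by (auto simp: le_of_int_ceiling)  linarith+
  qed
  have p: "real n powr (- (1 / 4)) <= B powr (1 / 4) * l powr (- (1 / 4))"
  proof -
   have "real n powr (- (1 / 4)) <= (l / B) powr (- (1 / 4))" using n1 l B by (intro powr_mono2') auto
   also have "... = B powr (1 / 4) * l powr (- (1 / 4))" using w B by (simp add: powr_divide powr_minus field_simps)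
   finally show ?thesis .
  qed
  have q: "b ^ (2 * n) * w <= b^2 * (2 * l powr (- (1 / 4)))"
  proof -
   have "b ^ (2 * n) = exp (real (2 * n) * ln b)" using exp_of_nat_mult[of "2 * n" "ln b"] G.b2 by simp
   also have "real (2 * n) * ln b = (B / 2) * real n" by (simp add: B_def)
   also have "exp ((B / 2) * real n) <= exp ((B / 2) * (l / B + 1))" using n1(3) G.b2 by (simp add: B_def)
   also have "(B / 2) * (l / B + 1) = l / 2 + 2 * ln b" using G.b2 by (simp add: B_def field_simps)
   also have "exp (l / 2 + 2 * ln b) = exp (l / 2) * b^2" using G.b2 exp_of_nat_mult[of 2 "ln b"] by (simp add: exp_add)
   finally have "b ^ (2 * n) * w <= exp (l / 2) * b^2 * exp (- l)" unfolding l(2) by auto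
   also have "... = b^2 * exp (- (l / 2))"
   proof -
    show ?thesis by (simp add: exp_add[symmetric])
   qed
   also have "... <= b^2 * (2 * l powr (- (1 / 4)))" by (intro mult_left_mono exp_neg_half_le l) auto
   finally show ?thesis .
  qed
  have "2 * C * real n powr (- (1 / 4)) <= 2 * C * (B powr (1 / 4) * l powr (- (1 / 4)))" using C p by (intro mult_left_mono) auto
  moreover have "real d ^ 3 * (b ^ (2 * n) * w) <= real d ^ 3 * (b^2 * (2 * l powr (- (1 / 4))))" using q by (intro mult_left_mono) auto
  moreover have "D * l powr (- (1 / 4)) = 2 * C * (B powr (1 / 4) * l powr (- (1 / 4))) + real d ^ 3 * (b^2 * (2 * l powr (- (1 / 4))))"
   by (simp add: D_def algebra_simps)
  ultimately have "lyap d \<mu>' 1 <= lyap d \<mu> 1 + D * l powr (- (1 / 4))" using mono[OF n1(1)] by auto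
  with False show ?thesis by (simp add: w_def l_def)
 qed
qed
with that D0 show thesis by blast
qed

text \<open>An exponent is the sum of all of them minus the others, which the first one bounds from above.\<close>

lemma exponents_bound:
assumes M: "GL_measure d K b \<mu>" and ss: "semisimple d \<mu>" and eq: "lyap d \<mu> 1 = lyap d \<mu> d"
shows "EX C>0. ALL \<mu>'. GL_measure d K b \<mu>' & wasserstein d \<mu>' \<mu> < 1 / 2 --> (ALL i:{1..d}.
 abs (lyap d \<mu>' i - lyap d \<mu> i) \<le>
  (if wasserstein d \<mu>' \<mu> = 0 then 0 else C * abs (ln (wasserstein d \<mu>' \<mu>)) powr (- (1 / 4))))"
proof -
interpret G: GL_measure d K b \<mu> by fact
obtain C where C: "0 <= C"
 "!!\<mu>'. GL_measure d K b \<mu>' ==> wasserstein d \<mu>' \<mu> < 1 ==> lyap d \<mu>' 1 <= lyap d \<mu> 1 +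
  (if wasserstein d \<mu>' \<mu> = 0 then 0 else C * abs (ln (wasserstein d \<mu>' \<mu>)) powr (- (1 / 4)))"
 by (rule first_exponent_bound[OF M ss eq]) blast
define L where "L = real d ^ 4 * b"
have L: "0 < L" using G.dim G.b2 by (simp add: L_def)
define D where "D = real d * C + 2 * L"
have D: "0 < D" using C L by (simp add: D_def add_nonneg_pos)
define l where "l = lyap d \<mu> 1"
have same: "lyap d \<mu> i = l" if "1 <= i" "i <= d" for i
 using G.lyapunov_decreasing[of 1 i] G.lyapunov_decreasing[of i d] that eq by (simp add: l_def)
have "abs (lyap d \<mu>' i - lyap d \<mu> i) \<le>
  (if wasserstein d \<mu>' \<mu> = 0 then 0 else D * abs (ln (wasserstein d \<mu>' \<mu>)) powr (- (1 / 4)))"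
 if M': "GL_measure d K b \<mu>'" and w2: "wasserstein d \<mu>' \<mu> < 1 / 2" and i: "1 <= i" "i <= d" for \<mu>' i
proof -
 interpret G': GL_measure d K b \<mu>' by fact
 define w where "w = wasserstein d \<mu>' \<mu>"
 have w0: "0 <= w" unfolding w_def by (rule wasserstein_bounds(1)[OF M M'])
 define t where "t = (if w = 0 then 0 else abs (ln w) powr (- (1 / 4)))"
 have t: "0 <= t" by (simp add: t_def)
 have wt: "w <= 2 * t"
 proof (cases "w = 0")
  case False
  hence w: "0 < w" "w < 1" using w0 w2 by (auto simp: w_def)
  have "w = exp (- abs (ln w))" using w by simp
  also have "... <= exp (- (abs (ln w) / 2))" by simp
  also have "... <= 2 * abs (ln w) powr (- (1 / 4))" using w by (intro exp_neg_half_le) simp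
  finally show ?thesis by (simp add: t_def)
 qed (simp add: t_def)
 have le: "lyap d \<mu>' j <= l + C * t" if "1 <= j" "j <= d" for j
  using G'.lyapunov_decreasing[of 1 j] that C(2)[OF M'] w2 by (auto simp: w_def[symmetric] t_def l_def split: if_splits)
 have dets: "abs ((LINT g|\<mu>'. ln (abs (det (cut d K g)))) - (LINT g|\<mu>. ln (abs (det (cut d K g))))) <= L * w" unfolding w_def
 proof (rule wasserstein_bounds(2)[OF M M' _ _ L])
  have m: "(%g. ln (abs (det (cut d K g)))) : Bor n" if "GL_measure d K b n" for n
  proof -
   interpret N: GL_measure d K b n by fact
   have [measurable]: "(%g. det (cut d K g)) : Bor n" by (rule measurable_det[of _ _ d]) (use N.cut_carrier N.measurable_cut in auto)
   show ?thesis by measurable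
  qed
  show "(%g. ln (abs (det (cut d K g)))) : Bor \<mu>" "(%g. ln (abs (det (cut d K g)))) : Bor \<mu>'" by (intro m M M')+
  show "abs (ln (abs (det (cut d K g))) - ln (abs (det (cut d K h)))) <= L * op_norm (g - h)" if "g : K" "h : K" for g h
   using G.ln_det_Lipschitz[OF that] that by (simp add: cut_def L_def)
 qed
 have sum\<mu>: "(LINT g|\<mu>. ln (abs (det (cut d K g)))) = real d * l" unfolding G.lyapunov_sum[symmetric] using same by simp
 obtain i' where i': "i = Suc i'" "i' < d" using i by (cases i) auto
 have "real d * l - L * w <= (SUM j<d. lyap d \<mu>' (Suc j))" unfolding G'.lyapunov_sum using dets sum\<mu> by linarith
 also have "... = lyap d \<mu>' (Suc i') + (SUM j:{..<d} - {i'}. lyap d \<mu>' (Suc j))" using i' by (intro sum.remove) auto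
 also have "(SUM j:{..<d} - {i'}. lyap d \<mu>' (Suc j)) <= (SUM j:{..<d} - {i'}. l + C * t)" by (intro sum_mono le) auto
 also have "... = (real d - 1) * (l + C * t)" using i' by auto
 finally have low: "l - (real d - 1) * (C * t) - L * w <= lyap d \<mu>' i" using i' by (simp add: algebra_simps)
 have 1: "(real d - 1) * (C * t) <= real d * (C * t)" "C * t <= real d * (C * t)"
  using C t G.dim mult_right_mono[of 1 "real d" "C * t"] by (auto intro!: mult_right_mono)
 have 2: "L * w <= L * (2 * t)" using wt G.dim G.b2 by (simp add: L_def)
 have 4: "0 <= L * (2 * t)" using G.dim G.b2 t by (simp add: L_def)
 have "abs (lyap d \<mu>' i - l) <= D * t" using low le[OF i] 1 2 4 by (simp add: D_def algebra_simps)
 thus ?thesis using same[OF i] by (auto simp: t_def w_def)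
qed
thus ?thesis using D by (intro exI[of _ D]) auto
qed

theorem theorem1:
  shows "\<exists>\<gamma>>0. \<forall>d\<ge>1. \<forall>K. compactin (GL_topology d) K \<longrightarrow>
    (\<exists>\<epsilon>>0. \<forall>\<mu>.
      prob_on_GL d \<mu> \<and> compactin (GL_topology d) (msupp d \<mu>) \<and> semisimple d \<mu> \<and>
      lyapunov_exponent d \<mu> 1 = lyapunov_exponent d \<mu> d \<and> msupp d \<mu> \<subseteq> K \<longrightarrow>
      (\<exists>C>0. \<forall>\<mu>'.
        prob_on_GL d \<mu>' \<and> msupp d \<mu>' \<subseteq> K \<and> wasserstein d \<mu>' \<mu> < \<epsilon> \<longrightarrow>
        (\<forall>i\<in>{1..d}.
          \<bar>lyapunov_exponent d \<mu>' i - lyapunov_exponent d \<mu> i\<bar>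
            \<le> (if wasserstein d \<mu>' \<mu> = 0 then 0
               else C * \<bar>ln (wasserstein d \<mu>' \<mu>)\<bar> powr (- \<gamma>)))))"
proof (rule exI[of _ "1 / 4"], intro conjI allI impI)
  fix d K assume d: "1 <= (d::nat)" and K: "compactin (GL_topology d) K"
  obtain b where b: "2 <= b" "real d <= b" "!!g. g : K ==> mn g <= b"
    "!!g v. g : K ==> v : Vec d ==> vn v <= b * vn (g *v v)" by (rule compact_GL_bounds[OF K]) blast
  have M: "GL_measure d K b \<mu>" if "prob_on_GL d \<mu>" "msupp d \<mu> \<subseteq> K" for \<mu>
    using d K b that by unfold_locales
  show "\<exists>\<epsilon>>0. \<forall>\<mu>. prob_on_GL d \<mu> & compactin (GL_topology d) (msupp d \<mu>) & semisimple d \<mu> \<and>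
      lyapunov_exponent d \<mu> 1 = lyapunov_exponent d \<mu> d & msupp d \<mu> \<subseteq> K -->
      (\<exists>C>0. \<forall>\<mu>'. prob_on_GL d \<mu>' & msupp d \<mu>' \<subseteq> K & wasserstein d \<mu>' \<mu> < \<epsilon> -->
        (\<forall>i\<in>{1..d}. abs (lyapunov_exponent d \<mu>' i - lyapunov_exponent d \<mu> i)
            <= (if wasserstein d \<mu>' \<mu> = 0 then 0 else C * abs (ln (wasserstein d \<mu>' \<mu>)) powr (- (1 / 4)))))"
  proof (rule exI[of _ "1 / 2"], intro conjI allI impI)
    fix \<mu> assume \<mu>: "prob_on_GL d \<mu> & compactin (GL_topology d) (msupp d \<mu>) & semisimple d \<mu> \<and>
      lyapunov_exponent d \<mu> 1 = lyapunov_exponent d \<mu> d & msupp d \<mu> \<subseteq> K"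
    obtain C where C: "C > 0" and bound: "!!\<mu>'. GL_measure d K b \<mu>' & wasserstein d \<mu>' \<mu> < 1 / 2 ==> \<forall>i\<in>{1..d}.
      abs (lyapunov_exponent d \<mu>' i - lyapunov_exponent d \<mu> i) \<le>
        (if wasserstein d \<mu>' \<mu> = 0 then 0 else C * abs (ln (wasserstein d \<mu>' \<mu>)) powr (- (1 / 4)))"
      using exponents_bound[OF M] \<mu> by blast
    show "\<exists>C>0. \<forall>\<mu>'. prob_on_GL d \<mu>' & msupp d \<mu>' \<subseteq> K & wasserstein d \<mu>' \<mu> < 1 / 2 -->
        (\<forall>i\<in>{1..d}. abs (lyapunov_exponent d \<mu>' i - lyapunov_exponent d \<mu> i)
            <= (if wasserstein d \<mu>' \<mu> = 0 then 0 else C * abs (ln (wasserstein d \<mu>' \<mu>)) powr (- (1 / 4))))"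
      using C bound M by (intro exI[of _ C]) blast
  qed simp
qed simp

end
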